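(* For $a\ge 1$ let $$A_a := \inf\left\{ \frac{\int_{B_1^2}|\nabla u|^2\,dx}{\int_{B_1^2}\frac{|u|^2}{|x|^2(\log\frac{a}{|x|})^2}\,dx}\ :\ u\in H_0^1(B_1^2)\setminus\{0\},\ \int_0^{2\pi}u(r\cos\theta,r\sin\theta)\,d\theta=0 \text{ for a.e. } r\in[0,1]\right\},$$ $$B_a := \inf\left\{ \frac{\int_{B_1^2}|\nabla u|^2\,dx}{\int_{B_1^2}\frac{|u|^2}{|x|^2(\log\frac{a}{|x|})^2}\,dx}\ :\ u\in H_0^1(B_1^2)\setminus\{0\}\right\}.$$ Then $A_a>\frac14=B_a$ for $a>1$, and $A_1=\frac14=B_1$. Moreover, for $a \ge 1$, there exists a minimizer of $A_a$ if and only if $a>1$.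
   Context: $B_1^2=\{x\in\mathbb{R}^2: |x|<1\}$. $H_0^1(B_1^2)$ is the completion of $C_0^\infty(B_1^2)$ with respect to the norm $\|\nabla u\|_{L^2}$. The spherical-average-zero condition on $u\in H_0^1(B_1^2)$ is equivalent to $u$ belonging to the orthogonal complement, with respect to the inner product $\int_{B_1^2}\nabla u\cdot\nabla v\,dx$, of the subspace of radial functions in $H_0^1(B_1^2)$. A minimizer of $A_a$ is an admissible $u$ at which the infimum is attained. *)

theory Defs
  imports "HOL-Analysis.Analysis"
begin

abbreviation unit_disc :: "(real^2) set" where
  "unit_disc \<equiv> ball 0 1"

definition partial_deriv :: "2 \<Rightarrow> (real^2 \<Rightarrow> real) \<Rightarrow> real^2 \<Rightarrow> real" where
  "partial_deriv i f x = frechet_derivative f (at x) (axis i 1)"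

definition grad :: "(real^2 \<Rightarrow> real) \<Rightarrow> real^2 \<Rightarrow> real^2" where
  "grad f x = (\<chi> i. partial_deriv i f x)"

primrec C_k :: "nat \<Rightarrow> (real^2 \<Rightarrow> real) \<Rightarrow> bool" where
  "C_k 0 f \<longleftrightarrow> continuous_on UNIV f"
| "C_k (Suc k) f \<longleftrightarrow> f differentiable_on UNIV \<and> (\<forall>i. C_k k (partial_deriv i f))"

definition test_functions :: "(real^2 \<Rightarrow> real) set" where
  "test_functions =
     {f. (\<forall>k. C_k k f) \<and> compact (closure {x. f x \<noteq> 0}) \<and> closure {x. f x \<noteq> 0} \<subseteq> unit_disc}"

definition L2_tendsto ::
    "(nat \<Rightarrow> real^2 \<Rightarrow> 'b::euclidean_space) \<Rightarrow> (real^2 \<Rightarrow> 'b) \<Rightarrow> bool" where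
  "L2_tendsto f g \<longleftrightarrow>
     (\<lambda>n. \<integral>\<^sup>+ x. ennreal ((norm (f n x - g x))\<^sup>2) \<partial>lebesgue_on unit_disc) \<longlonglongrightarrow> 0"

(* The completion of the test functions under the gradient norm, realised as a space of
   functions on the disc: by the Poincare inequality a sequence of test functions that is
   Cauchy in the gradient norm converges in L2, and u is its limit; G is then the (almost
   everywhere unique) weak gradient of u. That u and G are square integrable follows from
   the two convergences. Functions represent their almost-everywhere classes, and their
   values off the disc play no role. *)
definition has_H01_gradient :: "(real^2 \<Rightarrow> real) \<Rightarrow> (real^2 \<Rightarrow> real^2) \<Rightarrow> bool" where
  "has_H01_gradient u G \<longleftrightarrow>
     u \<in> borel_measurable (lebesgue_on unit_disc) \<and>
     G \<in> borel_measurable (lebesgue_on unit_disc) \<and>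
     (\<exists>\<phi>. (\<forall>n. \<phi> n \<in> test_functions) \<and> L2_tendsto \<phi> u \<and> L2_tendsto (\<lambda>n. grad (\<phi> n)) G)"

definition H01 :: "(real^2 \<Rightarrow> real) set" where
  "H01 = {u. \<exists>G. has_H01_gradient u G}"

definition weak_grad :: "(real^2 \<Rightarrow> real) \<Rightarrow> real^2 \<Rightarrow> real^2" where
  "weak_grad u = (SOME G. has_H01_gradient u G)"

definition H01_nonzero :: "(real^2 \<Rightarrow> real) set" where
  "H01_nonzero = {u \<in> H01. \<not> (AE x in lebesgue_on unit_disc. u x = 0)}"

definition zero_spherical_average :: "(real^2 \<Rightarrow> real) \<Rightarrow> bool" where
  "zero_spherical_average u \<longleftrightarrow>
     (AE r in lebesgue_on {0..1}.
        has_bochner_integral (lebesgue_on {0..2 * pi})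
          (\<lambda>\<theta>. u (vector [r * cos \<theta>, r * sin \<theta>])) 0)"

(* Both integrals are taken in [0, \<infinity>], so no finiteness is presupposed. For a \<ge> 1 the
   weight is a genuine division everywhere in the disc except at the origin. *)
definition hardy_quotient :: "real \<Rightarrow> (real^2 \<Rightarrow> real) \<Rightarrow> ennreal" where
  "hardy_quotient a u =
     (\<integral>\<^sup>+ x. ennreal ((norm (weak_grad u x))\<^sup>2) \<partial>lebesgue_on unit_disc) /
     (\<integral>\<^sup>+ x. ennreal (\<bar>u x\<bar>\<^sup>2 / ((norm x)\<^sup>2 * (ln (a / norm x))\<^sup>2)) \<partial>lebesgue_on unit_disc)"

definition A_admissible :: "(real^2 \<Rightarrow> real) set" where
  "A_admissible = {u \<in> H01_nonzero. zero_spherical_average u}"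

definition A_const :: "real \<Rightarrow> ennreal" where
  "A_const a = (INF u\<in>A_admissible. hardy_quotient a u)"

definition B_const :: "real \<Rightarrow> ennreal" where
  "B_const a = (INF u\<in>H01_nonzero. hardy_quotient a u)"

definition A_minimizer :: "real \<Rightarrow> (real^2 \<Rightarrow> real) \<Rightarrow> bool" where
  "A_minimizer a u \<longleftrightarrow> u \<in> A_admissible \<and> hardy_quotient a u = A_const a"

end

theory Submission
  imports Defs
begin

text \<open>In the variable \<open>t = ln (a / r)\<close> and on a single angular mode, both infima become
one-dimensional problems on \<open>{ln a<..}\<close>: a function \<open>f\<close> with \<open>f'' = (b - W) f\<close> and \<open>f > 0\<close> yields,
through Picone's identity with \<open>\<psi> = f' / f\<close>, the Hardy inequality with weight \<open>W (ln (a / r)) / r\<^sup>2\<close>.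
Here \<open>b = 0\<close> for general functions, where \<open>f = sqrt t\<close> gives the constant \<open>1/4\<close>; for functions with
vanishing spherical averages Wirtinger's inequality supplies an additional \<open>\<integral> u\<^sup>2 / |x|\<^sup>2\<close>,
which allows \<open>b = 1\<close>. For \<open>a > 1\<close> the Bessel function \<open>f = sqrt t K\<^sub>i\<^sub>\<mu>(t)\<close> solves this with
\<open>W = (1/4 + \<mu>\<^sup>2) / t\<^sup>2\<close>; choosing the largest \<open>\<mu>\<close> for which it is positive on \<open>{ln a<..}\<close> makes it
vanish at \<open>ln a\<close>, so that \<open>f (ln (a / r)) cos \<theta>\<close> is a minimizer. For \<open>a = 1\<close> the bound
\<open>1/4\<close> leaves the term \<open>\<integral> u\<^sup>2 / |x|\<^sup>2\<close> over, so no minimizer exists. That \<open>1/4\<close> cannot be improved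
is seen from the trial functions \<open>sqrt t sin ((ln t - \<sigma>) / n)\<close>, times \<open>1\<close> or times \<open>cos \<theta>\<close>.\<close>

section \<open>Polar coordinates on the unit disc\<close>

text \<open>An element of \<open>H01\<close> is only a limit of test functions, so each lower bound
  is proved for test functions and then passed to the limit. Two obstacles shape this. The
  approximants of a function with vanishing circle averages need not have vanishing averages; so
  Wirtinger's inequality is applied to a test function minus its mean on each circle
  (\<open>angvar\<close>), and that mean is bounded by the L2 distance to the limit. Moreover
  Picone's inequality on an annulus leaves a boundary term
  \<open>w \<epsilon> * angvar b \<phi> \<epsilon>\<close> at the inner radius. With means removed,
  \<open>angvar\<close> tends to 0 there, so a lower bound on \<open>w\<close> is enough; this
  matters for the Bessel ground state, whose logarithmic derivative need not be nonnegative. Without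
  mean removal \<open>w\<close> must be nonnegative, as it is for \<open>sqrt t\<close>. Upper
  bounds also need uniqueness of the weak gradient, because \<open>weak_grad\<close> is an arbitrary
  choice. The Bessel order is a supremum: positivity survives a small increase of the order unless
  the function already vanishes at \<open>ln a\<close>, and that zero is the boundary condition on
  the unit circle.\<close>

abbreviation pol :: "real \<Rightarrow> real \<Rightarrow> real^2" where
  "pol r \<theta> \<equiv> vector [r * cos \<theta>, r * sin \<theta>]"

lemma vector_2_eq_axis: "(vector [x, y] :: real^2) = x *\<^sub>R axis 1 1 + y *\<^sub>R axis 2 1"
  by (simp add: vec_eq_iff forall_2 axis_def)

lemma norm_real2: "norm (z :: real^2) = sqrt ((z$1)\<^sup>2 + (z$2)\<^sup>2)"
  by (simp add: norm_vec_def L2_set_def sum_2)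

lemma norm_pol [simp]: "norm (pol r \<theta>) = \<bar>r\<bar>"
proof -
  have "(r * cos \<theta>)\<^sup>2 + (r * sin \<theta>)\<^sup>2 = r\<^sup>2"
    by (simp add: power_mult_distrib flip: distrib_left)
  then show ?thesis by (simp add: norm_real2)
qed

lemma continuous_on_vector2 [continuous_intros]:
  assumes "continuous_on S f" "continuous_on S g"
  shows "continuous_on S (\<lambda>x. vector [f x, g x] :: real^2)"
  unfolding vector_2_eq_axis by (intro continuous_intros assms)

text \<open>Lebesgue measure is determined by its values on boxes, and the preimage of a box is a
  product of two intervals. This identification makes Fubini available for functions on
  \<open>real^2\<close>.\<close>

lemma distr_lborel_vector2:
  "distr lborel borel (\<lambda>(x,y). vector [x, y] :: real^2) = (lborel :: (real^2) measure)"
proof (rule lborel_eqI[symmetric])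
  have m: "(\<lambda>(x,y). vector [x, y] :: real^2) \<in> borel_measurable borel"
    by (intro borel_measurable_continuous_onI) (auto simp: case_prod_beta intro!: continuous_intros)
  fix l u :: "real^2"
  assume lu: "\<And>b. b \<in> Basis \<Longrightarrow> l \<bullet> b \<le> u \<bullet> b"
  have lu': "l$1 \<le> u$1" "l$2 \<le> u$2"
    using lu[of "axis 1 1"] lu[of "axis 2 1"] by (auto simp: inner_axis)
  have pre: "(\<lambda>(x,y). vector [x, y] :: real^2) -` box l u = box (l$1) (u$1) \<times> box (l$2) (u$2)"
    by (auto simp: mem_box_cart forall_2 box_real)
  have B: "(Basis :: (real^2) set) = {axis 1 1, axis 2 1}"
    by (auto simp: Basis_vec_def UNIV_2)
  have ne: "axis (1::2) (1::real) \<noteq> axis 2 1" by (simp add: axis_eq_axis)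
  have "emeasure (distr lborel borel (\<lambda>(x,y). vector [x, y] :: real^2)) (box l u)
     = emeasure (lborel \<Otimes>\<^sub>M lborel) (box (l$1) (u$1) \<times> box (l$2) (u$2))"
    using m by (subst emeasure_distr) (auto simp: pre lborel_prod)
  also have "\<dots> = emeasure lborel (box (l$1) (u$1)) * emeasure lborel (box (l$2) (u$2))"
    by (subst lborel.emeasure_pair_measure_Times) auto
  also have "\<dots> = ennreal (\<Prod>b\<in>Basis. (u - l) \<bullet> b)"
    using lu' ne by (simp add: B inner_axis algebra_simps flip: ennreal_mult)
  finally show "emeasure (distr lborel borel (\<lambda>(x,y). vector [x, y] :: real^2)) (box l u)
    = ennreal (\<Prod>b\<in>Basis. (u - l) \<bullet> b)" .
qed simp

lemma nn_integral_real2: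
  fixes h :: "real^2 \<Rightarrow> ennreal"
  assumes "h \<in> borel_measurable borel"
  shows "(\<integral>\<^sup>+ z. h z \<partial>lborel) = (\<integral>\<^sup>+ x. \<integral>\<^sup>+ y. h (vector [x, y]) \<partial>lborel \<partial>lborel)"
proof -
  have m: "(\<lambda>(x,y). vector [x, y] :: real^2) \<in> borel_measurable borel"
    by (intro borel_measurable_continuous_onI) (auto simp: case_prod_beta intro!: continuous_intros)
  have "(\<integral>\<^sup>+ z. h z \<partial>lborel) = (\<integral>\<^sup>+ z. h z \<partial>distr lborel borel (\<lambda>(x,y). vector [x, y] :: real^2))"
    by (simp add: distr_lborel_vector2)
  also have "\<dots> = (\<integral>\<^sup>+ p. h (vector [fst p, snd p]) \<partial>(lborel \<Otimes>\<^sub>M lborel))"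
    using m assms by (subst nn_integral_distr) (auto simp: lborel_prod case_prod_beta)
  also have "\<dots> = (\<integral>\<^sup>+ x. \<integral>\<^sup>+ y. h (vector [x, y]) \<partial>lborel \<partial>lborel)"
  proof -
    have "(\<lambda>p. h (vector [fst p, snd p])) \<in> borel_measurable (lborel \<Otimes>\<^sub>M lborel)"
      using measurable_compose[OF m assms] by (simp add: case_prod_beta lborel_prod)
    from lborel.nn_integral_fst[OF this] show ?thesis by simp
  qed
  finally show ?thesis .
qed

definition polmap :: "real^2 \<Rightarrow> real^2" where "polmap z = pol (z$1) (z$2)"
text \<open>On this open rectangle of radii and angles \<open>polmap\<close> is injective and its
  Jacobian \<open>z$1\<close> is positive.\<close>

definition polrect :: "(real^2) set" where "polrect = {z. 0 < z$1 \<and> z$1 < 1 \<and> 0 < z$2 \<and> z$2 < 2 * pi}"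

lemma polrect_eq_box: "polrect = box (vector [0,0]) (vector [1, 2*pi])"
  by (auto simp: polrect_def mem_box_cart forall_2)

lemma inj_on_polmap: "inj_on polmap polrect"
proof (rule inj_onI)
  fix z w assume z: "z \<in> polrect" and w: "w \<in> polrect" and eq: "polmap z = polmap w"
  have "norm (polmap z) = norm (polmap w)" by (simp add: eq)
  then have r: "z$1 = w$1" using z w by (simp add: polmap_def polrect_def)
  have "cos (z$2) = cos (w$2)" "sin (z$2) = sin (w$2)"
    using eq r z by (auto simp: polmap_def polrect_def vec_eq_iff forall_2)
  then obtain n :: int where n: "z$2 = w$2 + 2 * pi * n" using sin_cos_eq_iff by blast
  have "\<bar>z$2 - w$2\<bar> < 2 * pi" using z w by (auto simp: polrect_def)
  then have "\<bar>real_of_int n\<bar> < 1" using n by (simp add: abs_mult)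
  then have "n = 0" by linarith
  then have "z$2 = w$2" using n by simp
  with r show "z = w" by (simp add: vec_eq_iff forall_2)
qed

text \<open>Excluding the angle 0 costs the origin and the positive half of the axis; lying inside a
  null line is all that the change of variables requires.\<close>

lemma polmap_image: "ball 0 1 - polmap ` polrect \<subseteq> {z. z $ 2 = 0}"
proof safe
  fix x :: "real^2" assume x: "x \<in> ball 0 1" and n: "x \<notin> polmap ` polrect"
  show "x $ 2 = 0"
  proof (rule ccontr)
    assume ne: "x $ 2 \<noteq> 0"
    have r: "0 < norm x" "norm x < 1" using ne x by auto
    have "(x$1/norm x)\<^sup>2 + (x$2/norm x)\<^sup>2 = ((x$1)\<^sup>2 + (x$2)\<^sup>2) / (norm x)\<^sup>2"
      by (simp only: power_divide add_divide_distrib)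
    also have "\<dots> = (norm x)\<^sup>2 / (norm x)\<^sup>2" by (simp add: norm_real2)
    also have "\<dots> = 1" using r(1) by simp
    finally have "(x$1/norm x)\<^sup>2 + (x$2/norm x)\<^sup>2 = 1" .
    then obtain t where t: "0 \<le> t" "t < 2*pi" "x$1/norm x = cos t" "x$2/norm x = sin t"
      using sincos_total_2pi by blast
    have "t \<noteq> 0" using t ne r by auto
    then have "(vector [norm x, t] :: real^2) \<in> polrect" using t r by (simp add: polrect_def)
    moreover have "x$1 = norm x * cos t" "x$2 = norm x * sin t"
      unfolding t(3,4)[symmetric] using r(1) by auto
    then have "polmap (vector [norm x, t]) = x"
      by (simp add: polmap_def vec_eq_iff forall_2)
    ultimately show False using n by (metis imageI)
  qed
qed

lemma has_derivative_vec_nth_ident: "((\<lambda>x. x $ i) has_derivative (\<lambda>h. h $ i)) F"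
  for i :: "'n::finite"
  by (rule bounded_linear_imp_has_derivative) (rule bounded_linear_vec_nth)

lemma has_derivative_polmap:
  "(polmap has_derivative (\<lambda>h. vector [cos (z$2) * h$1 - z$1 * sin (z$2) * h$2,
                                      sin (z$2) * h$1 + z$1 * cos (z$2) * h$2])) (at z within S)"
proof -
  note nth = has_derivative_vec_nth_ident[where F = "at z within S"]
  have 1: "((\<lambda>z. z$1 * cos (z$2)) has_derivative (\<lambda>h. cos (z$2) * h$1 - z$1 * sin (z$2) * h$2)) (at z within S)"
    by (rule has_derivative_eq_rhs[OF has_derivative_mult[OF nth has_derivative_cos[OF nth]]])
      (simp add: fun_eq_iff)
  have 2: "((\<lambda>z. z$1 * sin (z$2)) has_derivative (\<lambda>h. sin (z$2) * h$1 + z$1 * cos (z$2) * h$2)) (at z within S)"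
    by (rule has_derivative_eq_rhs[OF has_derivative_mult[OF nth has_derivative_sin[OF nth]]])
      (simp add: fun_eq_iff)
  show ?thesis
    unfolding polmap_def vector_2_eq_axis
    by (intro has_derivative_add has_derivative_scaleR_left 1 2)
qed

lemma det_polmap:
  "det (matrix (\<lambda>h::real^2. vector [cos (z$2) * h$1 - z$1 * sin (z$2) * h$2,
             sin (z$2) * h$1 + z$1 * cos (z$2) * h$2] :: real^2)) = z$1" for z :: "real^2"
proof -
  have "z$1 * (cos (z$2))\<^sup>2 + z$1 * (sin (z$2))\<^sup>2 = z$1"
    by (simp flip: distrib_left)
  then show ?thesis
    by (simp add: det_2 matrix_def axis_def power2_eq_square algebra_simps)
qed

lemma null_slit: "negligible {z :: real^2. z $ 2 = 0}"
  by (rule negligible_standard_hyperplane_cart)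

lemma polmap_measurable [measurable]: "polmap \<in> borel_measurable borel"
  unfolding polmap_def by (intro borel_measurable_continuous_onI continuous_intros)

lemma polrect_borel [measurable]: "polrect \<in> sets borel"
  by (simp add: polrect_eq_box)

text \<open>Change of variables for the injective differentiable map \<open>polmap\<close>, whose
  Jacobian determinant is the radius. The image and \<open>A \<inter> ball 0 1\<close> have the same
  measure because the missed points lie on a null line.\<close>

lemma emeasure_polmap:
  assumes A: "A \<in> sets borel"
  shows "emeasure lborel (A \<inter> ball 0 1) = (\<integral>\<^sup>+ z. ennreal (z$1) * indicator (polrect \<inter> polmap -` A) z \<partial>lborel)"
proof -
  define S where "S = polrect \<inter> polmap -` A"
  have Sb: "S \<in> sets borel" unfolding S_def using A
    by (intro sets.Int polrect_borel) (metis measurable_sets_borel polmap_measurable)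
  have Sl: "S \<in> lmeasurable"
    by (rule bounded_set_imp_lmeasurable)
      (use Sb in \<open>auto simp: S_def polrect_eq_box intro: bounded_subset[OF bounded_box] sets_completionI_sets\<close>)
  have int: "integrable lborel (\<lambda>z. indicator S z *\<^sub>R (z$1))"
  proof (rule Bochner_Integration.integrable_bound)
    show "integrable lborel (\<lambda>z. indicator S z *\<^sub>R (1::real))"
      using Sl Sb by (auto simp: fmeasurable_def)
    show "(\<lambda>z. indicator S z *\<^sub>R (z$1)) \<in> borel_measurable lborel" using Sb by simp
  qed (auto simp: indicator_def S_def polrect_def)
  then have sint: "set_integrable lebesgue S (\<lambda>z. z$1)"
    unfolding set_integrable_def by (rule integrable_completion[THEN iffD2, rotated]) (use Sb in simp)
  have iS: "(\<lambda>z. z$1) integrable_on S" and iS': "integral S (\<lambda>z. z$1) = (LINT z:S|lebesgue. z$1)"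
    using set_lebesgue_integral_eq_integral[OF sint] by auto
  have ab: "\<bar>z$1\<bar> = z$1" if "z \<in> S" for z using that by (simp add: S_def polrect_def)
  have iSa: "(\<lambda>z. \<bar>z$1\<bar>) integrable_on S"
    using iS by (rule integrable_eq) (simp add: ab)
  have inj: "inj_on polmap S" by (rule inj_on_subset[OF inj_on_polmap]) (simp add: S_def)
  have Sleb: "S \<in> sets lebesgue" using Sl by (rule fmeasurableD)
  have meas: "measure lebesgue (polmap ` S) = integral S (\<lambda>z. \<bar>z$1\<bar>)"
    using measure_differentiable_image_eq[OF Sleb has_derivative_polmap inj, unfolded det_polmap, OF iSa] .
  have lm: "polmap ` S \<in> lmeasurable"
    using measurable_differentiable_image_eq[OF Sleb has_derivative_polmap inj, unfolded det_polmap] iSa by blast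
  have "integral S (\<lambda>z. \<bar>z$1\<bar>) = integral S (\<lambda>z. z$1)"
    by (rule integral_cong) (simp add: ab)
  then have *: "emeasure lebesgue (polmap ` S) = ennreal (LINT z:S|lebesgue. z$1)"
    using meas lm iS' by (simp add: emeasure_eq_measure2)
  have "ennreal (LINT z:S|lebesgue. z$1) = (\<integral>\<^sup>+ z. ennreal (indicator S z *\<^sub>R (z$1)) \<partial>lebesgue)"
    unfolding set_lebesgue_integral_def
    by (rule nn_integral_eq_integral[symmetric])
      (use sint ab in \<open>auto simp: set_integrable_def indicator_def S_def polrect_def\<close>)
  also have "\<dots> = (\<integral>\<^sup>+ z. ennreal (indicator S z *\<^sub>R (z$1)) \<partial>lborel)"
    by (rule nn_integral_completion)
  also have "\<dots> = (\<integral>\<^sup>+ z. ennreal (z$1) * indicator S z \<partial>lborel)"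
    by (intro nn_integral_cong) (auto simp: indicator_def)
  finally have **: "emeasure lebesgue (polmap ` S) = (\<integral>\<^sup>+ z. ennreal (z$1) * indicator S z \<partial>lborel)"
    using * by simp
  have sub: "polmap ` S \<subseteq> A \<inter> ball 0 1"
    by (auto simp: S_def polrect_def polmap_def)
  have diff: "(A \<inter> ball 0 1) - polmap ` S \<subseteq> {z. z$2 = 0}"
    using polmap_image by (auto simp: S_def)
  have "emeasure lebesgue (A \<inter> ball 0 1) = emeasure lebesgue (polmap ` S)"
  proof (rule emeasure_eq_AE)
    have "AE z in lebesgue. z \<notin> {z :: real^2. z $ 2 = 0}"
      using null_slit unfolding negligible_iff_null_sets by (rule AE_not_in)
    then show "AE z in lebesgue. (z \<in> A \<inter> ball 0 1) = (z \<in> polmap ` S)"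
      by eventually_elim (use sub diff in auto)
  qed (use A lm in auto)
  then show ?thesis using ** A by (simp add: S_def)
qed

text \<open>The formula for sets says that \<open>polmap\<close> pushes the measure with density
  \<open>z$1\<close> on \<open>polrect\<close> forward to Lebesgue measure on the disc; an equality
  of measures gives all nonnegative integrands at once.\<close>

lemma nn_integral_polar:
  fixes h :: "real^2 \<Rightarrow> ennreal"
  assumes h: "h \<in> borel_measurable borel"
  shows "(\<integral>\<^sup>+ x. h x * indicator (ball 0 1) x \<partial>lborel) =
    (\<integral>\<^sup>+ r. (\<integral>\<^sup>+ \<theta>. ennreal r * h (pol r \<theta>) * indicator {0<..<2*pi} \<theta> \<partial>lborel) * indicator {0<..<1} r \<partial>lborel)"
proof -
  define M where "M = density lborel (\<lambda>z::real^2. ennreal (z$1) * indicator polrect z)"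
  have pm: "polmap \<in> measurable M borel" by (simp add: M_def)
  have eq: "distr M borel polmap = density lborel (indicator (ball 0 1))"
  proof (rule measure_eqI)
    fix A assume "A \<in> sets (distr M borel polmap)"
    then have A: "A \<in> sets borel" by simp
    have pA: "polmap -` A \<in> sets borel" by (metis A measurable_sets_borel polmap_measurable)
    have "emeasure (distr M borel polmap) A = emeasure M (polmap -` A)"
      using A pm by (subst emeasure_distr) (auto simp: M_def)
    also have "\<dots> = (\<integral>\<^sup>+ z. ennreal (z$1) * indicator polrect z * indicator (polmap -` A) z \<partial>lborel)"
      unfolding M_def using pA by (subst emeasure_density) auto
    also have "\<dots> = emeasure lborel (A \<inter> ball 0 1)"
      unfolding emeasure_polmap[OF A] by (intro nn_integral_cong) (auto simp: indicator_def)
    also have "\<dots> = (\<integral>\<^sup>+ z. indicator (A \<inter> ball 0 1) z \<partial>lborel)"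
      using A by (subst nn_integral_indicator) auto
    also have "\<dots> = (\<integral>\<^sup>+ z. indicator (ball 0 1) z * indicator A z \<partial>lborel)"
      by (intro nn_integral_cong) (auto simp: indicator_def)
    also have "\<dots> = emeasure (density lborel (indicator (ball 0 1))) A"
      using A by (subst emeasure_density) (auto intro!: borel_measurable_indicator)
    finally show "emeasure (distr M borel polmap) A = emeasure (density lborel (indicator (ball 0 1))) A" .
  qed simp
  have "(\<integral>\<^sup>+ x. h x * indicator (ball 0 1) x \<partial>lborel) = (\<integral>\<^sup>+ x. h x \<partial>density lborel (indicator (ball 0 1)))"
    using h by (subst nn_integral_density) (auto simp: mult.commute intro!: borel_measurable_indicator)
  also have "\<dots> = (\<integral>\<^sup>+ z. h (polmap z) \<partial>M)"
    unfolding eq[symmetric] using h pm by (subst nn_integral_distr) auto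
  also have "\<dots> = (\<integral>\<^sup>+ z. ennreal (z$1) * indicator polrect z * h (polmap z) \<partial>lborel)"
    unfolding M_def using h by (subst nn_integral_density) auto
  also have "\<dots> = (\<integral>\<^sup>+ r. \<integral>\<^sup>+ \<theta>. ennreal r * indicator polrect (vector [r, \<theta>]) * h (pol r \<theta>) \<partial>lborel \<partial>lborel)"
  proof (subst nn_integral_real2)
    show "(\<lambda>z. ennreal (z$1) * indicator polrect z * h (polmap z)) \<in> borel_measurable borel"
      by (intro borel_measurable_times_ennreal measurable_compose[OF polmap_measurable h]) auto
  qed (simp add: polmap_def)
  also have "\<dots> = (\<integral>\<^sup>+ r. (\<integral>\<^sup>+ \<theta>. ennreal r * h (pol r \<theta>) * indicator {0<..<2*pi} \<theta> \<partial>lborel) * indicator {0<..<1} r \<partial>lborel)"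
    by (intro nn_integral_cong) (auto simp: indicator_def polrect_def mult_ac intro!: nn_integral_cong)
  finally show ?thesis .
qed

section \<open>Picone's and Wirtinger's inequalities\<close>

text \<open>For a positive solution \<open>f\<close> of \<open>(v f')' = - q f\<close> take
  \<open>w = - v f' / f\<close>; then \<open>w' - w\<^sup>2 / v = q\<close>. Only this Riccati
  relation, as an inequality, enters, so the ground state itself is absent from the statement. The
  proof integrates \<open>v (k' + k w / v)\<^sup>2 \<ge> 0\<close>, and the cross term is absorbed
  in the derivative of \<open>k\<^sup>2 w\<close>.\<close>

lemma picone_interval:
  fixes k k' :: "real \<Rightarrow> real"
  assumes "\<alpha> \<le> \<beta>"
    and k: "\<And>x. x \<in> {\<alpha>..\<beta>} \<Longrightarrow> (k has_real_derivative k' x) (at x within {\<alpha>..\<beta>})"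
    and ck: "continuous_on {\<alpha>..\<beta>} k'"
    and w: "\<And>x. x \<in> {\<alpha>..\<beta>} \<Longrightarrow> (w has_real_derivative w' x) (at x within {\<alpha>..\<beta>})"
    and cw: "continuous_on {\<alpha>..\<beta>} w'"
    and cv: "continuous_on {\<alpha>..\<beta>} v" and v0: "\<And>x. x \<in> {\<alpha>..\<beta>} \<Longrightarrow> 0 < v x"
    and cq: "continuous_on {\<alpha>..\<beta>} q"
    and q: "\<And>x. x \<in> {\<alpha>..\<beta>} \<Longrightarrow> q x \<le> w' x - (w x)\<^sup>2 / v x"
  shows "(k \<alpha>)\<^sup>2 * w \<alpha> - (k \<beta>)\<^sup>2 * w \<beta> + integral {\<alpha>..\<beta>} (\<lambda>x. q x * (k x)\<^sup>2)
         \<le> integral {\<alpha>..\<beta>} (\<lambda>x. v x * (k' x)\<^sup>2)"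
proof -
  have ckk: "continuous_on {\<alpha>..\<beta>} k"
    using k by (rule DERIV_continuous_on)
  have cww: "continuous_on {\<alpha>..\<beta>} w"
    using w by (rule DERIV_continuous_on)
  have F: "((\<lambda>x. 2 * k x * k' x * w x + (k x)\<^sup>2 * w' x) has_integral ((k \<beta>)\<^sup>2 * w \<beta> - (k \<alpha>)\<^sup>2 * w \<alpha>)) {\<alpha>..\<beta>}"
    using assms(1)
    by (rule fundamental_theorem_of_calculus)
      (auto intro!: derivative_eq_intros k w simp flip: has_real_derivative_iff_has_vector_derivative simp: algebra_simps)
  have "integral {\<alpha>..\<beta>} (\<lambda>x. q x * (k x)\<^sup>2) - ((k \<beta>)\<^sup>2 * w \<beta> - (k \<alpha>)\<^sup>2 * w \<alpha>) * (-1) * (-1)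
     = integral {\<alpha>..\<beta>} (\<lambda>x. q x * (k x)\<^sup>2 - (2 * k x * k' x * w x + (k x)\<^sup>2 * w' x))"
    using F by (subst integral_diff)
      (auto intro!: integrable_continuous_interval continuous_intros cq ckk simp: integral_unique has_integral_integrable)
  also have "\<dots> \<le> integral {\<alpha>..\<beta>} (\<lambda>x. v x * (k' x)\<^sup>2)"
  proof (rule integral_le)
    fix x assume x: "x \<in> {\<alpha>..\<beta>}"
    have "0 \<le> v x * (k' x + k x * w x / v x)\<^sup>2" using v0[OF x] by simp
    also have "\<dots> = v x * (k' x)\<^sup>2 + 2 * k x * k' x * w x + (k x)\<^sup>2 * ((w x)\<^sup>2 / v x)"
      using v0[OF x] by (simp add: power2_eq_square field_simps)
    finally have "- (k x)\<^sup>2 * ((w x)\<^sup>2 / v x) \<le> v x * (k' x)\<^sup>2 + 2 * k x * k' x * w x" by simp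
    moreover have "q x * (k x)\<^sup>2 \<le> (w' x - (w x)\<^sup>2 / v x) * (k x)\<^sup>2"
      by (intro mult_right_mono q x) simp
    ultimately show "q x * (k x)\<^sup>2 - (2 * k x * k' x * w x + (k x)\<^sup>2 * w' x) \<le> v x * (k' x)\<^sup>2"
      by (simp add: algebra_simps)
  qed (auto intro!: integrable_continuous_interval continuous_intros cq ckk ck cv cw cww)
  finally show ?thesis by simp
qed

text \<open>Picone's inequality with the ground state \<open>sin (\<rho> (x - c) + d)\<close>, \<open>\<rho> < 1\<close>, which is bounded away from \<open>0\<close>.\<close>

lemma dirichlet_poincare:
  fixes k k' :: "real \<Rightarrow> real"
  assumes k: "\<And>x. (k has_real_derivative k' x) (at x)"
    and ck: "continuous_on UNIV k'" and "k c = 0" "k (c + pi) = 0"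
  shows "integral {c..c+pi} (\<lambda>x. (k x)\<^sup>2) \<le> integral {c..c+pi} (\<lambda>x. (k' x)\<^sup>2)"
proof -
  have ckk: "continuous_on UNIV k"
    using k by (metis DERIV_continuous_on DERIV_subset top_greatest)
  let ?I = "integral {c..c+pi} (\<lambda>x. (k x)\<^sup>2)"
  have *: "\<rho>\<^sup>2 * ?I \<le> integral {c..c+pi} (\<lambda>x. (k' x)\<^sup>2)" if \<rho>: "0 < \<rho>" "\<rho> < 1" for \<rho> :: real
  proof -
    \<comment> \<open>The phase centres the arc: the argument of the sine runs from \<open>d\<close>
      to \<open>pi - d\<close>, hence stays where the sine is positive.\<close>
    define d where "d = (1 - \<rho>) * pi / 2"
    have s: "sin (\<rho> * (x - c) + d) > 0" if "x \<in> {c..c+pi}" for x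
    proof (rule sin_gt_zero)
      have "0 < d" using \<rho> by (simp add: d_def)
      then show "0 < \<rho> * (x - c) + d" using that \<rho> by (intro add_nonneg_pos) auto
      have "\<rho> * (x - c) \<le> \<rho> * pi" using that \<rho> by (intro mult_left_mono) auto
      moreover have "\<rho> * pi + d < pi"
      proof -
        have "pi - (\<rho> * pi + d) = (1 - \<rho>) * pi / 2" by (simp add: d_def field_simps)
        then show ?thesis using \<rho> by (smt (verit) \<open>0 < d\<close> d_def)
      qed
      ultimately show "\<rho> * (x - c) + d < pi" by linarith
    qed
    \<comment> \<open>Minus the logarithmic derivative of the sine;
      \<open>?w' - ?w\<^sup>2 = \<rho>\<^sup>2\<close>, so the weight in Picone's inequality is
      constant.\<close>
    let ?w = "\<lambda>x. - \<rho> * (cos (\<rho> * (x - c) + d) / sin (\<rho> * (x - c) + d))"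
    let ?w' = "\<lambda>x. \<rho>\<^sup>2 / (sin (\<rho> * (x - c) + d))\<^sup>2"
    have "(k c)\<^sup>2 * ?w c - (k (c+pi))\<^sup>2 * ?w (c+pi) + integral {c..c+pi} (\<lambda>x. \<rho>\<^sup>2 * (k x)\<^sup>2)
        \<le> integral {c..c+pi} (\<lambda>x. 1 * (k' x)\<^sup>2)"
    proof (rule picone_interval[where w = ?w and w' = ?w'])
      fix x assume x: "x \<in> {c..c+pi}"
      show "(k has_real_derivative k' x) (at x within {c..c+pi})" using k DERIV_subset by blast
      have "(sin (\<rho> * (x - c) + d))\<^sup>2 + (cos (\<rho> * (x - c) + d))\<^sup>2 = 1" by simp
      then have e: "\<rho>\<^sup>2 * (sin (\<rho> * (x - c) + d))\<^sup>2 + \<rho>\<^sup>2 * (cos (\<rho> * (x - c) + d))\<^sup>2 = \<rho>\<^sup>2"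
        by (metis distrib_left mult.right_neutral)
      show "(?w has_real_derivative ?w' x) (at x within {c..c+pi})"
      proof (rule DERIV_cong)
        let ?S = "sin (\<rho> * (x - c) + d)" and ?C = "cos (\<rho> * (x - c) + d)"
        show "(?w has_real_derivative - \<rho> * ((- ?S * \<rho> * ?S - ?C * (?C * \<rho>)) / (?S * ?S))) (at x within {c..c+pi})"
          by (rule DERIV_cmult[OF DERIV_divide]) (use s[OF x] in \<open>auto intro!: derivative_eq_intros\<close>)
        have "- \<rho> * ((- ?S * \<rho> * ?S - ?C * (?C * \<rho>)) / (?S * ?S)) = (\<rho>\<^sup>2 * ?S\<^sup>2 + \<rho>\<^sup>2 * ?C\<^sup>2) / ?S\<^sup>2"
          by (simp add: power2_eq_square algebra_simps add_divide_distrib diff_divide_distrib)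
        then show "- \<rho> * ((- ?S * \<rho> * ?S - ?C * (?C * \<rho>)) / (?S * ?S)) = ?w' x"
          by (simp only: e)
      qed
      show "\<rho>\<^sup>2 \<le> ?w' x - (?w x)\<^sup>2 / 1"
        using s[OF x] e by (simp add: field_simps power2_eq_square)
    qed (use s in \<open>auto intro!: continuous_intros continuous_on_subset[OF ck] dest: less_imp_neq[symmetric]\<close>, fastforce?)
    then show ?thesis using assms(3,4) by simp
  qed
  \<comment> \<open>The sharp constant is reached only in the limit, because for
    \<open>\<rho> = 1\<close> the sine vanishes at both ends.\<close>
  have "((\<lambda>\<rho>. \<rho>\<^sup>2 * ?I) \<longlongrightarrow> 1\<^sup>2 * ?I) (at_left 1)"
    by (intro tendsto_intros)
  moreover have "\<forall>\<^sub>F \<rho> in at_left (1::real). \<rho>\<^sup>2 * ?I \<le> integral {c..c+pi} (\<lambda>x. (k' x)\<^sup>2)"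
    using eventually_at_left[of 0 "1::real"] * by (auto intro!: exI[of _ 0])
  ultimately have "1\<^sup>2 * ?I \<le> integral {c..c+pi} (\<lambda>x. (k' x)\<^sup>2)"
    by (rule tendsto_upperbound) simp
  then show ?thesis by simp
qed

lemma integral_periodic_shift:
  fixes h :: "real \<Rightarrow> real"
  assumes c: "continuous_on UNIV h" and p: "\<And>x. h (x + T) = h x" and T: "0 \<le> c" "c \<le> T"
  shows "integral {c..c+T} h = integral {0..T} h"
proof -
  have i: "h integrable_on {x..y}" for x y
    by (intro integrable_continuous_interval continuous_on_subset[OF c]) simp
  have "integral {0..c} h = integral {T..c+T} h"
    using integral_shift_Icc_real[of 0 c h T] p by (simp add: o_def add.commute)
  then have "integral {0..T} h = integral {c..T} h + integral {T..c+T} h"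
    using Henstock_Kurzweil_Integration.integral_combine[of 0 c T h] i T by auto
  also have "\<dots> = integral {c..c+T} h"
    using T i by (intro Henstock_Kurzweil_Integration.integral_combine) auto
  finally show ?thesis by simp
qed

text \<open>By the intermediate value theorem \<open>h (c + pi) = h c\<close> for some \<open>c\<close>, and the Dirichlet inequality
applies to \<open>h - h c\<close> on the two half periods.\<close>

lemma wirtinger:
  fixes h h' :: "real \<Rightarrow> real"
  assumes h: "\<And>x. (h has_real_derivative h' x) (at x)"
    and ch: "continuous_on UNIV h'" and p: "\<And>x. h (x + 2*pi) = h x" "\<And>x. h' (x + 2*pi) = h' x"
    and z: "integral {0..2*pi} h = 0"
  shows "integral {0..2*pi} (\<lambda>x. (h x)\<^sup>2) \<le> integral {0..2*pi} (\<lambda>x. (h' x)\<^sup>2)"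
proof -
  have chh: "continuous_on UNIV h"
    using h by (metis DERIV_continuous_on DERIV_subset top_greatest)
  have "\<exists>c\<ge>0. c \<le> pi \<and> h (c + pi) - h c = 0"
  proof -
    let ?f = "\<lambda>c. h (c + pi) - h c"
    have cf: "continuous_on {0..pi} ?f"
      by (intro continuous_intros continuous_on_compose2[OF chh]) auto
    \<comment> \<open>Two shifts by \<open>pi\<close> make a full period, so one shift reverses the
      sign of the difference, which therefore has a zero.\<close>
    have op: "?f pi = - ?f 0" using p(1)[of 0] by simp
    show ?thesis
    proof (cases "?f 0 \<le> 0")
      case True
      then show ?thesis using IVT'[of ?f 0 0 pi] cf op by auto
    next
      case False
      then show ?thesis using IVT2'[of ?f pi 0 0] cf op by auto
    qed
  qed
  then obtain c where c: "0 \<le> c" "c \<le> pi" "h (c + pi) = h c" by auto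
  define k where "k x = h x - h c" for x
  have k: "(k has_real_derivative h' x) (at x)" for x
    unfolding k_def by (auto intro!: derivative_eq_intros h)
  have ck: "continuous_on UNIV k" unfolding k_def by (intro continuous_intros chh)
  have i: "(\<lambda>x. (f x)\<^sup>2) integrable_on {x..y}" "f integrable_on {x..y}" if "continuous_on UNIV f" for f :: "real \<Rightarrow> real" and x y
    by (intro integrable_continuous_interval continuous_intros continuous_on_subset[OF that]; simp)+
  have "integral {0..2*pi} (\<lambda>x. (k x)\<^sup>2) = integral {c..c+2*pi} (\<lambda>x. (k x)\<^sup>2)"
    by (rule integral_periodic_shift[symmetric]) (use c p in \<open>auto intro!: continuous_intros chh simp: k_def\<close>)
  also have "\<dots> = integral {c..c+pi} (\<lambda>x. (k x)\<^sup>2) + integral {c+pi..(c+pi)+pi} (\<lambda>x. (k x)\<^sup>2)"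
    by (subst Henstock_Kurzweil_Integration.integral_combine) (use i(1)[OF ck] in \<open>auto simp: add.commute\<close>)
  also have "\<dots> \<le> integral {c..c+pi} (\<lambda>x. (h' x)\<^sup>2) + integral {c+pi..(c+pi)+pi} (\<lambda>x. (h' x)\<^sup>2)"
    by (intro add_mono dirichlet_poincare[OF k ch]) (use c p(1)[of c] in \<open>auto simp: k_def add.assoc\<close>)
  also have "\<dots> = integral {c..c+2*pi} (\<lambda>x. (h' x)\<^sup>2)"
    by (subst Henstock_Kurzweil_Integration.integral_combine) (use i(1)[OF ch] in \<open>auto simp: add.commute\<close>)
  also have "\<dots> = integral {0..2*pi} (\<lambda>x. (h' x)\<^sup>2)"
    by (rule integral_periodic_shift) (use c p in \<open>auto intro!: continuous_intros ch\<close>)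
  finally have A: "integral {0..2*pi} (\<lambda>x. (k x)\<^sup>2) \<le> integral {0..2*pi} (\<lambda>x. (h' x)\<^sup>2)" .
  \<comment> \<open>Subtracting a constant from a function of mean zero can only increase its square
    integral, so the bound for \<open>k\<close> implies the one for \<open>h\<close>.\<close>
  have "integral {0..2*pi} (\<lambda>x. (k x)\<^sup>2) = integral {0..2*pi} (\<lambda>x. (h x)\<^sup>2 - 2 * h c * h x + (h c)\<^sup>2)"
    by (rule integral_cong) (simp add: k_def power2_eq_square algebra_simps)
  also have "\<dots> = integral {0..2*pi} (\<lambda>x. (h x)\<^sup>2) - 2 * h c * integral {0..2*pi} h + 2*pi*(h c)\<^sup>2"
    by (subst integral_add integral_diff integral_mult_right, (intro integrable_diff integrable_on_mult_right i chh integrable_const_ivl)+)+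
      simp
  also have "\<dots> \<ge> integral {0..2*pi} (\<lambda>x. (h x)\<^sup>2)" using z by simp
  finally show ?thesis using A by simp
qed

text \<open>The flag \<open>b\<close> selects whether angular means are subtracted; only then is the Wirtinger gain available.\<close>

lemma annulus_bound:
  fixes p pr pt :: "real \<Rightarrow> real \<Rightarrow> real" and b :: bool
  assumes cp: "continuous_on UNIV (\<lambda>(r,t). p r t)"
    and cpr: "continuous_on UNIV (\<lambda>(r,t). pr r t)"
    and cpt: "continuous_on UNIV (\<lambda>(r,t). pt r t)"
    and dr: "\<And>r t. ((\<lambda>r. p r t) has_real_derivative pr r t) (at r)"
    and dt: "\<And>r t. ((\<lambda>t. p r t) has_real_derivative pt r t) (at t)"
    and per: "\<And>r t. p r (t + 2*pi) = p r t" "\<And>r t. pt r (t + 2*pi) = pt r t"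
    and eps: "0 < \<epsilon>" "\<epsilon> \<le> \<rho>" and p0: "\<And>t. p \<rho> t = 0"
    and w: "\<And>x. x \<in> {\<epsilon>..\<rho>} \<Longrightarrow> (w has_real_derivative w' x) (at x within {\<epsilon>..\<rho>})"
    and cw: "continuous_on {\<epsilon>..\<rho>} w'" and cq: "continuous_on {\<epsilon>..\<rho>} q"
    and q: "\<And>x. x \<in> {\<epsilon>..\<rho>} \<Longrightarrow> (q x - of_bool b) / x \<le> w' x - (w x)\<^sup>2 / x"
  defines "m \<equiv> \<lambda>r. integral {0..2*pi} (p r) / (2*pi)"
  defines "g \<equiv> \<lambda>r t. p r t - of_bool b * m r"
  shows "w \<epsilon> * integral {0..2*pi} (\<lambda>t. (g \<epsilon> t)\<^sup>2) +
      integral {\<epsilon>..\<rho>} (\<lambda>r. integral {0..2*pi} (\<lambda>t. q r / r * (g r t)\<^sup>2))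
    \<le> integral {\<epsilon>..\<rho>} (\<lambda>r. integral {0..2*pi} (\<lambda>t. r * (pr r t)\<^sup>2 + (pt r t)\<^sup>2 / r))"
proof -
  define m' where "m' r = integral {0..2*pi} (pr r) / (2*pi)" for r
  have cont2: "continuous_on S (\<lambda>x. f (u x) (v x))"
    if "continuous_on UNIV (\<lambda>(r,t). f r t)" "continuous_on S u" "continuous_on S v"
    for f :: "real \<Rightarrow> real \<Rightarrow> real" and S and u v :: "'x::topological_space \<Rightarrow> real"
    using continuous_on_compose2[OF that(1) continuous_on_Pair[OF that(2,3)]] by simp
  note [continuous_intros] = cont2[OF cp] cont2[OF cpr] cont2[OF cpt]
  have m: "(m has_real_derivative m' r) (at r)" for r
  proof -
    have "((\<lambda>r. integral (cbox 0 (2*pi)) (p r)) has_field_derivative integral (cbox 0 (2*pi)) (pr r)) (at r within UNIV)"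
      by (rule leibniz_rule_field_derivative)
        (auto intro!: dr integrable_continuous_interval continuous_intros simp: split_beta)
    then show ?thesis unfolding m_def m'_def by (auto intro!: derivative_eq_intros)
  qed
  have cm: "continuous_on UNIV m" using m by (metis DERIV_continuous_on DERIV_subset top_greatest)
  have cm': "continuous_on UNIV m'"
  proof -
    have "continuous_on UNIV (\<lambda>r. integral (cbox 0 (2*pi)) (pr r))"
      by (rule integral_continuous_on_param) (auto intro!: continuous_intros simp: split_beta)
    then show ?thesis unfolding m'_def by (auto intro!: continuous_intros)
  qed
  note [continuous_intros] = continuous_on_compose2[OF cm] continuous_on_compose2[OF cm']
  define g' where "g' r t = pr r t - of_bool b * m' r" for r t
  have g: "((\<lambda>r. g r t) has_real_derivative g' r t) (at r)" for r t
    unfolding g_def g'_def by (auto intro!: derivative_eq_intros dr m)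
  have gt: "((\<lambda>t. g r t) has_real_derivative pt r t) (at t)" for r t
    unfolding g_def by (auto intro!: derivative_eq_intros dt)
  have cg: "continuous_on S (\<lambda>x. g (u x) (v x))" "continuous_on S (\<lambda>x. g' (u x) (v x))"
    if "continuous_on S u" "continuous_on S v" for S and u v :: "'x::topological_space \<Rightarrow> real"
    unfolding g_def g'_def using that by (auto intro!: continuous_intros)
  note [continuous_intros] = cg
  note ii = integrable_continuous_interval
  have pos: "r > 0" if "r \<in> {\<epsilon>..\<rho>}" for r using that eps by auto
  \<comment> \<open>Removing the mean from the radial derivative lowers its square integral by
    \<open>2 * pi * (m' r)\<^sup>2\<close>.\<close>
  have angr: "integral {0..2*pi} (\<lambda>t. (g' r t)\<^sup>2) \<le> integral {0..2*pi} (\<lambda>t. (pr r t)\<^sup>2)" for r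
  proof (cases b)
    case True
    have "integral {0..2*pi} (\<lambda>t. (g' r t)\<^sup>2) = integral {0..2*pi} (\<lambda>t. (pr r t)\<^sup>2 - 2 * m' r * pr r t + (m' r)\<^sup>2)"
      by (rule integral_cong) (simp add: g'_def True power2_eq_square algebra_simps)
    also have "\<dots> = integral {0..2*pi} (\<lambda>t. (pr r t)\<^sup>2) - 2 * m' r * integral {0..2*pi} (pr r) + 2*pi*(m' r)\<^sup>2"
      by (subst integral_add integral_diff integral_mult_right, (intro ii continuous_intros)+)+ simp
    also have "\<dots> = integral {0..2*pi} (\<lambda>t. (pr r t)\<^sup>2) - 2*pi*(m' r)\<^sup>2"
      by (simp add: m'_def power2_eq_square field_simps)
    finally show ?thesis by simp
  qed (simp add: g'_def)
  \<comment> \<open>If \<open>b\<close> holds, \<open>g r\<close> has mean zero and Wirtinger's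
    inequality applies; its angular derivative is still \<open>pt\<close>, as the mean does not
    depend on the angle.\<close>
  have angt: "of_bool b * integral {0..2*pi} (\<lambda>t. (g r t)\<^sup>2) \<le> integral {0..2*pi} (\<lambda>t. (pt r t)\<^sup>2)" for r
  proof (cases b)
    case True
    have "integral {0..2*pi} (g r) = integral {0..2*pi} (p r) - 2*pi * m r"
      unfolding g_def using True by (subst integral_diff) (auto intro!: ii continuous_intros)
    also have "\<dots> = 0" by (simp add: m_def)
    finally have "integral {0..2*pi} (\<lambda>t. (g r t)\<^sup>2) \<le> integral {0..2*pi} (\<lambda>t. (pt r t)\<^sup>2)"
      by (intro wirtinger gt) (auto intro!: continuous_intros simp: per g_def)
    then show ?thesis by (simp add: True)
  next
    case False
    have "0 \<le> integral {0..2*pi} (\<lambda>t. (pt r t)\<^sup>2)" by (rule integral_nonneg) (auto intro!: ii continuous_intros)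
    with False show ?thesis by simp
  qed
  let ?h = "\<lambda>r t. r * (g' r t)\<^sup>2 + of_bool b * (g r t)\<^sup>2 / r"
  have ch: "continuous_on (cbox (\<epsilon>,0) (\<rho>,2*pi)) (\<lambda>(r,t). ?h r t)"
    unfolding split_beta by (intro continuous_intros) (use eps in \<open>auto simp: cbox_Pair_eq\<close>)
  have cq2: "continuous_on (cbox (\<epsilon>,0) (\<rho>,2*pi)) (\<lambda>(r,t). q r / r * (g r t)\<^sup>2)"
    unfolding split_beta
    by (intro continuous_intros continuous_on_compose2[OF cq]) (use eps in \<open>auto simp: cbox_Pair_eq\<close>)
  have ce: "continuous_on (cbox (\<epsilon>,0) (\<rho>,2*pi)) (\<lambda>(r,t). r * (pr r t)\<^sup>2 + (pt r t)\<^sup>2 / r)"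
    unfolding split_beta by (intro continuous_intros) (use eps in \<open>auto simp: cbox_Pair_eq\<close>)
  have par: "(\<lambda>r. integral {0..2*pi} (f r)) integrable_on {\<epsilon>..\<rho>}"
    if "continuous_on (cbox (\<epsilon>,0) (\<rho>,2*pi)) (\<lambda>(r,t). f r t)" for f :: "real \<Rightarrow> real \<Rightarrow> real"
    using integral_continuous_on_param[of "{\<epsilon>..\<rho>}" 0 "2*pi" f] that
    by (auto intro!: ii simp: cbox_Pair_eq)
  have par2: "(\<lambda>t. integral {\<epsilon>..\<rho>} (\<lambda>r. f r t)) integrable_on {0..2*pi}"
    if "continuous_on (cbox (\<epsilon>,0) (\<rho>,2*pi)) (\<lambda>(r,t). f r t)" for f :: "real \<Rightarrow> real \<Rightarrow> real"
  proof -
    have "continuous_on ({0..2*pi} \<times> {\<epsilon>..\<rho>}) (\<lambda>(t,r). f r t)"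
      unfolding split_beta
      by (rule continuous_on_compose2[OF that[unfolded split_beta], where f = "\<lambda>z. (snd z, fst z)", simplified])
        (auto intro!: continuous_intros simp: cbox_Pair_eq)
    then show ?thesis
      using integral_continuous_on_param[of "{0..2*pi}" \<epsilon> \<rho> "\<lambda>t r. f r t"]
      by (auto intro!: ii)
  qed
  have swap: "integral {\<epsilon>..\<rho>} (\<lambda>r. integral {0..2*pi} (f r)) = integral {0..2*pi} (\<lambda>t. integral {\<epsilon>..\<rho>} (\<lambda>r. f r t))"
    if "continuous_on (cbox (\<epsilon>,0) (\<rho>,2*pi)) (\<lambda>(r,t). f r t)" for f :: "real \<Rightarrow> real \<Rightarrow> real"
    using integral_swap_continuous[OF that] by simp
  \<comment> \<open>Picone's inequality along the ray of angle \<open>t\<close>, with the polar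
    weight \<open>r\<close>. The summand \<open>of_bool b * (g r t)\<^sup>2 / r\<close> put on the
    right compensates the \<open>- of_bool b\<close> in the Riccati hypothesis.\<close>
  have rad: "w \<epsilon> * (g \<epsilon> t)\<^sup>2 + integral {\<epsilon>..\<rho>} (\<lambda>r. q r / r * (g r t)\<^sup>2) \<le> integral {\<epsilon>..\<rho>} (\<lambda>r. ?h r t)" for t
  proof -
    have "p \<rho> = (\<lambda>_. 0)" using p0 by auto
    then have g0: "g \<rho> t = 0" by (simp add: g_def m_def)
    have "(g \<epsilon> t)\<^sup>2 * w \<epsilon> - (g \<rho> t)\<^sup>2 * w \<rho> + integral {\<epsilon>..\<rho>} (\<lambda>r. ((q r - of_bool b) / r) * (g r t)\<^sup>2)
         \<le> integral {\<epsilon>..\<rho>} (\<lambda>r. r * (g' r t)\<^sup>2)"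
    proof (rule picone_interval[where w = w and w' = w'])
      fix x assume x: "x \<in> {\<epsilon>..\<rho>}"
      show "(q x - of_bool b) / x \<le> w' x - (w x)\<^sup>2 / x" by (rule q[OF x])
      show "0 < x" by (rule pos[OF x])
    qed (use eps in \<open>auto intro!: continuous_intros cq cw w DERIV_subset[OF g]\<close>)
    moreover have "integral {\<epsilon>..\<rho>} (\<lambda>r. q r / r * (g r t)\<^sup>2) - integral {\<epsilon>..\<rho>} (\<lambda>r. of_bool b * (g r t)\<^sup>2 / r)
        = integral {\<epsilon>..\<rho>} (\<lambda>r. ((q r - of_bool b) / r) * (g r t)\<^sup>2)"
      by (subst integral_diff[symmetric])
        (use eps in \<open>auto intro!: ii continuous_intros cq integral_cong simp: diff_divide_distrib left_diff_distrib\<close>)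
    moreover have "integral {\<epsilon>..\<rho>} (\<lambda>r. ?h r t) = integral {\<epsilon>..\<rho>} (\<lambda>r. r * (g' r t)\<^sup>2) + integral {\<epsilon>..\<rho>} (\<lambda>r. of_bool b * (g r t)\<^sup>2 / r)"
      by (rule integral_add) (use eps in \<open>auto intro!: ii continuous_intros\<close>)
    ultimately show ?thesis using g0 by (simp add: mult.commute)
  qed
  have "w \<epsilon> * integral {0..2*pi} (\<lambda>t. (g \<epsilon> t)\<^sup>2) + integral {\<epsilon>..\<rho>} (\<lambda>r. integral {0..2*pi} (\<lambda>t. q r / r * (g r t)\<^sup>2))
    = integral {0..2*pi} (\<lambda>t. w \<epsilon> * (g \<epsilon> t)\<^sup>2 + integral {\<epsilon>..\<rho>} (\<lambda>r. q r / r * (g r t)\<^sup>2))"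
    unfolding swap[OF cq2]
    by (subst integral_add[OF _ par2[OF cq2]]) (auto intro!: ii continuous_intros)
  also have "\<dots> \<le> integral {0..2*pi} (\<lambda>t. integral {\<epsilon>..\<rho>} (\<lambda>r. ?h r t))"
    by (intro integral_le rad integrable_add par2[OF cq2] par2[OF ch]) (auto intro!: ii continuous_intros)
  also have "\<dots> = integral {\<epsilon>..\<rho>} (\<lambda>r. integral {0..2*pi} (\<lambda>t. ?h r t))"
    by (rule swap[OF ch, symmetric])
  also have "\<dots> \<le> integral {\<epsilon>..\<rho>} (\<lambda>r. integral {0..2*pi} (\<lambda>t. r * (pr r t)\<^sup>2 + (pt r t)\<^sup>2 / r))"
  proof (rule integral_le[OF par[OF ch] par[OF ce]])
    fix r assume "r \<in> {\<epsilon>..\<rho>}"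
    then have r: "r > 0" by (rule pos)
    have "integral {0..2*pi} (?h r) = r * integral {0..2*pi} (\<lambda>t. (g' r t)\<^sup>2) + (of_bool b * integral {0..2*pi} (\<lambda>t. (g r t)\<^sup>2)) / r"
      by (subst integral_add) (use r in \<open>auto intro!: ii continuous_intros\<close>)
    \<comment> \<open>Here that additional summand is paid for by the angular energy.\<close>
    also have "\<dots> \<le> r * integral {0..2*pi} (\<lambda>t. (pr r t)\<^sup>2) + integral {0..2*pi} (\<lambda>t. (pt r t)\<^sup>2) / r"
      by (intro add_mono mult_left_mono divide_right_mono angr angt) (use r in auto)
    also have "\<dots> = integral {0..2*pi} (\<lambda>t. r * (pr r t)\<^sup>2 + (pt r t)\<^sup>2 / r)"
      by (subst integral_add) (use r in \<open>auto intro!: ii continuous_intros\<close>)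
    finally show "integral {0..2*pi} (?h r) \<le> integral {0..2*pi} (\<lambda>t. r * (pr r t)\<^sup>2 + (pt r t)\<^sup>2 / r)" .
  qed
  finally show ?thesis .
qed

section \<open>Modified Bessel functions of imaginary order\<close>

lemma integrable_exp_dominated:
  fixes f :: "real \<Rightarrow> real"
  assumes "continuous_on {0..} f" "0 < a" "\<And>s. 0 \<le> s \<Longrightarrow> \<bar>f s\<bar> \<le> C * exp (- a * s)"
  shows "integrable (lebesgue_on {0..}) f"
proof (rule Bochner_Integration.integrable_bound)
  have "(\<lambda>s. exp (- a * s)) absolutely_integrable_on {0..}"
    using assms(2) by (intro nonnegative_absolutely_integrable_1 integrable_on_exp_minus_to_infinity) auto
  then have "integrable (lebesgue_on {0..}) (\<lambda>s. exp (- a * s))"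
    by (rule absolutely_integrable_imp_integrable) simp
  then show "integrable (lebesgue_on {0..}) (\<lambda>s. C * exp (- a * s))" by simp
  show "f \<in> borel_measurable (lebesgue_on {0..})"
    using assms(1) by (rule continuous_imp_measurable_on_sets_lebesgue) simp
  show "AE s in lebesgue_on {0..}. norm (f s) \<le> norm (C * exp (- a * s))"
    using assms(3) by (intro AE_I2) (fastforce intro: order_trans[OF _ abs_ge_self])
qed

lemma ftc_halfline:
  fixes f F :: "real \<Rightarrow> real"
  assumes F: "\<And>s. (F has_real_derivative f s) (at s)" and c: "continuous_on UNIV f"
    and i: "integrable (lebesgue_on {0..}) f" and L: "(F \<longlongrightarrow> L) at_top"
  shows "(LINT s|lebesgue_on {0..}. f s) = L - F 0"
proof -
  have "(\<lambda>n. LINT s|lebesgue_on {0..}. indicator {0..real n} s *\<^sub>R f s) \<longlonglongrightarrow> (LINT s|lebesgue_on {0..}. f s)"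
  proof (rule integral_dominated_convergence)
    show "integrable (lebesgue_on {0..}) (\<lambda>s. \<bar>f s\<bar>)" using i by simp
    show "f \<in> borel_measurable (lebesgue_on {0..})" using i by simp
    show "(\<lambda>s. indicat_real {0..real n} s *\<^sub>R f s) \<in> borel_measurable (lebesgue_on {0..})" for n
      using i by (intro borel_measurable_scaleR borel_measurable_indicator) (auto simp: sets_restrict_space_iff)
    have "(\<lambda>n. indicat_real {0..real n} s *\<^sub>R f s) \<longlonglongrightarrow> f s" if "s \<ge> 0" for s
    proof (rule tendsto_eventually)
      show "\<forall>\<^sub>F n in sequentially. indicat_real {0..real n} s *\<^sub>R f s = f s"
        using eventually_ge_at_top[of "nat \<lceil>s\<rceil>"]
        by eventually_elim (use that in \<open>auto simp: indicator_def\<close>; linarith)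
    qed
    then show "AE s in lebesgue_on {0..}. (\<lambda>n. indicat_real {0..real n} s *\<^sub>R f s) \<longlonglongrightarrow> f s"
      by (intro AE_I2) auto
  qed (auto simp: indicator_def)
  moreover have "(LINT s|lebesgue_on {0..}. indicator {0..real n} s *\<^sub>R f s) = F (real n) - F 0" for n
  proof -
    have ci: "continuous_on {0..real n} f" using c continuous_on_subset by blast
    have "(f has_integral (F (real n) - F 0)) {0..real n}"
      by (rule fundamental_theorem_of_calculus)
        (use F in \<open>auto simp flip: has_real_derivative_iff_has_vector_derivative intro: DERIV_subset\<close>)
    moreover have "(LINT s|lebesgue_on {0..real n}. f s) = integral {0..real n} f"
      by (rule lebesgue_integral_eq_integral) (auto intro!: continuous_imp_integrable_real ci)
    moreover have "(LINT s|lebesgue_on {0..real n}. f s) = (LINT s|lebesgue_on {0..}. indicator {0..real n} s *\<^sub>R f s)"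
      by (simp add: integral_restrict_space) (auto intro!: Bochner_Integration.integral_cong simp: indicator_def)
    ultimately show ?thesis by (simp add: integral_unique)
  qed
  ultimately have "(\<lambda>n. F (real n) - F 0) \<longlonglongrightarrow> (LINT s|lebesgue_on {0..}. f s)" by simp
  moreover have "(\<lambda>n. F (real n) - F 0) \<longlonglongrightarrow> L - F 0"
    by (intro tendsto_intros filterlim_compose[OF L filterlim_real_sequentially])
  ultimately show ?thesis by (rule LIMSEQ_unique)
qed

text \<open>Along any sequence tending to 0 the difference quotients are dominated by
  \<open>g\<close>, by the mean value inequality on the segment, so dominated convergence
  applies.\<close>

lemma DERIV_lebesgue_integral:
  fixes f f' :: "real \<Rightarrow> 'a \<Rightarrow> real"
  assumes d: "0 < d"
    and f: "\<And>x s. \<bar>x - t\<bar> < d \<Longrightarrow> s \<in> space M \<Longrightarrow> ((\<lambda>x. f x s) has_real_derivative f' x s) (at x)"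
    and i: "\<And>x. \<bar>x - t\<bar> < d \<Longrightarrow> integrable M (f x)"
    and m: "f' t \<in> borel_measurable M"
    and g: "integrable M g" and b: "\<And>x s. \<bar>x - t\<bar> < d \<Longrightarrow> s \<in> space M \<Longrightarrow> \<bar>f' x s\<bar> \<le> g s"
  shows "((\<lambda>x. LINT s|M. f x s) has_real_derivative (LINT s|M. f' t s)) (at t)"
  unfolding DERIV_def tendsto_at_iff_sequentially
proof (intro allI impI)
  fix X :: "nat \<Rightarrow> real" assume X: "\<forall>i. X i \<in> UNIV - {0}" "X \<longlonglongrightarrow> 0"
  obtain N where N: "\<And>n. n \<ge> N \<Longrightarrow> \<bar>X n\<bar> < d"
    using X(2) d unfolding LIMSEQ_iff by (metis diff_zero real_norm_def)
  \<comment> \<open>Dropping the first \<open>N\<close> terms keeps every argument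
    \<open>t + Y n\<close> inside the interval where the hypotheses hold.\<close>
  define Y where "Y n = X (n + N)" for n
  have Y: "Y \<longlonglongrightarrow> 0" "\<And>n. Y n \<noteq> 0" "\<And>n. \<bar>Y n\<bar> < d"
    using X N LIMSEQ_ignore_initial_segment[OF X(2), of N] unfolding Y_def by auto
  have "(\<lambda>n. LINT s|M. (f (t + Y n) s - f t s) / Y n) \<longlonglongrightarrow> (LINT s|M. f' t s)"
  proof (rule integral_dominated_convergence)
    show "(\<lambda>s. (f (t + Y n) s - f t s) / Y n) \<in> borel_measurable M" for n
      using i[of "t + Y n"] i[of t] Y(3) d by auto
    show "AE s in M. (\<lambda>n. (f (t + Y n) s - f t s) / Y n) \<longlonglongrightarrow> f' t s"
    proof (rule AE_I2)
      fix s assume "s \<in> space M"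
      then have "((\<lambda>h. (f (t + h) s - f t s) / h) \<longlongrightarrow> f' t s) (at 0)"
        using f[of t s] d by (simp add: DERIV_def)
      then show "(\<lambda>n. (f (t + Y n) s - f t s) / Y n) \<longlonglongrightarrow> f' t s"
        unfolding tendsto_at_iff_sequentially using Y by (auto simp: o_def)
    qed
    show "AE s in M. norm ((f (t + Y n) s - f t s) / Y n) \<le> g s" for n
    proof (rule AE_I2)
      fix s assume s: "s \<in> space M"
      have "norm (f (t + Y n) s - f t s) \<le> g s * norm (t + Y n - t)"
      proof (rule field_differentiable_bound[where S = "{t - \<bar>Y n\<bar>..t + \<bar>Y n\<bar>}"])
        fix z assume z: "z \<in> {t - \<bar>Y n\<bar>..t + \<bar>Y n\<bar>}"
        then have zd: "\<bar>z - t\<bar> < d" using Y(3)[of n] by auto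
        show "((\<lambda>x. f x s) has_real_derivative f' z s) (at z within {t - \<bar>Y n\<bar>..t + \<bar>Y n\<bar>})"
          using f[OF zd s] DERIV_subset by blast
        show "norm (f' z s) \<le> g s" using b[OF zd s] by simp
      qed auto
      then show "norm ((f (t + Y n) s - f t s) / Y n) \<le> g s"
        using Y(2)[of n] by (simp add: field_simps)
    qed
  qed (use m g in auto)
  moreover have "(LINT s|M. (f (t + Y n) s - f t s) / Y n) = ((LINT s|M. f (t + Y n) s) - (LINT s|M. f t s)) / Y n" for n
    using i[of "t + Y n"] i[of t] Y(3) d by (simp add: Bochner_Integration.integral_diff)
  ultimately have "(\<lambda>n. ((LINT s|M. f (t + X (n+N)) s) - (LINT s|M. f t s)) / X (n+N)) \<longlonglongrightarrow> (LINT s|M. f' t s)"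
    by (simp only: Y_def)
  then show "((\<lambda>h. ((LINT s|M. f (t + h) s) - (LINT s|M. f t s)) / h) \<circ> X) \<longlonglongrightarrow> (LINT s|M. f' t s)"
    unfolding o_def by (rule LIMSEQ_offset)
qed

lemma sinh_ge_self: "0 \<le> x \<Longrightarrow> x \<le> sinh (x::real)"
proof -
  assume "0 \<le> x"
  then have "sinh 0 - 0 \<le> sinh x - x"
  proof (rule DERIV_nonneg_imp_nondecreasing)
    fix y :: real
    have "((\<lambda>x. sinh x - x) has_real_derivative cosh y - 1) (at y)"
      by (auto intro!: derivative_eq_intros)
    then show "\<exists>d. ((\<lambda>x. sinh x - x) has_real_derivative d) (at y) \<and> 0 \<le> d"
      using cosh_real_ge_1[of y] by (intro exI[of _ "cosh y - 1"]) simp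
  qed
  then show ?thesis by simp
qed

lemma cosh_ge_quadratic: "1 + s\<^sup>2 / 2 \<le> cosh (s::real)"
proof -
  have "(s/2)\<^sup>2 \<le> (sinh (s/2))\<^sup>2"
  proof -
    have "\<bar>s/2\<bar> \<le> \<bar>sinh (s/2)\<bar>"
      using sinh_ge_self[of "\<bar>s/2\<bar>"] by (simp del: abs_divide)
    then show ?thesis by (rule abs_le_square_iff[THEN iffD1])
  qed
  moreover have "cosh s = 1 + 2 * (sinh (s/2))\<^sup>2"
    using cosh_double[of "s/2"] cosh_square_eq[of "s/2"] by simp
  ultimately show ?thesis by (simp add: power_divide)
qed

lemma cosh_ge_self: "s \<le> cosh (s::real)"
proof -
  have "0 \<le> (s - 1)\<^sup>2" by simp
  then have "s \<le> 1 + s\<^sup>2 / 2" by (simp add: power2_eq_square algebra_simps)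
  then show ?thesis using cosh_ge_quadratic[of s] by linarith
qed

text \<open>With \<open>y = t * cosh s / 2\<close>, one half of the exponent absorbs
  \<open>(cosh s)\<^sup>2\<close> through \<open>y\<^sup>2 / 2 \<le> exp y\<close>, which produces
  the 8; the other half decays in \<open>s\<close> because \<open>s \<le> cosh s\<close>. Two powers
  of \<open>cosh\<close> are what the second derivative of the Macdonald function requires.\<close>

lemma exp_cosh_bound:
  assumes t: "0 < t" and h: "\<bar>h\<bar> \<le> B * (cosh (s::real))\<^sup>2"
  shows "\<bar>h * exp (- t * cosh s)\<bar> \<le> (8 * B / t\<^sup>2) * exp (- (t/2) * s)"
proof -
  let ?y = "t * cosh s / 2"
  have B: "0 \<le> B" 
  proof -
    have "0 \<le> B * (cosh s)\<^sup>2" using h abs_ge_zero[of h] by linarith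
    moreover have "0 < (cosh s)\<^sup>2" using cosh_real_pos[of s] by simp
    ultimately show ?thesis by (simp add: zero_le_mult_iff)
  qed
  have y: "0 \<le> ?y" using t by simp
  have "?y\<^sup>2 / 2 \<le> exp ?y" using exp_lower_Taylor_quadratic[OF y] y by linarith
  then have "(cosh s)\<^sup>2 \<le> 8 / t\<^sup>2 * exp ?y" using t by (simp add: field_simps power2_eq_square)
  then have "(cosh s)\<^sup>2 * exp (- t * cosh s) \<le> 8 / t\<^sup>2 * exp ?y * exp (- t * cosh s)"
    by (intro mult_right_mono) auto
  also have "\<dots> = 8 / t\<^sup>2 * exp (- ?y)" by (simp flip: exp_add)
  also have "\<dots> \<le> 8 / t\<^sup>2 * exp (- (t/2) * s)"
    using cosh_ge_self[of s] t by (intro mult_left_mono) auto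
  finally have *: "(cosh s)\<^sup>2 * exp (- t * cosh s) \<le> 8 / t\<^sup>2 * exp (- (t/2) * s)" .
  have "\<bar>h * exp (- t * cosh s)\<bar> \<le> B * ((cosh s)\<^sup>2 * exp (- t * cosh s))"
    using h by (simp add: abs_mult mult_right_mono flip: mult.assoc)
  also have "\<dots> \<le> B * (8 / t\<^sup>2 * exp (- (t/2) * s))" by (rule mult_left_mono[OF * B])
  finally show ?thesis by (simp add: mult_ac)
qed

lemma integrable_exp_cosh:
  fixes h :: "real \<Rightarrow> real"
  assumes "0 < t" "continuous_on UNIV h" "\<And>s. 0 \<le> s \<Longrightarrow> \<bar>h s\<bar> \<le> B * (cosh s)\<^sup>2"
  shows "integrable (lebesgue_on {0..}) (\<lambda>s. h s * exp (- t * cosh s))"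
  by (rule integrable_exp_dominated[of _ "t/2" "8 * B / t\<^sup>2"])
    (use assms exp_cosh_bound[OF assms(1,3)] in \<open>auto intro!: continuous_intros continuous_on_subset[OF assms(2)]\<close>)

lemma tendsto_exp_cosh:
  fixes h :: "real \<Rightarrow> real"
  assumes t: "0 < t" and h: "\<And>s. 0 \<le> s \<Longrightarrow> \<bar>h s\<bar> \<le> B * (cosh s)\<^sup>2"
  shows "((\<lambda>s. h s * exp (- t * cosh s)) \<longlongrightarrow> 0) at_top"
proof (rule Lim_null_comparison)
  show "\<forall>\<^sub>F s in at_top. norm (h s * exp (- t * cosh s)) \<le> (8 * B / t\<^sup>2) * exp (- (t/2) * s)"
    using eventually_ge_at_top[of 0] by eventually_elim (use exp_cosh_bound[OF t h] in auto)
  have "((\<lambda>s. exp (- (t/2) * s)) \<longlongrightarrow> 0) at_top"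
    using t by (intro filterlim_compose[OF exp_at_bot] filterlim_tendsto_neg_mult_at_bot[OF tendsto_const]
        filterlim_ident) auto
  from tendsto_mult_left[OF this, of "8 * B / t\<^sup>2"]
  show "((\<lambda>s. (8 * B / t\<^sup>2) * exp (- (t/2) * s)) \<longlongrightarrow> 0) at_top" by simp
qed

text \<open>\<open>KJ 0 \<mu>\<close> is the Macdonald function of order \<open>i \<mu>\<close>, and \<open>KJ j \<mu>\<close> its \<open>j\<close>-th derivative up to the sign \<open>(-1)^j\<close>.\<close>

definition KJ :: "nat \<Rightarrow> real \<Rightarrow> real \<Rightarrow> real" where
  "KJ j \<mu> t = (LINT s|lebesgue_on {0..}. cosh s ^ j * cos (\<mu> * s) * exp (- t * cosh s))"

lemma cosh_power_le: "j \<le> 2 \<Longrightarrow> cosh s ^ j \<le> (cosh (s::real))\<^sup>2"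
  by (rule power_increasing) (auto simp: cosh_real_ge_1)

lemma abs_cosh_cos_le: "j \<le> 2 \<Longrightarrow> \<bar>cosh s ^ j * cos x\<bar> \<le> 1 * (cosh (s::real))\<^sup>2"
  using mult_mono[OF cosh_power_le abs_cos_le_one, of j s x] by (simp add: abs_mult)

lemma integrable_KJ: "0 < t \<Longrightarrow> j \<le> 2 \<Longrightarrow>
  integrable (lebesgue_on {0..}) (\<lambda>s::real. cosh s ^ j * cos (\<mu> * s) * exp (- t * cosh s))"
  by (rule integrable_exp_cosh[where B = 1 and h = "\<lambda>s. cosh s ^ j * cos (\<mu> * s)"])
    (use abs_cosh_cos_le in \<open>auto intro!: continuous_intros\<close>)

lemma DERIV_KJ:
  assumes t: "0 < t" and j: "j \<le> 1"
  shows "(KJ j \<mu> has_real_derivative - KJ (Suc j) \<mu> t) (at t)"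
proof -
  have "((\<lambda>x. LINT s|lebesgue_on {0..}. cosh s ^ j * cos (\<mu> * s) * exp (- x * cosh s)) has_real_derivative
     (LINT s|lebesgue_on {0..}. - (cosh s ^ Suc j * cos (\<mu> * s) * exp (- t * cosh s)))) (at t)"
  \<comment> \<open>For \<open>x \<ge> t / 2\<close> the exponential is at most its value at
    \<open>t / 2\<close>, so the integrand of \<open>KJ (Suc j) 0 (t/2)\<close> dominates.\<close>
  proof (rule DERIV_lebesgue_integral[where d = "t/2" and g = "\<lambda>s. cosh s ^ Suc j * cos (0 * s) * exp (- (t/2) * cosh s)"])
    show "((\<lambda>x. cosh s ^ j * cos (\<mu> * s) * exp (- x * cosh s)) has_real_derivative
       - (cosh s ^ Suc j * cos (\<mu> * s) * exp (- x * cosh s))) (at x)" for x s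
      by (auto intro!: derivative_eq_intros)
    show "integrable (lebesgue_on {0..}) (\<lambda>s. cosh s ^ j * cos (\<mu> * s) * exp (- x * cosh s))" if "\<bar>x - t\<bar> < t/2" for x
      using that t j by (intro integrable_KJ) (auto simp: abs_if split: if_splits)
    show "(\<lambda>s. - (cosh s ^ Suc j * cos (\<mu> * s) * exp (- t * cosh s))) \<in> borel_measurable (lebesgue_on {0..})"
      using integrable_KJ[OF t, of "Suc j" \<mu>] j by (intro borel_measurable_uminus) auto
    show "integrable (lebesgue_on {0..}) (\<lambda>s. cosh s ^ Suc j * cos (0 * s) * exp (- (t/2) * cosh s))"
      using t j by (intro integrable_KJ) auto
    fix x s assume x: "\<bar>x - t\<bar> < t/2"
    have "t / 2 \<le> x" using x by (auto simp: abs_if split: if_splits)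
    then have "exp (- x * cosh s) \<le> exp (- (t/2) * cosh s)" by simp
    then have "(cosh s ^ Suc j * \<bar>cos (\<mu> * s)\<bar>) * exp (- x * cosh s) \<le> (cosh s ^ Suc j * 1) * exp (- (t/2) * cosh s)"
      by (intro mult_mono) auto
    then show "\<bar>- (cosh s ^ Suc j * cos (\<mu> * s) * exp (- x * cosh s))\<bar> \<le> cosh s ^ Suc j * cos (0 * s) * exp (- (t/2) * cosh s)"
      by (simp add: abs_mult)
  qed (use t in auto)
  then show ?thesis unfolding KJ_def[abs_def] by simp
qed

lemma abs_sinh_le_cosh: "\<bar>sinh s\<bar> \<le> cosh (s::real)"
  using sinh_le_cosh_real[of s] sinh_le_cosh_real[of "-s"] by (simp add: abs_le_iff)

text \<open>This is the modified Bessel equation of order \<open>i \<mu>\<close>, with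
  \<open>KJ 1\<close> being minus the first derivative. The corresponding combination of integrands
  is the \<open>s\<close>-derivative of \<open>?F\<close>, which vanishes at 0 and at
  infinity.\<close>

lemma KJ_ode:
  assumes t: "0 < t"
  shows "t\<^sup>2 * KJ 2 \<mu> t = t * KJ 1 \<mu> t + (t\<^sup>2 - \<mu>\<^sup>2) * KJ 0 \<mu> t"
proof -
  let ?F = "\<lambda>s. (\<mu> * sin (\<mu> * s) - t * sinh s * cos (\<mu> * s)) * exp (- t * cosh s)"
  let ?f = "\<lambda>s. (t\<^sup>2 * (cosh s)\<^sup>2 - t * cosh s + (\<mu>\<^sup>2 - t\<^sup>2)) * cos (\<mu> * s) * exp (- t * cosh s)"
  have sq: "(sinh s)\<^sup>2 = (cosh s)\<^sup>2 - 1" for s :: real by (simp add: cosh_square_eq)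
  have eq: "?f = (\<lambda>s. t\<^sup>2 * (cosh s ^ 2 * cos (\<mu> * s) * exp (- t * cosh s)) - t * (cosh s ^ 1 * cos (\<mu> * s) * exp (- t * cosh s))
      + (\<mu>\<^sup>2 - t\<^sup>2) * (cosh s ^ 0 * cos (\<mu> * s) * exp (- t * cosh s)))"
    by (simp add: fun_eq_iff algebra_simps)
  note I = integrable_KJ[OF t]
  have i: "integrable (lebesgue_on {0..}) ?f"
    unfolding eq by (intro Bochner_Integration.integrable_add Bochner_Integration.integrable_diff integrable_mult_right I) auto
  have "(LINT s|lebesgue_on {0..}. ?f s) = 0 - ?F 0"
  proof (rule ftc_halfline[OF _ _ i])
    show "(?F has_real_derivative ?f s) (at s)" for s
    proof -
      have 1: "((\<lambda>s. \<mu> * sin (\<mu> * s) - t * sinh s * cos (\<mu> * s)) has_real_derivative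
          \<mu> * (cos (\<mu> * s) * \<mu>) - (t * cosh s * cos (\<mu> * s) - t * sinh s * (sin (\<mu> * s) * \<mu>))) (at s)"
        by (auto intro!: derivative_eq_intros)
      have 2: "((\<lambda>s. exp (- t * cosh s)) has_real_derivative exp (- t * cosh s) * (- t * sinh s)) (at s)"
        by (auto intro!: derivative_eq_intros)
      have "(?F has_real_derivative
         (\<mu> * (cos (\<mu> * s) * \<mu>) - (t * cosh s * cos (\<mu> * s) - t * sinh s * (sin (\<mu> * s) * \<mu>))) * exp (- t * cosh s)
         + (\<mu> * sin (\<mu> * s) - t * sinh s * cos (\<mu> * s)) * (exp (- t * cosh s) * (- t * sinh s))) (at s)"
        using DERIV_mult[OF 1 2] by (simp add: mult.commute)
      also have "(\<mu> * (cos (\<mu> * s) * \<mu>) - (t * cosh s * cos (\<mu> * s) - t * sinh s * (sin (\<mu> * s) * \<mu>))) * exp (- t * cosh s)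
         + (\<mu> * sin (\<mu> * s) - t * sinh s * cos (\<mu> * s)) * (exp (- t * cosh s) * (- t * sinh s))
         = (t\<^sup>2 * (sinh s)\<^sup>2 - t * cosh s + \<mu>\<^sup>2) * cos (\<mu> * s) * exp (- t * cosh s)"
        by (simp add: algebra_simps power2_eq_square)
      also have "\<dots> = ?f s" unfolding sq by (simp add: algebra_simps)
      finally show ?thesis .
    qed
    show "continuous_on UNIV ?f" by (intro continuous_intros)
    show "(?F \<longlongrightarrow> 0) at_top"
    proof (rule tendsto_exp_cosh[OF t, where B = "\<bar>\<mu>\<bar> + t"])
      fix s :: real
      have c: "cosh s \<le> (cosh s)\<^sup>2" "1 \<le> (cosh s)\<^sup>2" using cosh_power_le[of 1 s] cosh_power_le[of 0 s] by auto
      have "\<bar>\<mu> * sin (\<mu> * s) - t * sinh s * cos (\<mu> * s)\<bar> \<le> \<bar>\<mu>\<bar> * \<bar>sin (\<mu> * s)\<bar> + (t * \<bar>sinh s\<bar>) * \<bar>cos (\<mu> * s)\<bar>"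
        using t abs_triangle_ineq4[of "\<mu> * sin (\<mu> * s)" "t * sinh s * cos (\<mu> * s)"] by (simp add: abs_mult)
      also have "\<dots> \<le> \<bar>\<mu>\<bar> * (cosh s)\<^sup>2 + (t * (cosh s)\<^sup>2) * 1"
        using t c by (intro add_mono mult_mono) (auto intro: order_trans[OF abs_sin_le_one] order_trans[OF abs_sinh_le_cosh])
      finally show "\<bar>\<mu> * sin (\<mu> * s) - t * sinh s * cos (\<mu> * s)\<bar> \<le> (\<bar>\<mu>\<bar> + t) * (cosh s)\<^sup>2"
        by (simp add: algebra_simps)
    qed
  qed
  moreover have "(LINT s|lebesgue_on {0..}. ?f s) = t\<^sup>2 * KJ 2 \<mu> t - t * KJ 1 \<mu> t + (\<mu>\<^sup>2 - t\<^sup>2) * KJ 0 \<mu> t"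
    unfolding eq KJ_def using I
    by (subst Bochner_Integration.integral_add Bochner_Integration.integral_diff integral_mult_right,
        (intro Bochner_Integration.integrable_add Bochner_Integration.integrable_diff integrable_mult_right I; simp)+)+ simp
  ultimately show ?thesis by (simp add: algebra_simps)
qed

section \<open>Bounds for \<open>KJ\<close> in its argument and in its order\<close>

lemma KJ_0_eq: "KJ j 0 t = (LINT s|lebesgue_on {0..}. cosh s ^ j * exp (- t * cosh s))"
  by (simp add: KJ_def)

lemma integrable_KJ_0: "0 < t \<Longrightarrow> j \<le> 2 \<Longrightarrow>
  integrable (lebesgue_on {0..}) (\<lambda>s::real. cosh s ^ j * exp (- t * cosh s))"
  using integrable_KJ[of t j 0] by simp

lemma abs_KJ_le:
  assumes "0 < t" "j \<le> 2"
  shows "\<bar>KJ j \<mu> t\<bar> \<le> KJ j 0 t"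
proof -
  have "\<bar>KJ j \<mu> t\<bar> \<le> (LINT s|lebesgue_on {0..}. norm (cosh s ^ j * cos (\<mu> * s) * exp (- t * cosh s)))"
    unfolding KJ_def real_norm_def[symmetric] by (rule integral_norm_bound)
  also have "\<dots> \<le> KJ j 0 t"
    unfolding KJ_0_eq
  proof (rule integral_mono)
    fix s
    have "(cosh s ^ j * \<bar>cos (\<mu> * s)\<bar>) * exp (- t * cosh s) \<le> (cosh s ^ j * 1) * exp (- t * cosh s)"
      by (intro mult_right_mono mult_left_mono) auto
    then show "norm (cosh s ^ j * cos (\<mu> * s) * exp (- t * cosh s)) \<le> cosh s ^ j * exp (- t * cosh s)"
      by (simp add: abs_mult)
  qed (rule integrable_norm[OF integrable_KJ[OF assms]] integrable_KJ_0[OF assms])+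
  finally show ?thesis .
qed

lemma KJ_0_pos: assumes "0 < t" shows "0 < KJ 0 0 t"
proof -
  have "0 \<le> KJ 0 0 t" unfolding KJ_0_eq by (rule integral_nonneg_AE) auto
  moreover have "KJ 0 0 t \<noteq> 0"
  proof
    assume "KJ 0 0 t = 0"
    then have "AE s in lebesgue_on {0..}. exp (- t * cosh s) = 0"
      using integral_nonneg_eq_0_iff_AE[OF integrable_KJ_0[OF assms, of 0]] by (simp add: KJ_0_eq)
    then have "AE s in lebesgue_on {0::real..}. False" by simp
    then have "emeasure (lebesgue_on {0::real..}) {0..} = 0"
    proof (rule AE_E)
      fix N assume "{s \<in> space (lebesgue_on {0::real..}). \<not> False} \<subseteq> N" "emeasure (lebesgue_on {0::real..}) N = 0"
        "N \<in> sets (lebesgue_on {0::real..})"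
      then show ?thesis using emeasure_mono[of "{0::real..}" N "lebesgue_on {0::real..}"] by auto
    qed
    then have "emeasure lborel {0::real..} = 0" by (simp add: emeasure_restrict_space)
    moreover have "emeasure lborel {0::real..1} \<le> emeasure lborel {0::real..}"
      by (rule emeasure_mono) auto
    ultimately show False by simp
  qed
  ultimately show ?thesis by simp
qed

lemma cosh_le_square: "cosh s \<le> (cosh (s::real))\<^sup>2" "1 \<le> (cosh s)\<^sup>2"
  using cosh_power_le[of 1 s] cosh_power_le[of 0 s] by auto

text \<open>Integration by parts with \<open>- s * exp (- t * cosh s)\<close>. It trades a factor
  \<open>s * sinh s\<close> in the integrand for a factor \<open>1 / t\<close>, so that
  \<open>KJ_lower\<close> can be stated in terms of \<open>KJ 0 0 t\<close> alone.\<close>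

lemma s_sinh_integral:
  assumes t: "0 < t"
  shows "integrable (lebesgue_on {0..}) (\<lambda>s. s * sinh s * exp (- t * cosh s))"
    and "t * (LINT s|lebesgue_on {0..}. s * sinh s * exp (- t * cosh s)) = KJ 0 0 t"
proof -
  have b: "\<bar>s * sinh s\<bar> \<le> 1 * (cosh s)\<^sup>2" if "0 \<le> s" for s :: real
    using that cosh_ge_self[of s] sinh_le_cosh_real[of s] mult_mono[of s "cosh s" "sinh s" "cosh s"]
    by (simp add: power2_eq_square abs_mult)
  show i: "integrable (lebesgue_on {0..}) (\<lambda>s. s * sinh s * exp (- t * cosh s))"
    by (rule integrable_exp_cosh[OF t, where B = 1]) (use b in \<open>auto intro!: continuous_intros\<close>)
  let ?f = "\<lambda>s. t * (s * sinh s * exp (- t * cosh s)) - cosh s ^ 0 * exp (- t * cosh s)"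
  let ?F = "\<lambda>s. (- s) * exp (- t * cosh s)"
  have I: "integrable (lebesgue_on {0..}) ?f"
    using i integrable_KJ_0[OF t, of 0] by (intro Bochner_Integration.integrable_diff integrable_mult_right) auto
  have "(LINT s|lebesgue_on {0..}. ?f s) = 0 - ?F 0"
  proof (rule ftc_halfline[OF _ _ I])
    fix s
    have 2: "((\<lambda>s. exp (- t * cosh s)) has_real_derivative exp (- t * cosh s) * (- t * sinh s)) (at s)"
      by (auto intro!: derivative_eq_intros)
    have 1: "((\<lambda>s. - s) has_real_derivative - 1) (at s)" by (auto intro!: derivative_eq_intros)
    show "(?F has_real_derivative ?f s) (at s)"
      using DERIV_mult[OF 1 2] by (simp add: algebra_simps)
  next
    show "(?F \<longlongrightarrow> 0) at_top"
    proof (rule tendsto_exp_cosh[OF t, where B = 1])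
      fix s :: real assume "0 \<le> s"
      then show "\<bar>- s\<bar> \<le> 1 * (cosh s)\<^sup>2" using cosh_ge_self[of s] cosh_le_square[of s] by simp
    qed
  qed (intro continuous_intros)
  moreover have "(LINT s|lebesgue_on {0..}. ?f s) = t * (LINT s|lebesgue_on {0..}. s * sinh s * exp (- t * cosh s)) - KJ 0 0 t"
    unfolding KJ_0_eq using i integrable_KJ_0[OF t, of 0] by (subst Bochner_Integration.integral_diff) auto
  ultimately show "t * (LINT s|lebesgue_on {0..}. s * sinh s * exp (- t * cosh s)) = KJ 0 0 t" by simp
qed

lemma cos_ge_quadratic: "1 - x\<^sup>2 / 2 \<le> cos (x::real)"
proof -
  have "(sin (x/2))\<^sup>2 \<le> (x/2)\<^sup>2"
    using abs_sin_x_le_abs_x[of "x/2"] by (rule abs_le_square_iff[THEN iffD1])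
  moreover have "cos x = 1 - 2 * (sin (x/2))\<^sup>2" using cos_double_sin[of "x/2"] by simp
  ultimately show ?thesis by (simp add: power_divide)
qed

text \<open>\<open>cos x \<ge> 1 - x\<^sup>2 / 2\<close> together with
  \<open>s\<^sup>2 \<le> s * sinh s\<close>, whose integral is known. Its use is positivity as soon
  as \<open>\<mu>\<^sup>2 < 2 * t\<close>: for a bounded set of orders only a bounded range of
  \<open>t\<close> is in question.\<close>

lemma KJ_lower:
  assumes t: "0 < t"
  shows "(1 - \<mu>\<^sup>2 / (2 * t)) * KJ 0 0 t \<le> KJ 0 \<mu> t"
proof -
  note i1 = integrable_KJ_0[OF t, of 0] and i2 = s_sinh_integral(1)[OF t]
  have "(1 - \<mu>\<^sup>2 / (2 * t)) * KJ 0 0 t = KJ 0 0 t - \<mu>\<^sup>2 / 2 * (LINT s|lebesgue_on {0..}. s * sinh s * exp (- t * cosh s))"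
    using t by (simp add: s_sinh_integral(2)[OF t, symmetric] field_simps)
  also have "\<dots> = (LINT s|lebesgue_on {0..}. cosh s ^ 0 * exp (- t * cosh s) - \<mu>\<^sup>2 / 2 * (s * sinh s * exp (- t * cosh s)))"
    unfolding KJ_0_eq using i1 i2 by (subst Bochner_Integration.integral_diff) auto
  also have "\<dots> \<le> KJ 0 \<mu> t"
    unfolding KJ_def
  proof (rule integral_mono)
    fix s :: real assume "s \<in> space (lebesgue_on {0..})"
    then have s: "0 \<le> s" by simp
    have "s * s \<le> s * sinh s" using sinh_ge_self[OF s] s by (rule mult_left_mono)
    then have "\<mu>\<^sup>2 * (s * s) \<le> \<mu>\<^sup>2 * (s * sinh s)" by (rule mult_left_mono) simp
    then have "1 - \<mu>\<^sup>2 / 2 * (s * sinh s) \<le> cos (\<mu> * s)"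
      using cos_ge_quadratic[of "\<mu> * s"] by (simp add: power2_eq_square algebra_simps)
    then have "(1 - \<mu>\<^sup>2 / 2 * (s * sinh s)) * exp (- t * cosh s) \<le> cos (\<mu> * s) * exp (- t * cosh s)"
      by (rule mult_right_mono) simp
    then show "cosh s ^ 0 * exp (- t * cosh s) - \<mu>\<^sup>2 / 2 * (s * sinh s * exp (- t * cosh s))
      \<le> cosh s ^ 0 * cos (\<mu> * s) * exp (- t * cosh s)"
      by (simp add: left_diff_distrib mult.assoc)
  qed (use i1 i2 integrable_KJ[OF t, of 0] in auto)
  finally show ?thesis .
qed

text \<open>Integrating the derivative of \<open>- sinh s * exp (- t * cosh s)\<close> gives
  \<open>KJ 1 0 t = t * (KJ 2 0 t - KJ 0 0 t)\<close>. With \<open>KJ 1 0 t \<le> KJ 2 0 t\<close>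
  and \<open>2 \<le> t\<close> this closes up with the factor 2. It later bounds the logarithmic
  derivative of the ground state from below.\<close>

lemma KJ_1_le:
  assumes t: "2 \<le> t"
  shows "KJ 1 0 t \<le> 2 * KJ 0 0 t"
proof -
  have t0: "0 < t" using t by simp
  note i0 = integrable_KJ_0[OF t0, of 0] and i1 = integrable_KJ_0[OF t0, of 1] and i2 = integrable_KJ_0[OF t0, of 2]
  let ?f = "\<lambda>s. t * (cosh s ^ 2 * exp (- t * cosh s)) - t * (cosh s ^ 0 * exp (- t * cosh s)) - cosh s ^ 1 * exp (- t * cosh s)"
  let ?F = "\<lambda>s. (- sinh s) * exp (- t * cosh s)"
  have I: "integrable (lebesgue_on {0..}) ?f"
    using i0 i1 i2 by (intro Bochner_Integration.integrable_diff integrable_mult_right) auto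
  have "(LINT s|lebesgue_on {0..}. ?f s) = 0 - ?F 0"
  proof (rule ftc_halfline[OF _ _ I])
    fix s :: real
    have 2: "((\<lambda>s. exp (- t * cosh s)) has_real_derivative exp (- t * cosh s) * (- t * sinh s)) (at s)"
      by (auto intro!: derivative_eq_intros)
    have 1: "((\<lambda>s. - sinh s) has_real_derivative - cosh s) (at s)" by (auto intro!: derivative_eq_intros)
    have sq: "sinh s * sinh s = (cosh s)\<^sup>2 - 1" by (simp add: sinh_square_eq flip: power2_eq_square)
    have "- cosh s * exp (- t * cosh s) + exp (- t * cosh s) * (- t * sinh s) * - sinh s
      = - cosh s * exp (- t * cosh s) + t * exp (- t * cosh s) * (sinh s * sinh s)" by simp
    also have "\<dots> = ?f s" unfolding sq by (simp add: algebra_simps)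
    finally show "(?F has_real_derivative ?f s) (at s)"
      using DERIV_mult[OF 1 2] by simp
  next
    show "(?F \<longlongrightarrow> 0) at_top"
    proof (rule tendsto_exp_cosh[OF t0, where B = 1])
      show "\<bar>- sinh s\<bar> \<le> 1 * (cosh s)\<^sup>2" for s :: real
        using order_trans[OF abs_sinh_le_cosh cosh_le_square(1), of s] by (simp only: abs_minus_cancel mult_1)
    qed
  qed (intro continuous_intros)
  moreover have "(LINT s|lebesgue_on {0..}. ?f s) = t * KJ 2 0 t - t * KJ 0 0 t - KJ 1 0 t"
    unfolding KJ_0_eq using i0 i1 i2 by simp
  ultimately have eq: "KJ 1 0 t = t * (KJ 2 0 t - KJ 0 0 t)" by (simp add: algebra_simps)
  have "KJ 1 0 t \<le> KJ 2 0 t"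
    unfolding KJ_0_eq by (rule integral_mono[OF i1 i2]) (use cosh_le_square in \<open>auto intro!: mult_right_mono\<close>)
  moreover have "2 * (KJ 2 0 t - KJ 0 0 t) \<le> KJ 1 0 t"
    unfolding eq
  proof (rule mult_right_mono[OF t])
    have "KJ 0 0 t \<le> KJ 2 0 t"
      unfolding KJ_0_eq by (rule integral_mono[OF i0 i2]) (use cosh_le_square in \<open>auto intro!: mult_right_mono\<close>)
    then show "0 \<le> KJ 2 0 t - KJ 0 0 t" by simp
  qed
  moreover have "x \<le> y \<Longrightarrow> 2 * (y - z) \<le> x \<Longrightarrow> x \<le> 2 * z" for x y z :: real
    by (simp add: algebra_simps)
  ultimately show ?thesis by blast
qed

text \<open>Because \<open>1 \<le> cosh s\<close>, the factor \<open>exp (t0 - t)\<close> can be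
  taken out of the integrand.\<close>

lemma KJ_decay:
  assumes "0 < t0" "t0 \<le> t" "j \<le> 2"
  shows "KJ j 0 t \<le> exp (t0 - t) * KJ j 0 t0"
proof -
  have "KJ j 0 t \<le> (LINT s|lebesgue_on {0..}. exp (t0 - t) * (cosh s ^ j * exp (- t0 * cosh s)))"
    unfolding KJ_0_eq
  proof (rule integral_mono)
    fix s :: real
    have "(t - t0) * 1 \<le> (t - t0) * cosh s" using assms cosh_real_ge_1 by (intro mult_left_mono) auto
    then have "- t * cosh s \<le> (t0 - t) + (- t0 * cosh s)" by (simp add: algebra_simps)
    then have "exp (- t * cosh s) \<le> exp (t0 - t) * exp (- t0 * cosh s)"
      unfolding exp_add[symmetric] by (rule iffD2[OF exp_le_cancel_iff])
    then have "cosh s ^ j * exp (- t * cosh s) \<le> cosh s ^ j * (exp (t0 - t) * exp (- t0 * cosh s))"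
      by (rule mult_left_mono) simp
    then show "cosh s ^ j * exp (- t * cosh s) \<le> exp (t0 - t) * (cosh s ^ j * exp (- t0 * cosh s))"
      by (simp add: mult_ac)
  next
    show "integrable (lebesgue_on {0..}) (\<lambda>s. cosh s ^ j * exp (- t * cosh s))"
      by (rule integrable_KJ_0) (use assms in auto)
    show "integrable (lebesgue_on {0..}) (\<lambda>s. exp (t0 - t) * (cosh s ^ j * exp (- t0 * cosh s)))"
      by (intro integrable_mult_right integrable_KJ_0) (use assms in auto)
  qed
  then show ?thesis by (simp add: KJ_0_eq)
qed

text \<open>The cosine is 1-Lipschitz and \<open>s \<le> cosh s\<close>. By \<open>KJ_decay\<close>
  the constant at \<open>t\<close> is controlled by the one at any earlier point, so the order can
  be varied with a uniform error; the supremum argument for the ground state rests on this.\<close>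

lemma KJ_lipschitz:
  assumes "0 < t"
  shows "\<bar>KJ 0 \<mu> t - KJ 0 \<nu> t\<bar> \<le> \<bar>\<mu> - \<nu>\<bar> * KJ 1 0 t"
proof -
  have i: "integrable (lebesgue_on {0..}) (\<lambda>s. cosh s ^ 0 * cos (\<xi> * s) * exp (- t * cosh s))" for \<xi>
    by (rule integrable_KJ[OF assms]) simp
  have "\<bar>KJ 0 \<mu> t - KJ 0 \<nu> t\<bar> = norm (LINT s|lebesgue_on {0..}. cosh s ^ 0 * cos (\<mu> * s) * exp (- t * cosh s) - cosh s ^ 0 * cos (\<nu> * s) * exp (- t * cosh s))"
    unfolding KJ_def Bochner_Integration.integral_diff[OF i i] by simp
  also have "\<dots> \<le> (LINT s|lebesgue_on {0..}. norm (cosh s ^ 0 * cos (\<mu> * s) * exp (- t * cosh s) - cosh s ^ 0 * cos (\<nu> * s) * exp (- t * cosh s)))"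
    by (rule integral_norm_bound)
  also have "\<dots> \<le> (LINT s|lebesgue_on {0..}. \<bar>\<mu> - \<nu>\<bar> * (cosh s ^ 1 * exp (- t * cosh s)))"
  proof (rule integral_mono)
    fix s :: real assume "s \<in> space (lebesgue_on {0..})"
    then have s: "0 \<le> s" by simp
    have "\<bar>cos (\<mu> * s) - cos (\<nu> * s)\<bar> = 2 * \<bar>sin ((\<mu> * s + \<nu> * s) / 2)\<bar> * \<bar>sin ((\<nu> * s - \<mu> * s) / 2)\<bar>"
      unfolding cos_diff_cos by (simp only: abs_mult abs_numeral)
    also have "\<dots> \<le> 2 * 1 * \<bar>(\<nu> * s - \<mu> * s) / 2\<bar>"
      by (intro mult_mono abs_sin_x_le_abs_x) auto
    also have "\<dots> = \<bar>(\<nu> - \<mu>) * s\<bar>" by (simp add: left_diff_distrib)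
    also have "\<dots> = \<bar>\<mu> - \<nu>\<bar> * s" using s abs_minus_commute[of \<nu> \<mu>] by (simp add: abs_mult)
    also have "\<dots> \<le> \<bar>\<mu> - \<nu>\<bar> * cosh s" using cosh_ge_self by (intro mult_left_mono) auto
    finally have *: "\<bar>cos (\<mu> * s) - cos (\<nu> * s)\<bar> * exp (- t * cosh s) \<le> \<bar>\<mu> - \<nu>\<bar> * cosh s * exp (- t * cosh s)"
      by (rule mult_right_mono) simp
    show "norm (cosh s ^ 0 * cos (\<mu> * s) * exp (- t * cosh s) - cosh s ^ 0 * cos (\<nu> * s) * exp (- t * cosh s))
       \<le> \<bar>\<mu> - \<nu>\<bar> * (cosh s ^ 1 * exp (- t * cosh s))"
    proof -
      have "cosh s ^ 0 * cos (\<mu> * s) * exp (- t * cosh s) - cosh s ^ 0 * cos (\<nu> * s) * exp (- t * cosh s)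
          = (cos (\<mu> * s) - cos (\<nu> * s)) * exp (- t * cosh s)" by (simp add: left_diff_distrib)
      then show ?thesis using * by (simp add: abs_mult mult.assoc)
    qed
  next
    show "integrable (lebesgue_on {0..}) (\<lambda>s. norm (cosh s ^ 0 * cos (\<mu> * s) * exp (- t * cosh s) - cosh s ^ 0 * cos (\<nu> * s) * exp (- t * cosh s)))"
      by (intro integrable_norm Bochner_Integration.integrable_diff i)
    show "integrable (lebesgue_on {0..}) (\<lambda>s. \<bar>\<mu> - \<nu>\<bar> * (cosh s ^ 1 * exp (- t * cosh s)))"
      by (intro integrable_mult_right integrable_KJ_0 assms) auto
  qed
  also have "\<dots> = \<bar>\<mu> - \<nu>\<bar> * KJ 1 0 t" by (simp add: KJ_0_eq)
  finally show ?thesis .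
qed

text \<open>Gronwall's argument: \<open>f\<^sup>2 + f'\<^sup>2\<close> grows at most at the rate
  \<open>1 + B\<close>, so after multiplication by \<open>exp (- (1 + B) * t)\<close> it is
  nonincreasing, and it starts at 0.\<close>

lemma linear_ode_unique:
  fixes f f' g :: "real \<Rightarrow> real"
  assumes "t1 \<le> T"
    and f: "\<And>t. t1 \<le> t \<Longrightarrow> t \<le> T \<Longrightarrow> (f has_real_derivative f' t) (at t)"
    and f': "\<And>t. t1 \<le> t \<Longrightarrow> t \<le> T \<Longrightarrow> (f' has_real_derivative g t * f t) (at t)"
    and g: "\<And>t. t1 \<le> t \<Longrightarrow> t \<le> T \<Longrightarrow> \<bar>g t\<bar> \<le> B"
    and z: "f t1 = 0" "f' t1 = 0"
  shows "f T = 0"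
proof -
  define E where "E t = ((f t)\<^sup>2 + (f' t)\<^sup>2) * exp (- (1 + B) * t)" for t
  have "E T \<le> E t1"
  proof (rule DERIV_nonpos_imp_nonincreasing[OF assms(1)])
    fix t assume t: "t1 \<le> t" "t \<le> T"
    let ?a = "2 * f t * f' t + 2 * f' t * (g t * f t)"
    have 1: "((\<lambda>t. (f t)\<^sup>2 + (f' t)\<^sup>2) has_real_derivative ?a) (at t)"
      by (auto intro!: derivative_eq_intros f f' t)
    have 2: "((\<lambda>t. exp (- (1 + B) * t)) has_real_derivative exp (- (1 + B) * t) * (- (1 + B))) (at t)"
      by (auto intro!: derivative_eq_intros)
    have d: "(E has_real_derivative ?a * exp (- (1 + B) * t) + exp (- (1 + B) * t) * (- (1 + B)) * ((f t)\<^sup>2 + (f' t)\<^sup>2)) (at t)"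
      unfolding E_def by (rule DERIV_mult[OF 1 2])
    have "?a = (2 * f t * f' t) * (1 + g t)" by (simp add: algebra_simps)
    also have "\<dots> \<le> \<bar>2 * f t * f' t\<bar> * \<bar>1 + g t\<bar>" by (metis abs_ge_self abs_mult)
    also have "\<dots> \<le> ((f t)\<^sup>2 + (f' t)\<^sup>2) * (1 + B)"
    proof (rule mult_mono)
      have "0 \<le> (\<bar>f t\<bar> - \<bar>f' t\<bar>)\<^sup>2" by simp
      then show "\<bar>2 * f t * f' t\<bar> \<le> (f t)\<^sup>2 + (f' t)\<^sup>2" by (simp add: power2_diff abs_mult)
      show "\<bar>1 + g t\<bar> \<le> 1 + B" using g[OF t] by linarith
    qed auto
    finally have "(?a - ((f t)\<^sup>2 + (f' t)\<^sup>2) * (1 + B)) * exp (- (1 + B) * t) \<le> 0"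
      by (intro mult_nonpos_nonneg) auto
    moreover have "a * e + e * (- (1 + B)) * b = (a - b * (1 + B)) * e" for a b e :: real
      by (simp add: algebra_simps)
    ultimately have "?a * exp (- (1 + B) * t) + exp (- (1 + B) * t) * (- (1 + B)) * ((f t)\<^sup>2 + (f' t)\<^sup>2) \<le> 0"
      by simp
    with d show "\<exists>y. (E has_real_derivative y) (at t) \<and> y \<le> 0" by blast
  qed
  then have "((f T)\<^sup>2 + (f' T)\<^sup>2) * exp (- (1 + B) * T) \<le> 0" by (simp add: E_def z)
  then have "(f T)\<^sup>2 + (f' T)\<^sup>2 \<le> 0" by (simp add: mult_le_0_iff)
  then show ?thesis by (smt (verit) zero_le_power2 power2_eq_iff zero_eq_power2)
qed

text \<open>The factor \<open>sqrt t\<close> removes the first-order term of Bessel's equation and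
  leaves \<open>f'' = (1 - (1/4 + \<mu>\<^sup>2) / t\<^sup>2) f\<close>; the 1/4 of the theorem
  appears here as the value at order 0.\<close>

definition bF :: "real \<Rightarrow> real \<Rightarrow> real" where "bF \<mu> t = sqrt t * KJ 0 \<mu> t"
definition bF' :: "real \<Rightarrow> real \<Rightarrow> real" where "bF' \<mu> t = KJ 0 \<mu> t / (2 * sqrt t) - sqrt t * KJ 1 \<mu> t"

lemma DERIV_bF: "0 < t \<Longrightarrow> (bF \<mu> has_real_derivative bF' \<mu> t) (at t)"
proof -
  assume t: "0 < t"
  have "((\<lambda>t. sqrt t * KJ 0 \<mu> t) has_real_derivative inverse (sqrt t) / 2 * KJ 0 \<mu> t + - KJ (Suc 0) \<mu> t * sqrt t) (at t)"
    by (rule DERIV_mult[OF DERIV_real_sqrt DERIV_KJ]) (use t in auto)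
  then show ?thesis unfolding bF_def[abs_def] bF'_def by (simp add: field_simps)
qed

text \<open>The second derivative of \<open>sqrt t * K\<close>, written in \<open>r = sqrt t\<close>
  so that the identity becomes rational; \<open>m\<close> stands for
  \<open>\<mu>\<^sup>2\<close>.\<close>

lemma bF''_identity:
  fixes r K0 K1 K2 m :: real
  assumes r: "0 < r" and K2: "r^4 * K2 = r\<^sup>2 * K1 + (r^4 - m) * K0"
  shows "((- K1) * (2 * r) - K0 * inverse r) / ((2 * r) * (2 * r)) - (inverse r / 2 * K1 + (- K2) * r)
    = (1 - (1/4 + m) / r^4) * (r * K0)"
proof -
  have "K2 = (r\<^sup>2 * K1 + (r^4 - m) * K0) / r^4" using K2 r by (simp add: field_simps)
  moreover have "((- K1) * (2 * r) - K0 * inverse r) / ((2 * r) * (2 * r)) - (inverse r / 2 * K1 + (- ((r\<^sup>2 * K1 + (r^4 - m) * K0) / r^4)) * r)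
    = (1 - (1/4 + m) / r^4) * (r * K0)"
    using r by (simp add: field_simps power2_eq_square power4_eq_xxxx)
  ultimately show ?thesis by simp
qed

lemma DERIV_bF': "0 < t \<Longrightarrow> (bF' \<mu> has_real_derivative (1 - (1/4 + \<mu>\<^sup>2) / t\<^sup>2) * bF \<mu> t) (at t)"
proof -
  assume t: "0 < t"
  let ?r = "sqrt t"
  have r: "0 < ?r" "?r\<^sup>2 = t" "?r^4 = t\<^sup>2" using t by (auto simp: power4_eq_xxxx power2_eq_square)
  have s: "((\<lambda>t. 2 * sqrt t) has_real_derivative inverse ?r) (at t)"
    using DERIV_cmult[OF DERIV_real_sqrt[OF t], of 2] by simp
  have 1: "((\<lambda>t. KJ 0 \<mu> t / (2 * sqrt t)) has_real_derivative
      ((- KJ 1 \<mu> t) * (2 * ?r) - KJ 0 \<mu> t * inverse ?r) / ((2 * ?r) * (2 * ?r))) (at t)"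
    by (rule DERIV_divide[OF DERIV_cong[OF DERIV_KJ] s]) (use t in auto)
  have 2: "((\<lambda>t. sqrt t * KJ 1 \<mu> t) has_real_derivative inverse ?r / 2 * KJ 1 \<mu> t + (- KJ 2 \<mu> t) * ?r) (at t)"
    by (rule DERIV_mult[OF DERIV_real_sqrt DERIV_cong[OF DERIV_KJ]]) (use t in \<open>auto simp: numeral_2_eq_2\<close>)
  have eq: "((- KJ 1 \<mu> t) * (2 * ?r) - KJ 0 \<mu> t * inverse ?r) / ((2 * ?r) * (2 * ?r)) - (inverse ?r / 2 * KJ 1 \<mu> t + (- KJ 2 \<mu> t) * ?r)
    = (1 - (1/4 + \<mu>\<^sup>2) / t\<^sup>2) * (?r * KJ 0 \<mu> t)"
    using bF''_identity[OF r(1), of "KJ 2 \<mu> t" "KJ 1 \<mu> t" "\<mu>\<^sup>2" "KJ 0 \<mu> t", unfolded r(2,3)] KJ_ode[OF t, of \<mu>] by blast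
  show ?thesis
    unfolding bF'_def[abs_def] bF_def
    by (rule DERIV_cong[OF DERIV_diff[OF 1 2] eq])
qed

section \<open>The ground state on a half-line\<close>

lemma bF_pos_iff: "0 < t \<Longrightarrow> 0 < bF \<mu> t \<longleftrightarrow> 0 < KJ 0 \<mu> t"
  by (simp add: bF_def zero_less_mult_iff)

lemma KJ_pos: assumes "0 < t" "\<mu>\<^sup>2 < 2 * t" shows "0 < KJ 0 \<mu> t"
proof -
  have "0 < (1 - \<mu>\<^sup>2 / (2 * t)) * KJ 0 0 t"
    using assms KJ_0_pos[of t] by (intro mult_pos_pos) auto
  then show ?thesis using KJ_lower[OF assms(1), of \<mu>] by linarith
qed

text \<open>A positive solution on \<open>{t0<..}\<close> gives by Picone's inequality a bound on the Rayleigh quotient of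
any fixed test function, here a sine arc on \<open>{t0+1..t0+2}\<close>.\<close>

lemma bounded_positive_orders:
  assumes t0: "0 < t0"
  shows "\<exists>B. \<forall>\<mu>. (\<forall>t>t0. 0 < KJ 0 \<mu> t) \<longrightarrow> \<mu>\<^sup>2 \<le> B"
proof -
  let ?I = "{t0+1..t0+2}"
  let ?k = "\<lambda>t. sin (pi * (t - t0 - 1))" and ?k' = "\<lambda>t. cos (pi * (t - t0 - 1)) * pi"
  let ?S = "integral ?I (\<lambda>t. (?k t)\<^sup>2)" and ?S' = "integral ?I (\<lambda>t. 1 * (?k' t)\<^sup>2)"
  have Spos: "0 < ?S"
  proof (rule ccontr)
    assume "\<not> 0 < ?S"
    moreover have "0 \<le> ?S" by (intro integral_nonneg integrable_continuous_interval continuous_intros) auto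
    ultimately have "?S = 0" by simp
    then have "\<forall>x\<in>?I. (?k x)\<^sup>2 = 0"
      by (subst (asm) integral_eq_0_iff) (auto intro!: continuous_intros)
    then have "(?k (t0 + 3/2))\<^sup>2 = 0" by (rule bspec) simp
    moreover have "pi * (t0 + 3/2 - t0 - 1) = pi / 2" by simp
    ultimately show False by simp
  qed
  have "\<mu>\<^sup>2 \<le> (t0+2)\<^sup>2 * (?S' / ?S + 1)" if pos: "\<forall>t>t0. 0 < KJ 0 \<mu> t" for \<mu>
  proof -
    define l where "l = 1/4 + \<mu>\<^sup>2"
    have p: "0 < bF \<mu> t" if "t \<in> ?I" for t using pos that t0 by (subst bF_pos_iff) auto
    \<comment> \<open>Again \<open>- f' / f\<close> for the positive solution; the differential
      equation turns \<open>?w' - ?w\<^sup>2\<close> into \<open>l / t\<^sup>2 - 1\<close>.\<close>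
    let ?w = "\<lambda>t. - bF' \<mu> t / bF \<mu> t" and ?w' = "\<lambda>t. (bF' \<mu> t / bF \<mu> t)\<^sup>2 - (1 - l / t\<^sup>2)"
    have dw: "(?w has_real_derivative ?w' t) (at t within ?I)" if t: "t \<in> ?I" for t
    proof -
      have t': "0 < t" using t t0 by auto
      have "(?w has_real_derivative ((- ((1 - l / t\<^sup>2) * bF \<mu> t)) * bF \<mu> t - (- bF' \<mu> t) * bF' \<mu> t) / (bF \<mu> t * bF \<mu> t)) (at t)"
        unfolding l_def by (rule DERIV_divide[OF DERIV_minus[OF DERIV_bF'] DERIV_bF]) (use t' p[OF t] in auto)
      also have "((- ((1 - l / t\<^sup>2) * bF \<mu> t)) * bF \<mu> t - (- bF' \<mu> t) * bF' \<mu> t) / (bF \<mu> t * bF \<mu> t) = ?w' t"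
      proof -
        have "((- (c * y)) * y - (- z) * z) / (y * y) = (z / y)\<^sup>2 - c" if "0 < y" for c y z :: real
          using that by (simp add: field_simps power2_eq_square)
        from this[OF p[OF t]] show ?thesis .
      qed
      finally show ?thesis by (rule DERIV_subset) simp
    qed
    have cF: "continuous_on ?I (bF \<mu>)" "continuous_on ?I (bF' \<mu>)"
      by (rule DERIV_continuous_on, rule DERIV_subset, rule DERIV_bF DERIV_bF', use t0 in auto)+
    have "(?k (t0+1))\<^sup>2 * ?w (t0+1) - (?k (t0+2))\<^sup>2 * ?w (t0+2) + integral ?I (\<lambda>t. (l / t\<^sup>2 - 1) * (?k t)\<^sup>2) \<le> ?S'"
    proof (rule picone_interval[where w = ?w and w' = ?w'])
      show "continuous_on ?I ?w'"
        by (intro continuous_intros cF) (use p t0 in \<open>force\<close>)+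
      show "(?k has_real_derivative ?k' x) (at x within ?I)" for x
        by (auto intro!: derivative_eq_intros)
      show "continuous_on ?I (\<lambda>t. l / t\<^sup>2 - 1)" by (intro continuous_intros) (use t0 in auto)
      show "(?w has_real_derivative ?w' x) (at x within ?I)" if "x \<in> ?I" for x using that by (rule dw)
    qed (auto intro!: continuous_intros)
    then have 1: "integral ?I (\<lambda>t. (l / t\<^sup>2 - 1) * (?k t)\<^sup>2) \<le> ?S'" by simp
    \<comment> \<open>Replacing \<open>l / t\<^sup>2\<close> by its smallest value on the interval
      isolates \<open>l\<close>, which the fixed quotient \<open>?S' / ?S\<close> then
      bounds.\<close>
    have "integral ?I (\<lambda>t. (l / (t0+2)\<^sup>2 - 1) * (?k t)\<^sup>2) \<le> integral ?I (\<lambda>t. (l / t\<^sup>2 - 1) * (?k t)\<^sup>2)"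
    proof (rule integral_le)
      fix t assume t: "t \<in> ?I"
      have "l / (t0+2)\<^sup>2 \<le> l / t\<^sup>2"
        using t t0 by (intro divide_left_mono power_mono mult_pos_pos) (auto simp: l_def)
      then show "(l / (t0+2)\<^sup>2 - 1) * (?k t)\<^sup>2 \<le> (l / t\<^sup>2 - 1) * (?k t)\<^sup>2" by (intro mult_right_mono) auto
    qed (intro integrable_continuous_interval continuous_intros; use t0 in auto)+
    also have "integral ?I (\<lambda>t. (l / (t0+2)\<^sup>2 - 1) * (?k t)\<^sup>2) = (l / (t0+2)\<^sup>2 - 1) * ?S" by simp
    finally have "(l / (t0+2)\<^sup>2 - 1) * ?S \<le> ?S'" using 1 by linarith
    then have "l / (t0+2)\<^sup>2 - 1 \<le> ?S' / ?S" unfolding pos_le_divide_eq[OF Spos] .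
    then have "l / (t0+2)\<^sup>2 \<le> ?S' / ?S + 1" by linarith
    then have "l \<le> (?S' / ?S + 1) * (t0+2)\<^sup>2" using t0 by (subst (asm) pos_divide_le_eq) auto
    then show ?thesis by (simp add: l_def mult.commute)
  qed
  then show ?thesis by blast
qed

text \<open>\<open>l\<close> is \<open>1/4 + m\<^sup>2\<close> for the supremum \<open>m\<close> of
  the nonnegative orders with \<open>KJ 0 \<mu>\<close> positive beyond \<open>t0\<close>; taking
  the supremum forces the zero at \<open>t0\<close>. The decay serves membership in
  \<open>H01\<close> and makes the boundary term of the energy identity vanish; the lower bound on
  \<open>f' / f\<close> is what the Hardy argument needs near the origin of the disc.\<close>

lemma bessel_ground_state:
  assumes t0: "0 < t0"
  shows "\<exists>l f f'. 1/4 < l \<and> f t0 = 0 \<and> (\<forall>t>t0. 0 < f t) \<and>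
    (\<forall>t>0. (f has_real_derivative f' t) (at t) \<and> (f' has_real_derivative (1 - l / t\<^sup>2) * f t) (at t)) \<and>
    (\<exists>C. \<forall>t\<ge>t0. \<bar>f t\<bar> \<le> C * exp (- t / 2) \<and> \<bar>f' t\<bar> \<le> C * exp (- t / 2)) \<and>
    (\<exists>C T. \<forall>t\<ge>T. - C \<le> f' t / f t)"
proof -
  define M where "M = {\<mu>. 0 \<le> \<mu> \<and> (\<forall>t>t0. 0 < KJ 0 \<mu> t)}"
  define m where "m = Sup M"
  obtain B where B: "\<And>\<mu>. (\<forall>t>t0. 0 < KJ 0 \<mu> t) \<Longrightarrow> \<mu>\<^sup>2 \<le> B"
    using bounded_positive_orders[OF t0] by blast
  have bdd: "bdd_above M"
    unfolding bdd_above_def M_def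
  proof (intro exI ballI)
    fix \<mu> assume "\<mu> \<in> {\<mu>. 0 \<le> \<mu> \<and> (\<forall>t>t0. 0 < KJ 0 \<mu> t)}"
    then show "\<mu> \<le> sqrt B" using B[of \<mu>] by (intro real_le_rsqrt) auto
  qed
  \<comment> \<open>\<open>KJ_pos\<close> covers this order, since \<open>2 * t0 < 2 * t\<close>;
    hence \<open>m\<close> is positive and \<open>l\<close> exceeds 1/4.\<close>
  have in_M: "sqrt (2 * t0) \<in> M"
    unfolding M_def using t0 by (auto intro!: KJ_pos)
  have m0: "0 < m"
  proof -
    have "sqrt (2 * t0) \<le> m" unfolding m_def by (rule cSup_upper[OF in_M bdd])
    moreover have "0 < sqrt (2 * t0)" using t0 by simp
    ultimately show ?thesis by linarith
  qed
  \<comment> \<open>Nonnegativity passes to the supremum: by \<open>KJ_lipschitz\<close> a negative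
    value of \<open>KJ 0 m t\<close> would persist for orders in \<open>M\<close> close to
    \<open>m\<close>.\<close>
  have lim: "0 \<le> KJ 0 m t" if t: "t \<ge> t0" for t
  proof (rule ccontr)
    assume neg: "\<not> 0 \<le> KJ 0 m t"
    have t': "0 < t" using t t0 by simp
    have nonneg: "0 \<le> KJ 0 \<mu> t" if "\<mu> \<in> M" for \<mu>
    proof (cases "t = t0")
      case False
      then show ?thesis using that t by (auto simp: M_def intro: less_imp_le)
    next
      case True
      have "((\<lambda>x. KJ 0 \<mu> x) \<longlongrightarrow> KJ 0 \<mu> t0) (at_right t0)"
        using DERIV_isCont[OF DERIV_KJ[OF t0, of 0 \<mu>]] tendsto_mono[OF at_le[OF subset_UNIV]]
        unfolding isCont_def by blast
      moreover have "\<forall>\<^sub>F x in at_right t0. 0 \<le> KJ 0 \<mu> x"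
        using that by (auto simp: M_def eventually_at_right_field intro!: exI[of _ "t0+1"] less_imp_le)
      ultimately show ?thesis unfolding True by (intro tendsto_lowerbound[where F = "at_right t0"]) auto
    qed
    define e where "e = - KJ 0 m t / (KJ 1 0 t + 1)"
    have K1: "0 \<le> KJ 1 0 t" using abs_KJ_le[OF t', of 1 0] by linarith
    have e: "0 < e" unfolding e_def using neg K1 by (intro divide_pos_pos) auto
    obtain \<mu> where \<mu>: "\<mu> \<in> M" "m - e < \<mu>"
      using less_cSupD[of M "m - e"] in_M e by (auto simp: m_def)
    have "\<mu> \<le> m" unfolding m_def by (rule cSup_upper[OF \<mu>(1) bdd])
    then have "\<bar>\<mu> - m\<bar> * KJ 1 0 t \<le> e * KJ 1 0 t" using \<mu> K1 by (intro mult_right_mono) auto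
    also have "\<dots> < e * (KJ 1 0 t + 1)" using e by (simp add: algebra_simps)
    also have "\<dots> = - KJ 0 m t" using K1 by (simp add: e_def)
    finally show False using KJ_lipschitz[OF t', of \<mu> m] nonneg[OF \<mu>(1)] by linarith
  qed
  \<comment> \<open>A zero here would be a minimum of a nonnegative function, hence a double zero,
    and uniqueness for the differential equation would make the solution vanish at large
    \<open>t\<close>, where it is positive.\<close>
  have pos: "0 < KJ 0 m t" if t: "t > t0" for t
  proof (rule ccontr)
    assume "\<not> 0 < KJ 0 m t"
    then have "KJ 0 m t = 0" using lim[of t] t by simp
    then have f0: "bF m t = 0" by (simp add: bF_def)
    have f'0: "bF' m t = 0"
    proof (rule DERIV_local_min[of "bF m" _ t "t - t0"])
      show "(bF m has_real_derivative bF' m t) (at t)" using t t0 by (intro DERIV_bF) auto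
      show "\<forall>y. \<bar>t - y\<bar> < t - t0 \<longrightarrow> bF m t \<le> bF m y"
        using f0 lim t0 by (auto simp: bF_def intro!: mult_nonneg_nonneg)
    qed (use t in auto)
    define T where "T = max t (m\<^sup>2) + 1"
    have "t < T" "m\<^sup>2 < T" unfolding T_def by linarith+
    moreover have "0 \<le> m\<^sup>2" by simp
    ultimately have T: "t \<le> T" "m\<^sup>2 < 2 * T" by linarith+
    have "bF m T = 0"
    proof (rule linear_ode_unique[OF T(1), where f = "bF m" and f' = "bF' m" and g = "\<lambda>t. 1 - (1/4 + m\<^sup>2) / t\<^sup>2" and B = "1 + (1/4 + m\<^sup>2) / t0\<^sup>2"])
      fix x assume x: "t \<le> x" "x \<le> T"
      have "\<bar>1 - (1/4 + m\<^sup>2) / x\<^sup>2\<bar> \<le> 1 + (1/4 + m\<^sup>2) / x\<^sup>2" by (simp add: abs_le_iff)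
      also have "(1/4 + m\<^sup>2) / x\<^sup>2 \<le> (1/4 + m\<^sup>2) / t0\<^sup>2"
        using x t t0 by (intro divide_left_mono power_mono mult_pos_pos) auto
      finally show "\<bar>1 - (1/4 + m\<^sup>2) / x\<^sup>2\<bar> \<le> 1 + (1/4 + m\<^sup>2) / t0\<^sup>2" by simp
    qed (use f0 f'0 t t0 in \<open>auto intro!: DERIV_bF DERIV_bF'\<close>)
    moreover have "0 < bF m T" using T t t0 by (subst bF_pos_iff) (auto intro!: KJ_pos)
    ultimately show False by simp
  qed
  \<comment> \<open>Otherwise the order could be increased, against the choice of \<open>m\<close>:
    on \<open>{t0..T}\<close> the positive minimum absorbs the change, and beyond \<open>T\<close>
    positivity holds for all orders up to \<open>m + 1\<close> by \<open>KJ_pos\<close>.\<close>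
  have zero: "KJ 0 m t0 = 0"
  proof (rule ccontr)
    assume "KJ 0 m t0 \<noteq> 0"
    then have pos': "0 < KJ 0 m t" if "t \<ge> t0" for t
      using pos[of t] lim[of t0] that by (cases "t = t0") auto
    define T where "T = t0 + (m + 1)\<^sup>2"
    have "continuous_on {t0..T} (KJ 0 m)"
      by (rule DERIV_continuous_on, rule DERIV_subset, rule DERIV_KJ) (use t0 in auto)
    moreover have "{t0..T} \<noteq> {}" by (simp add: T_def)
    ultimately obtain x where x: "x \<in> {t0..T}" "\<And>y. y \<in> {t0..T} \<Longrightarrow> KJ 0 m x \<le> KJ 0 m y"
      using continuous_attains_inf[of "{t0..T}" "KJ 0 m"] by auto
    have K1: "0 \<le> KJ 1 0 t0" using abs_KJ_le[OF t0, of 1 0] by linarith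
    \<comment> \<open>The second entry keeps the Lipschitz error at most half of the minimum, the
      first keeps the order at most \<open>m + 1\<close>.\<close>
    define e where "e = min 1 (KJ 0 m x / (2 * (KJ 1 0 t0 + 1)))"
    have e: "0 < e" "e \<le> 1" using pos'[of x] x K1 by (auto simp: e_def)
    have "m + e \<in> M"
      unfolding M_def
    proof (intro CollectI conjI allI impI)
      fix t assume t: "t0 < t"
      show "0 < KJ 0 (m + e) t"
      proof (cases "t \<le> T")
        case True
        have "KJ 1 0 t \<le> exp (t0 - t) * KJ 1 0 t0" using t t0 by (intro KJ_decay) auto
        also have "\<dots> \<le> 1 * KJ 1 0 t0" using t K1 by (intro mult_right_mono) auto
        finally have "e * KJ 1 0 t \<le> e * (KJ 1 0 t0 + 1)" using e by (intro mult_left_mono) auto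
        also have "\<dots> \<le> KJ 0 m x / (2 * (KJ 1 0 t0 + 1)) * (KJ 1 0 t0 + 1)"
          using K1 by (intro mult_right_mono) (auto simp: e_def)
        also have "\<dots> = KJ 0 m x / 2" using K1 by (simp add: field_simps)
        also have "\<dots> < KJ 0 m x" using pos'[of x] x by auto
        also have "\<dots> \<le> KJ 0 m t" using x(2) True t by auto
        finally show ?thesis using KJ_lipschitz[of t "m + e" m] e t t0 by simp
      next
        case False
        have "(m + e)\<^sup>2 \<le> (m + 1)\<^sup>2" using e m0 by (intro power_mono) auto
        also have "\<dots> < 2 * t" using False t0 zero_le_power2[of "m + 1"] unfolding T_def by linarith
        finally show ?thesis using t t0 by (intro KJ_pos) auto
      qed
    qed (use m0 e in auto)
    then have "m + e \<le> m" unfolding m_def by (rule cSup_upper[OF _ bdd])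
    then show False using e by simp
  qed
  \<comment> \<open>The integrals decay like \<open>exp (- t)\<close>; half of that rate is spent on
    \<open>sqrt t \<le> exp (t/2)\<close>.\<close>
  have decay: "\<bar>bF m t\<bar> \<le> C * exp (- t / 2) \<and> \<bar>bF' m t\<bar> \<le> C * exp (- t / 2)"
    if t: "t \<ge> t0" and C: "C = exp t0 * (KJ 0 0 t0 + KJ 0 0 t0 / (2 * sqrt t0) + KJ 1 0 t0)" for t C
  proof -
    have t': "0 < t" using t t0 by simp
    have K: "0 \<le> KJ 0 0 t0" "0 \<le> KJ 1 0 t0"
      using abs_KJ_le[OF t0, of 0 0] abs_KJ_le[OF t0, of 1 0] by linarith+
    have b: "\<bar>KJ j m t\<bar> \<le> exp t0 * KJ j 0 t0 * exp (- t)" if "j \<le> 2" for j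
    proof -
      have "\<bar>KJ j m t\<bar> \<le> exp (t0 - t) * KJ j 0 t0"
        using abs_KJ_le[OF t' that] KJ_decay[OF t0 t that] by (rule order_trans)
      then show ?thesis by (simp add: exp_diff exp_minus field_simps)
    qed
    have "t \<le> exp t" using exp_ge_add_one_self[of t] by linarith
    then have "sqrt t \<le> sqrt ((exp (t/2))\<^sup>2)"
      by (intro real_sqrt_le_mono) (simp flip: exp_double)
    then have sq: "sqrt t \<le> exp (t/2)" by simp
    have e: "exp (t/2) * exp (- t) = exp (- t / 2)" by (simp flip: exp_add)
    have e2: "exp (- t) \<le> exp (- t / 2)" using t' by simp
    have s: "sqrt t * \<bar>KJ j m t\<bar> \<le> exp t0 * KJ j 0 t0 * exp (- t / 2)" if "j \<le> 2" for j
    proof -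
      have "sqrt t * \<bar>KJ j m t\<bar> \<le> exp (t/2) * (exp t0 * KJ j 0 t0 * exp (- t))"
        using sq b[OF that] t' by (intro mult_mono) auto
      also have "\<dots> = exp t0 * KJ j 0 t0 * (exp (t/2) * exp (- t))" by (simp only: mult_ac)
      finally show ?thesis by (simp only: e)
    qed
    have q: "\<bar>KJ 0 m t\<bar> / (2 * sqrt t) \<le> (exp t0 * KJ 0 0 t0 * exp (- t / 2)) / (2 * sqrt t0)"
    proof (rule frac_le)
      show "\<bar>KJ 0 m t\<bar> \<le> exp t0 * KJ 0 0 t0 * exp (- t / 2)"
        by (rule order_trans[OF b mult_left_mono[OF e2]]) (use K in auto)
    qed (use t t0 K in auto)
    have x: "0 \<le> exp t0 * KJ 0 0 t0 * exp (- t / 2)" "0 \<le> exp t0 * KJ 1 0 t0 * exp (- t / 2)"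
      "0 \<le> (exp t0 * KJ 0 0 t0 * exp (- t / 2)) / (2 * sqrt t0)" using K t0 by auto
    have Ceq: "C * exp (- t / 2) = exp t0 * KJ 0 0 t0 * exp (- t / 2) + (exp t0 * KJ 0 0 t0 * exp (- t / 2)) / (2 * sqrt t0)
        + exp t0 * KJ 1 0 t0 * exp (- t / 2)"
      unfolding C by (simp add: algebra_simps)
    have "\<bar>bF m t\<bar> = sqrt t * \<bar>KJ 0 m t\<bar>" using t' by (simp add: bF_def abs_mult)
    moreover have "\<bar>bF' m t\<bar> \<le> \<bar>KJ 0 m t\<bar> / (2 * sqrt t) + sqrt t * \<bar>KJ 1 m t\<bar>"
      using t' abs_triangle_ineq4[of "KJ 0 m t / (2 * sqrt t)" "sqrt t * KJ 1 m t"] by (simp add: bF'_def abs_mult)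
    ultimately show ?thesis using s[of 0] s[of 1] q x unfolding Ceq by simp
  qed
  \<comment> \<open>The quotient is \<open>1 / (2 * t) - KJ 1 m t / KJ 0 m t\<close>. For
    \<open>t \<ge> m\<^sup>2\<close>, \<open>KJ_lower\<close> gives
    \<open>KJ 0 0 t \<le> 2 * KJ 0 m t\<close>, and \<open>KJ_1_le\<close> contributes another
    factor 2, whence the 4.\<close>
  have low: "- 4 \<le> bF' m t / bF m t" if t: "t \<ge> max (max 2 (t0 + 1)) (m\<^sup>2)" for t
  proof -
    have t': "0 < t" "2 \<le> t" "t0 < t" "m\<^sup>2 \<le> t" using t t0 by auto
    have p: "0 < KJ 0 m t" using pos t' by simp
    have "bF' m t / bF m t = 1 / (2 * t) - KJ 1 m t / KJ 0 m t"
    proof -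
      have "(a / (2 * r) - r * b) / (r * a) = 1 / (2 * (r * r)) - b / a" if "0 < r" "0 < a" for r a b :: real
        using that by (simp add: field_simps)
      from this[of "sqrt t" "KJ 0 m t" "KJ 1 m t"] show ?thesis using p t' by (simp add: bF_def bF'_def)
    qed
    moreover have "KJ 1 m t / KJ 0 m t \<le> 4"
    proof -
      have "m\<^sup>2 / (2 * t) \<le> 1 / 2" using t' by (simp add: field_simps)
      then have "1 / 2 * KJ 0 0 t \<le> (1 - m\<^sup>2 / (2 * t)) * KJ 0 0 t"
        using KJ_0_pos[OF t'(1)] by (intro mult_right_mono) auto
      then have "KJ 0 0 t \<le> 2 * KJ 0 m t" using KJ_lower[OF t'(1), of m] by linarith
      moreover have "KJ 1 m t \<le> 2 * KJ 0 0 t"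
        using abs_KJ_le[OF t'(1), of 1 m] KJ_1_le[OF t'(2)] by linarith
      ultimately have "KJ 1 m t \<le> 4 * KJ 0 m t" by linarith
      then show ?thesis using p by (simp add: field_simps)
    qed
    moreover have "0 \<le> 1 / (2 * t)" using t' by simp
    ultimately show ?thesis by linarith
  qed
  show ?thesis
  proof (intro exI conjI allI impI)
    show "1/4 < 1/4 + m\<^sup>2" using m0 by simp
    show "bF m t0 = 0" by (simp add: bF_def zero)
    show "0 < bF m t" if "t0 < t" for t using that pos[OF that] t0 by (subst bF_pos_iff) auto
    show "(bF m has_real_derivative bF' m t) (at t)" if "0 < t" for t using that by (rule DERIV_bF)
    show "(bF' m has_real_derivative (1 - (1/4 + m\<^sup>2) / t\<^sup>2) * bF m t) (at t)" if "0 < t" for t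
      using that by (rule DERIV_bF')
    show "\<bar>bF m t\<bar> \<le> exp t0 * (KJ 0 0 t0 + KJ 0 0 t0 / (2 * sqrt t0) + KJ 1 0 t0) * exp (- t / 2)"
      "\<bar>bF' m t\<bar> \<le> exp t0 * (KJ 0 0 t0 + KJ 0 0 t0 / (2 * sqrt t0) + KJ 1 0 t0) * exp (- t / 2)" if "t0 \<le> t" for t
      using decay[OF that refl] by auto
    show "- 4 \<le> bF' m t / bF m t" if "max (max 2 (t0 + 1)) (m\<^sup>2) \<le> t" for t using low[OF that] .
  qed
qed

section \<open>Approximation by test functions\<close>

text \<open>All derivatives of \<open>exp (- (1/x))\<close>, extended by 0, have this form; carrying
  the polynomial as a parameter makes the family closed under differentiation.\<close>

definition flat :: "real poly \<Rightarrow> real \<Rightarrow> real" where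
  "flat q x = (if 0 < x then poly q (1/x) * exp (- (1/x)) else 0)"

lemma poly_times_exp_minus_tendsto: "((\<lambda>y. y ^ k * poly q y * exp (- y)) \<longlongrightarrow> (0::real)) at_top"
proof (induction q arbitrary: k)
  case (pCons a q)
  have "((\<lambda>y. a * (y ^ k / exp y) + y ^ Suc k * poly q y * exp (- y)) \<longlongrightarrow> a * 0 + 0) at_top"
    by (intro tendsto_intros tendsto_power_div_exp_0 pCons.IH)
  moreover have "(\<lambda>y. a * (y ^ k / exp y) + y ^ Suc k * poly q y * exp (- y)) = (\<lambda>y. y ^ k * poly (pCons a q) y * exp (- y))"
    by (simp add: fun_eq_iff exp_minus field_simps)
  ultimately show ?case by simp
qed simp

text \<open>In the variable \<open>y = 1/x\<close> the new polynomial is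
  \<open>y\<^sup>2 (q - q')\<close>. At 0 the right-hand difference quotient is
  \<open>y * poly q y * exp (- y)\<close> with \<open>y\<close> tending to infinity.\<close>

lemma DERIV_flat: "(flat q has_real_derivative flat (pCons 0 (pCons 0 (q - pderiv q))) x) (at x)"
proof (cases x "0::real" rule: linorder_cases)
  case less
  have "((\<lambda>x. 0) has_real_derivative 0) (at x)" by simp
  then have "(flat q has_real_derivative 0) (at x)"
    by (rule has_field_derivative_transform_within_open[where S = "{..<0}"]) (use less in \<open>auto simp: flat_def\<close>)
  then show ?thesis using less by (simp add: flat_def)
next
  case greater
  have "((\<lambda>x. poly q (1/x) * exp (- (1/x))) has_real_derivative
      (poly (pderiv q) (1/x) * (- (1 / x\<^sup>2))) * exp (- (1/x)) + (exp (- (1/x)) * (1 / x\<^sup>2)) * poly q (1/x)) (at x)"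
  proof (rule DERIV_mult)
    have 1: "((\<lambda>x. 1/x) has_real_derivative - (1 / x\<^sup>2)) (at x)"
      using greater by (auto intro!: derivative_eq_intros simp: power2_eq_square)
    show "((\<lambda>x. poly q (1/x)) has_real_derivative poly (pderiv q) (1/x) * (- (1 / x\<^sup>2))) (at x)"
      by (rule DERIV_chain2[OF poly_DERIV 1])
    show "((\<lambda>x. exp (- (1/x))) has_real_derivative exp (- (1/x)) * (1 / x\<^sup>2)) (at x)"
      using DERIV_chain2[OF DERIV_exp DERIV_minus[OF 1]] by simp
  qed
  then have "(flat q has_real_derivative
      (poly (pderiv q) (1/x) * (- (1 / x\<^sup>2))) * exp (- (1/x)) + (exp (- (1/x)) * (1 / x\<^sup>2)) * poly q (1/x)) (at x)"
    by (rule has_field_derivative_transform_within_open[where S = "{0<..}"]) (use greater in \<open>auto simp: flat_def\<close>)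
  moreover have "(poly (pderiv q) (1/x) * (- (1 / x\<^sup>2))) * exp (- (1/x)) + (exp (- (1/x)) * (1 / x\<^sup>2)) * poly q (1/x)
     = flat (pCons 0 (pCons 0 (q - pderiv q))) x"
    using greater by (simp add: flat_def power2_eq_square field_simps)
  ultimately show ?thesis by simp
next
  case equal
  have "((\<lambda>h. (flat q (0 + h) - flat q 0) / h) \<longlongrightarrow> 0) (at 0)"
    unfolding filterlim_at_split
  proof
    show "((\<lambda>h. (flat q (0 + h) - flat q 0) / h) \<longlongrightarrow> 0) (at_left 0)"
      by (rule tendsto_eventually) (auto simp: flat_def eventually_at_left_field intro!: exI[of _ "-1"])
    have "((\<lambda>h. inverse h ^ 1 * poly q (inverse h) * exp (- inverse h)) \<longlongrightarrow> 0) (at_right 0)"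
      by (rule filterlim_compose[OF poly_times_exp_minus_tendsto filterlim_inverse_at_top_right])
    then show "((\<lambda>h. (flat q (0 + h) - flat q 0) / h) \<longlongrightarrow> 0) (at_right 0)"
      by (rule Lim_transform_eventually)
        (auto simp: flat_def eventually_at_right_field field_simps intro!: exI[of _ 1])
  qed
  then show ?thesis unfolding equal DERIV_def by (simp add: flat_def)
qed

lemma continuous_on_flat: "continuous_on S (flat q)"
  using DERIV_flat by (meson DERIV_continuous_on DERIV_subset top_greatest)

text \<open>A class of functions closed under partial derivatives, hence smooth; the generators \<open>flat q\<close>
provide compact support.\<close>

inductive_set smooth_ring :: "real \<Rightarrow> (real^2 \<Rightarrow> real) set" for c where
  const: "(\<lambda>x. k) \<in> smooth_ring c"
| coord: "(\<lambda>x. x $ i) \<in> smooth_ring c"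
| flat: "(\<lambda>x. flat q (c - x \<bullet> x)) \<in> smooth_ring c"
| add: "f \<in> smooth_ring c \<Longrightarrow> g \<in> smooth_ring c \<Longrightarrow> (\<lambda>x. f x + g x) \<in> smooth_ring c"
| mult: "f \<in> smooth_ring c \<Longrightarrow> g \<in> smooth_ring c \<Longrightarrow> (\<lambda>x. f x * g x) \<in> smooth_ring c"

lemma smooth_ring_derivative:
  "f \<in> smooth_ring c \<Longrightarrow>
    \<exists>D. (\<forall>x. (f has_derivative D x) (at x)) \<and> (\<forall>i. (\<lambda>x. D x (axis i 1)) \<in> smooth_ring c)"
proof (induction rule: smooth_ring.induct)
  case (const k)
  show ?case by (intro exI[of _ "\<lambda>x h. 0"]) (auto intro: smooth_ring.const)
next
  case (coord i)
  show ?case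
  proof (intro exI[of _ "\<lambda>x h. h $ i"] conjI allI)
    show "((\<lambda>x. x $ i) has_derivative (\<lambda>h. h $ i)) (at x)" for x :: "real^2"
      by (rule has_derivative_vec_nth_ident)
    show "(\<lambda>x. axis j 1 $ i) \<in> smooth_ring c" for j by (rule smooth_ring.const)
  qed
next
  case (flat q)
  let ?q = "pCons 0 (pCons 0 (q - pderiv q))"
  show ?case
  proof (intro exI[of _ "\<lambda>x h. flat ?q (c - x \<bullet> x) * (- (2 * (x \<bullet> h)))"] conjI allI)
    fix x :: "real^2"
    have 1: "((\<lambda>x. c - x \<bullet> x) has_derivative (\<lambda>h. - (2 * (x \<bullet> h)))) (at x)"
      by (auto intro!: derivative_eq_intros simp: inner_commute)
    have "(flat q has_derivative (*) (flat ?q (c - x \<bullet> x))) (at (c - x \<bullet> x))"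
      using DERIV_flat[of q "c - x \<bullet> x"] by (simp add: has_field_derivative_def)
    from has_derivative_compose[OF 1 this]
    show "((\<lambda>x. flat q (c - x \<bullet> x)) has_derivative (\<lambda>h. flat ?q (c - x \<bullet> x) * (- (2 * (x \<bullet> h))))) (at x)" .
  next
    fix i
    have "(\<lambda>x. flat ?q (c - x \<bullet> x) * ((- 2) * x $ i)) \<in> smooth_ring c"
      by (intro smooth_ring.intros)
    then show "(\<lambda>x. flat ?q (c - x \<bullet> x) * (- (2 * (x \<bullet> axis i 1)))) \<in> smooth_ring c"
      by (simp add: inner_axis)
  qed
next
  case (add f g)
  then obtain D E where "\<And>x. (f has_derivative D x) (at x)" "\<And>i. (\<lambda>x. D x (axis i 1)) \<in> smooth_ring c"
    "\<And>x. (g has_derivative E x) (at x)" "\<And>i. (\<lambda>x. E x (axis i 1)) \<in> smooth_ring c" by blast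
  then show ?case
    by (intro exI[of _ "\<lambda>x h. D x h + E x h"]) (auto intro: has_derivative_add smooth_ring.add)
next
  case (mult f g)
  then obtain D E where "\<And>x. (f has_derivative D x) (at x)" "\<And>i. (\<lambda>x. D x (axis i 1)) \<in> smooth_ring c"
    "\<And>x. (g has_derivative E x) (at x)" "\<And>i. (\<lambda>x. E x (axis i 1)) \<in> smooth_ring c" by blast
  with mult.hyps show ?case
    by (intro exI[of _ "\<lambda>x h. f x * E x h + D x h * g x"]) (auto intro!: has_derivative_mult smooth_ring.add smooth_ring.mult)
qed

lemma partial_deriv_eq: "(f has_derivative D) (at x) \<Longrightarrow> partial_deriv i f x = D (axis i 1)"
  by (simp add: partial_deriv_def frechet_derivative_at[symmetric])

lemma smooth_ring_C_k: "f \<in> smooth_ring c \<Longrightarrow> C_k k f"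
proof (induction k arbitrary: f)
  case 0
  obtain D where "\<And>x. (f has_derivative D x) (at x)"
    using smooth_ring_derivative[OF 0] by blast
  then have "isCont f x" for x using has_derivative_continuous by blast
  then show ?case by (simp add: continuous_at_imp_continuous_on)
next
  case (Suc k)
  obtain D where D: "\<And>x. (f has_derivative D x) (at x)" "\<And>i. (\<lambda>x. D x (axis i 1)) \<in> smooth_ring c"
    using smooth_ring_derivative[OF Suc.prems] by blast
  then have "partial_deriv i f = (\<lambda>x. D x (axis i 1))" for i
    by (auto simp: partial_deriv_eq)
  then show ?case using D Suc.IH by (auto simp: differentiable_on_def differentiable_def intro: has_derivative_at_withinI)
qed

lemma smooth_ring_test_function:
  assumes "f \<in> smooth_ring c" and c: "c < 1" and z: "\<And>x. c \<le> x \<bullet> x \<Longrightarrow> f x = 0"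
  shows "f \<in> test_functions"
proof -
  have sub: "{x. f x \<noteq> 0} \<subseteq> cball 0 (sqrt c)"
  proof
    fix x assume "x \<in> {x. f x \<noteq> 0}"
    then have "(norm x)\<^sup>2 \<le> c" using z[of x] by (force simp: power2_norm_eq_inner)
    then show "x \<in> cball 0 (sqrt c)" by (simp add: real_le_rsqrt)
  qed
  then have cl: "closure {x. f x \<noteq> 0} \<subseteq> cball 0 (sqrt c)" by (rule closure_minimal) simp
  moreover have "cball 0 (sqrt c) \<subseteq> (unit_disc :: (real^2) set)"
  proof -
    have "sqrt c < 1" using c by simp
    then show ?thesis by (auto dest: le_less_trans simp del: real_sqrt_lt_1_iff)
  qed
  moreover have "compact (closure {x. f x \<noteq> 0})"
    using bounded_subset[OF bounded_cball sub] by (simp add: compact_closure)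
  ultimately show ?thesis
    unfolding test_functions_def using smooth_ring_C_k[OF assms(1)] by blast
qed

lemma smooth_ring_inner: "(\<lambda>x. x \<bullet> x) \<in> smooth_ring c"
proof -
  have "(\<lambda>x::real^2. x $ 1 * x $ 1 + x $ 2 * x $ 2) \<in> smooth_ring c" by (intro smooth_ring.intros)
  then show ?thesis by (simp add: inner_vec_def sum_2)
qed

lemma smooth_ring_power: "f \<in> smooth_ring c \<Longrightarrow> (\<lambda>x. f x ^ n) \<in> smooth_ring c"
  by (induction n) (auto intro: smooth_ring.intros)

lemma smooth_ring_sum: "(\<And>i. i \<in> I \<Longrightarrow> f i \<in> smooth_ring c) \<Longrightarrow> (\<lambda>x. \<Sum>i\<in>I. f i x) \<in> smooth_ring c"
  by (induction I rule: infinite_finite_induct) (auto intro: smooth_ring.intros)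

text \<open>The derivative is approximated first, by Weierstrass, and the polynomial is then
  integrated from the exact value \<open>h 0\<close>; on an interval of length 1 integration does
  not enlarge the error.\<close>

lemma polynomial_C1_approx:
  fixes h h' :: "real \<Rightarrow> real"
  assumes h: "\<And>s. (h has_real_derivative h' s) (at s)" and c: "continuous_on UNIV h'" and e: "0 < e"
  shows "\<exists>a n b. let P = (\<lambda>s. b + (\<Sum>i\<le>n. a i / real (Suc i) * s ^ Suc i)); P' = (\<lambda>s. \<Sum>i\<le>n. a i * s ^ i) in
    (\<forall>s. (P has_real_derivative P' s) (at s)) \<and> (\<forall>s\<in>{0..1}. \<bar>P s - h s\<bar> \<le> e \<and> \<bar>P' s - h' s\<bar> \<le> e)"
proof -
  obtain Q where Q: "real_polynomial_function Q" "\<And>s. s \<in> {0..1} \<Longrightarrow> \<bar>h' s - Q s\<bar> < e"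
    using Stone_Weierstrass_real_polynomial_function[of "{0..1::real}" h' e] continuous_on_subset[OF c] e by auto
  obtain a n where Qa: "Q = (\<lambda>x. \<Sum>i\<le>n. a i * x ^ i)"
    using Q(1) unfolding real_polynomial_function_iff_sum by blast
  let ?P = "\<lambda>s. h 0 + (\<Sum>i\<le>n. a i / real (Suc i) * s ^ Suc i)"
  have P: "(?P has_real_derivative Q s) (at s)" for s
    unfolding Qa
    by (rule derivative_eq_intros refl | simp)+ (auto intro!: sum.cong simp: field_simps)
  have "\<bar>?P s - h s\<bar> \<le> e" if s: "s \<in> {0..1}" for s
  proof -
    have "norm ((?P s - h s) - (?P 0 - h 0)) \<le> e * norm (s - 0)"
    proof (rule field_differentiable_bound[where S = "{0..1}" and f' = "\<lambda>s. Q s - h' s"])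
      fix z :: real assume z: "z \<in> {0..1}"
      show "((\<lambda>s. ?P s - h s) has_real_derivative Q z - h' z) (at z within {0..1})"
        by (rule DERIV_subset[OF DERIV_diff[OF P h]]) simp
      show "norm (Q z - h' z) \<le> e" using Q(2)[OF z] by (simp add: abs_minus_commute)
    qed (use s in auto)
    also have "e * norm (s - 0) \<le> e * 1" using s e by (intro mult_left_mono) auto
    finally show ?thesis by simp
  qed
  moreover have "\<bar>Q s - h' s\<bar> \<le> e" if "s \<in> {0..1}" for s using Q(2)[OF that] by (simp add: abs_minus_commute)
  ultimately show ?thesis using P unfolding Qa Let_def by blast
qed

text \<open>\<open>G\<close> is divided by the flat bump \<open>E\<close>, which is positive exactly
  below \<open>c\<close>; the quotient is again C1 because \<open>G\<close> vanishes already from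
  \<open>c' < c\<close> on. A polynomial close to \<open>G / E\<close> in C1, multiplied by
  \<open>E\<close>, is smooth, vanishes beyond \<open>c\<close> and is close to
  \<open>G\<close>.\<close>

lemma radial_test_approx:
  fixes G G' :: "real \<Rightarrow> real"
  assumes G: "\<And>s. (G has_real_derivative G' s) (at s)" and cG: "continuous_on UNIV G'"
    and c': "c' < 1" "\<And>s. c' \<le> s \<Longrightarrow> G s = 0" and e: "0 < e"
  shows "\<exists>H H'. (\<forall>s. (H has_real_derivative H' s) (at s)) \<and> (\<forall>s\<in>{0..1}. \<bar>H s - G s\<bar> \<le> e \<and> \<bar>H' s - G' s\<bar> \<le> e) \<and>
    (\<lambda>x. H (x \<bullet> x)) \<in> test_functions \<and> (\<lambda>x. x $ 1 * H (x \<bullet> x)) \<in> test_functions"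
proof -
  define c where "c = (1 + c') / 2"
  have c: "c' < c" "c < 1" using c' by (auto simp: c_def)
  have G'0: "G' s = 0" if "c' < s" for s
  proof -
    have "(G has_real_derivative 0) (at s)"
      by (rule has_field_derivative_transform_within_open[where S = "{c'<..}" and f = "\<lambda>_. 0"]) (use that c' in auto)
    then show ?thesis using G DERIV_unique by blast
  qed
  define E where "E s = flat 1 (c - s)" for s
  define E' where "E' s = - flat (pCons 0 (pCons 0 1)) (c - s)" for s
  have E: "(E has_real_derivative E' s) (at s)" for s
  proof -
    have "((\<lambda>s. c - s) has_real_derivative - 1) (at s)" by (auto intro!: derivative_eq_intros)
    from DERIV_chain2[OF DERIV_flat[of 1] this] show ?thesis
      by (simp add: E_def[abs_def] E'_def)
  qed
  have cE: "continuous_on S E" "continuous_on S E'" for S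
    unfolding E_def E'_def by (intro continuous_intros continuous_on_compose2[OF continuous_on_flat[of UNIV]]; simp)+
  have E0: "E s = 0" "E' s = 0" if "c \<le> s" for s using that by (auto simp: E_def E'_def flat_def)
  have Epos: "0 < E s" if "s < c" for s using that by (auto simp: E_def flat_def)
  define h where "h s = (if s < c then G s / E s else 0)" for s
  define h' where "h' s = (if s < c then (G' s * E s - G s * E' s) / (E s * E s) else 0)" for s
  have hE: "h s * E s = G s" for s
    using Epos[of s] c'(2)[of s] c by (auto simp: h_def)
  have h: "(h has_real_derivative h' s) (at s)" for s
  proof (cases "s < c")
    case True
    have "((\<lambda>s. G s / E s) has_real_derivative (G' s * E s - G s * E' s) / (E s * E s)) (at s)"
      by (rule DERIV_divide[OF G E]) (use Epos[OF True] in auto)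
    then have "(h has_real_derivative (G' s * E s - G s * E' s) / (E s * E s)) (at s)"
      by (rule has_field_derivative_transform_within_open[where S = "{..<c}"]) (use True in \<open>auto simp: h_def\<close>)
    then show ?thesis using True by (simp add: h'_def)
  next
    case False
    have "(h has_real_derivative 0) (at s)"
      by (rule has_field_derivative_transform_within_open[where S = "{c'<..}" and f = "\<lambda>_. 0"])
        (use False c c' in \<open>auto simp: h_def\<close>)
    then show ?thesis using False by (simp add: h'_def)
  qed
  have G_cont: "continuous_on S G" for S using G by (meson DERIV_continuous_on DERIV_subset top_greatest)
  have ch: "continuous_on UNIV h'"
  proof -
    \<comment> \<open>The two open half-lines overlap because \<open>c' < c\<close>; on the right
      one \<open>h'\<close> is 0.\<close>
    have "continuous_on ({..<c} \<union> {c'<..}) h'"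
    proof (rule continuous_on_open_Un)
      have "continuous_on {..<c} (\<lambda>s. (G' s * E s - G s * E' s) / (E s * E s))"
        by (intro continuous_intros cE G_cont continuous_on_subset[OF cG]) (use Epos in force)+
      then show "continuous_on {..<c} h'" by (rule continuous_on_eq) (auto simp: h'_def)
      show "continuous_on {c'<..} h'"
        by (rule continuous_on_eq[of _ "\<lambda>_. 0"]) (use c' G'0 in \<open>auto simp: h'_def\<close>)
    qed auto
    moreover have "{..<c} \<union> {c'<..} = UNIV" using c by auto
    ultimately show ?thesis by simp
  qed
  obtain B where B: "\<And>s. s \<in> {0..1} \<Longrightarrow> \<bar>E s\<bar> \<le> B" "\<And>s. s \<in> {0..1} \<Longrightarrow> \<bar>E' s\<bar> \<le> B" "0 < B"
  proof -
    have "bounded (E ` {0..1})" "bounded (E' ` {0..1})"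
      by (intro compact_imp_bounded compact_continuous_image cE compact_Icc)+
    then obtain B1 B2 where "\<forall>x\<in>E ` {0..1}. norm x \<le> B1" "\<forall>x\<in>E' ` {0..1}. norm x \<le> B2"
      unfolding bounded_iff by blast
    then show ?thesis by (intro that[of "max 1 (max B1 B2)"]) (auto simp: le_max_iff_disj)
  qed
  \<comment> \<open>The product rule produces two error terms, each at most
    \<open>d * B\<close>.\<close>
  define d where "d = e / (2 * B)"
  have d: "0 < d" "2 * B * d = e" using B(3) e by (auto simp: d_def)
  obtain a n b where P: "let P = (\<lambda>s. b + (\<Sum>i\<le>n. a i / real (Suc i) * s ^ Suc i)); P' = (\<lambda>s. \<Sum>i\<le>n. a i * s ^ i) in
    (\<forall>s. (P has_real_derivative P' s) (at s)) \<and> (\<forall>s\<in>{0..1}. \<bar>P s - h s\<bar> \<le> d \<and> \<bar>P' s - h' s\<bar> \<le> d)"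
    using polynomial_C1_approx[OF h ch d(1)] by blast
  define P where "P = (\<lambda>s. b + (\<Sum>i\<le>n. a i / real (Suc i) * s ^ Suc i))"
  define P' where "P' = (\<lambda>s. \<Sum>i\<le>n. a i * s ^ i)"
  have P: "\<And>s. (P has_real_derivative P' s) (at s)" "\<And>s. s \<in> {0..1} \<Longrightarrow> \<bar>P s - h s\<bar> \<le> d" "\<And>s. s \<in> {0..1} \<Longrightarrow> \<bar>P' s - h' s\<bar> \<le> d"
    using P by (auto simp: Let_def P_def P'_def)
  define H where "H s = P s * E s" for s
  define H' where "H' s = P' s * E s + E' s * P s" for s
  have G'eq: "G' s = h' s * E s + E' s * h s" for s
  proof -
    have "((\<lambda>s. h s * E s) has_real_derivative h' s * E s + E' s * h s) (at s)" by (rule DERIV_mult[OF h E])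
    then show ?thesis using G[of s] unfolding hE by (rule DERIV_unique[symmetric])
  qed
  have "(\<lambda>x. P (x \<bullet> x)) \<in> smooth_ring c"
    unfolding P_def by (intro smooth_ring.intros smooth_ring_sum smooth_ring_power smooth_ring_inner)
  then have Hr: "(\<lambda>x. H (x \<bullet> x)) \<in> smooth_ring c"
    unfolding H_def E_def by (intro smooth_ring.intros)
  have Ha: "H s = 0" if "c \<le> s" for s using E0[OF that] by (simp add: H_def)
  show ?thesis
  proof (intro exI conjI allI ballI)
    show "(H has_real_derivative H' s) (at s)" for s
      unfolding H_def[abs_def] H'_def by (rule DERIV_mult[OF P(1) E])
    show "(\<lambda>x. H (x \<bullet> x)) \<in> test_functions"
      by (rule smooth_ring_test_function[OF Hr c(2) Ha])
    show "(\<lambda>x. x $ 1 * H (x \<bullet> x)) \<in> test_functions"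
      by (rule smooth_ring_test_function[OF smooth_ring.mult[OF smooth_ring.coord Hr] c(2)]) (simp add: Ha)
    fix s :: real assume s: "s \<in> {0..1}"
    have "\<bar>H s - G s\<bar> = \<bar>P s - h s\<bar> * \<bar>E s\<bar>" by (simp add: H_def hE[symmetric] left_diff_distrib flip: abs_mult)
    also have "\<dots> \<le> d * B" by (intro mult_mono P B s) (use d in auto)
    also have "\<dots> \<le> d * B + B * d" using d(1) B(3) by simp
    also have "\<dots> = e" using d by simp
    finally show "\<bar>H s - G s\<bar> \<le> e" .
    have "\<bar>H' s - G' s\<bar> = \<bar>(P' s - h' s) * E s + E' s * (P s - h s)\<bar>" by (simp add: H'_def G'eq algebra_simps)
    also have "\<dots> \<le> \<bar>P' s - h' s\<bar> * \<bar>E s\<bar> + \<bar>E' s\<bar> * \<bar>P s - h s\<bar>" by (simp flip: abs_mult)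
    also have "\<dots> \<le> d * B + B * d" by (intro add_mono mult_mono P B s) (use d B(3) in auto)
    also have "\<dots> = e" using d by simp
    finally show "\<bar>H' s - G' s\<bar> \<le> e" .
  qed
qed

section \<open>Calculus of test functions\<close>

lemma C_k_SucD: "C_k (Suc k) f \<Longrightarrow> f differentiable (at x)" "C_k (Suc k) f \<Longrightarrow> C_k k (partial_deriv i f)"
  by (auto simp: differentiable_on_def)

lemma test_functionD:
  assumes "f \<in> test_functions"
  shows test_differentiable: "f differentiable (at x)"
    and test_continuous: "continuous_on UNIV f"
    and test_has_derivative: "(f has_derivative frechet_derivative f (at x)) (at x)"
proof -
  have "C_k (Suc 0) f" using assms unfolding test_functions_def by blast
  then show d: "f differentiable (at x)" for x by (rule C_k_SucD)
  show "continuous_on UNIV f"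
    using assms unfolding test_functions_def by (auto dest!: spec[of _ 0])
  show "(f has_derivative frechet_derivative f (at x)) (at x)"
    using d frechet_derivative_works by blast
qed

lemma test_support:
  assumes "f \<in> test_functions"
  shows "\<exists>\<rho>. 0 < \<rho> \<and> \<rho> < 1 \<and> (\<forall>x. \<rho> \<le> norm x \<longrightarrow> f x = 0)"
proof -
  let ?K = "closure {x. f x \<noteq> 0}"
  have K: "compact ?K" "?K \<subseteq> unit_disc" using assms by (auto simp: test_functions_def)
  show ?thesis
  proof (cases "?K = {}")
    case True
    then have "f x = 0" for x :: "real^2" by auto
    then show ?thesis by (intro exI[of _ "1/2"]) auto
  next
    case False
    obtain y where y: "y \<in> ?K" "\<And>x. x \<in> ?K \<Longrightarrow> norm x \<le> norm y"
      using continuous_attains_sup[OF K(1) False, of norm] by (auto intro: continuous_intros)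
    have ny: "norm y < 1" using y(1) K(2) by auto
    show ?thesis
    proof (intro exI[of _ "(1 + norm y) / 2"] conjI allI impI)
      show "0 < (1 + norm y) / 2" by (intro divide_pos_pos add_pos_nonneg) auto
      show "(1 + norm y) / 2 < 1" using ny by simp
      fix x :: "real^2" assume x: "(1 + norm y) / 2 \<le> norm x"
      show "f x = 0"
      proof (rule ccontr)
        assume "f x \<noteq> 0"
        then have "x \<in> ?K" using closure_subset[of "{x. f x \<noteq> 0}"] by auto
        then show False using y(2)[of x] x ny by simp
      qed
    qed
  qed
qed

lemma test_partial:
  assumes "f \<in> test_functions"
  shows "partial_deriv i f \<in> test_functions"
proof -
  let ?K = "closure {x. f x \<noteq> 0}"
  have "partial_deriv i f x = 0" if x: "x \<notin> ?K" for x
  proof -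
    have "(f has_derivative (\<lambda>h. 0)) (at x)"
    proof (rule has_derivative_transform_within_open[where f = "\<lambda>_. 0" and s = "- ?K"])
      show "0 = f y" if "y \<in> - ?K" for y using that closure_subset[of "{x. f x \<noteq> 0}"] by auto
    qed (use x in \<open>auto intro: derivative_intros\<close>)
    then show ?thesis by (simp add: partial_deriv_eq)
  qed
  then have "{x. partial_deriv i f x \<noteq> 0} \<subseteq> ?K" by blast
  then have "closure {x. partial_deriv i f x \<noteq> 0} \<subseteq> ?K" by (rule closure_minimal) simp
  moreover have "C_k k (partial_deriv i f)" for k
    using assms unfolding test_functions_def by (auto dest!: spec[of _ "Suc k"])
  moreover have "compact (closure {x. partial_deriv i f x \<noteq> 0})"
    using calculation(1) assms unfolding test_functions_def
    by (metis (no_types, lifting) bounded_subset closed_closure compact_eq_bounded_closed mem_Collect_eq)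
  ultimately show ?thesis using assms unfolding test_functions_def by blast
qed

lemma C_k_diff: "C_k k f \<Longrightarrow> C_k k g \<Longrightarrow> C_k k (\<lambda>x. f x - g x)"
proof (induction k arbitrary: f g)
  case 0
  then show ?case by (auto intro: continuous_intros)
next
  case (Suc k)
  have "partial_deriv i (\<lambda>x. f x - g x) = (\<lambda>x. partial_deriv i f x - partial_deriv i g x)" for i
  proof
    fix x
    have "(f has_derivative frechet_derivative f (at x)) (at x)" "(g has_derivative frechet_derivative g (at x)) (at x)"
      using Suc.prems[THEN C_k_SucD(1)] frechet_derivative_works by blast+
    from partial_deriv_eq[OF has_derivative_diff[OF this]]
    show "partial_deriv i (\<lambda>x. f x - g x) x = partial_deriv i f x - partial_deriv i g x"
      by (simp add: partial_deriv_def)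
  qed
  then show ?case using Suc by (auto intro: differentiable_on_diff)
qed

lemma test_diff:
  assumes "f \<in> test_functions" "g \<in> test_functions"
  shows "(\<lambda>x. f x - g x) \<in> test_functions"
proof -
  let ?K = "closure {x. f x \<noteq> 0} \<union> closure {x. g x \<noteq> 0}"
  have "{x. f x - g x \<noteq> 0} \<subseteq> {x. f x \<noteq> 0} \<union> {x. g x \<noteq> 0}" by auto
  also have "\<dots> \<subseteq> ?K" by (intro Un_mono closure_subset)
  finally have "{x. f x - g x \<noteq> 0} \<subseteq> ?K" .
  then have s: "closure {x. f x - g x \<noteq> 0} \<subseteq> ?K" by (rule closure_minimal) auto
  have K: "compact ?K" "?K \<subseteq> unit_disc" using assms by (auto simp: test_functions_def)
  have "compact (closure {x. f x - g x \<noteq> 0})"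
    using bounded_subset[OF compact_imp_bounded[OF K(1)] s] by (simp add: compact_eq_bounded_closed)
  then show ?thesis
    using s K assms C_k_diff unfolding test_functions_def by blast
qed

lemma grad_eq:
  assumes "(f has_derivative D) (at x)"
  shows "grad f x = (\<chi> i. D (axis i 1))"
  using assms by (simp add: grad_def partial_deriv_eq)

lemma grad_diff:
  assumes "f \<in> test_functions" "g \<in> test_functions"
  shows "grad (\<lambda>x. f x - g x) x = grad f x - grad g x"
  using partial_deriv_eq[OF has_derivative_diff[OF assms[THEN test_has_derivative]]]
  by (simp add: grad_def vec_eq_iff partial_deriv_def)

lemma continuous_grad: "f \<in> test_functions \<Longrightarrow> continuous_on UNIV (grad f)"
  unfolding grad_def[abs_def] using test_partial test_continuous
  by (intro continuous_on_vec_lambda) blast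

text \<open>By translation invariance the difference quotients of \<open>h\<close> have integral 0;
  they converge to the partial derivative and are bounded by \<open>M\<close>. The dominating ball
  has radius 2 because the steps have length at most 1.\<close>

lemma integral_derivative_zero:
  fixes h :: "real^2 \<Rightarrow> real"
  assumes h: "\<And>x. (h has_derivative D x) (at x)" and c: "continuous_on UNIV (\<lambda>x. D x (axis i 1))"
    and z: "\<And>x. 1 \<le> norm x \<Longrightarrow> h x = 0"
  shows "integrable lborel (\<lambda>x. D x (axis i 1))" "(LINT x|lborel. D x (axis i 1)) = 0"
proof -
  let ?e = "axis i 1 :: real^2"
  let ?d = "\<lambda>x. D x ?e"
  have ch: "continuous_on UNIV h" using h by (meson has_derivative_continuous continuous_at_imp_continuous_on)
  have dz: "?d x = 0" if "1 < norm x" for x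
  proof -
    have "(h has_derivative (\<lambda>h. 0)) (at x)"
      by (rule has_derivative_transform_within_open[where f = "\<lambda>_. 0" and s = "- cball 0 1"])
        (use that z in \<open>auto intro: derivative_intros\<close>)
    then show ?thesis using has_derivative_unique[OF h] by metis
  qed
  obtain M where M: "\<And>x. x \<in> cball 0 1 \<Longrightarrow> \<bar>?d x\<bar> \<le> M" "0 \<le> M"
  proof -
    have "bounded (?d ` cball 0 1)"
      by (intro compact_imp_bounded compact_continuous_image continuous_on_subset[OF c]) auto
    then obtain M where "\<forall>y\<in>?d ` cball 0 1. norm y \<le> M" unfolding bounded_iff by blast
    then show ?thesis by (intro that[of "max 0 M"]) (auto simp: le_max_iff_disj)
  qed
  have M': "\<bar>?d x\<bar> \<le> M" for x using M dz[of x] by (cases "norm x \<le> 1") auto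
  have der: "((\<lambda>t. h (x + t *\<^sub>R ?e)) has_real_derivative ?d (x + t *\<^sub>R ?e)) (at t)" for x t
  proof -
    have "((\<lambda>t. x + t *\<^sub>R ?e) has_derivative (\<lambda>s. s *\<^sub>R ?e)) (at t)"
      by (auto intro!: derivative_eq_intros)
    from has_derivative_compose[OF this h]
    have "((\<lambda>t. h (x + t *\<^sub>R ?e)) has_derivative (\<lambda>s. D (x + t *\<^sub>R ?e) (s *\<^sub>R ?e))) (at t)" .
    moreover have "D y (s *\<^sub>R ?e) = ?d y * s" for y s
      using linear_scale[OF has_derivative_linear[OF h]] by simp
    ultimately show ?thesis by (simp add: has_field_derivative_def)
  qed
  define q where "q n x = (h (x + inverse (real (Suc n)) *\<^sub>R ?e) - h x) * real (Suc n)" for n x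
  have ib: "integrable lborel (\<lambda>x::real^2. M * indicator (cball 0 2) x)"
    using emeasure_bounded_finite[OF bounded_cball[of "0::real^2" 2]]
    by (intro integrable_mult_right integrable_real_indicator) auto
  have db: "\<bar>?d x\<bar> \<le> M * indicator (cball 0 2) x" for x
    using M'[of x] dz[of x] by (auto simp: indicator_def)
  have mh: "h \<in> borel_measurable borel" by (rule borel_measurable_continuous_onI[OF ch])
  have md: "?d \<in> borel_measurable borel" by (rule borel_measurable_continuous_onI[OF c])
  show "integrable lborel ?d"
    by (rule Bochner_Integration.integrable_bound[OF ib]) (use md db in \<open>auto intro: order_trans[OF _ abs_ge_self]\<close>)
  have ih: "integrable lborel h"
  proof -
    obtain B where B: "\<And>x. x \<in> cball 0 1 \<Longrightarrow> \<bar>h x\<bar> \<le> B"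
    proof -
      have "bounded (h ` cball 0 1)"
        by (intro compact_imp_bounded compact_continuous_image continuous_on_subset[OF ch]) auto
      then obtain B where "\<forall>y\<in>h ` cball 0 1. norm y \<le> B" unfolding bounded_iff by blast
      then show ?thesis by (intro that[of B]) auto
    qed
    have ib: "integrable lborel (\<lambda>x::real^2. B * indicator (cball 0 1) x)"
      using emeasure_bounded_finite[OF bounded_cball[of "0::real^2" 1]]
      by (intro integrable_mult_right integrable_real_indicator) auto
    have "\<bar>h x\<bar> \<le> B * indicator (cball 0 1) x" for x
      using B[of x] z[of x] by (auto simp: indicator_def)
    then show ?thesis
      by (intro Bochner_Integration.integrable_bound[OF ib]) (use mh in \<open>auto intro: order_trans[OF _ abs_ge_self]\<close>)
  qed
  have tr: "integrable lborel (\<lambda>x. h (v + x))" "(LINT x|lborel. h (v + x)) = (LINT x|lborel. h x)" for v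
    using ih integrable_distr_eq[of "(+) v" lborel borel h] integral_distr[of "(+) v" lborel borel h] mh
    by (auto simp: lborel_distr_plus)
  have iq: "(LINT x|lborel. q n x) = 0" for n
  proof -
    have e: "q n = (\<lambda>x. (h (inverse (real (Suc n)) *\<^sub>R ?e + x) - h x) * real (Suc n))"
      by (simp add: q_def fun_eq_iff add.commute)
    have "(LINT x|lborel. (h (inverse (real (Suc n)) *\<^sub>R ?e + x) - h x)) = 0"
      by (subst Bochner_Integration.integral_diff[OF tr(1) ih]) (simp only: tr(2) diff_self)
    then show ?thesis unfolding e by (simp only: integral_mult_left_zero mult_zero_left)
  qed
  have "(\<lambda>n. LINT x|lborel. q n x) \<longlonglongrightarrow> (LINT x|lborel. ?d x)"
  proof (rule integral_dominated_convergence[OF _ _ ib])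
    show "?d \<in> borel_measurable lborel" using md by simp
    show "q n \<in> borel_measurable lborel" for n
    proof -
      have "continuous_on UNIV (q n)"
        unfolding q_def[abs_def] by (intro continuous_intros continuous_on_compose2[OF ch]) auto
      then show ?thesis using borel_measurable_continuous_onI by simp
    qed
    have "(\<lambda>n. q n x) \<longlonglongrightarrow> ?d x" for x
    proof -
      have "((\<lambda>t. (h (x + t *\<^sub>R ?e) - h x) / t) \<longlongrightarrow> ?d x) (at 0)"
        using der[of x 0] by (simp add: DERIV_def)
      from filterlim_compose[OF this, of "\<lambda>n. inverse (real (Suc n))" sequentially]
      have "(\<lambda>n. (h (x + inverse (real (Suc n)) *\<^sub>R ?e) - h x) / inverse (real (Suc n))) \<longlonglongrightarrow> ?d x"
        using LIMSEQ_inverse_real_of_nat by (auto simp: filterlim_at)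
      then show ?thesis by (simp add: q_def divide_inverse)
    qed
    then show "AE x in lborel. (\<lambda>n. q n x) \<longlonglongrightarrow> ?d x" by simp
    have "norm (q n x) \<le> M * indicator (cball 0 2) x" for n x
    proof (cases "norm x \<le> 2")
      case True
      have "norm (h (x + inverse (real (Suc n)) *\<^sub>R ?e) - h (x + 0 *\<^sub>R ?e)) \<le> M * norm (inverse (real (Suc n)) - 0)"
        by (rule field_differentiable_bound[where S = UNIV]) (use der M' in auto)
      then show ?thesis using True by (simp add: q_def abs_mult divide_simps)
    next
      case False
      have n1: "norm (inverse (real (Suc n)) *\<^sub>R ?e) \<le> 1" by (simp add: field_simps)
      have "norm x \<le> norm (x + inverse (real (Suc n)) *\<^sub>R ?e) + norm (inverse (real (Suc n)) *\<^sub>R ?e)"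
        by (metis add_diff_cancel_right' norm_triangle_ineq4)
      then have "1 \<le> norm (x + inverse (real (Suc n)) *\<^sub>R ?e)" using False n1 by linarith
      then show ?thesis using False z by (simp add: q_def)
    qed
    then show "AE x in lborel. norm (q n x) \<le> M * indicator (cball 0 2) x" for n by simp
  qed
  then show "(LINT x|lborel. ?d x) = 0" unfolding iq by (simp add: LIMSEQ_const_iff)
qed

lemma test_integrable:
  fixes f :: "real^2 \<Rightarrow> real"
  assumes c: "continuous_on UNIV f" and z: "\<And>x. 1 \<le> norm x \<Longrightarrow> f x = 0"
  shows "integrable lborel f"
proof -
  obtain B where B: "\<And>x. x \<in> cball 0 1 \<Longrightarrow> \<bar>f x\<bar> \<le> B"
  proof -
    have "bounded (f ` cball 0 1)"
      by (intro compact_imp_bounded compact_continuous_image continuous_on_subset[OF c]) auto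
    then obtain B where "\<forall>y\<in>f ` cball 0 1. norm y \<le> B" unfolding bounded_iff by blast
    then show ?thesis by (intro that[of B]) auto
  qed
  have ib: "integrable lborel (\<lambda>x::real^2. B * indicator (cball 0 1) x)"
    using emeasure_bounded_finite[OF bounded_cball[of "0::real^2" 1]]
    by (intro integrable_mult_right integrable_real_indicator) auto
  have "\<bar>f x\<bar> \<le> B * indicator (cball 0 1) x" for x
    using B[of x] z[of x] by (auto simp: indicator_def)
  then show ?thesis
    by (intro Bochner_Integration.integrable_bound[OF ib])
      (use borel_measurable_continuous_onI[OF c] in \<open>auto intro: order_trans[OF _ abs_ge_self]\<close>)
qed

lemma test_outside: "f \<in> test_functions \<Longrightarrow> 1 \<le> norm x \<Longrightarrow> f x = 0"
  using test_support by (metis less_eq_real_def order_trans)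

lemma test_integral_by_parts:
  assumes f: "f \<in> test_functions" and g: "g \<in> test_functions"
  shows "(LINT x|lborel. partial_deriv i f x * partial_deriv i g x)
    = - (LINT x|lborel. f x * partial_deriv i (partial_deriv i g) x)"
proof -
  let ?g = "partial_deriv i g"
  note t = test_has_derivative[OF f] test_has_derivative[OF test_partial[OF g]]
  let ?D = "\<lambda>x h. f x * frechet_derivative ?g (at x) h + frechet_derivative f (at x) h * ?g x"
  have e: "?D x (axis i 1) = f x * partial_deriv i ?g x + partial_deriv i f x * ?g x" for x
    by (simp add: partial_deriv_def)
  note c = test_continuous[OF f] test_continuous[OF test_partial[OF f]] test_continuous[OF test_partial[OF g]]
    test_continuous[OF test_partial[OF test_partial[OF g]]]
  have "(LINT x|lborel. ?D x (axis i 1)) = 0"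
    by (rule integral_derivative_zero(2)[where h = "\<lambda>x. f x * ?g x"])
      (auto simp: e test_outside[OF f] intro!: has_derivative_mult t continuous_intros c)
  moreover have "integrable lborel (\<lambda>x. f x * partial_deriv i ?g x)" "integrable lborel (\<lambda>x. partial_deriv i f x * ?g x)"
    by (rule test_integrable; auto intro!: continuous_intros c simp: test_outside[OF f] test_outside[OF test_partial[OF g]])+
  ultimately show ?thesis unfolding e by simp
qed

lemma borel_measurable_disc: "h \<in> borel_measurable borel \<Longrightarrow> h \<in> borel_measurable (lebesgue_on S)"
  by (intro measurable_restrict_space1 measurable_completion) simp

lemma nn_integral_disc:
  assumes "h \<in> borel_measurable borel"
  shows "(\<integral>\<^sup>+ x. h x \<partial>lebesgue_on unit_disc) = (\<integral>\<^sup>+ x. h x * indicator unit_disc x \<partial>lborel)"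
  using assms by (subst nn_integral_restrict_space) (auto simp: nn_integral_completion)

text \<open>Young's inequality \<open>2 a b \<le> d a\<^sup>2 + b\<^sup>2 / d\<close> under the
  integral. A small \<open>d\<close> keeps the constant in front of \<open>g\<close> near 1, so
  sharp constants survive a passage to the limit.\<close>

lemma nn_integral_L2_split:
  fixes f g :: "'a \<Rightarrow> 'b::euclidean_space"
  assumes [measurable]: "f \<in> borel_measurable M" "g \<in> borel_measurable M" and d: "0 < d"
  shows "(\<integral>\<^sup>+ x. ennreal ((norm (f x))\<^sup>2) \<partial>M) \<le>
    ennreal (1 + d) * (\<integral>\<^sup>+ x. ennreal ((norm (g x))\<^sup>2) \<partial>M) + ennreal (1 + 1/d) * (\<integral>\<^sup>+ x. ennreal ((norm (f x - g x))\<^sup>2) \<partial>M)"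
proof -
  have "(norm (f x))\<^sup>2 \<le> (1 + d) * (norm (g x))\<^sup>2 + (1 + 1/d) * (norm (f x - g x))\<^sup>2" for x
  proof -
    let ?a = "norm (g x)" and ?b = "norm (f x - g x)"
    have "norm (f x) \<le> ?a + ?b" using norm_triangle_ineq[of "g x" "f x - g x"] by simp
    then have "(norm (f x))\<^sup>2 \<le> (?a + ?b)\<^sup>2" by (rule power_mono) simp
    also have "\<dots> = ?a\<^sup>2 + 2 * ?a * ?b + ?b\<^sup>2" by (simp add: power2_sum)
    also have "2 * ?a * ?b \<le> d * ?a\<^sup>2 + ?b\<^sup>2 / d"
    proof -
      have "0 \<le> (d * ?a - ?b)\<^sup>2 / d" using d by simp
      also have "\<dots> = d * ?a\<^sup>2 + ?b\<^sup>2 / d - 2 * ?a * ?b"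
        using d by (simp add: power2_eq_square field_simps)
      finally show ?thesis by simp
    qed
    finally show ?thesis by (simp add: algebra_simps)
  qed
  then have "(\<integral>\<^sup>+ x. ennreal ((norm (f x))\<^sup>2) \<partial>M) \<le>
    (\<integral>\<^sup>+ x. ennreal (1 + d) * ennreal ((norm (g x))\<^sup>2) + ennreal (1 + 1/d) * ennreal ((norm (f x - g x))\<^sup>2) \<partial>M)"
    using d by (intro nn_integral_mono) (auto simp flip: ennreal_mult ennreal_plus intro!: ennreal_leI)
  also have "\<dots> = ennreal (1 + d) * (\<integral>\<^sup>+ x. ennreal ((norm (g x))\<^sup>2) \<partial>M) + ennreal (1 + 1/d) * (\<integral>\<^sup>+ x. ennreal ((norm (f x - g x))\<^sup>2) \<partial>M)"
    by (subst nn_integral_add) (auto simp: nn_integral_cmult)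
  finally show ?thesis .
qed

lemma nn_integral_test:
  fixes f :: "real^2 \<Rightarrow> real"
  assumes c: "continuous_on UNIV f" and z: "\<And>x. 1 \<le> norm x \<Longrightarrow> f x = 0" and p: "\<And>x. 0 \<le> f x"
  shows "(\<integral>\<^sup>+ x. ennreal (f x) \<partial>lebesgue_on unit_disc) = ennreal (LINT x|lborel. f x)"
proof -
  have "(\<integral>\<^sup>+ x. ennreal (f x) \<partial>lebesgue_on unit_disc) = (\<integral>\<^sup>+ x. ennreal (f x) * indicator unit_disc x \<partial>lborel)"
    using borel_measurable_continuous_onI[OF c] by (intro nn_integral_disc) auto
  also have "\<dots> = (\<integral>\<^sup>+ x. ennreal (f x) \<partial>lborel)"
    by (intro nn_integral_cong) (auto simp: indicator_def z)
  also have "\<dots> = ennreal (LINT x|lborel. f x)"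
    by (intro nn_integral_eq_integral test_integrable c z) (auto simp: p)
  finally show ?thesis .
qed

section \<open>Weak gradients\<close>

abbreviation L2sq :: "(real^2 \<Rightarrow> 'b::real_normed_vector) \<Rightarrow> ennreal" where
  "L2sq f \<equiv> \<integral>\<^sup>+ x. ennreal ((norm (f x))\<^sup>2) \<partial>lebesgue_on unit_disc"

lemma L2sq_split2:
  fixes f g h :: "real^2 \<Rightarrow> 'b::euclidean_space"
  assumes "f \<in> borel_measurable (lebesgue_on unit_disc)" "g \<in> borel_measurable (lebesgue_on unit_disc)"
    "h \<in> borel_measurable (lebesgue_on unit_disc)"
  shows "L2sq (\<lambda>x. f x - h x) \<le> 2 * L2sq (\<lambda>x. f x - g x) + 2 * L2sq (\<lambda>x. g x - h x)"
proof -
  have "L2sq (\<lambda>x. f x - h x) \<le> ennreal (1 + 1) * L2sq (\<lambda>x. f x - g x) + ennreal (1 + 1/1) * L2sq (\<lambda>x. (f x - h x) - (f x - g x))"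
    by (rule nn_integral_L2_split) (use assms in \<open>auto intro: borel_measurable_diff\<close>)
  then show ?thesis by simp
qed

lemma L2sq_commute: "L2sq (\<lambda>x. f x - g x) = L2sq (\<lambda>x. g x - f x)"
  by (simp add: norm_minus_commute)

lemma test_measurable:
  assumes "f \<in> test_functions"
  shows "f \<in> borel_measurable (lebesgue_on unit_disc)" "grad f \<in> borel_measurable (lebesgue_on unit_disc)"
  using assms test_continuous continuous_grad
  by (auto intro!: borel_measurable_disc borel_measurable_continuous_onI)

lemma grad_outside: "f \<in> test_functions \<Longrightarrow> 1 \<le> norm x \<Longrightarrow> grad f x = 0"
  using test_outside[OF test_partial] by (simp add: grad_def vec_eq_iff)

lemma L2sq_test:
  assumes "f \<in> test_functions"
  shows "L2sq f = ennreal (LINT x|lborel. (f x)\<^sup>2)"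
    "L2sq (grad f) = ennreal (LINT x|lborel. (norm (grad f x))\<^sup>2)"
    "integrable lborel (\<lambda>x. (f x)\<^sup>2)" "integrable lborel (\<lambda>x. (norm (grad f x))\<^sup>2)"
proof -
  note c = test_continuous[OF assms] continuous_grad[OF assms] and z = test_outside[OF assms] grad_outside[OF assms]
  show "L2sq f = ennreal (LINT x|lborel. (f x)\<^sup>2)"
    using nn_integral_test[of "\<lambda>x. (f x)\<^sup>2"] c z by (simp add: continuous_on_power)
  show "L2sq (grad f) = ennreal (LINT x|lborel. (norm (grad f x))\<^sup>2)"
    using nn_integral_test[of "\<lambda>x. (norm (grad f x))\<^sup>2"] c z by (simp add: continuous_on_power continuous_on_norm)
  show "integrable lborel (\<lambda>x. (f x)\<^sup>2)" "integrable lborel (\<lambda>x. (norm (grad f x))\<^sup>2)"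
    by (rule test_integrable; use c z in \<open>auto intro!: continuous_intros\<close>)+
qed

definition lapl :: "(real^2 \<Rightarrow> real) \<Rightarrow> real^2 \<Rightarrow> real" where
  "lapl f x = partial_deriv 1 (partial_deriv 1 f) x + partial_deriv 2 (partial_deriv 2 f) x"

lemma grad_inner_by_parts:
  assumes f: "f \<in> test_functions" and g: "g \<in> test_functions"
  shows "(LINT x|lborel. grad f x \<bullet> grad g x) = - (LINT x|lborel. f x * lapl g x)"
proof -
  note c = test_continuous[OF f] test_continuous[OF test_partial[OF f]] test_continuous[OF test_partial[OF g]]
    test_continuous[OF test_partial[OF test_partial[OF g]]]
  note z = test_outside[OF f] test_outside[OF test_partial[OF f]]
  have i: "integrable lborel (\<lambda>x. partial_deriv i f x * partial_deriv i g x)"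
    "integrable lborel (\<lambda>x. f x * partial_deriv i (partial_deriv i g) x)" for i
    by (rule test_integrable; use c z in \<open>auto intro!: continuous_intros\<close>)+
  have "(LINT x|lborel. grad f x \<bullet> grad g x)
    = (LINT x|lborel. partial_deriv 1 f x * partial_deriv 1 g x) + (LINT x|lborel. partial_deriv 2 f x * partial_deriv 2 g x)"
    using i(1) by (simp add: grad_def inner_vec_def sum_2)
  also have "\<dots> = - (LINT x|lborel. f x * lapl g x)"
    using i(2) by (simp add: test_integral_by_parts[OF f g] lapl_def distrib_left)
  finally show ?thesis .
qed

lemma ennreal_eq_0I:
  fixes x :: ennreal
  assumes "\<And>e. 0 < e \<Longrightarrow> x \<le> ennreal (C * e)" "0 \<le> C"
  shows "x = 0"
proof -
  have "x \<le> 0"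
  proof (rule ennreal_le_epsilon)
    fix e :: real assume e: "0 < e"
    have "x \<le> ennreal (C * (e / (C + 1)))" using assms e by (intro assms) auto
    also have "\<dots> \<le> ennreal e" using assms(2) e by (intro ennreal_leI) (simp add: field_simps)
    finally show "x \<le> 0 + ennreal e" by simp
  qed
  then show ?thesis by simp
qed

lemma L2_tendsto_ev:
  assumes "L2_tendsto f g" "0 < e"
  shows "\<exists>N. \<forall>n\<ge>N. L2sq (\<lambda>x. f n x - g x) \<le> ennreal e"
  using order_tendstoD(2)[OF assms(1)[unfolded L2_tendsto_def], of "ennreal e"] assms(2)
  unfolding eventually_sequentially by (meson ennreal_less_zero_iff less_imp_le)

text \<open>Closability of the gradient. For fixed \<open>m\<close> the inner product of
  \<open>grad (w n)\<close> and \<open>grad (w m)\<close> equals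
  \<open>- \<integral> w n * lapl (w m)\<close> and becomes small. The squared distance of the two
  gradients is the sum of their squared norms up to this cross term, so a small distance forces
  small norms.\<close>

lemma weak_gradient_of_zero:
  assumes w: "\<And>n. w n \<in> test_functions" and w0: "L2_tendsto w (\<lambda>_. 0)"
    and D: "L2_tendsto (\<lambda>n. grad (w n)) D" "D \<in> borel_measurable (lebesgue_on unit_disc)"
  shows "L2sq D = 0"
proof (rule ennreal_eq_0I[where C = 14])
  fix e :: real assume e: "0 < e"
  obtain m where m: "\<And>n. n \<ge> m \<Longrightarrow> L2sq (\<lambda>x. grad (w n) x - D x) \<le> ennreal e"
    using L2_tendsto_ev[OF D(1) e] by blast
  let ?L = "lapl (w m)"
  have cL: "continuous_on UNIV ?L"
    unfolding lapl_def[abs_def]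
    by (intro continuous_intros test_continuous[OF test_partial[OF test_partial[OF w]]])
  have zL: "?L x = 0" if "1 \<le> norm x" for x
    using that by (simp add: lapl_def test_outside[OF test_partial[OF test_partial[OF w]]])
  define S where "S = (LINT x|lborel. (?L x)\<^sup>2)"
  have S: "0 \<le> S" unfolding S_def by (rule integral_nonneg_AE) simp
  \<comment> \<open>The Laplacian of \<open>w m\<close> may be large; the weight \<open>K\<close> in
    Young's inequality, and then the index \<open>n\<close>, are chosen after it.\<close>
  define K where "K = S / e + 1"
  have K: "0 < K" "S / K \<le> e" using S e by (auto simp: K_def field_simps add_pos_nonneg add_nonneg_pos)
  obtain n0 where n0: "\<And>n. n \<ge> n0 \<Longrightarrow> L2sq (\<lambda>x. w n x - 0) \<le> ennreal (e / K)"
    using L2_tendsto_ev[OF w0, of "e / K"] e K(1) by auto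
  define n where "n = max m n0"
  have an: "(LINT x|lborel. (w n x)\<^sup>2) \<le> e / K"
    using n0[of n] L2sq_test(1)[OF w, of n] e K(1) by (simp add: n_def)
  have bnd: "\<bar>LINT x|lborel. w n x * ?L x\<bar> \<le> e"
  proof -
    have iw: "integrable lborel (\<lambda>x. (w n x)\<^sup>2)" by (rule L2sq_test(3)[OF w])
    have iL: "integrable lborel (\<lambda>x. (?L x)\<^sup>2)"
      by (rule test_integrable) (use cL zL in \<open>auto intro!: continuous_intros\<close>)
    have iwL: "integrable lborel (\<lambda>x. w n x * ?L x)"
      by (rule test_integrable) (use cL zL test_continuous[OF w] in \<open>auto intro!: continuous_intros\<close>)
    have "\<bar>LINT x|lborel. w n x * ?L x\<bar> \<le> (LINT x|lborel. norm (w n x * ?L x))"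
      unfolding real_norm_def[symmetric] by (rule integral_norm_bound)
    also have "\<dots> \<le> (LINT x|lborel. K / 2 * (w n x)\<^sup>2 + 1 / (2 * K) * (?L x)\<^sup>2)"
    proof (rule integral_mono)
      fix x
      have "0 \<le> (K * \<bar>w n x\<bar> - \<bar>?L x\<bar>)\<^sup>2 / (2 * K)" using K(1) by simp
      also have "\<dots> = K / 2 * (w n x)\<^sup>2 + 1 / (2 * K) * (?L x)\<^sup>2 - \<bar>w n x\<bar> * \<bar>?L x\<bar>"
        using K(1) by (simp add: power2_diff power_mult_distrib field_simps) (simp add: power2_eq_square)
      finally show "norm (w n x * ?L x) \<le> K / 2 * (w n x)\<^sup>2 + 1 / (2 * K) * (?L x)\<^sup>2" by (simp add: abs_mult)
    qed (use iw iL iwL in auto)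
    also have "\<dots> = K / 2 * (LINT x|lborel. (w n x)\<^sup>2) + S / K / 2"
      using iw iL by (simp add: S_def)
    also have "\<dots> \<le> K / 2 * (e / K) + e / 2" using an K by (intro add_mono mult_left_mono divide_right_mono) auto
    also have "\<dots> = e" using K by simp
    finally show ?thesis .
  qed
  define N where "N k = (LINT x|lborel. (norm (grad (w k) x))\<^sup>2)" for k
  have Nn: "0 \<le> N k" for k unfolding N_def by (rule integral_nonneg_AE) simp
  have ii: "integrable lborel (\<lambda>x. grad (w n) x \<bullet> grad (w m) x)"
    by (rule test_integrable) (auto intro!: continuous_intros continuous_grad w simp: grad_outside[OF w])
  have "ennreal (LINT x|lborel. (norm (grad (\<lambda>x. w n x - w m x) x))\<^sup>2) = L2sq (grad (\<lambda>x. w n x - w m x))"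
    by (rule L2sq_test(2)[symmetric]) (intro test_diff w)
  also have "\<dots> = L2sq (\<lambda>x. grad (w n) x - grad (w m) x)" by (simp add: grad_diff[OF w w])
  also have "\<dots> \<le> 2 * L2sq (\<lambda>x. grad (w n) x - D x) + 2 * L2sq (\<lambda>x. D x - grad (w m) x)"
    by (intro L2sq_split2 D test_measurable w)
  also have "\<dots> \<le> 2 * ennreal e + 2 * ennreal e"
    using m[of n] m[of m] by (intro add_mono mult_left_mono) (auto simp: n_def L2sq_commute[of D])
  also have "\<dots> = ennreal (4 * e)" using e by (simp flip: ennreal_plus ennreal_numeral ennreal_mult)
  finally have "(LINT x|lborel. (norm (grad (\<lambda>x. w n x - w m x) x))\<^sup>2) \<le> 4 * e" using e by simp
  moreover have "(LINT x|lborel. (norm (grad (\<lambda>x. w n x - w m x) x))\<^sup>2) = N n + N m - 2 * (LINT x|lborel. grad (w n) x \<bullet> grad (w m) x)"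
  proof -
    have "(norm (grad (\<lambda>x. w n x - w m x) x))\<^sup>2 = (norm (grad (w n) x))\<^sup>2 + (norm (grad (w m) x))\<^sup>2 - 2 * (grad (w n) x \<bullet> grad (w m) x)" for x
      unfolding grad_diff[OF w w] by (simp add: power2_norm_eq_inner inner_diff_left inner_diff_right inner_commute)
    then show ?thesis using ii L2sq_test(4)[OF w] by (simp add: N_def)
  qed
  moreover have "\<bar>LINT x|lborel. grad (w n) x \<bullet> grad (w m) x\<bar> \<le> e"
    using bnd by (simp add: grad_inner_by_parts[OF w w])
  \<comment> \<open>\<open>4 * e\<close> comes from the distance and \<open>2 * e\<close> from the
    cross term; the final 14 is \<open>2 + 2 * 6\<close>.\<close>
  ultimately have "N n \<le> 6 * e" using Nn[of m] by linarith
  then have Ne: "L2sq (grad (w n)) \<le> ennreal (6 * e)"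
    unfolding L2sq_test(2)[OF w] N_def by (rule ennreal_leI)
  have "L2sq D = L2sq (\<lambda>x. D x - 0)" by simp
  also have "\<dots> \<le> 2 * L2sq (\<lambda>x. D x - grad (w n) x) + 2 * L2sq (\<lambda>x. grad (w n) x - 0)"
    by (intro L2sq_split2 D test_measurable w) simp
  also have "\<dots> \<le> 2 * ennreal e + 2 * ennreal (6 * e)"
    using m[of n] Ne by (intro add_mono mult_left_mono) (auto simp: n_def L2sq_commute[of D])
  also have "\<dots> = ennreal (14 * e)" using e by (simp flip: ennreal_plus ennreal_numeral ennreal_mult)
  finally show "L2sq D \<le> ennreal (14 * e)" .
qed simp

text \<open>The difference of two approximating sequences tends to 0 in L2, so
  \<open>weak_gradient_of_zero\<close> applies to the difference of the gradients.\<close>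

lemma has_H01_gradient_unique:
  assumes "has_H01_gradient u G" "has_H01_gradient u G'"
  shows "AE x in lebesgue_on unit_disc. G x = G' x"
proof -
  obtain \<phi> where \<phi>: "\<And>n. \<phi> n \<in> test_functions" "L2_tendsto \<phi> u" "L2_tendsto (\<lambda>n. grad (\<phi> n)) G"
    using assms(1) unfolding has_H01_gradient_def by blast
  obtain \<psi> where \<psi>: "\<And>n. \<psi> n \<in> test_functions" "L2_tendsto \<psi> u" "L2_tendsto (\<lambda>n. grad (\<psi> n)) G'"
    using assms(2) unfolding has_H01_gradient_def by blast
  have m: "u \<in> borel_measurable (lebesgue_on unit_disc)" "G \<in> borel_measurable (lebesgue_on unit_disc)"
    "G' \<in> borel_measurable (lebesgue_on unit_disc)"
    using assms by (auto simp: has_H01_gradient_def)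
  have two: "(\<lambda>n. 2 * a n + 2 * b n) \<longlonglongrightarrow> 0" if "a \<longlonglongrightarrow> 0" "b \<longlonglongrightarrow> 0" for a b :: "nat \<Rightarrow> ennreal"
    using tendsto_add[OF ennreal_tendsto_cmult[OF _ that(1), of 2] ennreal_tendsto_cmult[OF _ that(2), of 2]] by simp
  have "L2sq (\<lambda>x. G x - G' x) = 0"
  proof (rule weak_gradient_of_zero[where w = "\<lambda>n x. \<phi> n x - \<psi> n x"])
    show "(\<lambda>x. \<phi> n x - \<psi> n x) \<in> test_functions" for n by (intro test_diff \<phi> \<psi>)
    show "L2_tendsto (\<lambda>n x. \<phi> n x - \<psi> n x) (\<lambda>_. 0)"
      unfolding L2_tendsto_def diff_0_right
    proof (rule tendsto_sandwich[OF _ _ tendsto_const])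
      show "\<forall>\<^sub>F n in sequentially. L2sq (\<lambda>x. \<phi> n x - \<psi> n x) \<le> 2 * L2sq (\<lambda>x. \<phi> n x - u x) + 2 * L2sq (\<lambda>x. \<psi> n x - u x)"
      proof (intro always_eventually allI)
        fix n
        have "L2sq (\<lambda>x. \<phi> n x - \<psi> n x) \<le> 2 * L2sq (\<lambda>x. \<phi> n x - u x) + 2 * L2sq (\<lambda>x. u x - \<psi> n x)"
          by (intro L2sq_split2 m test_measurable \<phi> \<psi>)
        then show "L2sq (\<lambda>x. \<phi> n x - \<psi> n x) \<le> 2 * L2sq (\<lambda>x. \<phi> n x - u x) + 2 * L2sq (\<lambda>x. \<psi> n x - u x)"
          by (simp only: L2sq_commute[of u])
      qed
      show "(\<lambda>n. 2 * L2sq (\<lambda>x. \<phi> n x - u x) + 2 * L2sq (\<lambda>x. \<psi> n x - u x)) \<longlonglongrightarrow> 0"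
        using \<phi>(2) \<psi>(2) unfolding L2_tendsto_def by (rule two)
    qed simp
    show "L2_tendsto (\<lambda>n. grad (\<lambda>x. \<phi> n x - \<psi> n x)) (\<lambda>x. G x - G' x)"
      unfolding L2_tendsto_def grad_diff[OF \<phi>(1) \<psi>(1)]
    proof (rule tendsto_sandwich[OF _ _ tendsto_const])
      show "\<forall>\<^sub>F n in sequentially. L2sq (\<lambda>x. grad (\<phi> n) x - grad (\<psi> n) x - (G x - G' x))
          \<le> 2 * L2sq (\<lambda>x. grad (\<phi> n) x - G x) + 2 * L2sq (\<lambda>x. grad (\<psi> n) x - G' x)"
      proof (intro always_eventually allI)
        fix n
        have "L2sq (\<lambda>x. (grad (\<phi> n) x - G x) - (grad (\<psi> n) x - G' x))
          \<le> 2 * L2sq (\<lambda>x. (grad (\<phi> n) x - G x) - 0) + 2 * L2sq (\<lambda>x. 0 - (grad (\<psi> n) x - G' x))"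
          by (intro L2sq_split2 borel_measurable_diff m test_measurable \<phi> \<psi>) simp
        then show "L2sq (\<lambda>x. grad (\<phi> n) x - grad (\<psi> n) x - (G x - G' x))
          \<le> 2 * L2sq (\<lambda>x. grad (\<phi> n) x - G x) + 2 * L2sq (\<lambda>x. grad (\<psi> n) x - G' x)"
          by (simp add: algebra_simps norm_minus_commute)
      qed
      show "(\<lambda>n. 2 * L2sq (\<lambda>x. grad (\<phi> n) x - G x) + 2 * L2sq (\<lambda>x. grad (\<psi> n) x - G' x)) \<longlonglongrightarrow> 0"
        using \<phi>(3) \<psi>(3) unfolding L2_tendsto_def by (rule two)
    qed simp
    show "(\<lambda>x. G x - G' x) \<in> borel_measurable (lebesgue_on unit_disc)" by (intro borel_measurable_diff m)
  qed
  then have "AE x in lebesgue_on unit_disc. ennreal ((norm (G x - G' x))\<^sup>2) = 0"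
    using m by (subst (asm) nn_integral_0_iff_AE) auto
  then show ?thesis by eventually_elim (simp add: ennreal_eq_0_iff)
qed

text \<open>\<open>weak_grad\<close> is chosen by \<open>SOME\<close>; uniqueness makes its energy
  computable from any known gradient.\<close>

lemma weak_grad_energy:
  assumes "has_H01_gradient u G"
  shows "L2sq (weak_grad u) = L2sq G"
proof -
  have "has_H01_gradient u (weak_grad u)"
    unfolding weak_grad_def by (rule someI[of "has_H01_gradient u", OF assms])
  from has_H01_gradient_unique[OF this assms] show ?thesis
    by (intro nn_integral_cong_AE) (auto elim: eventually_mono)
qed

lemma has_H01_gradientI:
  assumes m: "u \<in> borel_measurable (lebesgue_on unit_disc)" "G \<in> borel_measurable (lebesgue_on unit_disc)"
    and a: "\<And>e. 0 < e \<Longrightarrow> \<exists>\<phi>\<in>test_functions. L2sq (\<lambda>x. \<phi> x - u x) \<le> ennreal e \<and> L2sq (\<lambda>x. grad \<phi> x - G x) \<le> ennreal e"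
  shows "has_H01_gradient u G"
proof -
  have "\<forall>n. \<exists>\<phi>\<in>test_functions. L2sq (\<lambda>x. \<phi> x - u x) \<le> ennreal (inverse (real (Suc n))) \<and> L2sq (\<lambda>x. grad \<phi> x - G x) \<le> ennreal (inverse (real (Suc n)))"
    by (intro allI a) simp
  then have "\<exists>\<phi>. \<forall>n. \<phi> n \<in> test_functions \<and> L2sq (\<lambda>x. \<phi> n x - u x) \<le> ennreal (inverse (real (Suc n))) \<and> L2sq (\<lambda>x. grad (\<phi> n) x - G x) \<le> ennreal (inverse (real (Suc n)))"
    unfolding Bex_def by (rule choice)
  then obtain \<phi> where \<phi>: "\<And>n. \<phi> n \<in> test_functions" "\<And>n. L2sq (\<lambda>x. \<phi> n x - u x) \<le> ennreal (inverse (real (Suc n)))"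
     "\<And>n. L2sq (\<lambda>x. grad (\<phi> n) x - G x) \<le> ennreal (inverse (real (Suc n)))"
    by blast
  have lim: "(\<lambda>n. ennreal (inverse (real (Suc n)))) \<longlonglongrightarrow> 0"
    using tendsto_ennrealI[OF LIMSEQ_inverse_real_of_nat] by simp
  have "L2_tendsto \<phi> u" "L2_tendsto (\<lambda>n. grad (\<phi> n)) G"
    unfolding L2_tendsto_def
    by (rule tendsto_sandwich[OF _ _ tendsto_const lim]; use \<phi> in auto)+
  then show ?thesis using m \<phi>(1) unfolding has_H01_gradient_def by blast
qed

lemma has_H01_gradient_closed:
  assumes m: "u \<in> borel_measurable (lebesgue_on unit_disc)" "G \<in> borel_measurable (lebesgue_on unit_disc)"
    and h: "\<And>n. has_H01_gradient (v n) (H n)" and v: "L2_tendsto v u" "L2_tendsto H G"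
  shows "has_H01_gradient u G"
proof (rule has_H01_gradientI[OF m])
  fix e :: real assume e: "0 < e"
  obtain N where N: "\<And>n. n \<ge> N \<Longrightarrow> L2sq (\<lambda>x. v n x - u x) \<le> ennreal (e/4)"
    using L2_tendsto_ev[OF v(1), of "e/4"] e by auto
  obtain N' where N': "\<And>n. n \<ge> N' \<Longrightarrow> L2sq (\<lambda>x. H n x - G x) \<le> ennreal (e/4)"
    using L2_tendsto_ev[OF v(2), of "e/4"] e by auto
  define n where "n = max N N'"
  obtain \<phi> where \<phi>: "\<And>n. \<phi> n \<in> test_functions" "L2_tendsto \<phi> (v n)" "L2_tendsto (\<lambda>n. grad (\<phi> n)) (H n)"
    and mv: "v n \<in> borel_measurable (lebesgue_on unit_disc)" "H n \<in> borel_measurable (lebesgue_on unit_disc)"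
    using h[of n] unfolding has_H01_gradient_def by blast
  obtain M where M: "\<And>k. k \<ge> M \<Longrightarrow> L2sq (\<lambda>x. \<phi> k x - v n x) \<le> ennreal (e/4)"
    using L2_tendsto_ev[OF \<phi>(2), of "e/4"] e by auto
  obtain M' where M': "\<And>k. k \<ge> M' \<Longrightarrow> L2sq (\<lambda>x. grad (\<phi> k) x - H n x) \<le> ennreal (e/4)"
    using L2_tendsto_ev[OF \<phi>(3), of "e/4"] e by auto
  define k where "k = max M M'"
  have e2: "2 * ennreal (e/4) + 2 * ennreal (e/4) = ennreal e"
    using e by (simp flip: ennreal_plus ennreal_numeral ennreal_mult)
  have "L2sq (\<lambda>x. \<phi> k x - u x) \<le> 2 * L2sq (\<lambda>x. \<phi> k x - v n x) + 2 * L2sq (\<lambda>x. v n x - u x)"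
    by (intro L2sq_split2 m mv test_measurable \<phi>)
  also have "\<dots> \<le> 2 * ennreal (e/4) + 2 * ennreal (e/4)"
    using M[of k] N[of n] by (intro add_mono mult_left_mono) (auto simp: n_def k_def)
  finally have 1: "L2sq (\<lambda>x. \<phi> k x - u x) \<le> ennreal e" unfolding e2 .
  have "L2sq (\<lambda>x. grad (\<phi> k) x - G x) \<le> 2 * L2sq (\<lambda>x. grad (\<phi> k) x - H n x) + 2 * L2sq (\<lambda>x. H n x - G x)"
    by (intro L2sq_split2 m mv test_measurable \<phi>)
  also have "\<dots> \<le> 2 * ennreal (e/4) + 2 * ennreal (e/4)"
    using M'[of k] N'[of n] by (intro add_mono mult_left_mono) (auto simp: n_def k_def)
  finally have "L2sq (\<lambda>x. grad (\<phi> k) x - G x) \<le> ennreal e" unfolding e2 .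
  with 1 \<phi>(1) show "\<exists>\<phi>\<in>test_functions. L2sq (\<lambda>x. \<phi> x - u x) \<le> ennreal e \<and> L2sq (\<lambda>x. grad \<phi> x - G x) \<le> ennreal e"
    by blast
qed

section \<open>Functions of the form \<open>F r * (c + d * cos \<theta>)\<close>\<close>

lemma test_add:
  assumes "f \<in> test_functions" "g \<in> test_functions"
  shows "(\<lambda>x. f x + g x) \<in> test_functions"
  using test_diff[OF assms(1) test_diff[OF test_diff[OF assms(2,2)] assms(2)]] by simp

lemma radial_has_derivative:
  fixes H0 H1 :: "real \<Rightarrow> real" and x :: "real^2"
  assumes "(H0 has_real_derivative H0') (at (x \<bullet> x))" "(H1 has_real_derivative H1') (at (x \<bullet> x))"
  shows "((\<lambda>x. H0 (x \<bullet> x) + x $ 1 * H1 (x \<bullet> x)) has_derivative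
    (\<lambda>h. H0' * (2 * (x \<bullet> h)) + (x $ 1 * (H1' * (2 * (x \<bullet> h))) + h $ 1 * H1 (x \<bullet> x)))) (at x)"
proof -
  have i: "((\<lambda>x. x \<bullet> x) has_derivative (\<lambda>h. 2 * (x \<bullet> h))) (at x)"
    by (auto intro!: derivative_eq_intros simp: inner_commute)
  have c: "((\<lambda>x. H (x \<bullet> x)) has_derivative (\<lambda>h. H' * (2 * (x \<bullet> h)))) (at x)"
    if "(H has_real_derivative H') (at (x \<bullet> x))" for H H'
    using has_derivative_compose[OF i that[unfolded has_field_derivative_def]] .
  show ?thesis
    by (intro has_derivative_add has_derivative_mult c assms has_derivative_vec_nth_ident)
qed

text \<open>Profiles are functions of \<open>x \<bullet> x\<close>, not of the norm, and the first
  angular mode is \<open>x $ 1\<close> times such a profile; in this form the approximants from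
  \<open>radial_test_approx\<close> are smooth at the origin as well.\<close>

lemma C1_radial_H01:
  fixes G0 G0' G1 G1' :: "real \<Rightarrow> real"
  assumes G0: "\<And>s. (G0 has_real_derivative G0' s) (at s)" "continuous_on UNIV G0'"
    and G1: "\<And>s. (G1 has_real_derivative G1' s) (at s)" "continuous_on UNIV G1'"
    and c': "c' < 1" "\<And>s. c' \<le> s \<Longrightarrow> G0 s = 0" "\<And>s. c' \<le> s \<Longrightarrow> G1 s = 0"
  shows "has_H01_gradient (\<lambda>x. G0 (x \<bullet> x) + x $ 1 * G1 (x \<bullet> x))
    (\<lambda>x. (2 * (G0' (x \<bullet> x) + x $ 1 * G1' (x \<bullet> x))) *\<^sub>R x + G1 (x \<bullet> x) *\<^sub>R axis 1 1)"
    (is "has_H01_gradient ?u ?G")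
proof (rule has_H01_gradientI)
  have cont: "continuous_on UNIV G0" "continuous_on UNIV G1"
    using G0(1) G1(1) by (meson DERIV_continuous_on DERIV_subset top_greatest)+
  have cc: "continuous_on UNIV (\<lambda>x::real^2. f (x \<bullet> x))" if "continuous_on UNIV f" for f :: "real \<Rightarrow> real"
    by (rule continuous_on_compose2[OF that]) (auto intro!: continuous_intros)
  have "continuous_on UNIV ?u" "continuous_on UNIV ?G"
    by (intro continuous_intros cc cont G0 G1)+
  then show m: "?u \<in> borel_measurable (lebesgue_on unit_disc)" "?G \<in> borel_measurable (lebesgue_on unit_disc)"
    by (auto intro!: borel_measurable_disc borel_measurable_continuous_onI)
  fix e :: real assume e: "0 < e"
  define A where "A = enn2real (emeasure (lebesgue_on unit_disc) (unit_disc :: (real^2) set))"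
  have A: "0 \<le> A" "emeasure (lebesgue_on unit_disc) (unit_disc :: (real^2) set) = ennreal A"
    using emeasure_bounded_finite[OF bounded_ball[of "0::real^2" 1]]
    by (auto simp: A_def emeasure_restrict_space)
  \<comment> \<open>Both pointwise errors are at most \<open>5 * d\<close>, the gradient
    contributing \<open>2 * (d + d) + d\<close>; squared and integrated over the disc of measure
    \<open>A\<close> this is at most \<open>e\<close>.\<close>
  define d where "d = sqrt (e / (25 * (A + 1)))"
  have d: "0 < d" "(5 * d)\<^sup>2 * A \<le> e"
  proof -
    show "0 < d" using e A by (auto simp: d_def)
    have "(5 * d)\<^sup>2 * A = e * (A / (A + 1))" using e A by (simp add: d_def power_mult_distrib field_simps)
    also have "\<dots> \<le> e * 1" using e A by (intro mult_left_mono) auto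
    finally show "(5 * d)\<^sup>2 * A \<le> e" by simp
  qed
  obtain H0 H0' where H0: "\<And>s. (H0 has_real_derivative H0' s) (at s)"
      "\<And>s. s \<in> {0..1} \<Longrightarrow> \<bar>H0 s - G0 s\<bar> \<le> d \<and> \<bar>H0' s - G0' s\<bar> \<le> d" "(\<lambda>x. H0 (x \<bullet> x)) \<in> test_functions"
    using radial_test_approx[OF G0 c'(1,2) d(1)] by blast
  obtain H1 H1' where H1: "\<And>s. (H1 has_real_derivative H1' s) (at s)"
      "\<And>s. s \<in> {0..1} \<Longrightarrow> \<bar>H1 s - G1 s\<bar> \<le> d \<and> \<bar>H1' s - G1' s\<bar> \<le> d" "(\<lambda>x. x $ 1 * H1 (x \<bullet> x)) \<in> test_functions"
    using radial_test_approx[OF G1 c'(1,3) d(1)] by blast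
  let ?\<phi> = "\<lambda>x::real^2. H0 (x \<bullet> x) + x $ 1 * H1 (x \<bullet> x)"
  have \<phi>: "?\<phi> \<in> test_functions" by (rule test_add[OF H0(3) H1(3)])
  have g: "grad ?\<phi> x = (2 * (H0' (x \<bullet> x) + x $ 1 * H1' (x \<bullet> x))) *\<^sub>R x + H1 (x \<bullet> x) *\<^sub>R axis 1 1" for x
    unfolding grad_eq[OF radial_has_derivative[OF H0(1) H1(1)]]
    by (simp add: vec_eq_iff forall_2 inner_axis) (simp add: axis_def algebra_simps)
  have b: "norm (?\<phi> x - ?u x) \<le> 5 * d" "norm (grad ?\<phi> x - ?G x) \<le> 5 * d" if x: "x \<in> unit_disc" for x
  proof -
    have "(norm x)\<^sup>2 \<le> 1\<^sup>2" using x by (intro power_mono) auto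
    then have s: "x \<bullet> x \<in> {0..1}" by (simp add: power2_norm_eq_inner)
    have x1: "\<bar>x $ 1\<bar> \<le> 1" using component_le_norm_cart[of x 1] x by simp
    have m1: "\<bar>x $ 1 * y\<bar> \<le> d" if "\<bar>y\<bar> \<le> d" for y
      using mult_mono[OF x1 that] by (simp add: abs_mult)
    have "\<bar>?\<phi> x - ?u x\<bar> = \<bar>(H0 (x \<bullet> x) - G0 (x \<bullet> x)) + x $ 1 * (H1 (x \<bullet> x) - G1 (x \<bullet> x))\<bar>"
      by (simp add: algebra_simps)
    also have "\<dots> \<le> d + d"
      using H0(2)[OF s] m1 H1(2)[OF s] by (intro order_trans[OF abs_triangle_ineq] add_mono) auto
    finally show "norm (?\<phi> x - ?u x) \<le> 5 * d" using d(1) by simp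
    have eq: "grad ?\<phi> x - ?G x = (2 * ((H0' (x \<bullet> x) - G0' (x \<bullet> x)) + x $ 1 * (H1' (x \<bullet> x) - G1' (x \<bullet> x)))) *\<^sub>R x
        + (H1 (x \<bullet> x) - G1 (x \<bullet> x)) *\<^sub>R axis 1 1"
      unfolding g by (simp add: algebra_simps)
    have "norm (grad ?\<phi> x - ?G x) \<le> norm ((2 * ((H0' (x \<bullet> x) - G0' (x \<bullet> x)) + x $ 1 * (H1' (x \<bullet> x) - G1' (x \<bullet> x)))) *\<^sub>R x)
        + norm ((H1 (x \<bullet> x) - G1 (x \<bullet> x)) *\<^sub>R axis 1 (1::real) :: real^2)"
      unfolding eq by (rule norm_triangle_ineq)
    also have "\<dots> \<le> (2 * (d + d)) * 1 + d"
    proof (rule add_mono)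
      have "\<bar>(H0' (x \<bullet> x) - G0' (x \<bullet> x)) + x $ 1 * (H1' (x \<bullet> x) - G1' (x \<bullet> x))\<bar> \<le> d + d"
        using H0(2)[OF s] m1 H1(2)[OF s] by (intro order_trans[OF abs_triangle_ineq] add_mono) auto
      then have "\<bar>2 * ((H0' (x \<bullet> x) - G0' (x \<bullet> x)) + x $ 1 * (H1' (x \<bullet> x) - G1' (x \<bullet> x)))\<bar> \<le> 2 * (d + d)"
        by (simp add: abs_mult)
      then show "norm ((2 * ((H0' (x \<bullet> x) - G0' (x \<bullet> x)) + x $ 1 * (H1' (x \<bullet> x) - G1' (x \<bullet> x)))) *\<^sub>R x) \<le> (2 * (d + d)) * 1"
        unfolding norm_scaleR using x d(1) by (intro mult_mono) auto
      show "norm ((H1 (x \<bullet> x) - G1 (x \<bullet> x)) *\<^sub>R axis 1 (1::real) :: real^2) \<le> d"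
        using H1(2)[OF s] by simp
    qed
    finally show "norm (grad ?\<phi> x - ?G x) \<le> 5 * d" by simp
  qed
  have small: "L2sq f \<le> ennreal e" if "\<And>x. x \<in> unit_disc \<Longrightarrow> norm (f x) \<le> 5 * d" for f :: "real^2 \<Rightarrow> 'b::real_normed_vector"
  proof -
    have "L2sq f \<le> (\<integral>\<^sup>+ x. ennreal ((5 * d)\<^sup>2) \<partial>lebesgue_on unit_disc)"
      using that by (intro nn_integral_mono ennreal_leI power_mono) auto
    also have "\<dots> = ennreal ((5 * d)\<^sup>2) * ennreal A" by (simp add: A)
    also have "\<dots> = ennreal ((5 * d)\<^sup>2 * A)" using A by (simp add: ennreal_mult)
    also have "\<dots> \<le> ennreal e" using d(2) by (rule ennreal_leI)
    finally show ?thesis .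
  qed
  show "\<exists>\<phi>\<in>test_functions. L2sq (\<lambda>x. \<phi> x - ?u x) \<le> ennreal e \<and> L2sq (\<lambda>x. grad \<phi> x - ?G x) \<le> ennreal e"
    by (rule bexI[OF _ \<phi>], rule conjI[OF small[OF b(1)] small[OF b(2)]])
qed

text \<open>A \<open>C\<^sup>1\<close> truncation: composing with it makes the support of a nonnegative function compact.\<close>

definition soft :: "real \<Rightarrow> real \<Rightarrow> real" where
  "soft e y = (if y \<le> e then 0 else (y - e)\<^sup>2 / y)"
definition soft' :: "real \<Rightarrow> real \<Rightarrow> real" where
  "soft' e y = (if y \<le> e then 0 else 1 - e\<^sup>2 / y\<^sup>2)"

lemma soft_bounds: "0 < e \<Longrightarrow> 0 \<le> y \<Longrightarrow> 0 \<le> soft e y \<and> soft e y \<le> y"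
proof -
  assume e: "0 < e" and y: "0 \<le> y"
  have "(y - e)\<^sup>2 / y \<le> y" if "e < y"
  proof -
    have "(y - e)\<^sup>2 \<le> y\<^sup>2" using that e by (intro power_mono) auto
    then show ?thesis using that e by (simp add: pos_divide_le_eq power2_eq_square)
  qed
  then show ?thesis using e y by (auto simp: soft_def)
qed

lemma soft'_bounds: "0 < e \<Longrightarrow> 0 \<le> soft' e y \<and> soft' e y \<le> 1"
proof -
  assume e: "0 < e"
  have "e\<^sup>2 / y\<^sup>2 \<le> 1" if "e < y"
  proof -
    have "e\<^sup>2 \<le> y\<^sup>2" using that e by (intro power_mono) auto
    then show ?thesis using that e by (simp add: divide_le_eq)
  qed
  then show ?thesis by (auto simp: soft'_def)
qed

lemma DERIV_soft:
  assumes e: "0 < e"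
  shows "(soft e has_real_derivative soft' e y) (at y)"
proof (cases y e rule: linorder_cases)
  case less
  have "(soft e has_real_derivative 0) (at y)"
    by (rule has_field_derivative_transform_within_open[where S = "{..<e}" and f = "\<lambda>_. 0"])
      (use less in \<open>auto simp: soft_def\<close>)
  then show ?thesis using less by (simp add: soft'_def)
next
  case greater
  have "((\<lambda>y. (y - e)\<^sup>2 / y) has_real_derivative ((2 * (y - e)) * y - (y - e)\<^sup>2 * 1) / (y * y)) (at y)"
    by (rule DERIV_divide) (use greater e in \<open>auto intro!: derivative_eq_intros\<close>)
  then have "(soft e has_real_derivative ((2 * (y - e)) * y - (y - e)\<^sup>2 * 1) / (y * y)) (at y)"
    by (rule has_field_derivative_transform_within_open[where S = "{e<..}"])
      (use greater in \<open>auto simp: soft_def\<close>)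
  moreover have "((2 * (y - e)) * y - (y - e)\<^sup>2 * 1) / (y * y) = soft' e y"
    using greater e by (simp add: soft'_def power2_eq_square field_simps)
  ultimately show ?thesis by simp
next
  case equal
  have "((\<lambda>h. (soft e (e + h) - soft e e) / h) \<longlongrightarrow> 0) (at 0)"
  proof (rule Lim_null_comparison)
    show "\<forall>\<^sub>F h in at 0. norm ((soft e (e + h) - soft e e) / h) \<le> \<bar>h\<bar> / e"
    proof (intro always_eventually allI)
      fix h :: real
      show "norm ((soft e (e + h) - soft e e) / h) \<le> \<bar>h\<bar> / e"
      proof (cases "h \<le> 0")
        case False
        then have h: "0 < h" by simp
        have "h / (e + h) \<le> h / e" using h e by (intro divide_left_mono) auto
        moreover have "(soft e (e + h) - soft e e) / h = h / (e + h)"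
          using h e by (simp add: soft_def power2_eq_square)
        ultimately show ?thesis using h e by simp
      qed (use e in \<open>auto simp: soft_def divide_nonpos_pos\<close>)
    qed
    show "((\<lambda>h. \<bar>h\<bar> / e) \<longlongrightarrow> 0) (at 0)"
    proof -
      have "((\<lambda>h. \<bar>h\<bar> / e) \<longlongrightarrow> \<bar>0\<bar> / e) (at 0)" using e by (intro tendsto_intros) auto
      then show ?thesis by simp
    qed
  qed
  then show ?thesis unfolding equal DERIV_def by (simp add: soft'_def)
qed

lemma continuous_on_soft': "0 < e \<Longrightarrow> continuous_on UNIV (soft' e)"
proof -
  assume e: "0 < e"
  \<comment> \<open>With \<open>max y e\<close> one formula covers both branches and its denominator
    never vanishes.\<close>
  have "soft' e = (\<lambda>y. 1 - e\<^sup>2 / (max y e)\<^sup>2)" using e by (auto simp: soft'_def fun_eq_iff max_def)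
  then show ?thesis using e by (auto intro!: continuous_intros)
qed

lemma soft_limits:
  assumes "0 < y"
  shows "(\<lambda>n. soft (inverse (real (Suc n))) y) \<longlonglongrightarrow> y" "(\<lambda>n. soft' (inverse (real (Suc n))) y) \<longlonglongrightarrow> 1"
proof -
  have l: "(\<lambda>n. inverse (real (Suc n))) \<longlonglongrightarrow> 0" by (rule LIMSEQ_inverse_real_of_nat)
  then have ev: "\<forall>\<^sub>F n in sequentially. inverse (real (Suc n)) < y" using assms order_tendstoD(2) by blast
  have "(\<lambda>n. (y - inverse (real (Suc n)))\<^sup>2 / y) \<longlonglongrightarrow> (y - 0)\<^sup>2 / y"
    by (intro tendsto_intros l) (use assms in auto)
  then have "(\<lambda>n. (y - inverse (real (Suc n)))\<^sup>2 / y) \<longlonglongrightarrow> y" using assms by (simp add: power2_eq_square)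
  then show "(\<lambda>n. soft (inverse (real (Suc n))) y) \<longlonglongrightarrow> y"
    by (rule Lim_transform_eventually) (use ev in \<open>auto elim!: eventually_mono simp: soft_def\<close>)
  have "(\<lambda>n. 1 - (inverse (real (Suc n)))\<^sup>2 / y\<^sup>2) \<longlonglongrightarrow> 1 - 0\<^sup>2 / y\<^sup>2"
    by (intro tendsto_intros l) (use assms in auto)
  then have "(\<lambda>n. 1 - (inverse (real (Suc n)))\<^sup>2 / y\<^sup>2) \<longlonglongrightarrow> 1" by simp
  then show "(\<lambda>n. soft' (inverse (real (Suc n))) y) \<longlonglongrightarrow> 1"
    by (rule Lim_transform_eventually) (use ev in \<open>auto elim!: eventually_mono simp: soft'_def\<close>)
qed

lemma trig_nn_integral:
  fixes A B c d :: real
  assumes "0 \<le> A" "0 \<le> B"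
  shows "(\<integral>\<^sup>+ \<theta>. ennreal (A * (c + d * cos \<theta>)\<^sup>2 + B * (sin \<theta>)\<^sup>2) * indicator {0<..<2*pi} \<theta> \<partial>lborel)
    = ennreal (A * (2 * pi * c\<^sup>2 + pi * d\<^sup>2) + pi * B)"
proof (rule nn_integral_has_integral_lebesgue')
  let ?F = "\<lambda>\<theta>. A * (c\<^sup>2 * \<theta> + 2 * c * d * sin \<theta> + d\<^sup>2 * (\<theta> / 2 + sin \<theta> * cos \<theta> / 2)) + B * (\<theta> / 2 - sin \<theta> * cos \<theta> / 2)"
  have "((\<lambda>\<theta>. A * (c + d * cos \<theta>)\<^sup>2 + B * (sin \<theta>)\<^sup>2) has_integral (?F (2*pi) - ?F 0)) {0..2*pi}"
  proof (rule fundamental_theorem_of_calculus)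
    fix x :: real
    have "(?F has_real_derivative A * (c\<^sup>2 + 2 * c * d * cos x + d\<^sup>2 * (1 / 2 + (cos x * cos x - sin x * sin x) / 2)) + B * (1 / 2 - (cos x * cos x - sin x * sin x) / 2)) (at x)"
      by (auto intro!: derivative_eq_intros simp: field_simps)
    moreover have "A * (c\<^sup>2 + 2 * c * d * cos x + d\<^sup>2 * (1 / 2 + (cos x * cos x - sin x * sin x) / 2)) + B * (1 / 2 - (cos x * cos x - sin x * sin x) / 2)
      = A * (c + d * cos x)\<^sup>2 + B * (sin x)\<^sup>2"
    proof -
      have s: "sin x * sin x = 1 - cos x * cos x"
        using sin_squared_eq[of x] by (simp add: power2_eq_square)
      show ?thesis by (simp add: s power2_eq_square field_simps)
    qed
    ultimately show "(?F has_vector_derivative A * (c + d * cos x)\<^sup>2 + B * (sin x)\<^sup>2) (at x within {0..2*pi})"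
      by (simp add: has_real_derivative_iff_has_vector_derivative has_vector_derivative_at_within)
  qed simp
  then show "((\<lambda>\<theta>. A * (c + d * cos \<theta>)\<^sup>2 + B * (sin \<theta>)\<^sup>2) has_integral A * (2 * pi * c\<^sup>2 + pi * d\<^sup>2) + pi * B) {0<..<2*pi}"
    by (simp add: has_integral_Icc_iff_Ioo algebra_simps)
qed (use assms in auto)

text \<open>\<open>x $ 1 / norm x\<close> is the cosine of the angle and
  \<open>1 - (x $ 1 / norm x)\<^sup>2\<close> the square of its sine, so the angular integral is
  explicit and a one-dimensional integral remains.\<close>

lemma polar_profile:
  fixes A B :: "real \<Rightarrow> real"
  assumes [measurable]: "A \<in> borel_measurable borel" "B \<in> borel_measurable borel"
    and p: "\<And>r. 0 \<le> A r" "\<And>r. 0 \<le> B r"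
  shows "(\<integral>\<^sup>+ x. ennreal (A (norm x) * (c + d * (x $ 1 / norm x))\<^sup>2 + B (norm x) * (1 - (x $ 1 / norm x)\<^sup>2)) \<partial>lebesgue_on unit_disc)
    = (\<integral>\<^sup>+ r. ennreal (r * (A r * (2 * pi * c\<^sup>2 + pi * d\<^sup>2) + pi * B r)) * indicator {0<..<1} r \<partial>lborel)"
proof -
  let ?h = "\<lambda>x::real^2. ennreal (A (norm x) * (c + d * (x $ 1 / norm x))\<^sup>2 + B (norm x) * (1 - (x $ 1 / norm x)\<^sup>2))"
  have [measurable]: "(\<lambda>x::real^2. x $ 1) \<in> borel_measurable borel"
    by (intro borel_measurable_continuous_onI continuous_intros)
  have m: "?h \<in> borel_measurable borel" by measurable
  have "(\<integral>\<^sup>+ x. ?h x \<partial>lebesgue_on unit_disc)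
     = (\<integral>\<^sup>+ r. (\<integral>\<^sup>+ \<theta>. ennreal r * ?h (pol r \<theta>) * indicator {0<..<2*pi} \<theta> \<partial>lborel) * indicator {0<..<1} r \<partial>lborel)"
    unfolding nn_integral_disc[OF m] nn_integral_polar[OF m] ..
  also have "\<dots> = (\<integral>\<^sup>+ r. ennreal (r * (A r * (2 * pi * c\<^sup>2 + pi * d\<^sup>2) + pi * B r)) * indicator {0<..<1} r \<partial>lborel)"
  proof (intro nn_integral_cong)
    fix r :: real
    show "(\<integral>\<^sup>+ \<theta>. ennreal r * ?h (pol r \<theta>) * indicator {0<..<2*pi} \<theta> \<partial>lborel) * indicator {0<..<1} r
       = ennreal (r * (A r * (2 * pi * c\<^sup>2 + pi * d\<^sup>2) + pi * B r)) * indicator {0<..<1} r"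
    proof (cases "0 < r")
      case True
      have s: "1 - (cos \<theta>)\<^sup>2 = (sin \<theta>)\<^sup>2" for \<theta> :: real by (simp add: sin_squared_eq)
      have "(\<integral>\<^sup>+ \<theta>. ennreal r * ?h (pol r \<theta>) * indicator {0<..<2*pi} \<theta> \<partial>lborel)
         = (\<integral>\<^sup>+ \<theta>. ennreal r * (ennreal (A r * (c + d * cos \<theta>)\<^sup>2 + B r * (sin \<theta>)\<^sup>2) * indicator {0<..<2*pi} \<theta>) \<partial>lborel)"
        using True by (intro nn_integral_cong) (simp add: s mult.assoc)
      also have "\<dots> = ennreal r * ennreal (A r * (2 * pi * c\<^sup>2 + pi * d\<^sup>2) + pi * B r)"
        by (subst nn_integral_cmult) (simp_all add: trig_nn_integral[OF p])
      also have "\<dots> = ennreal (r * (A r * (2 * pi * c\<^sup>2 + pi * d\<^sup>2) + pi * B r))"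
        using True p by (simp add: ennreal_mult)
      finally show ?thesis by simp
    qed (simp add: indicator_def)
  qed
  finally show ?thesis .
qed

text \<open>In polar coordinates \<open>pu c d F\<close> is \<open>F r * (c + d * cos \<theta>)\<close>, and \<open>pg c d F F'\<close> is its gradient.\<close>

definition pu :: "real \<Rightarrow> real \<Rightarrow> (real \<Rightarrow> real) \<Rightarrow> real^2 \<Rightarrow> real" where
  "pu c d F x = F (norm x) * (c + d * (x $ 1 / norm x))"
definition pg :: "real \<Rightarrow> real \<Rightarrow> (real \<Rightarrow> real) \<Rightarrow> (real \<Rightarrow> real) \<Rightarrow> real^2 \<Rightarrow> real^2" where
  "pg c d F F' x = (F' (norm x) * (c + d * (x $ 1 / norm x))) *\<^sub>R (x /\<^sub>R norm x)
     + (d * F (norm x) / norm x) *\<^sub>R (axis 1 1 - (x $ 1 / norm x) *\<^sub>R (x /\<^sub>R norm x))"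

text \<open>The radial direction and the tangential part of the first axis are orthogonal, and the
  latter has squared length \<open>1 - y\<^sup>2\<close>. At the origin division by 0 makes
  \<open>pg\<close> vanish, and the assumption on \<open>F'\<close> makes the right-hand side agree
  there.\<close>

lemma norm_pg:
  assumes "F' 0 = 0"
  shows "(norm (pg c d F F' x))\<^sup>2 = (F' (norm x))\<^sup>2 * (c + d * (x $ 1 / norm x))\<^sup>2 + (d * F (norm x) / norm x)\<^sup>2 * (1 - (x $ 1 / norm x)\<^sup>2)"
proof (cases "x = 0")
  case False
  define e where "e = x /\<^sub>R norm x"
  define y where "y = x $ 1 / norm x"
  have e1: "e \<bullet> e = 1" using False by (simp add: e_def dot_square_norm power2_eq_square)
  have ax: "axis 1 (1::real) \<bullet> axis 1 1 = (1::real)" by (simp add: inner_axis_axis)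
  have ey: "e \<bullet> axis 1 1 = y" "axis 1 1 \<bullet> e = y" by (auto simp: e_def y_def inner_axis inner_axis' divide_inverse mult.commute)
  have "(norm (a *\<^sub>R e + b *\<^sub>R (axis 1 1 - y *\<^sub>R e)))\<^sup>2 = a\<^sup>2 + b\<^sup>2 * (1 - y\<^sup>2)" for a b
    unfolding power2_norm_eq_inner
    by (simp add: inner_add_left inner_add_right inner_diff_left inner_diff_right e1 ey ax power2_eq_square algebra_simps)
  then show ?thesis by (simp add: pg_def e_def[symmetric] y_def[symmetric] power_mult_distrib)
qed (simp add: pg_def assms)

text \<open>Both the trial arcs and the ground state may have a corner where they reach 0, and no
  bound on the derivative is assumed. Hence differentiability is demanded only where
  \<open>F\<close> is positive, and \<open>F'\<close> is set to 0 elsewhere.\<close>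

locale profile =
  fixes F F' :: "real \<Rightarrow> real"
  assumes cF: "continuous_on UNIV F"
    and F_nonneg: "0 \<le> F r"
    and F_supp: "0 < F r \<Longrightarrow> 0 < r \<and> r < 1"
    and F_deriv: "0 < F r \<Longrightarrow> (F has_real_derivative F' r) (at r)"
    and F'_cont: "0 < F r \<Longrightarrow> isCont F' r"
    and F'_zero: "F r = 0 \<Longrightarrow> F' r = 0"
begin

lemma F_outside: "r \<le> 0 \<or> 1 \<le> r \<Longrightarrow> F r = 0"
  using F_supp[of r] F_nonneg[of r] by (cases "F r = 0") auto

lemma F'_0: "F' 0 = 0" by (rule F'_zero) (rule F_outside, simp)

lemma open_sub: "open {r. F r < e}"
  by (rule open_Collect_less[OF cF continuous_on_const])

lemma F_measurable [measurable]: "F \<in> borel_measurable borel"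
  by (rule borel_measurable_continuous_onI[OF cF])

lemma F'_measurable [measurable]: "F' \<in> borel_measurable borel"
proof -
  have "open {r. 0 < F r}" by (rule open_Collect_less[OF continuous_on_const cF])
  moreover have "continuous_on {r. 0 < F r} F'"
    using F'_cont by (intro continuous_at_imp_continuous_on) auto
  ultimately have "(\<lambda>r. indicator {r. 0 < F r} r *\<^sub>R F' r) \<in> borel_measurable borel"
    by (intro borel_measurable_continuous_on_indicator) auto
  moreover have "(\<lambda>r. indicator {r. 0 < F r} r *\<^sub>R F' r) = F'"
    using F'_zero F_nonneg by (fastforce simp: indicator_def fun_eq_iff order_less_le)
  ultimately show ?thesis by simp
qed

lemma pu_measurable [measurable]: "pu c d F \<in> borel_measurable borel"
proof -
  have [measurable]: "(\<lambda>x::real^2. x $ 1) \<in> borel_measurable borel"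
    by (intro borel_measurable_continuous_onI continuous_intros)
  show ?thesis unfolding pu_def by measurable
qed

lemma pg_measurable [measurable]: "pg c d F F' \<in> borel_measurable borel"
proof -
  have [measurable]: "(\<lambda>x::real^2. x $ 1) \<in> borel_measurable borel"
    by (intro borel_measurable_continuous_onI continuous_intros)
  show ?thesis unfolding pg_def by measurable
qed

text \<open>Superlevel sets at positive heights are compact in the open unit interval. A cutoff by
  \<open>soft e\<close> therefore lives away from both the origin and the unit circle.\<close>

lemma superlevel:
  assumes "0 < e"
  shows "\<exists>\<alpha> \<beta>. 0 < \<alpha> \<and> \<alpha> < 1 \<and> 0 < \<beta> \<and> \<beta> < 1 \<and> (\<forall>r. e \<le> F r \<longrightarrow> \<alpha> < r \<and> r < \<beta>)"
proof (cases "{r. e \<le> F r} = {}")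
  case True
  then show ?thesis by (intro exI[of _ "1/2"]) auto
next
  case False
  let ?S = "{r. e \<le> F r}"
  have sub: "?S \<subseteq> {0<..<1}" using F_supp assms by force
  have "closed ?S" by (rule closed_Collect_le[OF continuous_on_const cF])
  then have "compact ?S"
    using bounded_subset[OF bounded_box[of 0 "1::real"], of ?S] sub by (simp add: compact_eq_bounded_closed box_real)
  then obtain l u where l: "l \<in> ?S" "\<And>r. r \<in> ?S \<Longrightarrow> l \<le> r" and u: "u \<in> ?S" "\<And>r. r \<in> ?S \<Longrightarrow> r \<le> u"
    using False compact_attains_inf[of ?S] compact_attains_sup[of ?S] by auto
  have "0 < l" "l < 1" "0 < u" "u < 1" using l(1) u(1) sub by auto
  moreover have "l / 2 < r \<and> r < (1 + u) / 2" if "e \<le> F r" for r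
    using l(2)[of r] u(2)[of r] that \<open>0 < l\<close> \<open>u < 1\<close> by auto
  ultimately have "0 < l / 2 \<and> l / 2 < 1 \<and> 0 < (1 + u) / 2 \<and> (1 + u) / 2 < 1 \<and> (\<forall>r. e \<le> F r \<longrightarrow> l / 2 < r \<and> r < (1 + u) / 2)"
    by auto
  then show ?thesis by blast
qed

lemma cutoff_DERIV:
  assumes e: "0 < e"
  shows "((\<lambda>r. soft e (F r)) has_real_derivative soft' e (F r) * F' r) (at r)"
proof (cases "0 < F r")
  case True
  show ?thesis by (rule DERIV_chain2[OF DERIV_soft[OF e] F_deriv[OF True]])
next
  case False
  then have 0: "F r = 0" using F_nonneg[of r] by simp
  have "((\<lambda>r. soft e (F r)) has_real_derivative 0) (at r)"
    by (rule has_field_derivative_transform_within_open[where S = "{r. F r < e}" and f = "\<lambda>_. 0"])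
      (use 0 e open_sub in \<open>auto simp: soft_def\<close>)
  then show ?thesis by (simp add: F'_zero[OF 0])
qed

lemma cutoff_cont:
  assumes e: "0 < e"
  shows "continuous_on UNIV (\<lambda>r. soft' e (F r) * F' r)"
proof (rule continuous_at_imp_continuous_on, rule ballI)
  fix r :: real
  show "isCont (\<lambda>r. soft' e (F r) * F' r) r"
  proof (cases "0 < F r")
    case True
    have 1: "isCont F r" using cF by (simp add: continuous_on_eq_continuous_at)
    have 2: "isCont (soft' e) (F r)" using continuous_on_soft'[OF e] by (simp add: continuous_on_eq_continuous_at)
    show ?thesis by (rule continuous_mult[OF isCont_o2[OF 1 2] F'_cont[OF True]])
  next
    case False
    then have 0: "F r = 0" using F_nonneg[of r] by simp
    have "continuous_on {r. F r < e} (\<lambda>r. soft' e (F r) * F' r)"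
      by (rule continuous_on_eq[of _ "\<lambda>_. 0"]) (auto simp: soft'_def)
    then show ?thesis using open_sub[of e] 0 e by (simp add: continuous_on_eq_continuous_at)
  qed
qed

text \<open>In the variable \<open>s = r\<^sup>2\<close> the two profiles are
  \<open>c * f (sqrt s)\<close> and \<open>d * (f (sqrt s) / sqrt s)\<close>. The cutoff vanishes
  near 0, so the singularities of root and quotient are never met and \<open>C1_radial_H01\<close>
  applies.\<close>

lemma cutoff_H01:
  assumes e: "0 < e"
  shows "has_H01_gradient (pu c d (\<lambda>r. soft e (F r))) (pg c d (\<lambda>r. soft e (F r)) (\<lambda>r. soft' e (F r) * F' r))"
proof -
  define f where "f r = soft e (F r)" for r
  define f' where "f' r = soft' e (F r) * F' r" for r
  have f: "(f has_real_derivative f' r) (at r)" for r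
    unfolding f_def[abs_def] f'_def by (rule cutoff_DERIV[OF e])
  have cf': "continuous_on UNIV f'" unfolding f'_def[abs_def] by (rule cutoff_cont[OF e])
  have cf: "continuous_on UNIV f" using f by (meson DERIV_continuous_on DERIV_subset top_greatest)
  obtain \<alpha> \<beta> where ab: "0 < \<alpha>" "0 < \<beta>" "\<beta> < 1" "\<And>r. e \<le> F r \<Longrightarrow> \<alpha> < r \<and> r < \<beta>"
    using superlevel[OF e] by blast
  have z: "f r = 0" "f' r = 0" if "r \<le> \<alpha> \<or> \<beta> \<le> r" for r
    using ab(4)[of r] that by (auto simp: f_def f'_def soft_def soft'_def)
  define q where "q s = f' (sqrt s) / (2 * sqrt s)" for s
  define G0 where "G0 s = c * f (sqrt s)" for s
  define G0' where "G0' s = c * q s" for s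
  define G1 where "G1 s = d * (f (sqrt s) / sqrt s)" for s
  define G1' where "G1' s = d * ((q s * sqrt s - f (sqrt s) * (inverse (sqrt s) / 2)) / (sqrt s * sqrt s))" for s
  have low: "sqrt s \<le> \<alpha>" if "s < \<alpha>\<^sup>2" for s
    using real_sqrt_le_mono[of s "\<alpha>\<^sup>2"] that ab(1) by simp
  have zlow: "f (sqrt s) = 0" "q s = 0" "G0 s = 0" "G1 s = 0" "G0' s = 0" "G1' s = 0" if "s < \<alpha>\<^sup>2" for s
    using z[of "sqrt s"] low[OF that] by (auto simp: q_def G0_def G1_def G0'_def G1'_def)
  have fs: "((\<lambda>s. f (sqrt s)) has_real_derivative q s) (at s)" if "0 < s" for s
  proof -
    have "((\<lambda>s. f (sqrt s)) has_real_derivative f' (sqrt s) * (inverse (sqrt s) / 2)) (at s)"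
      by (rule DERIV_chain2[OF f DERIV_real_sqrt[OF that]])
    then show ?thesis by (simp add: q_def field_simps)
  qed
  have dG0: "(G0 has_real_derivative G0' s) (at s)" for s
  proof (cases "0 < s")
    case True
    then show ?thesis unfolding G0_def[abs_def] G0'_def by (intro DERIV_cmult fs)
  next
    case False
    have sa: "s < \<alpha>\<^sup>2" using False zero_less_power[OF ab(1), of 2] by linarith
    have "(G0 has_real_derivative 0) (at s)"
      by (rule has_field_derivative_transform_within_open[where S = "{..<\<alpha>\<^sup>2}" and f = "\<lambda>_. 0"])
        (use sa zlow in auto)
    then show ?thesis using sa by (simp add: zlow)
  qed
  have dG1: "(G1 has_real_derivative G1' s) (at s)" for s
  proof (cases "0 < s")
    case True
    then show ?thesis unfolding G1_def[abs_def] G1'_def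
      by (intro DERIV_cmult DERIV_divide fs DERIV_real_sqrt) auto
  next
    case False
    have sa: "s < \<alpha>\<^sup>2" using False zero_less_power[OF ab(1), of 2] by linarith
    have "(G1 has_real_derivative 0) (at s)"
      by (rule has_field_derivative_transform_within_open[where S = "{..<\<alpha>\<^sup>2}" and f = "\<lambda>_. 0"])
        (use sa zlow in auto)
    then show ?thesis using sa by (simp add: zlow)
  qed
  have glue: "continuous_on UNIV g" if "continuous_on {0<..} g" "\<And>s. s < \<alpha>\<^sup>2 \<Longrightarrow> g s = 0" for g :: "real \<Rightarrow> real"
  proof -
    have "continuous_on {..<\<alpha>\<^sup>2} g" by (rule continuous_on_eq[of _ "\<lambda>_. 0"]) (use that(2) in auto)
    then have "continuous_on ({0<..} \<union> {..<\<alpha>\<^sup>2}) g" by (intro continuous_on_open_Un that(1)) auto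
    moreover have "{0<..} \<union> {..<\<alpha>\<^sup>2} = UNIV"
      using zero_less_power[OF ab(1), of 2] by (auto simp: not_less intro: le_less_trans)
    ultimately show ?thesis by simp
  qed
  have c2: "continuous_on S (\<lambda>s. f (sqrt s))" "continuous_on S (\<lambda>s. f' (sqrt s))" for S
    by (rule continuous_on_compose2[OF cf] continuous_on_compose2[OF cf']; auto intro!: continuous_intros)+
  have cq: "continuous_on {0<..} q"
    unfolding q_def by (intro continuous_intros c2) auto
  have cG0': "continuous_on UNIV G0'"
    by (rule glue) (use zlow in \<open>auto simp: G0'_def intro!: continuous_intros cq\<close>)
  have cG1': "continuous_on UNIV G1'"
    by (rule glue) (use zlow in \<open>auto simp: G1'_def intro!: continuous_intros cq c2\<close>)
  have "\<beta>\<^sup>2 < 1" using ab by (simp add: power_less_one_iff)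
  moreover have "f (sqrt s) = 0" if "\<beta>\<^sup>2 \<le> s" for s
    using z(1)[of "sqrt s"] that ab(2) by (simp add: real_le_rsqrt)
  ultimately have H: "has_H01_gradient (\<lambda>x. G0 (x \<bullet> x) + x $ 1 * G1 (x \<bullet> x))
    (\<lambda>x. (2 * (G0' (x \<bullet> x) + x $ 1 * G1' (x \<bullet> x))) *\<^sub>R x + G1 (x \<bullet> x) *\<^sub>R axis 1 1)"
    by (intro C1_radial_H01[OF dG0 cG0' dG1 cG1', of "\<beta>\<^sup>2"]) (auto simp: G0_def G1_def)
  have sq: "sqrt (x \<bullet> x) = norm x" for x :: "real^2" by (simp add: norm_eq_sqrt_inner)
  have u: "(\<lambda>x. G0 (x \<bullet> x) + x $ 1 * G1 (x \<bullet> x)) = pu c d f"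
    by (simp add: fun_eq_iff G0_def G1_def sq pu_def algebra_simps)
  have g: "(2 * (G0' (x \<bullet> x) + x $ 1 * G1' (x \<bullet> x))) *\<^sub>R x + G1 (x \<bullet> x) *\<^sub>R axis 1 1 = pg c d f f' x" for x
  proof (cases "x = 0")
    case True
    have "f 0 = 0" "f' 0 = 0" using z[of 0] ab by auto
    then show ?thesis using True by (simp add: pg_def G1_def)
  next
    case False
    define r where "r = norm x"
    have r: "0 < r" using False by (simp add: r_def)
    have "2 * (G0' (x \<bullet> x) + x $ 1 * G1' (x \<bullet> x)) = f' r * (c + d * (x $ 1 / r)) / r - d * f r / r * (x $ 1 / r) / r"
      using r by (simp add: G0'_def G1'_def q_def sq r_def[symmetric] field_simps)
    then have "(2 * (G0' (x \<bullet> x) + x $ 1 * G1' (x \<bullet> x))) *\<^sub>R x + G1 (x \<bullet> x) *\<^sub>R axis 1 1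
      = (f' r * (c + d * (x $ 1 / r)) / r - d * f r / r * (x $ 1 / r) / r) *\<^sub>R x + (d * f r / r) *\<^sub>R axis 1 1"
      by (simp add: G1_def sq r_def)
    also have "\<dots> = pg c d f f' x"
      unfolding pg_def r_def[symmetric]
      by (simp add: scaleR_diff_left scaleR_diff_right divide_inverse mult_ac)
    finally show ?thesis .
  qed
  show ?thesis using H unfolding u g by (simp add: f_def[abs_def] f'_def[abs_def])
qed

lemma F_bounded: "\<exists>B. \<forall>r. F r \<le> B"
proof -
  have "bounded (F ` {0..1})"
    by (intro compact_imp_bounded compact_continuous_image continuous_on_subset[OF cF]) auto
  then obtain B where "\<forall>y\<in>F ` {0..1}. norm y \<le> B" unfolding bounded_iff by blast
  then have B: "\<And>r. r \<in> {0..1} \<Longrightarrow> \<bar>F r\<bar> \<le> B" by auto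
  have "F r \<le> max 0 B" for r
    using B[of r] F_outside[of r] by (cases "r \<in> {0..1}") (auto simp: le_max_iff_disj)
  then show ?thesis by blast
qed

lemma abs_cos_bound: "\<bar>x $ 1 / norm (x::real^2)\<bar> \<le> 1"
  using component_le_norm_cart[of x 1] by (cases "x = 0") (auto simp: divide_le_eq)

lemma pu_finite: "L2sq (pu c d F) < \<infinity>"
proof -
  obtain B where B: "\<And>r. F r \<le> B" using F_bounded by blast
  have "norm (pu c d F x) \<le> B * (\<bar>c\<bar> + \<bar>d\<bar>)" for x
  proof -
    have "\<bar>c + d * (x $ 1 / norm x)\<bar> \<le> \<bar>c\<bar> + \<bar>d\<bar> * \<bar>x $ 1 / norm x\<bar>"
      using abs_triangle_ineq[of c "d * (x $ 1 / norm x)"] by (simp add: abs_mult)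
    also have "\<dots> \<le> \<bar>c\<bar> + \<bar>d\<bar> * 1" using abs_cos_bound by (intro add_left_mono mult_left_mono) auto
    finally have 1: "\<bar>c + d * (x $ 1 / norm x)\<bar> \<le> \<bar>c\<bar> + \<bar>d\<bar>" by simp
    show ?thesis unfolding pu_def real_norm_def abs_mult
      using B[of "norm x"] F_nonneg[of "norm x"] by (intro mult_mono 1) auto
  qed
  then have "L2sq (pu c d F) \<le> (\<integral>\<^sup>+ x. ennreal ((B * (\<bar>c\<bar> + \<bar>d\<bar>))\<^sup>2) \<partial>lebesgue_on (unit_disc::(real^2) set))"
    by (intro nn_integral_mono ennreal_leI power_mono) auto
  also have "\<dots> < \<infinity>"
    using emeasure_bounded_finite[OF bounded_ball[of "0::real^2" 1]]
    by (simp add: emeasure_restrict_space ennreal_mult_less_top)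
  finally show ?thesis .
qed

text \<open>The cutoffs converge pointwise, and their distances to the value and to the gradient
  never exceed the norms of the value and of the gradient. Dominated convergence, which uses the
  finite energy, and closedness of the weak gradient conclude.\<close>

lemma profile_has_gradient:
  assumes fin: "L2sq (pg c d F F') < \<infinity>"
  shows "has_H01_gradient (pu c d F) (pg c d F F')"
proof (rule has_H01_gradient_closed)
  let ?e = "\<lambda>n. inverse (real (Suc n))"
  let ?F = "\<lambda>n r. soft (?e n) (F r)" and ?F' = "\<lambda>n r. soft' (?e n) (F r) * F' r"
  have e: "0 < ?e n" for n by simp
  show "has_H01_gradient (pu c d (?F n)) (pg c d (?F n) (?F' n))" for n by (rule cutoff_H01[OF e])
  show mu: "pu c d F \<in> borel_measurable (lebesgue_on unit_disc)" "pg c d F F' \<in> borel_measurable (lebesgue_on unit_disc)"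
    by (intro borel_measurable_disc pu_measurable pg_measurable)+
  have mn: "pu c d (?F n) \<in> borel_measurable (lebesgue_on unit_disc)"
    "pg c d (?F n) (?F' n) \<in> borel_measurable (lebesgue_on unit_disc)" for n
    using cutoff_H01[OF e[of n], of c d] by (auto simp: has_H01_gradient_def)
  have lims: "(\<lambda>n. ?F n r) \<longlonglongrightarrow> F r" "(\<lambda>n. ?F' n r) \<longlonglongrightarrow> F' r" for r
  proof -
    show "(\<lambda>n. ?F n r) \<longlonglongrightarrow> F r"
    proof (cases "F r = 0")
      case True
      then show ?thesis by (simp add: soft_def)
    next
      case False
      then show ?thesis using F_nonneg[of r] by (intro soft_limits) auto
    qed
    show "(\<lambda>n. ?F' n r) \<longlonglongrightarrow> F' r"
    proof (cases "F r = 0")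
      case True
      then show ?thesis by (simp add: F'_zero)
    next
      case False
      then have "(\<lambda>n. soft' (?e n) (F r) * F' r) \<longlonglongrightarrow> 1 * F' r"
        using F_nonneg[of r] by (intro tendsto_mult soft_limits tendsto_const) auto
      then show ?thesis by simp
    qed
  qed
  have F'n0: "?F' n 0 = 0" for n by (simp add: F'_0)
  show "L2_tendsto (\<lambda>n. pu c d (?F n)) (pu c d F)"
  proof -
    have "(\<lambda>n. L2sq (\<lambda>x. pu c d (?F n) x - pu c d F x)) \<longlonglongrightarrow> (\<integral>\<^sup>+ x. 0 \<partial>lebesgue_on (unit_disc::(real^2) set))"
    proof (rule nn_integral_dominated_convergence[where w = "\<lambda>x. ennreal ((norm (pu c d F x))\<^sup>2)"])
      show "L2sq (pu c d F) < \<infinity>" by (rule pu_finite)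
      have "(\<lambda>n. ennreal ((norm (pu c d (?F n) x - pu c d F x))\<^sup>2)) \<longlonglongrightarrow> ennreal ((norm (pu c d F x - pu c d F x))\<^sup>2)" for x
        unfolding pu_def by (intro tendsto_ennrealI tendsto_intros lims)
      then show "AE x in lebesgue_on unit_disc. (\<lambda>n. ennreal ((norm (pu c d (?F n) x - pu c d F x))\<^sup>2)) \<longlonglongrightarrow> 0"
        by (intro AE_I2) simp
      have "norm (pu c d (?F n) x - pu c d F x) \<le> norm (pu c d F x)" for n x
      proof -
        have "pu c d (?F n) x - pu c d F x = (?F n (norm x) - F (norm x)) * (c + d * (x $ 1 / norm x))"
          by (simp add: pu_def algebra_simps)
        moreover have "\<bar>?F n (norm x) - F (norm x)\<bar> \<le> \<bar>F (norm x)\<bar>"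
          using soft_bounds[OF e[of n] F_nonneg[of "norm x"]] by simp
        ultimately show ?thesis by (simp only: pu_def real_norm_def abs_mult) (intro mult_right_mono; simp)
      qed
      then show "AE x in lebesgue_on unit_disc. ennreal ((norm (pu c d (?F n) x - pu c d F x))\<^sup>2) \<le> ennreal ((norm (pu c d F x))\<^sup>2)" for n
        by (intro AE_I2 ennreal_leI power_mono) auto
    qed (use mu mn in auto)
    then show ?thesis by (simp add: L2_tendsto_def)
  qed
  show "L2_tendsto (\<lambda>n. pg c d (?F n) (?F' n)) (pg c d F F')"
  proof -
    have diff: "pg c d (?F n) (?F' n) x - pg c d F F' x = pg c d (\<lambda>r. ?F n r - F r) (\<lambda>r. ?F' n r - F' r) x" for n x
      unfolding pg_def by (simp add: left_diff_distrib right_diff_distrib diff_divide_distrib scaleR_diff_left)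
    have "(\<lambda>n. L2sq (\<lambda>x. pg c d (?F n) (?F' n) x - pg c d F F' x)) \<longlonglongrightarrow> (\<integral>\<^sup>+ x. 0 \<partial>lebesgue_on (unit_disc::(real^2) set))"
    proof (rule nn_integral_dominated_convergence[where w = "\<lambda>x. ennreal ((norm (pg c d F F' x))\<^sup>2)"])
      show "L2sq (pg c d F F') < \<infinity>" by (rule fin)
      have "(\<lambda>n. ennreal ((norm (pg c d (?F n) (?F' n) x - pg c d F F' x))\<^sup>2)) \<longlonglongrightarrow> ennreal ((norm (pg c d F F' x - pg c d F F' x))\<^sup>2)" for x
        unfolding pg_def divide_inverse by (intro tendsto_ennrealI tendsto_intros lims)
      then show "AE x in lebesgue_on unit_disc. (\<lambda>n. ennreal ((norm (pg c d (?F n) (?F' n) x - pg c d F F' x))\<^sup>2)) \<longlonglongrightarrow> 0"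
        by (intro AE_I2) simp
      have "(norm (pg c d (?F n) (?F' n) x - pg c d F F' x))\<^sup>2 \<le> (norm (pg c d F F' x))\<^sup>2" for n x
      proof -
        have z: "(\<lambda>r. ?F' n r - F' r) 0 = 0" by (simp add: F'_0)
        have b1: "(?F' n r - F' r)\<^sup>2 \<le> (F' r)\<^sup>2" for r
        proof -
          have "?F' n r - F' r = (soft' (?e n) (F r) - 1) * F' r" by (simp add: left_diff_distrib)
          then have "\<bar>?F' n r - F' r\<bar> = \<bar>soft' (?e n) (F r) - 1\<bar> * \<bar>F' r\<bar>" by (simp only: abs_mult)
          also have "\<dots> \<le> 1 * \<bar>F' r\<bar>" using soft'_bounds[OF e[of n], of "F r"] by (intro mult_right_mono) auto
          finally show ?thesis by (intro abs_le_square_iff[THEN iffD1]) simp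
        qed
        have b2: "(d * (?F n r - F r) / r)\<^sup>2 \<le> (d * F r / r)\<^sup>2" for r
        proof -
          have "\<bar>?F n r - F r\<bar> \<le> \<bar>F r\<bar>" using soft_bounds[OF e[of n] F_nonneg[of r]] by simp
          then have "\<bar>d\<bar> * \<bar>?F n r - F r\<bar> / \<bar>r\<bar> \<le> \<bar>d\<bar> * \<bar>F r\<bar> / \<bar>r\<bar>" by (intro divide_right_mono mult_left_mono) auto
          then show ?thesis by (intro abs_le_square_iff[THEN iffD1]) (simp add: abs_mult)
        qed
        have s: "0 \<le> 1 - (x $ 1 / norm x)\<^sup>2"
          using abs_cos_bound[of x] by (simp add: abs_square_le_1)
        show ?thesis
          unfolding diff norm_pg[of F', OF F'_0] norm_pg[of "\<lambda>r. ?F' n r - F' r", OF z]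
          by (intro add_mono mult_right_mono b1 b2 s) auto
      qed
      then show "AE x in lebesgue_on unit_disc. ennreal ((norm (pg c d (?F n) (?F' n) x - pg c d F F' x))\<^sup>2) \<le> ennreal ((norm (pg c d F F' x))\<^sup>2)" for n
        by (intro AE_I2 ennreal_leI) auto
    qed (use mu mn in auto)
    then show ?thesis by (simp add: L2_tendsto_def)
  qed
qed

lemma pg_energy:
  "L2sq (pg c d F F') = (\<integral>\<^sup>+ r. ennreal (r * ((F' r)\<^sup>2 * (2 * pi * c\<^sup>2 + pi * d\<^sup>2) + pi * (d * F r / r)\<^sup>2)) * indicator {0<..<1} r \<partial>lborel)"
  unfolding norm_pg[of F', OF F'_0]
  by (rule polar_profile[of "\<lambda>r. (F' r)\<^sup>2" "\<lambda>r. (d * F r / r)\<^sup>2"]) auto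

lemma pu_weighted:
  "(\<integral>\<^sup>+ x. ennreal (\<bar>pu c d F x\<bar>\<^sup>2 / ((norm x)\<^sup>2 * (ln (a / norm x))\<^sup>2)) \<partial>lebesgue_on unit_disc)
   = (\<integral>\<^sup>+ r. ennreal (r * ((F r)\<^sup>2 / (r\<^sup>2 * (ln (a / r))\<^sup>2) * (2 * pi * c\<^sup>2 + pi * d\<^sup>2))) * indicator {0<..<1} r \<partial>lborel)"
proof -
  have "(\<integral>\<^sup>+ x. ennreal (\<bar>pu c d F x\<bar>\<^sup>2 / ((norm x)\<^sup>2 * (ln (a / norm x))\<^sup>2)) \<partial>lebesgue_on unit_disc)
    = (\<integral>\<^sup>+ x. ennreal ((F (norm x))\<^sup>2 / ((norm x)\<^sup>2 * (ln (a / norm x))\<^sup>2) * (c + d * (x $ 1 / norm x))\<^sup>2 + 0 * (1 - (x $ 1 / norm x)\<^sup>2)) \<partial>lebesgue_on unit_disc)"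
    by (intro nn_integral_cong) (simp add: pu_def power_mult_distrib)
  also have "\<dots> = (\<integral>\<^sup>+ r. ennreal (r * ((F r)\<^sup>2 / (r\<^sup>2 * (ln (a / r))\<^sup>2) * (2 * pi * c\<^sup>2 + pi * d\<^sup>2) + pi * 0)) * indicator {0<..<1} r \<partial>lborel)"
    by (rule polar_profile[of "\<lambda>r. (F r)\<^sup>2 / (r\<^sup>2 * (ln (a / r))\<^sup>2)" "\<lambda>_. 0"]) auto
  finally show ?thesis by simp
qed

lemma pu_zero_average: "zero_spherical_average (pu 0 d F)"
  unfolding zero_spherical_average_def
proof (intro AE_I2)
  fix r :: real assume "r \<in> space (lebesgue_on {0..1})"
  then have r: "0 \<le> r" by simp
  \<comment> \<open>The factor \<open>r / r\<close> is 1 for positive \<open>r\<close> and 0 at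
    \<open>r = 0\<close>, matching the value of \<open>x $ 1 / norm x\<close> at the origin.\<close>
  define k where "k = F r * d * (r / r)"
  have e: "(\<lambda>\<theta>. pu 0 d F (vector [r * cos \<theta>, r * sin \<theta>])) = (\<lambda>\<theta>. k * cos \<theta>)"
    using r by (simp add: fun_eq_iff pu_def k_def)
  have "((\<lambda>\<theta>. k * cos \<theta>) has_integral (k * sin (2*pi) - k * sin 0)) {0..2*pi}"
    by (rule fundamental_theorem_of_calculus)
      (auto intro!: derivative_eq_intros simp flip: has_real_derivative_iff_has_vector_derivative)
  then have "((\<lambda>\<theta>. k * cos \<theta>) has_integral 0) {0..2*pi}" by simp
  moreover have i: "integrable (lebesgue_on {0..2*pi}) (\<lambda>\<theta>. k * cos \<theta>)"
    by (intro continuous_imp_integrable_real continuous_intros)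
  moreover have "(LINT \<theta>|lebesgue_on {0..2*pi}. k * cos \<theta>) = integral {0..2*pi} (\<lambda>\<theta>. k * cos \<theta>)"
    by (rule lebesgue_integral_eq_integral[OF i]) simp
  ultimately show "has_bochner_integral (lebesgue_on {0..2 * pi}) (\<lambda>\<theta>. pu 0 d F (vector [r * cos \<theta>, r * sin \<theta>])) 0"
    unfolding e by (simp add: has_bochner_integral_iff integral_unique)
qed

lemma profile_quotient:
  fixes c d a :: real
  defines "N \<equiv> (\<integral>\<^sup>+ r. ennreal (r * ((F' r)\<^sup>2 * (2 * pi * c\<^sup>2 + pi * d\<^sup>2) + pi * (d * F r / r)\<^sup>2)) * indicator {0<..<1} r \<partial>lborel)"
    and "D \<equiv> (\<integral>\<^sup>+ r. ennreal (r * ((F r)\<^sup>2 / (r\<^sup>2 * (ln (a / r))\<^sup>2) * (2 * pi * c\<^sup>2 + pi * d\<^sup>2))) * indicator {0<..<1} r \<partial>lborel)"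
  assumes N: "N < \<infinity>" and D: "D \<noteq> 0"
  shows "pu c d F \<in> H01_nonzero" "hardy_quotient a (pu c d F) = N / D"
proof -
  have h: "has_H01_gradient (pu c d F) (pg c d F F')"
    by (rule profile_has_gradient) (use N in \<open>simp add: pg_energy N_def\<close>)
  have nz: "\<not> (AE x in lebesgue_on unit_disc. pu c d F x = 0)"
  proof
    assume "AE x in lebesgue_on unit_disc. pu c d F x = 0"
    then have "(\<integral>\<^sup>+ x. ennreal (\<bar>pu c d F x\<bar>\<^sup>2 / ((norm x)\<^sup>2 * (ln (a / norm x))\<^sup>2)) \<partial>lebesgue_on unit_disc)
      = (\<integral>\<^sup>+ x. 0 \<partial>lebesgue_on (unit_disc::(real^2) set))"
      by (intro nn_integral_cong_AE) (auto elim: eventually_mono)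
    then show False using D unfolding pu_weighted D_def by simp
  qed
  show "pu c d F \<in> H01_nonzero"
    using h nz by (auto simp: H01_nonzero_def H01_def)
  show "hardy_quotient a (pu c d F) = N / D"
    unfolding hardy_quotient_def weak_grad_energy[OF h] pu_weighted pg_energy N_def D_def ..
qed

end

section \<open>The one-dimensional reduction\<close>

lemma nn_integral_continuous_Icc:
  fixes f :: "real \<Rightarrow> real"
  assumes "continuous_on {a..b} f" "\<And>x. x \<in> {a..b} \<Longrightarrow> 0 \<le> f x"
  shows "(\<integral>\<^sup>+ x. ennreal (f x) * indicator {a..b} x \<partial>lborel) = ennreal (integral {a..b} f)"
  by (rule nn_integral_has_integral_lebesgue') (use assms in \<open>auto intro!: integrable_integral integrable_continuous_interval\<close>)

lemma nn_integral_continuous_Ioo: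
  fixes f :: "real \<Rightarrow> real"
  assumes "continuous_on {a..b} f" "\<And>x. x \<in> {a..b} \<Longrightarrow> 0 \<le> f x"
  shows "(\<integral>\<^sup>+ x. ennreal (f x) * indicator {a<..<b} x \<partial>lborel) = ennreal (integral {a..b} f)"
proof (rule nn_integral_has_integral_lebesgue')
  have "(f has_integral integral {a..b} f) {a..b}"
    using assms(1) by (intro integrable_integral integrable_continuous_interval)
  then show "(f has_integral integral {a..b} f) {a<..<b}" by (simp add: has_integral_Icc_iff_Ioo)
qed (use assms in auto)

section \<open>Lower bounds for test functions in polar coordinates\<close>

definition angmean :: "(real^2 \<Rightarrow> real) \<Rightarrow> real \<Rightarrow> real" where
  "angmean \<phi> r = integral {0..2*pi} (\<lambda>\<theta>. \<phi> (pol r \<theta>)) / (2*pi)"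

text \<open>For \<open>b\<close> false this is the plain integral of the square over the circle, so
  the general Hardy inequality and the one for mean zero share a single proof.\<close>

definition angvar :: "bool \<Rightarrow> (real^2 \<Rightarrow> real) \<Rightarrow> real \<Rightarrow> real" where
  "angvar b \<phi> r = integral {0..2*pi} (\<lambda>\<theta>. (\<phi> (pol r \<theta>) - of_bool b * angmean \<phi> r)\<^sup>2)"

context
  fixes \<phi> :: "real^2 \<Rightarrow> real"
  assumes \<phi>: "\<phi> \<in> test_functions"
begin

definition tp where "tp r \<theta> = \<phi> (pol r \<theta>)" for r \<theta>
definition tpr where "tpr r \<theta> = partial_deriv 1 \<phi> (pol r \<theta>) * cos \<theta> + partial_deriv 2 \<phi> (pol r \<theta>) * sin \<theta>" for r \<theta>
definition tpt where "tpt r \<theta> = - partial_deriv 1 \<phi> (pol r \<theta>) * (r * sin \<theta>) + partial_deriv 2 \<phi> (pol r \<theta>) * (r * cos \<theta>)" for r \<theta>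

lemma cont_pol:
  fixes f :: "real^2 \<Rightarrow> real" and u v :: "'x::t2_space \<Rightarrow> real"
  assumes "continuous_on UNIV f" "continuous_on S u" "continuous_on S v"
  shows "continuous_on S (\<lambda>x. f (pol (u x) (v x)))"
  by (rule continuous_on_compose2[OF assms(1)]) (auto intro!: continuous_intros assms)

lemma cont_tp:
  fixes u v :: "'x::t2_space \<Rightarrow> real"
  assumes "continuous_on S u" "continuous_on S v"
  shows "continuous_on S (\<lambda>x. tp (u x) (v x))" "continuous_on S (\<lambda>x. tpr (u x) (v x))" "continuous_on S (\<lambda>x. tpt (u x) (v x))"
  unfolding tp_def tpr_def tpt_def
  by (intro continuous_intros cont_pol assms test_continuous[OF \<phi>] test_continuous[OF test_partial[OF \<phi>]])+

lemma derivative_vector2: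
  assumes "(p has_real_derivative p') (at t)" "(q has_real_derivative q') (at t)"
  shows "((\<lambda>t. \<phi> (vector [p t, q t])) has_real_derivative
    partial_deriv 1 \<phi> (vector [p t, q t]) * p' + partial_deriv 2 \<phi> (vector [p t, q t]) * q') (at t)"
proof -
  let ?D = "frechet_derivative \<phi> (at (vector [p t, q t]))"
  have 1: "((\<lambda>t. vector [p t, q t] :: real^2) has_derivative (\<lambda>h. (h * p') *\<^sub>R axis 1 1 + (h * q') *\<^sub>R axis 2 1)) (at t)"
    unfolding vector_2_eq_axis using assms[unfolded has_field_derivative_def]
    by (intro has_derivative_add has_derivative_scaleR_left) (simp_all add: mult_commute_abs)
  have lin: "linear ?D" by (rule has_derivative_linear[OF test_has_derivative[OF \<phi>]])
  have "((\<lambda>t. \<phi> (vector [p t, q t])) has_derivative (\<lambda>h. ?D ((h * p') *\<^sub>R axis 1 1 + (h * q') *\<^sub>R axis 2 1))) (at t)"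
    by (rule has_derivative_compose[OF 1 test_has_derivative[OF \<phi>]])
  moreover have "?D ((h * p') *\<^sub>R axis 1 1 + (h * q') *\<^sub>R axis 2 1)
     = (partial_deriv 1 \<phi> (vector [p t, q t]) * p' + partial_deriv 2 \<phi> (vector [p t, q t]) * q') * h" for h
    unfolding linear_add[OF lin] linear_scale[OF lin] by (simp add: partial_deriv_def algebra_simps)
  ultimately show ?thesis by (simp add: has_field_derivative_def)
qed

lemma DERIV_tp_r: "((\<lambda>r. tp r \<theta>) has_real_derivative tpr r \<theta>) (at r)"
proof -
  have "((\<lambda>r. r * cos \<theta>) has_real_derivative cos \<theta>) (at r)" "((\<lambda>r. r * sin \<theta>) has_real_derivative sin \<theta>) (at r)"
    by (auto intro!: derivative_eq_intros)
  from derivative_vector2[OF this] show ?thesis by (simp add: tp_def tpr_def)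
qed

lemma DERIV_tp_t: "((\<lambda>\<theta>. tp r \<theta>) has_real_derivative tpt r \<theta>) (at \<theta>)"
proof -
  have "((\<lambda>\<theta>. r * cos \<theta>) has_real_derivative - (r * sin \<theta>)) (at \<theta>)" "((\<lambda>\<theta>. r * sin \<theta>) has_real_derivative r * cos \<theta>) (at \<theta>)"
    by (auto intro!: derivative_eq_intros)
  from derivative_vector2[OF this] show ?thesis by (simp add: tp_def tpt_def)
qed

lemma tp_periodic: "tp r (\<theta> + 2*pi) = tp r \<theta>" "tpt r (\<theta> + 2*pi) = tpt r \<theta>"
  by (simp_all add: tp_def tpt_def)

lemma grad_polar:
  assumes r: "0 < r"
  shows "r * (norm (grad \<phi> (pol r \<theta>)))\<^sup>2 = r * (tpr r \<theta>)\<^sup>2 + (tpt r \<theta>)\<^sup>2 / r"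
proof -
  have gen: "r * (p * C + q * S)\<^sup>2 + (- p * (r * S) + q * (r * C))\<^sup>2 / r = r * (p\<^sup>2 + q\<^sup>2) * (C\<^sup>2 + S\<^sup>2)" for p q C S
    using r by (simp add: power2_eq_square field_simps)
  have "(norm (grad \<phi> (pol r \<theta>)))\<^sup>2 = (partial_deriv 1 \<phi> (pol r \<theta>))\<^sup>2 + (partial_deriv 2 \<phi> (pol r \<theta>))\<^sup>2"
    by (simp add: norm_real2 grad_def)
  then show ?thesis unfolding tpr_def tpt_def gen by simp
qed

lemma test_energy_annulus:
  assumes e: "0 < \<epsilon>" "\<rho> < 1"
  shows "ennreal (integral {\<epsilon>..\<rho>} (\<lambda>r. integral {0..2*pi} (\<lambda>\<theta>. r * (tpr r \<theta>)\<^sup>2 + (tpt r \<theta>)\<^sup>2 / r))) \<le> L2sq (grad \<phi>)"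
proof -
  let ?h = "\<lambda>r \<theta>. r * (norm (grad \<phi> (pol r \<theta>)))\<^sup>2"
  have cg: "continuous_on S (\<lambda>x. grad \<phi> (pol (u x) (v x)))" if "continuous_on S u" "continuous_on S v" for S and u v :: "'x::t2_space \<Rightarrow> real"
    by (rule continuous_on_compose2[OF continuous_grad[OF \<phi>]]) (auto intro!: continuous_intros that)
  have i: "integral {0..2*pi} (\<lambda>\<theta>. r * (tpr r \<theta>)\<^sup>2 + (tpt r \<theta>)\<^sup>2 / r) = integral {0..2*pi} (?h r)" if "r \<in> {\<epsilon>..\<rho>}" for r
    using that e by (intro integral_cong) (simp add: grad_polar)
  have c1: "continuous_on {0..2*pi} (?h r)" for r by (intro continuous_intros cg)
  have p1: "0 \<le> integral {0..2*pi} (?h r)" if "0 \<le> r" for r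
    using that by (intro integral_nonneg integrable_continuous_interval c1) auto
  have c2: "continuous_on {\<epsilon>..\<rho>} (\<lambda>r. integral {0..2*pi} (?h r))"
    by (rule integral_continuous_on_param[of _ 0 "2*pi", simplified])
      (auto simp: split_beta intro!: continuous_intros cg)
  have "ennreal (integral {\<epsilon>..\<rho>} (\<lambda>r. integral {0..2*pi} (\<lambda>\<theta>. r * (tpr r \<theta>)\<^sup>2 + (tpt r \<theta>)\<^sup>2 / r)))
     = ennreal (integral {\<epsilon>..\<rho>} (\<lambda>r. integral {0..2*pi} (?h r)))"
    by (rule arg_cong[where f = ennreal]) (rule integral_cong[OF i])
  also have "\<dots> = (\<integral>\<^sup>+ r. ennreal (integral {0..2*pi} (?h r)) * indicator {\<epsilon>..\<rho>} r \<partial>lborel)"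
    by (rule nn_integral_continuous_Icc[symmetric, OF c2]) (use p1 e in auto)
  also have "\<dots> \<le> (\<integral>\<^sup>+ r. (\<integral>\<^sup>+ \<theta>. ennreal r * ennreal ((norm (grad \<phi> (pol r \<theta>)))\<^sup>2) * indicator {0<..<2*pi} \<theta> \<partial>lborel) * indicator {0<..<1} r \<partial>lborel)"
  proof (rule nn_integral_mono)
    fix r :: real
    show "ennreal (integral {0..2*pi} (?h r)) * indicator {\<epsilon>..\<rho>} r
      \<le> (\<integral>\<^sup>+ \<theta>. ennreal r * ennreal ((norm (grad \<phi> (pol r \<theta>)))\<^sup>2) * indicator {0<..<2*pi} \<theta> \<partial>lborel) * indicator {0<..<1} r"
    proof (cases "r \<in> {\<epsilon>..\<rho>}")
      case True
      then have r: "0 < r" "r < 1" using e by auto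
      have "ennreal (integral {0..2*pi} (?h r)) = (\<integral>\<^sup>+ \<theta>. ennreal (?h r \<theta>) * indicator {0<..<2*pi} \<theta> \<partial>lborel)"
        by (rule nn_integral_continuous_Ioo[symmetric, OF c1]) (use r in auto)
      also have "\<dots> = (\<integral>\<^sup>+ \<theta>. ennreal r * ennreal ((norm (grad \<phi> (pol r \<theta>)))\<^sup>2) * indicator {0<..<2*pi} \<theta> \<partial>lborel)"
        using r by (intro nn_integral_cong) (simp add: ennreal_mult)
      finally show ?thesis using r True by simp
    qed simp
  qed
  also have "\<dots> = L2sq (grad \<phi>)"
  proof -
    have m: "(\<lambda>x. ennreal ((norm (grad \<phi> x))\<^sup>2)) \<in> borel_measurable borel"
      using borel_measurable_continuous_onI[OF continuous_grad[OF \<phi>]] by measurable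
    show ?thesis unfolding nn_integral_disc[OF m] nn_integral_polar[OF m] ..
  qed
  finally show ?thesis .
qed

lemma cont_angmean: "continuous_on UNIV (angmean \<phi>)"
  unfolding angmean_def[abs_def]
  by (intro continuous_intros integral_continuous_on_param[of _ 0 "2*pi", simplified])
    (auto simp: split_beta intro!: cont_pol continuous_intros test_continuous[OF \<phi>])

lemma cont_angvar: "continuous_on UNIV (angvar b \<phi>)"
  unfolding angvar_def[abs_def]
  by (intro integral_continuous_on_param[of _ 0 "2*pi", simplified])
    (auto simp: split_beta intro!: continuous_intros cont_pol test_continuous[OF \<phi>] continuous_on_compose2[OF cont_angmean])

lemma angvar_nonneg: "0 \<le> angvar b \<phi> r"
  unfolding angvar_def
  by (intro integral_nonneg integrable_continuous_interval)
    (auto intro!: continuous_intros cont_pol test_continuous[OF \<phi>])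

text \<open>On the degenerate circle of radius 0 the function is constant and equals its mean. This
  removes the boundary term at the origin when \<open>w\<close> is only bounded below.\<close>

lemma angvar_0: "angvar True \<phi> 0 = 0"
proof -
  have "pol 0 \<theta> = 0" for \<theta> by (simp add: vec_eq_iff forall_2)
  then show ?thesis by (simp add: angvar_def angmean_def)
qed

text \<open>\<open>annulus_bound\<close> with inner radius \<open>e n\<close> tending to 0. The
  inner boundary term is at worst \<open>- C * angvar b \<phi> (e n)\<close>, which tends to 0
  either because \<open>C = 0\<close> or because means are removed: hence the alternative
  \<open>b \<or> C = 0\<close>.\<close>

lemma test_lower_bound:
  assumes w: "\<And>x. 0 < x \<Longrightarrow> x < 1 \<Longrightarrow> (w has_real_derivative w' x) (at x)"
    and cw: "continuous_on {0<..<1} w'" and cq: "continuous_on {0<..<1} q"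
    and q: "\<And>x. 0 < x \<Longrightarrow> x < 1 \<Longrightarrow> (q x - of_bool b) / x \<le> w' x - (w x)\<^sup>2 / x"
    and q0: "\<And>x. 0 < x \<Longrightarrow> x < 1 \<Longrightarrow> 0 \<le> q x"
    and C: "0 \<le> C" "0 < \<delta>" "\<And>x. 0 < x \<Longrightarrow> x < \<delta> \<Longrightarrow> - C \<le> w x" "b \<or> C = 0"
  shows "(\<integral>\<^sup>+ r. ennreal (q r / r * angvar b \<phi> r) * indicator {0<..<1} r \<partial>lborel) \<le> L2sq (grad \<phi>)"
proof -
  obtain \<rho> where \<rho>: "0 < \<rho>" "\<rho> < 1" "\<And>x. \<rho> \<le> norm x \<Longrightarrow> \<phi> x = 0"
    using test_support[OF \<phi>] by blast
  define m where "m = min (min \<delta> \<rho>) 1 / 2"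
  have m: "0 < m" "m < \<delta>" "m < \<rho>" using C \<rho> by (auto simp: m_def min_def)
  define e where "e n = m * inverse (real (Suc n))" for n
  have e: "0 < e n" "e n < \<delta>" "e n \<le> \<rho>" for n
  proof -
    have "inverse (real (Suc n)) \<le> 1" by (simp add: field_simps)
    then have "e n \<le> m * 1" unfolding e_def using m by (intro mult_left_mono) auto
    then show "e n < \<delta>" "e n \<le> \<rho>" using m by linarith+
    show "0 < e n" using m by (simp add: e_def)
  qed
  have e0: "e \<longlonglongrightarrow> 0"
    using tendsto_mult_left[OF LIMSEQ_inverse_real_of_nat, of m] by (simp add: e_def[abs_def])
  let ?f = "\<lambda>r. q r / r * angvar b \<phi> r"
  have av0: "angvar b \<phi> r = 0" if "\<rho> \<le> r" for r
    using that \<rho> by (simp add: angvar_def angmean_def)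
  have fnn: "0 \<le> ?f r" if "0 < r" "r < 1" for r using q0[OF that] that angvar_nonneg by simp
  have bound: "(\<integral>\<^sup>+ r. ennreal (?f r) * indicator {e n..\<rho>} r \<partial>lborel) \<le> L2sq (grad \<phi>) + ennreal (C * angvar b \<phi> (e n))" for n
  proof -
    have sub: "{e n..\<rho>} \<subseteq> {0<..<1}" using e[of n] \<rho> by auto
    have cf: "continuous_on {e n..\<rho>} ?f"
      by (intro continuous_intros continuous_on_subset[OF cq] continuous_on_subset[OF cont_angvar] sub) (use e[of n] in auto)
    have ab: "w (e n) * integral {0..2*pi} (\<lambda>t. (tp (e n) t - of_bool b * (integral {0..2*pi} (tp (e n)) / (2*pi)))\<^sup>2) +
      integral {e n..\<rho>} (\<lambda>r. integral {0..2*pi} (\<lambda>t. q r / r * (tp r t - of_bool b * (integral {0..2*pi} (tp r) / (2*pi)))\<^sup>2))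
      \<le> integral {e n..\<rho>} (\<lambda>r. integral {0..2*pi} (\<lambda>t. r * (tpr r t)\<^sup>2 + (tpt r t)\<^sup>2 / r))"
    proof (rule annulus_bound[where w' = w'])
      show "continuous_on UNIV (\<lambda>(r, t). tp r t)" "continuous_on UNIV (\<lambda>(r, t). tpr r t)" "continuous_on UNIV (\<lambda>(r, t). tpt r t)"
        unfolding split_beta by (intro cont_tp continuous_intros)+
      show "tp \<rho> t = 0" for t unfolding tp_def using \<rho> by (intro \<rho>(3)) simp
      fix x assume x: "x \<in> {e n..\<rho>}"
      then have x': "0 < x" "x < 1" using sub by auto
      show "(w has_real_derivative w' x) (at x within {e n..\<rho>})" using w[OF x'] DERIV_subset by blast
      show "(q x - of_bool b) / x \<le> w' x - (w x)\<^sup>2 / x" by (rule q[OF x'])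
    qed (use e[of n] continuous_on_subset[OF cw sub] continuous_on_subset[OF cq sub] in
        \<open>auto simp: DERIV_tp_r DERIV_tp_t tp_periodic\<close>)
    have tpe: "tp r = (\<lambda>\<theta>. \<phi> (pol r \<theta>))" for r by (simp add: tp_def fun_eq_iff)
    have av: "integral {0..2*pi} (\<lambda>t. (tp r t - of_bool b * (integral {0..2*pi} (tp r) / (2*pi)))\<^sup>2) = angvar b \<phi> r" for r
      by (simp add: angvar_def angmean_def tpe)
    have "w (e n) * angvar b \<phi> (e n) + integral {e n..\<rho>} ?f \<le> integral {e n..\<rho>} (\<lambda>r. integral {0..2*pi} (\<lambda>t. r * (tpr r t)\<^sup>2 + (tpt r t)\<^sup>2 / r))"
      using ab by (simp only: integral_mult_right av)
    moreover have "- C * angvar b \<phi> (e n) \<le> w (e n) * angvar b \<phi> (e n)"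
      by (intro mult_right_mono C(3) e angvar_nonneg)
    ultimately have "integral {e n..\<rho>} ?f \<le> integral {e n..\<rho>} (\<lambda>r. integral {0..2*pi} (\<lambda>t. r * (tpr r t)\<^sup>2 + (tpt r t)\<^sup>2 / r)) + C * angvar b \<phi> (e n)"
      by simp
    then have "ennreal (integral {e n..\<rho>} ?f) \<le> ennreal (integral {e n..\<rho>} (\<lambda>r. integral {0..2*pi} (\<lambda>t. r * (tpr r t)\<^sup>2 + (tpt r t)\<^sup>2 / r)) + C * angvar b \<phi> (e n))"
      by (rule ennreal_leI)
    also have "\<dots> \<le> ennreal (integral {e n..\<rho>} (\<lambda>r. integral {0..2*pi} (\<lambda>t. r * (tpr r t)\<^sup>2 + (tpt r t)\<^sup>2 / r))) + ennreal (C * angvar b \<phi> (e n))"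
    proof -
      \<comment> \<open>The sign of the first summand is left open, and \<open>ennreal\<close> cuts
        negative reals to 0; for \<open>0 \<le> y\<close> the estimate holds in either case.\<close>
      have "ennreal (x + y) \<le> ennreal x + ennreal y" if "0 \<le> y" for x y :: real
      proof (cases "0 \<le> x")
        case False
        then have "ennreal (x + y) \<le> ennreal y" by (intro ennreal_leI) simp
        then show ?thesis using False by (simp add: ennreal_neg)
      qed (use that in simp)
      then show ?thesis using C(1) angvar_nonneg by simp
    qed
    also have "\<dots> \<le> L2sq (grad \<phi>) + ennreal (C * angvar b \<phi> (e n))"
      by (intro add_right_mono test_energy_annulus e \<rho>)
    finally show ?thesis
      using nn_integral_continuous_Icc[OF cf] fnn sub by force
  qed
  have lim: "(\<lambda>n. \<integral>\<^sup>+ r. ennreal (?f r) * indicator {e n..\<rho>} r \<partial>lborel) \<longlonglongrightarrow> (\<integral>\<^sup>+ r. ennreal (?f r) * indicator {0<..<1} r \<partial>lborel)"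
  proof (rule nn_integral_LIMSEQ)
    have dec: "e (Suc n) \<le> e n" for n
      unfolding e_def using m by (intro mult_left_mono) (auto simp: field_simps)
    show "incseq (\<lambda>n r. ennreal (?f r) * indicator {e n..\<rho>} r)"
      by (rule incseq_SucI) (auto simp: le_fun_def indicator_def intro: order_trans[OF dec])
    show "(\<lambda>r. ennreal (?f r) * indicator {e n..\<rho>} r) \<in> borel_measurable lborel" for n
    proof -
      have sub: "{e n..\<rho>} \<subseteq> {0<..<1}" using e[of n] \<rho> by auto
      have "continuous_on {e n..\<rho>} ?f"
        by (intro continuous_intros continuous_on_subset[OF cq] continuous_on_subset[OF cont_angvar] sub) (use e[of n] in auto)
      then have "(\<lambda>r. indicator {e n..\<rho>} r *\<^sub>R ?f r) \<in> borel_measurable borel"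
        by (intro borel_measurable_continuous_on_indicator) auto
      then have "(\<lambda>r. ennreal (indicator {e n..\<rho>} r *\<^sub>R ?f r)) \<in> borel_measurable borel" by measurable
      moreover have "(\<lambda>r. ennreal (indicator {e n..\<rho>} r *\<^sub>R ?f r)) = (\<lambda>r. ennreal (?f r) * indicator {e n..\<rho>} r)"
        by (auto simp: fun_eq_iff indicator_def)
      ultimately show ?thesis by simp
    qed
    fix r :: real
    have "\<forall>\<^sub>F n in sequentially. ennreal (?f r) * indicator {e n..\<rho>} r = ennreal (?f r) * indicator {0<..<1} r"
    proof (cases "0 < r")
      case True
      then have "\<forall>\<^sub>F n in sequentially. e n < r" using e0 by (rule order_tendstoD(2)[rotated])
      then show ?thesis
        by eventually_elim (use True \<rho> av0[of r] in \<open>auto simp: indicator_def\<close>)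
    next
      case False
      have "r \<notin> {e n..\<rho>}" for n using e(1)[of n] False by auto
      then show ?thesis using False by simp
    qed
    then show "(\<lambda>n. ennreal (?f r) * indicator {e n..\<rho>} r) \<longlonglongrightarrow> ennreal (?f r) * indicator {0<..<1} r"
      by (rule tendsto_eventually)
  qed
  have "(\<lambda>n. C * angvar b \<phi> (e n)) \<longlonglongrightarrow> C * angvar b \<phi> 0"
    by (intro tendsto_intros continuous_on_tendsto_compose[OF cont_angvar e0]) auto
  moreover have "C * angvar b \<phi> 0 = 0" using C(4) angvar_0 by (cases b) auto
  ultimately have "(\<lambda>n. L2sq (grad \<phi>) + ennreal (C * angvar b \<phi> (e n))) \<longlonglongrightarrow> L2sq (grad \<phi>) + ennreal 0"
    by (intro tendsto_add tendsto_const tendsto_ennrealI) simp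
  then show ?thesis using LIMSEQ_le[OF lim, of _ "L2sq (grad \<phi>) + ennreal 0"] bound by fastforce
qed

end

section \<open>Passage from test functions to \<open>H01\<close>\<close>

definition ang :: "(real^2 \<Rightarrow> ennreal) \<Rightarrow> real \<Rightarrow> ennreal" where
  "ang h r = (\<integral>\<^sup>+ \<theta>. h (pol r \<theta>) \<partial>lebesgue_on {0..2*pi})"

lemma pol_measurable [measurable]: "(\<lambda>\<theta>. pol r \<theta>) \<in> borel_measurable borel"
  by (intro borel_measurable_continuous_onI continuous_intros)

lemma ang_eq:
  assumes h: "h \<in> borel_measurable borel"
  shows "ang h r = (\<integral>\<^sup>+ \<theta>. h (pol r \<theta>) * indicator {0<..<2*pi} \<theta> \<partial>lborel)"
proof -
  have [measurable]: "(\<lambda>\<theta>. h (pol r \<theta>)) \<in> borel_measurable borel"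
    by (rule measurable_compose[OF pol_measurable h])
  have "ang h r = (\<integral>\<^sup>+ \<theta>. h (pol r \<theta>) * indicator {0..2*pi} \<theta> \<partial>lborel)"
    unfolding ang_def by (subst nn_integral_restrict_space) (auto simp: nn_integral_completion)
  also have "\<dots> = (\<integral>\<^sup>+ \<theta>. h (pol r \<theta>) * indicator {0<..<2*pi} \<theta> \<partial>lborel)"
  proof (rule nn_integral_cong_AE)
    have "AE \<theta> in lborel. \<theta> \<noteq> 0" "AE \<theta> in lborel. \<theta> \<noteq> 2*pi" by (rule AE_lborel_singleton)+
    then show "AE \<theta> in lborel. h (pol r \<theta>) * indicator {0..2*pi} \<theta> = h (pol r \<theta>) * indicator {0<..<2*pi} \<theta>"
      by eventually_elim (auto simp: indicator_def)
  qed
  finally show ?thesis .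
qed

lemma ang_measurable:
  assumes h: "h \<in> borel_measurable borel"
  shows "ang h \<in> borel_measurable borel"
proof -
  have "(\<lambda>p. pol (fst p) (snd p)) \<in> borel_measurable (borel :: (real \<times> real) measure)"
    by (intro borel_measurable_continuous_onI continuous_intros)
  from measurable_compose[OF this h]
  have [measurable]: "(\<lambda>p. h (pol (fst p) (snd p))) \<in> borel_measurable (borel \<Otimes>\<^sub>M lborel)"
    by (simp add: borel_prod[symmetric] cong: measurable_cong_sets)
  have "(\<lambda>r. \<integral>\<^sup>+ \<theta>. h (pol r \<theta>) * indicator {0<..<2*pi} \<theta> \<partial>lborel) \<in> borel_measurable borel"
    by (rule lborel.borel_measurable_nn_integral) (simp add: split_beta)
  then show ?thesis by (simp add: ang_eq[OF h, abs_def])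
qed

lemma polar_ang:
  assumes h: "h \<in> borel_measurable borel"
  shows "(\<integral>\<^sup>+ x. h x \<partial>lebesgue_on unit_disc) = (\<integral>\<^sup>+ r. ennreal r * ang h r * indicator {0<..<1} r \<partial>lborel)"
proof -
  have [measurable]: "(\<lambda>\<theta>. h (pol r \<theta>)) \<in> borel_measurable borel" for r
    by (rule measurable_compose[OF pol_measurable h])
  show ?thesis
    unfolding nn_integral_disc[OF h] nn_integral_polar[OF h] ang_eq[OF h]
    by (intro nn_integral_cong) (simp add: mult.assoc nn_integral_cmult)
qed

text \<open>A null set of the disc, enlarged to a Borel null set, meets almost every circle in a
  null set of angles, by the polar formula. This lets \<open>u\<close> be replaced by a Borel
  representative circle by circle.\<close>

lemma AE_polar:
  assumes "AE x in lebesgue_on unit_disc. P x"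
  shows "AE r in lborel. 0 < r \<and> r < 1 \<longrightarrow> (AE \<theta> in lebesgue_on {0..2*pi}. P (pol r \<theta>))"
proof -
  have "AE x in lborel. x \<in> unit_disc \<longrightarrow> P x"
    using assms by (simp add: AE_restrict_space_iff AE_completion_iff)
  then obtain N where N: "{x \<in> space lborel. \<not> (x \<in> unit_disc \<longrightarrow> P x)} \<subseteq> N" "emeasure lborel N = 0" "N \<in> sets lborel"
    by (rule AE_E)
  have Nb: "indicator N \<in> borel_measurable (borel :: (real^2) measure)" using N(3) by (intro borel_measurable_indicator) simp
  have "(\<integral>\<^sup>+ x. indicator N x \<partial>lebesgue_on unit_disc) \<le> (\<integral>\<^sup>+ x. indicator N x \<partial>lborel)"
    unfolding nn_integral_disc[OF Nb] by (intro nn_integral_mono) (auto simp: indicator_def)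
  also have "\<dots> = 0" using N by simp
  finally have "(\<integral>\<^sup>+ r. ennreal r * ang (indicator N) r * indicator {0<..<1} r \<partial>lborel) = 0"
    unfolding polar_ang[OF Nb] by simp
  moreover have [measurable]: "ang (indicator N) \<in> borel_measurable borel" by (rule ang_measurable[OF Nb])
  ultimately have "AE r in lborel. ennreal r * ang (indicator N) r * indicator {0<..<1} r = 0"
    by (subst (asm) nn_integral_0_iff_AE) auto
  then show ?thesis
  proof eventually_elim
    case (elim r)
    show ?case
    proof (intro impI)
      assume r: "0 < r \<and> r < 1"
      then have "ang (indicator N) r = 0" using elim by (simp add: ennreal_eq_0_iff)
      then have "AE \<theta> in lebesgue_on {0..2*pi}. indicator N (pol r \<theta>) = (0::ennreal)"
        unfolding ang_def by (subst (asm) nn_integral_0_iff_AE)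
          (auto intro!: borel_measurable_disc measurable_compose[OF pol_measurable Nb])
      then show "AE \<theta> in lebesgue_on {0..2*pi}. P (pol r \<theta>)"
      proof eventually_elim
        case (elim \<theta>)
        then have "pol r \<theta> \<notin> N" by (auto simp: indicator_def split: if_splits)
        moreover have "pol r \<theta> \<in> unit_disc" using r by simp
        ultimately show ?case using N(1) unfolding space_lborel space_borel by blast
      qed
    qed
  qed
qed

text \<open>The variance about \<open>m\<close> is nonnegative; if the square is not integrable, the
  right-hand side is infinite.\<close>

lemma mean_square_le:
  fixes h :: "real \<Rightarrow> real"
  assumes h: "integrable (lebesgue_on {0..2*pi}) h" and m: "(LINT \<theta>|lebesgue_on {0..2*pi}. h \<theta>) = 2 * pi * m"
  shows "ennreal (2 * pi * m\<^sup>2) \<le> (\<integral>\<^sup>+ \<theta>. ennreal ((h \<theta>)\<^sup>2) \<partial>lebesgue_on {0..2*pi})"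
proof (cases "(\<integral>\<^sup>+ \<theta>. ennreal ((h \<theta>)\<^sup>2) \<partial>lebesgue_on {0..2*pi}) < \<infinity>")
  case True
  have i2: "integrable (lebesgue_on {0..2*pi}) (\<lambda>\<theta>. (h \<theta>)\<^sup>2)"
    by (rule integrableI_bounded) (use h True in auto)
  have ic: "integrable (lebesgue_on {0..2*pi}) (\<lambda>_. c)" for c :: real
    by (intro continuous_imp_integrable_real continuous_intros)
  have mc: "(LINT \<theta>|lebesgue_on {0..2*pi}. m\<^sup>2) = 2 * pi * m\<^sup>2"
  proof -
    have "(LINT \<theta>|lebesgue_on {0..2*pi}. m\<^sup>2) = integral {0..2*pi} (\<lambda>\<theta>. m\<^sup>2)"
      by (rule lebesgue_integral_eq_integral[OF ic]) simp
    also have "\<dots> = 2 * pi * m\<^sup>2" by simp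
    finally show ?thesis .
  qed
  have "0 \<le> (LINT \<theta>|lebesgue_on {0..2*pi}. (h \<theta> - m)\<^sup>2)" by (rule integral_nonneg_AE) simp
  also have "\<dots> = (LINT \<theta>|lebesgue_on {0..2*pi}. (h \<theta>)\<^sup>2 - 2 * m * h \<theta> + m\<^sup>2)"
    by (intro Bochner_Integration.integral_cong) (auto simp: power2_eq_square algebra_simps)
  also have "\<dots> = (LINT \<theta>|lebesgue_on {0..2*pi}. (h \<theta>)\<^sup>2) - 2 * m * (2 * pi * m) + 2 * pi * m\<^sup>2"
    using i2 h ic by (simp only: Bochner_Integration.integral_add Bochner_Integration.integral_diff
        Bochner_Integration.integrable_diff integrable_mult_right integral_mult_right_zero m mc)
  finally have "2 * pi * m\<^sup>2 \<le> (LINT \<theta>|lebesgue_on {0..2*pi}. (h \<theta>)\<^sup>2)" by (simp add: power2_eq_square)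
  then show ?thesis
    using nn_integral_eq_integral[OF i2] by (simp add: ennreal_leI)
next
  case False
  then have "(\<integral>\<^sup>+ \<theta>. ennreal ((h \<theta>)\<^sup>2) \<partial>lebesgue_on {0..2*pi}) = \<infinity>" by (simp flip: less_top)
  then show ?thesis by simp
qed

text \<open>The circle means of an approximant need not vanish. If \<open>u\<close> has mean zero,
  the mean \<open>m\<close> of \<open>\<phi>\<close> is the mean of \<open>\<phi> - u\<close>, so
  \<open>mean_square_le\<close> bounds it by the distance of the two; splitting the square with a
  factor 2 on each part gives the 4.\<close>

lemma angular_comparison:
  fixes u :: "real^2 \<Rightarrow> real"
  assumes \<phi>: "\<phi> \<in> test_functions" and u: "u \<in> borel_measurable borel"
    and z: "b \<Longrightarrow> has_bochner_integral (lebesgue_on {0..2*pi}) (\<lambda>\<theta>. u (pol r \<theta>)) 0" and d: "0 < d"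
  shows "ang (\<lambda>x. ennreal ((u x)\<^sup>2)) r \<le> ennreal (1 + d) * ennreal (angvar b \<phi> r)
    + ennreal (1 + 1/d) * (4 * ang (\<lambda>x. ennreal ((\<phi> x - u x)\<^sup>2)) r)"
proof -
  let ?T = "lebesgue_on {0..2*pi}"
  define m where "m = of_bool b * angmean \<phi> r"
  let ?f = "\<lambda>\<theta>. u (pol r \<theta>)" and ?g = "\<lambda>\<theta>. \<phi> (pol r \<theta>) - m" and ?h = "\<lambda>\<theta>. \<phi> (pol r \<theta>) - u (pol r \<theta>)"
  have cp: "continuous_on S (\<lambda>\<theta>. \<phi> (pol r \<theta>))" for S
    by (rule cont_pol[OF \<phi> test_continuous[OF \<phi>]]) (auto intro: continuous_intros)
  have mp: "(\<lambda>\<theta>. \<phi> (pol r \<theta>)) \<in> borel_measurable ?T"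
    using borel_measurable_continuous_onI[OF cp] by (rule borel_measurable_disc)
  have mf: "?f \<in> borel_measurable ?T"
    by (rule borel_measurable_disc) (rule measurable_compose[OF pol_measurable u])
  have mg: "?g \<in> borel_measurable ?T" using mp by simp
  have 1: "(\<integral>\<^sup>+ \<theta>. ennreal ((norm (?f \<theta>))\<^sup>2) \<partial>?T) \<le> ennreal (1 + d) * (\<integral>\<^sup>+ \<theta>. ennreal ((norm (?g \<theta>))\<^sup>2) \<partial>?T)
     + ennreal (1 + 1/d) * (\<integral>\<^sup>+ \<theta>. ennreal ((norm (?f \<theta> - ?g \<theta>))\<^sup>2) \<partial>?T)"
    by (rule nn_integral_L2_split[OF mf mg d])
  have 2: "(\<integral>\<^sup>+ \<theta>. ennreal ((norm (?g \<theta>))\<^sup>2) \<partial>?T) = ennreal (angvar b \<phi> r)"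
  proof -
    have c: "continuous_on S (\<lambda>\<theta>. (?g \<theta>)\<^sup>2)" for S by (intro continuous_intros cp)
    have "(\<integral>\<^sup>+ \<theta>. ennreal ((?g \<theta>)\<^sup>2) \<partial>?T) = (\<integral>\<^sup>+ \<theta>. ennreal ((?g \<theta>)\<^sup>2) * indicator {0..2*pi} \<theta> \<partial>lborel)"
      using borel_measurable_continuous_onI[OF c] by (subst nn_integral_restrict_space) (auto simp: nn_integral_completion)
    also have "\<dots> = ennreal (integral {0..2*pi} (\<lambda>\<theta>. (?g \<theta>)\<^sup>2))" by (rule nn_integral_continuous_Icc[OF c]) simp
    finally show ?thesis by (simp add: angvar_def m_def)
  qed
  have 3: "(\<integral>\<^sup>+ \<theta>. ennreal ((norm (?f \<theta> - ?g \<theta>))\<^sup>2) \<partial>?T) \<le> 4 * (\<integral>\<^sup>+ \<theta>. ennreal ((?h \<theta>)\<^sup>2) \<partial>?T)"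
  proof (cases b)
    case False
    then have "(\<integral>\<^sup>+ \<theta>. ennreal ((norm (?f \<theta> - ?g \<theta>))\<^sup>2) \<partial>?T) = 1 * (\<integral>\<^sup>+ \<theta>. ennreal ((?h \<theta>)\<^sup>2) \<partial>?T)"
      by (simp add: m_def power2_commute)
    also have "\<dots> \<le> 4 * (\<integral>\<^sup>+ \<theta>. ennreal ((?h \<theta>)\<^sup>2) \<partial>?T)" by (rule mult_right_mono) auto
    finally show ?thesis .
  next
    case True
    have ip: "integrable ?T (\<lambda>\<theta>. \<phi> (pol r \<theta>))" by (rule continuous_imp_integrable_real[OF cp])
    have iu: "integrable ?T ?f" "(LINT \<theta>|?T. ?f \<theta>) = 0"
      using z[OF True] by (auto simp: has_bochner_integral_iff)
    have "(LINT \<theta>|?T. \<phi> (pol r \<theta>)) = integral {0..2*pi} (\<lambda>\<theta>. \<phi> (pol r \<theta>))"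
      by (rule lebesgue_integral_eq_integral[OF ip]) simp
    then have "(LINT \<theta>|?T. ?h \<theta>) = 2 * pi * m"
      using ip iu True by (simp add: m_def angmean_def)
    then have D: "ennreal (2 * pi * m\<^sup>2) \<le> (\<integral>\<^sup>+ \<theta>. ennreal ((?h \<theta>)\<^sup>2) \<partial>?T)"
      by (intro mean_square_le Bochner_Integration.integrable_diff ip iu)
    have "(\<integral>\<^sup>+ \<theta>. ennreal ((norm (?f \<theta> - ?g \<theta>))\<^sup>2) \<partial>?T) \<le> (\<integral>\<^sup>+ \<theta>. 2 * ennreal ((?h \<theta>)\<^sup>2) + ennreal (2 * m\<^sup>2) \<partial>?T)"
    proof (rule nn_integral_mono)
      fix \<theta>
      have "0 \<le> (?h \<theta> + m)\<^sup>2" by simp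
      then have "(norm (?f \<theta> - ?g \<theta>))\<^sup>2 \<le> 2 * (?h \<theta>)\<^sup>2 + 2 * m\<^sup>2" by (simp add: power2_eq_square algebra_simps)
      then have "ennreal ((norm (?f \<theta> - ?g \<theta>))\<^sup>2) \<le> ennreal (2 * (?h \<theta>)\<^sup>2 + 2 * m\<^sup>2)" by (rule ennreal_leI)
      also have "\<dots> = 2 * ennreal ((?h \<theta>)\<^sup>2) + ennreal (2 * m\<^sup>2)" by (simp add: ennreal_mult)
      finally show "ennreal ((norm (?f \<theta> - ?g \<theta>))\<^sup>2) \<le> 2 * ennreal ((?h \<theta>)\<^sup>2) + ennreal (2 * m\<^sup>2)" .
    qed
    also have "\<dots> = 2 * (\<integral>\<^sup>+ \<theta>. ennreal ((?h \<theta>)\<^sup>2) \<partial>?T) + ennreal (2 * m\<^sup>2) * ennreal (2 * pi)"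
      using mf mp by (simp add: nn_integral_add nn_integral_cmult emeasure_restrict_space)
    also have "ennreal (2 * m\<^sup>2) * ennreal (2 * pi) = 2 * ennreal (2 * pi * m\<^sup>2)"
      by (simp add: mult_ac flip: ennreal_mult ennreal_numeral)
    also have "2 * (\<integral>\<^sup>+ \<theta>. ennreal ((?h \<theta>)\<^sup>2) \<partial>?T) + 2 * ennreal (2 * pi * m\<^sup>2) \<le> 2 * (\<integral>\<^sup>+ \<theta>. ennreal ((?h \<theta>)\<^sup>2) \<partial>?T) + 2 * (\<integral>\<^sup>+ \<theta>. ennreal ((?h \<theta>)\<^sup>2) \<partial>?T)"
      by (intro add_left_mono mult_left_mono D) simp
    also have "\<dots> = 4 * (\<integral>\<^sup>+ \<theta>. ennreal ((?h \<theta>)\<^sup>2) \<partial>?T)" by (simp flip: distrib_right)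
    finally show ?thesis .
  qed
  have "ang (\<lambda>x. ennreal ((u x)\<^sup>2)) r = (\<integral>\<^sup>+ \<theta>. ennreal ((norm (?f \<theta>))\<^sup>2) \<partial>?T)" by (simp add: ang_def)
  also have "\<dots> \<le> ennreal (1 + d) * ennreal (angvar b \<phi> r) + ennreal (1 + 1/d) * (\<integral>\<^sup>+ \<theta>. ennreal ((norm (?f \<theta> - ?g \<theta>))\<^sup>2) \<partial>?T)"
    using 1 unfolding 2 .
  also have "\<dots> \<le> ennreal (1 + d) * ennreal (angvar b \<phi> r) + ennreal (1 + 1/d) * (4 * (\<integral>\<^sup>+ \<theta>. ennreal ((?h \<theta>)\<^sup>2) \<partial>?T))"
    by (intro add_left_mono mult_left_mono 3) simp
  finally show ?thesis by (simp add: ang_def)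
qed

text \<open>Lebesgue measurability on the disc is not inherited by every single circle, whereas a
  Borel function restricts to all of them.\<close>

lemma borel_representative:
  fixes u :: "real^2 \<Rightarrow> real"
  assumes "u \<in> borel_measurable (lebesgue_on unit_disc)"
  shows "\<exists>v\<in>borel_measurable borel. AE x in lebesgue_on unit_disc. u x = v x"
proof -
  have "(\<lambda>x. indicator unit_disc x *\<^sub>R u x) \<in> borel_measurable (completion lborel)"
    using assms by (subst (asm) borel_measurable_restrict_space_iff) auto
  from completion_ex_borel_measurable_real[OF this]
  obtain v where v: "v \<in> borel_measurable lborel" "AE x in lborel. indicator unit_disc x *\<^sub>R u x = v x" by blast
  have "AE x in lborel. x \<in> unit_disc \<longrightarrow> u x = v x" using v(2) by eventually_elim auto
  then have "AE x in lebesgue_on unit_disc. u x = v x"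
    by (simp add: AE_restrict_space_iff AE_completion_iff)
  then show ?thesis using v(1) by auto
qed

lemma ennreal_le_mult_limit:
  fixes x y :: ennreal
  assumes "\<And>d. 0 < d \<Longrightarrow> x \<le> ennreal ((1 + d)\<^sup>2) * y"
  shows "x \<le> y"
proof (cases "y = \<infinity>")
  case False
  have "(\<lambda>n. (1 + inverse (real (Suc n)))\<^sup>2) \<longlonglongrightarrow> (1 + 0)\<^sup>2"
    by (intro tendsto_intros LIMSEQ_inverse_real_of_nat)
  then have "(\<lambda>n. ennreal ((1 + inverse (real (Suc n)))\<^sup>2)) \<longlonglongrightarrow> ennreal 1"
    by (intro tendsto_ennrealI) simp
  then have "(\<lambda>n. y * ennreal ((1 + inverse (real (Suc n)))\<^sup>2)) \<longlonglongrightarrow> y * ennreal 1"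
    by (intro ennreal_tendsto_cmult) (use False in \<open>auto simp: less_top\<close>)
  then show ?thesis
    by (intro LIMSEQ_le_const[of _ y x]) (use assms in \<open>auto simp: mult.commute\<close>)
qed simp

lemma indicator_mono: "A \<subseteq> B \<Longrightarrow> indicator A x \<le> (indicator B x :: ennreal)"
  by (auto simp: indicator_def)

text \<open>\<open>test_lower_bound\<close> holds for the approximants and
  \<open>angular_comparison\<close> transfers it to \<open>u\<close>. Since the weight may blow up
  at both ends of the unit interval, the transfer is made on
  \<open>{\<epsilon>..1-\<epsilon>}\<close>; monotone convergence then removes
  \<open>\<epsilon>\<close>.\<close>

lemma H01_lower_bound:
  fixes w w' q :: "real \<Rightarrow> real"
  assumes w: "\<And>x. 0 < x \<Longrightarrow> x < 1 \<Longrightarrow> (w has_real_derivative w' x) (at x)"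
    and cw: "continuous_on {0<..<1} w'" and cq: "continuous_on {0<..<1} q" and mq [measurable]: "q \<in> borel_measurable borel"
    and q: "\<And>x. 0 < x \<Longrightarrow> x < 1 \<Longrightarrow> (q x - of_bool b) / x \<le> w' x - (w x)\<^sup>2 / x"
    and q0: "\<And>x. 0 < x \<Longrightarrow> x < 1 \<Longrightarrow> 0 \<le> q x"
    and C: "0 \<le> C" "0 < \<delta>" "\<And>x. 0 < x \<Longrightarrow> x < \<delta> \<Longrightarrow> - C \<le> w x" "b \<or> C = 0"
    and u: "has_H01_gradient u G" and z: "b \<Longrightarrow> zero_spherical_average u"
  shows "(\<integral>\<^sup>+ x. ennreal (q (norm x) / (norm x)\<^sup>2 * (u x)\<^sup>2) \<partial>lebesgue_on unit_disc) \<le> L2sq G"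
proof -
  have mu: "u \<in> borel_measurable (lebesgue_on unit_disc)" and mG: "G \<in> borel_measurable (lebesgue_on unit_disc)"
    using u by (auto simp: has_H01_gradient_def)
  obtain v where v [measurable]: "v \<in> borel_measurable borel" and uv: "AE x in lebesgue_on unit_disc. u x = v x"
    using borel_representative[OF mu] by blast
  obtain \<phi> where \<phi>: "\<And>n. \<phi> n \<in> test_functions" "L2_tendsto \<phi> u" "L2_tendsto (\<lambda>n. grad (\<phi> n)) G"
    using u unfolding has_H01_gradient_def by blast
  have zero_mean: "AE r in lborel. 0 < r \<and> r < 1 \<longrightarrow> (b \<longrightarrow> has_bochner_integral (lebesgue_on {0..2*pi}) (\<lambda>\<theta>. v (pol r \<theta>)) 0)"
  proof (cases b)
    case True
    have "AE r in lborel. r \<in> {0..1} \<longrightarrow> has_bochner_integral (lebesgue_on {0..2*pi}) (\<lambda>\<theta>. u (pol r \<theta>)) 0"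
      using z[OF True] unfolding zero_spherical_average_def by (simp add: AE_restrict_space_iff AE_completion_iff)
    with AE_polar[OF uv] show ?thesis
    proof eventually_elim
      case (elim r)
      show ?case
      proof (intro impI)
        assume r: "0 < r \<and> r < 1"
        then have h: "has_bochner_integral (lebesgue_on {0..2*pi}) (\<lambda>\<theta>. u (pol r \<theta>)) 0" using elim by auto
        have ae: "AE \<theta> in lebesgue_on {0..2*pi}. u (pol r \<theta>) = v (pol r \<theta>)" using elim r by blast
        have mv: "(\<lambda>\<theta>. v (pol r \<theta>)) \<in> borel_measurable (lebesgue_on {0..2*pi})"
          by (rule borel_measurable_disc) (rule measurable_compose[OF pol_measurable v])
        show "has_bochner_integral (lebesgue_on {0..2*pi}) (\<lambda>\<theta>. v (pol r \<theta>)) 0"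
          using has_bochner_integralI_AE[OF h mv ae] .
      qed
    qed
  qed simp
  let ?U = "ang (\<lambda>x. ennreal ((v x)\<^sup>2))"
  have mU [measurable]: "?U \<in> borel_measurable borel" by (rule ang_measurable) measurable
  define X where "X \<epsilon> = (\<integral>\<^sup>+ r. ennreal (q r / r) * ?U r * indicator {\<epsilon>..1-\<epsilon>} r \<partial>lborel)" for \<epsilon>
  have X_le: "X \<epsilon> \<le> L2sq G" if e: "0 < \<epsilon>" for \<epsilon>
  proof (rule ennreal_le_mult_limit)
    fix d :: real assume d: "0 < d"
    have sub: "{\<epsilon>..1-\<epsilon>} \<subseteq> {0<..<1}" using e by auto
    \<comment> \<open>On the truncated interval the weight \<open>q r / r\<close> is at most
      \<open>K\<close> times the polar density \<open>r\<close>, so the L2 distance on the disc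
      controls the weighted error.\<close>
    obtain K where K: "0 \<le> K" "\<And>r. r \<in> {\<epsilon>..1-\<epsilon>} \<Longrightarrow> q r / r \<le> K * r"
    proof -
      have "continuous_on {\<epsilon>..1-\<epsilon>} (\<lambda>r. q r / r\<^sup>2)"
        by (intro continuous_intros continuous_on_subset[OF cq sub]) (use e in auto)
      then have "bounded ((\<lambda>r. q r / r\<^sup>2) ` {\<epsilon>..1-\<epsilon>})" by (intro compact_imp_bounded compact_continuous_image) auto
      then obtain K where K: "\<forall>y\<in>(\<lambda>r. q r / r\<^sup>2) ` {\<epsilon>..1-\<epsilon>}. norm y \<le> K" unfolding bounded_iff by blast
      show ?thesis
      proof (rule that[of "max 0 K"])
        fix r assume r: "r \<in> {\<epsilon>..1-\<epsilon>}"
        then have "\<bar>q r / r\<^sup>2\<bar> \<le> K" using K by auto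
        then have "q r / r\<^sup>2 \<le> max 0 K" by linarith
        then have "q r / r\<^sup>2 * r \<le> max 0 K * r" using r e by (intro mult_right_mono) auto
        then show "q r / r \<le> max 0 K * r" using r e by (simp add: power2_eq_square)
      qed simp
    qed
    let ?D = "\<lambda>n. ang (\<lambda>x. ennreal ((\<phi> n x - v x)\<^sup>2))"
    let ?c = "ennreal (1 + 1/d) * (4 * ennreal K)"
    have m\<phi> [measurable]: "\<phi> n \<in> borel_measurable borel" for n
      by (rule borel_measurable_continuous_onI[OF test_continuous[OF \<phi>(1)]])
    have mD [measurable]: "?D n \<in> borel_measurable borel" for n by (rule ang_measurable) measurable
    have mav [measurable]: "angvar b (\<phi> n) \<in> borel_measurable borel" for n
      by (rule borel_measurable_continuous_onI[OF cont_angvar[OF \<phi>(1)]])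
    have step: "X \<epsilon> \<le> ennreal (1 + d) * (ennreal (1 + d) * L2sq G + ennreal (1 + 1/d) * L2sq (\<lambda>x. grad (\<phi> n) x - G x))
        + ?c * L2sq (\<lambda>x. \<phi> n x - u x)" for n
    proof -
      have "X \<epsilon> \<le> (\<integral>\<^sup>+ r. ennreal (1 + d) * (ennreal (q r / r * angvar b (\<phi> n) r) * indicator {0<..<1} r)
          + ?c * (ennreal r * ?D n r * indicator {0<..<1} r) \<partial>lborel)"
        unfolding X_def
      proof (rule nn_integral_mono_AE)
        show "AE r in lborel. ennreal (q r / r) * ?U r * indicator {\<epsilon>..1-\<epsilon>} r \<le>
          ennreal (1 + d) * (ennreal (q r / r * angvar b (\<phi> n) r) * indicator {0<..<1} r) + ?c * (ennreal r * ?D n r * indicator {0<..<1} r)"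
          using zero_mean
        proof eventually_elim
          case (elim r)
          show ?case
          proof (cases "r \<in> {\<epsilon>..1-\<epsilon>}")
            case True
            then have r: "0 < r" "r < 1" using sub by auto
            have qr: "0 \<le> q r / r" using q0[OF r] r by simp
            have "?U r \<le> ennreal (1 + d) * ennreal (angvar b (\<phi> n) r) + ennreal (1 + 1/d) * (4 * ?D n r)"
              by (rule angular_comparison[OF \<phi>(1) v _ d]) (use elim r in blast)
            then have "ennreal (q r / r) * ?U r \<le> ennreal (q r / r) * (ennreal (1 + d) * ennreal (angvar b (\<phi> n) r) + ennreal (1 + 1/d) * (4 * ?D n r))"
              by (rule mult_left_mono) simp
            also have "\<dots> = ennreal (1 + d) * (ennreal (q r / r) * ennreal (angvar b (\<phi> n) r)) + ennreal (1 + 1/d) * (4 * (ennreal (q r / r) * ?D n r))"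
              by (simp add: distrib_left mult_ac)
            also have "\<dots> \<le> ennreal (1 + d) * (ennreal (q r / r) * ennreal (angvar b (\<phi> n) r)) + ennreal (1 + 1/d) * (4 * (ennreal (K * r) * ?D n r))"
              by (intro add_left_mono mult_left_mono mult_right_mono ennreal_leI K(2) True) auto
            also have "\<dots> = ennreal (1 + d) * ennreal (q r / r * angvar b (\<phi> n) r) + ?c * (ennreal r * ?D n r)"
            proof -
              have e1: "ennreal (q r / r) * ennreal (angvar b (\<phi> n) r) = ennreal (q r / r * angvar b (\<phi> n) r)"
                by (rule ennreal_mult[OF qr angvar_nonneg[OF \<phi>(1)], symmetric])
              have e2: "ennreal (K * r) = ennreal K * ennreal r" using K(1) r by (simp add: ennreal_mult)
              show ?thesis unfolding e1 e2 by (simp only: mult_ac)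
            qed
            finally show ?thesis using True r by simp
          qed simp
        qed
      qed
      also have "\<dots> = ennreal (1 + d) * (\<integral>\<^sup>+ r. ennreal (q r / r * angvar b (\<phi> n) r) * indicator {0<..<1} r \<partial>lborel)
          + ?c * (\<integral>\<^sup>+ r. ennreal r * ?D n r * indicator {0<..<1} r \<partial>lborel)"
        by (subst nn_integral_add) (auto simp: nn_integral_cmult)
      also have "\<dots> \<le> ennreal (1 + d) * L2sq (grad (\<phi> n)) + ?c * L2sq (\<lambda>x. \<phi> n x - u x)"
      proof (intro add_mono mult_left_mono)
        show "(\<integral>\<^sup>+ r. ennreal (q r / r * angvar b (\<phi> n) r) * indicator {0<..<1} r \<partial>lborel) \<le> L2sq (grad (\<phi> n))"
          by (rule test_lower_bound[OF \<phi>(1) w cw cq q q0 C])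
        have "(\<integral>\<^sup>+ r. ennreal r * ?D n r * indicator {0<..<1} r \<partial>lborel) = (\<integral>\<^sup>+ x. ennreal ((\<phi> n x - v x)\<^sup>2) \<partial>lebesgue_on unit_disc)"
          by (rule polar_ang[symmetric]) measurable
        also have "\<dots> = L2sq (\<lambda>x. \<phi> n x - u x)"
          by (rule nn_integral_cong_AE) (use uv in \<open>auto elim: eventually_mono\<close>)
        finally show "(\<integral>\<^sup>+ r. ennreal r * ?D n r * indicator {0<..<1} r \<partial>lborel) \<le> L2sq (\<lambda>x. \<phi> n x - u x)" by simp
      qed auto
      also have "\<dots> \<le> ennreal (1 + d) * (ennreal (1 + d) * L2sq G + ennreal (1 + 1/d) * L2sq (\<lambda>x. grad (\<phi> n) x - G x))
        + ?c * L2sq (\<lambda>x. \<phi> n x - u x)"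
        by (intro add_right_mono mult_left_mono nn_integral_L2_split test_measurable \<phi> mG d) auto
      finally show ?thesis .
    qed
    have cfin: "?c \<noteq> \<infinity>" by (simp add: ennreal_mult_eq_top_iff)
    have "(\<lambda>n. ennreal (1 + d) * (ennreal (1 + d) * L2sq G + ennreal (1 + 1/d) * L2sq (\<lambda>x. grad (\<phi> n) x - G x))
        + ?c * L2sq (\<lambda>x. \<phi> n x - u x)) \<longlonglongrightarrow> ennreal (1 + d) * (ennreal (1 + d) * L2sq G + ennreal (1 + 1/d) * 0) + ?c * 0"
      using \<phi>(2,3) cfin unfolding L2_tendsto_def
      by (intro tendsto_add ennreal_tendsto_cmult tendsto_const) (auto simp: less_top)
    then have "X \<epsilon> \<le> ennreal (1 + d) * (ennreal (1 + d) * L2sq G + ennreal (1 + 1/d) * 0) + ?c * 0"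
      by (rule LIMSEQ_le_const) (use step in blast)
    \<comment> \<open>One factor \<open>1 + d\<close> stems from the angular comparison, the other
      from replacing \<open>grad (\<phi> n)\<close> by \<open>G\<close>.\<close>
    also have "\<dots> = ennreal ((1 + d)\<^sup>2) * L2sq G"
      using d by (simp add: power2_eq_square ennreal_mult mult.assoc)
    finally show "X \<epsilon> \<le> ennreal ((1 + d)\<^sup>2) * L2sq G" .
  qed
  let ?e = "\<lambda>n. inverse (real (Suc n))"
  have lim: "(\<lambda>n. X (?e n)) \<longlonglongrightarrow> (\<integral>\<^sup>+ r. ennreal (q r / r) * ?U r * indicator {0<..<1} r \<partial>lborel)"
    unfolding X_def
  proof (rule nn_integral_LIMSEQ)
    have dec: "?e (Suc n) \<le> ?e n" for n by (simp add: field_simps)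
    show "incseq (\<lambda>n r. ennreal (q r / r) * ?U r * indicator {?e n..1 - ?e n} r)"
    proof (rule incseq_SucI, rule le_funI)
      fix n r
      have "{?e n..1 - ?e n} \<subseteq> {?e (Suc n)..1 - ?e (Suc n)}"
        unfolding atLeastatMost_subset_iff by (intro disjI2 conjI dec diff_left_mono)
      then have "indicator {?e n..1 - ?e n} r \<le> (indicator {?e (Suc n)..1 - ?e (Suc n)} r :: ennreal)"
        by (rule indicator_mono)
      then show "ennreal (q r / r) * ?U r * indicator {?e n..1 - ?e n} r \<le> ennreal (q r / r) * ?U r * indicator {?e (Suc n)..1 - ?e (Suc n)} r"
        by (rule mult_left_mono) simp
    qed
    show "(\<lambda>r. ennreal (q r / r) * ?U r * indicator {?e n..1 - ?e n} r) \<in> borel_measurable lborel" for n by measurable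
    fix r :: real
    have "\<forall>\<^sub>F n in sequentially. ennreal (q r / r) * ?U r * indicator {?e n..1 - ?e n} r = ennreal (q r / r) * ?U r * indicator {0<..<1} r"
    proof (cases "0 < r \<and> r < 1")
      case True
      then have "\<forall>\<^sub>F n in sequentially. ?e n < min r (1 - r)"
        by (intro order_tendstoD(2)[OF LIMSEQ_inverse_real_of_nat]) simp
      then show ?thesis by eventually_elim (use True in \<open>auto simp: indicator_def\<close>)
    next
      case False
      have "r \<notin> {?e n..1 - ?e n}" for n
      proof -
        have "0 < ?e n" by simp
        then show ?thesis using False unfolding atLeastAtMost_iff by linarith
      qed
      then show ?thesis using False by (auto simp: indicator_def)
    qed
    then show "(\<lambda>n. ennreal (q r / r) * ?U r * indicator {?e n..1 - ?e n} r) \<longlonglongrightarrow> ennreal (q r / r) * ?U r * indicator {0<..<1} r"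
      by (rule tendsto_eventually)
  qed
  have le: "(\<integral>\<^sup>+ r. ennreal (q r / r) * ?U r * indicator {0<..<1} r \<partial>lborel) \<le> L2sq G"
    by (rule LIMSEQ_le_const2[OF lim]) (use X_le in auto)
  let ?h = "\<lambda>x. ennreal (q (norm x) / (norm x)\<^sup>2 * (v x)\<^sup>2)"
  have mh: "?h \<in> borel_measurable borel" by measurable
  have "(\<integral>\<^sup>+ x. ennreal (q (norm x) / (norm x)\<^sup>2 * (u x)\<^sup>2) \<partial>lebesgue_on unit_disc) = (\<integral>\<^sup>+ x. ?h x \<partial>lebesgue_on unit_disc)"
    by (rule nn_integral_cong_AE) (use uv in \<open>auto elim: eventually_mono\<close>)
  also have "\<dots> = (\<integral>\<^sup>+ r. ennreal r * ang ?h r * indicator {0<..<1} r \<partial>lborel)" by (rule polar_ang[OF mh])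
  also have "\<dots> = (\<integral>\<^sup>+ r. ennreal (q r / r) * ?U r * indicator {0<..<1} r \<partial>lborel)"
  proof (intro nn_integral_cong)
    fix r :: real
    show "ennreal r * ang ?h r * indicator {0<..<1} r = ennreal (q r / r) * ?U r * indicator {0<..<1} r"
    proof (cases "0 < r \<and> r < 1")
      case True
      then have p: "0 \<le> q r / r\<^sup>2" using q0 by simp
      have mv: "(\<lambda>\<theta>. ennreal ((v (pol r \<theta>))\<^sup>2)) \<in> borel_measurable (lebesgue_on {0..2*pi})"
        by (rule borel_measurable_disc) (rule measurable_compose[OF pol_measurable], measurable)
      have "ang ?h r = (\<integral>\<^sup>+ \<theta>. ennreal (q r / r\<^sup>2) * ennreal ((v (pol r \<theta>))\<^sup>2) \<partial>lebesgue_on {0..2*pi})"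
      proof -
        have "\<bar>r\<bar> = r" using True by simp
        then show ?thesis unfolding ang_def norm_pol
          by (intro nn_integral_cong) (simp only: ennreal_mult'[OF p])
      qed
      also have "\<dots> = ennreal (q r / r\<^sup>2) * ?U r" unfolding ang_def by (rule nn_integral_cmult[OF mv])
      finally have e: "ang ?h r = ennreal (q r / r\<^sup>2) * ?U r" .
      have "r * (q r / r\<^sup>2) = q r / r" using True by (simp add: power2_eq_square)
      then have "ennreal (q r / r) = ennreal r * ennreal (q r / r\<^sup>2)"
        using ennreal_mult[of r "q r / r\<^sup>2"] True p by simp
      then show ?thesis unfolding e by (simp only: mult.assoc)
    qed (auto simp: indicator_def)
  qed
  finally show ?thesis using le by simp
qed

section \<open>Hardy inequalities\<close>

lemma quarter_ennreal: "ennreal (1/4) = 1/4"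
  using divide_ennreal[of 1 4] by simp

definition hardy_den :: "real \<Rightarrow> (real^2 \<Rightarrow> real) \<Rightarrow> ennreal" where
  "hardy_den a u = (\<integral>\<^sup>+ x. ennreal (\<bar>u x\<bar>\<^sup>2 / ((norm x)\<^sup>2 * (ln (a / norm x))\<^sup>2)) \<partial>lebesgue_on unit_disc)"

lemma hardy_quotient_eq: "has_H01_gradient u G \<Longrightarrow> hardy_quotient a u = L2sq G / hardy_den a u"
  by (simp add: hardy_quotient_def hardy_den_def weak_grad_energy)

lemma log_weight_pos: "1 \<le> a \<Longrightarrow> 0 < r \<Longrightarrow> r < 1 \<Longrightarrow> 0 < ln (a / r)" for a r :: real
  by (rule ln_gt_zero) (simp add: less_divide_eq)

lemma DERIV_log_weight:
  assumes "1 \<le> a" "0 < r"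
  shows "((\<lambda>r. ln (a / r)) has_real_derivative - (1 / r)) (at r)"
proof -
  have "((\<lambda>r. ln a - ln r) has_real_derivative - (1 / r)) (at r)"
    using assms by (auto intro!: derivative_eq_intros simp: divide_inverse)
  then show ?thesis
    by (rule has_field_derivative_transform_within_open[where S = "{0<..}"])
      (use assms in \<open>auto simp: ln_div\<close>)
qed

text \<open>The substitution \<open>t = ln (a / r)\<close> with \<open>\<psi>\<close> the logarithmic derivative of the ground state.\<close>

lemma H01_lower_bound_log:
  fixes \<psi> \<psi>' W :: "real \<Rightarrow> real"
  assumes a: "1 \<le> a"
    and \<psi>: "\<And>t. ln a < t \<Longrightarrow> (\<psi> has_real_derivative \<psi>' t) (at t)"
    and c\<psi>': "continuous_on {ln a<..} \<psi>'" and cW: "continuous_on {ln a<..} W" and mW [measurable]: "W \<in> borel_measurable borel"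
    and ineq: "\<And>t. ln a < t \<Longrightarrow> W t - of_bool b \<le> - \<psi>' t - (\<psi> t)\<^sup>2"
    and W0: "\<And>t. ln a < t \<Longrightarrow> 0 \<le> W t"
    and C: "0 \<le> C" "\<And>t. t > T \<Longrightarrow> - C \<le> \<psi> t" "b \<or> C = 0"
    and u: "has_H01_gradient u G" and z: "b \<Longrightarrow> zero_spherical_average u"
  shows "(\<integral>\<^sup>+ x. ennreal (W (ln (a / norm x)) / (norm x)\<^sup>2 * (u x)\<^sup>2) \<partial>lebesgue_on unit_disc) \<le> L2sq G"
proof (rule H01_lower_bound[where w = "\<lambda>r. \<psi> (ln (a / r))" and w' = "\<lambda>r. \<psi>' (ln (a / r)) * (- (1 / r))"
      and q = "\<lambda>r. W (ln (a / r))" and \<delta> = "a * exp (- T)"])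
  have t: "ln a < ln (a / x)" if "0 < x" "x < 1" for x
    using that a by (simp add: ln_div)
  have ct: "continuous_on {0<..<1} (\<lambda>r. ln (a / r))"
    using a by (intro continuous_intros) auto
  show "((\<lambda>r. \<psi> (ln (a / r))) has_real_derivative \<psi>' (ln (a / x)) * (- (1 / x))) (at x)" if "0 < x" "x < 1" for x
    by (rule DERIV_chain2[OF \<psi>[OF t[OF that]] DERIV_log_weight[OF a that(1)]])
  show "continuous_on {0<..<1} (\<lambda>r. \<psi>' (ln (a / r)) * (- (1 / r)))"
    by (intro continuous_intros continuous_on_compose2[OF c\<psi>' ct]) (use t in auto)
  show "continuous_on {0<..<1} (\<lambda>r. W (ln (a / r)))"
    by (intro continuous_on_compose2[OF cW ct]) (use t in auto)
  show "(\<lambda>r. W (ln (a / r))) \<in> borel_measurable borel" by measurable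
  show "(W (ln (a / x)) - of_bool b) / x \<le> \<psi>' (ln (a / x)) * (- (1 / x)) - (\<psi> (ln (a / x)))\<^sup>2 / x" if "0 < x" "x < 1" for x
  proof -
    have "(W (ln (a / x)) - of_bool b) / x \<le> (- \<psi>' (ln (a / x)) - (\<psi> (ln (a / x)))\<^sup>2) / x"
      using ineq[OF t[OF that]] that by (intro divide_right_mono) auto
    then show ?thesis by (simp add: diff_divide_distrib)
  qed
  show "0 \<le> W (ln (a / x))" if "0 < x" "x < 1" for x using W0[OF t[OF that]] .
  show "0 < a * exp (- T)" using a by simp
  \<comment> \<open>For positive \<open>x\<close>, \<open>x < a * exp (- T)\<close> means
    \<open>T < ln (a / x)\<close>: small radii are large \<open>t\<close>.\<close>
  show "- C \<le> \<psi> (ln (a / x))" if "0 < x" "x < a * exp (- T)" for x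
  proof (rule C(2))
    have "exp T < a / x"
      using that a by (simp add: exp_minus field_simps)
    then have "ln (exp T) < ln (a / x)" using that a by (subst ln_less_cancel_iff) auto
    then show "T < ln (a / x)" by simp
  qed
qed (use C u z in auto)

text \<open>\<open>\<psi> = 1 / (2 * t)\<close> is the logarithmic derivative of
  \<open>sqrt t\<close>, and \<open>- \<psi>' - \<psi>\<^sup>2 = 1 / (4 * t\<^sup>2)\<close>. It is
  positive, so \<open>C = 0\<close> serves both values of \<open>b\<close>; for \<open>b\<close>
  true the Wirtinger gain remains as the summand 1.\<close>

lemma hardy_inequality:
  assumes a: "1 \<le> a" and u: "has_H01_gradient u G" and z: "b \<Longrightarrow> zero_spherical_average u"
  shows "(\<integral>\<^sup>+ x. ennreal ((1 / (4 * (ln (a / norm x))\<^sup>2) + of_bool b) / (norm x)\<^sup>2 * (u x)\<^sup>2) \<partial>lebesgue_on unit_disc) \<le> L2sq G"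
proof (rule H01_lower_bound_log[where \<psi> = "\<lambda>t. 1 / (2 * t)" and \<psi>' = "\<lambda>t. - (1 / (2 * t\<^sup>2))" and W = "\<lambda>t. 1 / (4 * t\<^sup>2) + of_bool b" and C = 0 and T = 0])
  have pos: "0 < t" if "ln a < t" for t using that a ln_ge_zero[of a] by linarith
  show "((\<lambda>t. 1 / (2 * t)) has_real_derivative - (1 / (2 * t\<^sup>2))) (at t)" if "ln a < t" for t
    using pos[OF that] by (auto intro!: derivative_eq_intros simp: power2_eq_square field_simps)
  show "continuous_on {ln a<..} (\<lambda>t. - (1 / (2 * t\<^sup>2)))" "continuous_on {ln a<..} (\<lambda>t. 1 / (4 * t\<^sup>2) + of_bool b)"
    by (intro continuous_intros; use pos in force)+
  show "1 / (4 * t\<^sup>2) + of_bool b - of_bool b \<le> - (- (1 / (2 * t\<^sup>2))) - (1 / (2 * t))\<^sup>2" if "ln a < t" for t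
    using pos[OF that] by (simp add: power_divide power_mult_distrib field_simps)
qed (use a u z in auto)

lemma H01_energy_finite:
  assumes "has_H01_gradient u G"
  shows "L2sq G < \<infinity>"
proof -
  obtain \<phi> where \<phi>: "\<And>n. \<phi> n \<in> test_functions" "L2_tendsto (\<lambda>n. grad (\<phi> n)) G"
    and m: "G \<in> borel_measurable (lebesgue_on unit_disc)"
    using assms unfolding has_H01_gradient_def by blast
  obtain n where n: "L2sq (\<lambda>x. grad (\<phi> n) x - G x) \<le> ennreal 1"
    using L2_tendsto_ev[OF \<phi>(2), of 1] by auto
  have "L2sq (\<lambda>x. G x - 0) \<le> 2 * L2sq (\<lambda>x. G x - grad (\<phi> n) x) + 2 * L2sq (\<lambda>x. grad (\<phi> n) x - 0)"
    by (intro L2sq_split2 m test_measurable \<phi>) simp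
  also have "\<dots> \<le> 2 * ennreal 1 + 2 * L2sq (grad (\<phi> n))"
    using n by (intro add_mono mult_left_mono) (auto simp: L2sq_commute[of G])
  also have "\<dots> < \<infinity>" unfolding L2sq_test(2)[OF \<phi>(1)] by (simp add: ennreal_mult_less_top)
  finally show ?thesis by simp
qed

lemma norm_measurable_disc [measurable]: "(norm :: real^2 \<Rightarrow> real) \<in> borel_measurable (lebesgue_on unit_disc)"
  by (rule borel_measurable_disc) simp

lemma AE_disc_pos: "AE x in lebesgue_on unit_disc. 0 < norm (x::real^2) \<and> norm x < 1"
proof -
  have "AE x in lborel. x \<noteq> (0::real^2)" by (rule AE_lborel_singleton)
  then have "AE x in lborel. x \<in> unit_disc \<longrightarrow> 0 < norm (x::real^2) \<and> norm x < 1" by eventually_elim auto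
  then show ?thesis by (simp add: AE_restrict_space_iff AE_completion_iff)
qed

lemma weighted_zero_imp:
  fixes u :: "real^2 \<Rightarrow> real"
  assumes [measurable]: "u \<in> borel_measurable (lebesgue_on unit_disc)"
    and [measurable]: "w \<in> borel_measurable borel" and w: "\<And>r. 0 < r \<Longrightarrow> r < 1 \<Longrightarrow> 0 < w r"
    and 0: "(\<integral>\<^sup>+ x. ennreal (w (norm x) * (u x)\<^sup>2) \<partial>lebesgue_on unit_disc) = 0"
  shows "AE x in lebesgue_on unit_disc. u x = 0"
proof -
  have "(\<lambda>x::real^2. w (norm x)) \<in> borel_measurable (lebesgue_on unit_disc)"
    by (rule measurable_compose[OF norm_measurable_disc]) measurable
  then have "AE x in lebesgue_on unit_disc. ennreal (w (norm x) * (u x)\<^sup>2) = 0"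
    using 0 by (subst (asm) nn_integral_0_iff_AE) auto
  with AE_disc_pos show ?thesis
  proof eventually_elim
    case (elim x)
    then have "w (norm x) * (u x)\<^sup>2 \<le> 0" by (simp add: ennreal_eq_0_iff)
    moreover have "0 < w (norm x)" using w elim by blast
    ultimately show ?case by (simp add: mult_le_0_iff)
  qed
qed

lemma hardy_den_eq: "hardy_den a u = (\<integral>\<^sup>+ x. ennreal (1 / ((norm x)\<^sup>2 * (ln (a / norm x))\<^sup>2) * (u x)\<^sup>2) \<partial>lebesgue_on unit_disc)"
  by (simp add: hardy_den_def)

lemma hardy_den_scaled:
  assumes "u \<in> borel_measurable (lebesgue_on unit_disc)" "0 \<le> c"
  shows "(\<integral>\<^sup>+ x. ennreal (c / (ln (a / norm x))\<^sup>2 / (norm x)\<^sup>2 * (u x)\<^sup>2) \<partial>lebesgue_on unit_disc) = ennreal c * hardy_den a u"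
proof -
  have [measurable]: "u \<in> borel_measurable (lebesgue_on unit_disc)" by (rule assms)
  have "(\<integral>\<^sup>+ x. ennreal (c / (ln (a / norm x))\<^sup>2 / (norm x)\<^sup>2 * (u x)\<^sup>2) \<partial>lebesgue_on unit_disc)
    = (\<integral>\<^sup>+ x. ennreal c * ennreal (1 / ((norm x)\<^sup>2 * (ln (a / norm x))\<^sup>2) * (u x)\<^sup>2) \<partial>lebesgue_on unit_disc)"
    using assms(2) by (intro nn_integral_cong) (simp add: ennreal_mult[symmetric] mult_ac)
  also have "\<dots> = ennreal c * hardy_den a u"
    unfolding hardy_den_eq by (rule nn_integral_cmult) measurable
  finally show ?thesis .
qed

lemma hardy_den_nonzero:
  assumes "1 \<le> a" "u \<in> H01_nonzero"
  shows "hardy_den a u \<noteq> 0"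
proof
  assume 0: "hardy_den a u = 0"
  have m: "u \<in> borel_measurable (lebesgue_on unit_disc)"
    using assms(2) by (auto simp: H01_nonzero_def H01_def has_H01_gradient_def)
  have "AE x in lebesgue_on unit_disc. u x = 0"
  proof (rule weighted_zero_imp[OF m, of "\<lambda>r. 1 / (r\<^sup>2 * (ln (a / r))\<^sup>2)"])
    show "0 < 1 / (r\<^sup>2 * (ln (a / r))\<^sup>2)" if "0 < r" "r < 1" for r
      using log_weight_pos[OF assms(1) that] that by (intro divide_pos_pos mult_pos_pos zero_less_power) auto
  qed (use 0 in \<open>auto simp: hardy_den_eq\<close>)
  then show False using assms(2) by (simp add: H01_nonzero_def)
qed

lemma hardy_quarter:
  assumes "1 \<le> a" "has_H01_gradient u G"
  shows "ennreal (1/4) * hardy_den a u \<le> L2sq G"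
proof -
  have "u \<in> borel_measurable (lebesgue_on unit_disc)" using assms(2) by (simp add: has_H01_gradient_def)
  from hardy_den_scaled[OF this, of "1/4" a] hardy_inequality[OF assms, of False]
  show ?thesis by simp
qed

lemma hardy_den_finite:
  assumes "1 \<le> a" "has_H01_gradient u G"
  shows "hardy_den a u \<noteq> \<infinity>"
proof
  assume "hardy_den a u = \<infinity>"
  then have "\<infinity> \<le> L2sq G" using hardy_quarter[OF assms] by (simp add: ennreal_mult_top)
  then show False using H01_energy_finite[OF assms(2)] by simp
qed

lemma le_quotient:
  fixes c N D :: ennreal
  assumes "c * D \<le> N" "D \<noteq> 0" "D \<noteq> \<infinity>"
  shows "c \<le> N / D"
proof -
  have "c = (c * D) / D" using assms(2,3) by (simp add: mult_divide_eq_ennreal)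
  also have "\<dots> \<le> N / D" by (rule divide_right_mono_ennreal[OF assms(1)])
  finally show ?thesis .
qed

lemma quotient_le:
  fixes c N D :: ennreal
  assumes "N \<le> c * D" "D \<noteq> 0" "D \<noteq> \<infinity>"
  shows "N / D \<le> c"
proof -
  have "N / D \<le> (c * D) / D" by (rule divide_right_mono_ennreal[OF assms(1)])
  also have "\<dots> = c" using assms(2,3) by (simp add: mult_divide_eq_ennreal)
  finally show ?thesis .
qed

lemma B_const_ge:
  assumes a: "1 \<le> a"
  shows "1/4 \<le> B_const a"
  unfolding B_const_def
proof (rule INF_greatest)
  fix u assume u: "u \<in> H01_nonzero"
  then obtain G where G: "has_H01_gradient u G" by (auto simp: H01_nonzero_def H01_def)
  show "1/4 \<le> hardy_quotient a u"
    unfolding hardy_quotient_eq[OF G] quarter_ennreal[symmetric]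
    by (intro le_quotient hardy_quarter[OF a G] hardy_den_nonzero[OF a u] hardy_den_finite[OF a G])
qed

lemma B_le_A: "B_const a \<le> A_const a"
  unfolding B_const_def A_const_def A_admissible_def by (intro INF_superset_mono) auto

lemma no_minimizer_1:
  assumes A: "A_const 1 = 1/4"
  shows "\<not> A_minimizer 1 u"
proof
  assume "A_minimizer 1 u"
  then have u: "u \<in> H01_nonzero" "zero_spherical_average u" and q: "hardy_quotient 1 u = 1/4"
    using A by (auto simp: A_minimizer_def A_admissible_def)
  then obtain G where G: "has_H01_gradient u G" by (auto simp: H01_nonzero_def H01_def)
  have m [measurable]: "u \<in> borel_measurable (lebesgue_on unit_disc)" using G by (simp add: has_H01_gradient_def)
  note D = hardy_den_nonzero[OF order_refl u(1)] hardy_den_finite[OF order_refl G]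
  have "L2sq G = (L2sq G / hardy_den 1 u) * hardy_den 1 u"
    using D by (simp add: ennreal_divide_times ennreal_divide_self less_top)
  then have E: "L2sq G = ennreal (1/4) * hardy_den 1 u"
    using q unfolding hardy_quotient_eq[OF G] quarter_ennreal[symmetric] by simp
  let ?I = "\<integral>\<^sup>+ x. ennreal (1 / (norm x)\<^sup>2 * (u x)\<^sup>2) \<partial>lebesgue_on unit_disc"
  have "ennreal (1/4) * hardy_den 1 u + ?I = (\<integral>\<^sup>+ x. ennreal (1/4 / (ln (1 / norm x))\<^sup>2 / (norm x)\<^sup>2 * (u x)\<^sup>2) + ennreal (1 / (norm x)\<^sup>2 * (u x)\<^sup>2) \<partial>lebesgue_on unit_disc)"
    unfolding hardy_den_scaled[OF m, of "1/4" 1, simplified, symmetric]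
    by (subst nn_integral_add) auto
  also have "\<dots> = (\<integral>\<^sup>+ x. ennreal ((1 / (4 * (ln (1 / norm x))\<^sup>2) + of_bool True) / (norm x)\<^sup>2 * (u x)\<^sup>2) \<partial>lebesgue_on unit_disc)"
    by (intro nn_integral_cong) (simp add: ennreal_plus[symmetric] add_divide_distrib distrib_right del: ennreal_plus)
  also have "\<dots> \<le> L2sq G" by (rule hardy_inequality[OF order_refl G]) (use u in auto)
  finally have "L2sq G + ?I \<le> L2sq G + 0" unfolding E[symmetric] by simp
  \<comment> \<open>Finiteness of the energy permits cancelling it in the extended nonnegative
    reals.\<close>
  then have "?I = 0" using H01_energy_finite[OF G] by (auto simp: ennreal_add_left_cancel_le)
  then have "AE x in lebesgue_on unit_disc. u x = 0"
    by (intro weighted_zero_imp[OF m, of "\<lambda>r. 1 / r\<^sup>2"]) auto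
  then show False using u(1) by (simp add: H01_nonzero_def)
qed

section \<open>Trial functions\<close>

lemma continuous_on_mult_left_real: "continuous_on S g \<Longrightarrow> continuous_on S (\<lambda>r. m * g r)" for m :: real and g :: "real \<Rightarrow> real"
  by (intro continuous_intros)

text \<open>On \<open>{t1..t2}\<close> the argument \<open>X\<close> of the sine runs through one
  half period, so \<open>H\<close> is positive inside; as \<open>r\<close> decreases in
  \<open>t\<close>, \<open>r1\<close> belongs to \<open>t2\<close>. The condition on
  \<open>\<sigma>\<close> places the arc inside the disc, and \<open>k\<close> is its width
  parameter: a large \<open>k\<close> brings the quotient towards 1/4.\<close>

locale trial =
  fixes a k \<sigma> :: real
  assumes a: "1 \<le> a" and k: "0 < k" and \<sigma>: "ln a < exp \<sigma>"
begin

definition "t1 = exp \<sigma>"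
definition "t2 = exp (\<sigma> + k * pi)"
definition "r1 = a * exp (- t2)"
definition "r2 = a * exp (- t1)"
definition X where "X r = (ln (ln (a / r)) - \<sigma>) / k"
definition H where "H r = sqrt (ln (a / r)) * sin (X r)"
definition H' where "H' r = - (1 / r) * (sin (X r) / 2 + cos (X r) / k) / sqrt (ln (a / r))"
definition F where "F r = (if r1 < r \<and> r < r2 then H r else 0)"
definition F' where "F' r = (if r1 < r \<and> r < r2 then H' r else 0)"

lemma t12: "0 < t1" "t1 < t2" using k by (auto simp: t1_def t2_def)

lemma r12: "0 < r1" "r1 < r2" "r2 < 1"
proof -
  show "0 < r1" using a by (simp add: r1_def)
  show "r1 < r2" using a t12 by (simp add: r1_def r2_def)
  have "a < exp t1" using \<sigma> a by (metis exp_less_cancel_iff exp_ln less_le_trans t1_def zero_less_one)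
  then show "r2 < 1" by (simp add: r2_def exp_minus field_simps)
qed

lemma T_bounds:
  assumes "r1 \<le> r" "r \<le> r2"
  shows "t1 \<le> ln (a / r)" "ln (a / r) \<le> t2"
proof -
  have r: "0 < r" using assms r12 by linarith
  have "ln r1 \<le> ln r" "ln r \<le> ln r2" using assms r r12 by auto
  moreover have "ln r1 = ln a - t2" "ln r2 = ln a - t1" using a by (auto simp: r1_def r2_def ln_mult)
  ultimately show "t1 \<le> ln (a / r)" "ln (a / r) \<le> t2" using a r by (auto simp: ln_div)
qed

lemma T_strict:
  assumes "r1 < r" "r < r2"
  shows "t1 < ln (a / r)" "ln (a / r) < t2"
proof -
  have r: "0 < r" using assms r12 by linarith
  have "ln r1 < ln r" "ln r < ln r2" using assms r r12 by auto
  moreover have "ln r1 = ln a - t2" "ln r2 = ln a - t1" using a by (auto simp: r1_def r2_def ln_mult)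
  ultimately show "t1 < ln (a / r)" "ln (a / r) < t2" using a r by (auto simp: ln_div)
qed

lemma X_ends: "X r1 = pi" "X r2 = 0"
proof -
  have "ln (a / r1) = t2" "ln (a / r2) = t1" using a by (auto simp: r1_def r2_def ln_div ln_mult)
  then show "X r1 = pi" "X r2 = 0" using k by (auto simp: X_def t1_def t2_def)
qed

lemma X_strict:
  assumes "r1 < r" "r < r2"
  shows "0 < X r" "X r < pi"
proof -
  have "ln t1 < ln (ln (a / r))" "ln (ln (a / r)) < ln t2"
    using T_strict[OF assms] t12 by auto
  then show "0 < X r" "X r < pi" using k by (auto simp: X_def t1_def t2_def field_simps)
qed

lemma T_pos: "r1 \<le> r \<Longrightarrow> r \<le> r2 \<Longrightarrow> 0 < ln (a / r)"
  using T_bounds t12 by force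

lemma r_pos: "r1 \<le> r \<Longrightarrow> 0 < r" using r12 by simp

lemma DERIV_X:
  assumes "r1 \<le> r" "r \<le> r2"
  shows "(X has_real_derivative - (1 / (k * r * ln (a / r)))) (at r)"
proof -
  have "((\<lambda>r. ln (ln (a / r))) has_real_derivative 1 / ln (a / r) * (- (1 / r))) (at r)"
    by (rule DERIV_chain2[OF DERIV_ln_divide[OF T_pos[OF assms]] DERIV_log_weight[OF a r_pos[OF assms(1)]]])
  then have "((\<lambda>r. (ln (ln (a / r)) - \<sigma>) / k) has_real_derivative (1 / ln (a / r) * (- (1 / r)) - 0) / k) (at r)"
    by (intro DERIV_cdivide DERIV_diff DERIV_const)
  then show ?thesis by (simp add: X_def[abs_def] mult_ac)
qed

lemma DERIV_H:
  assumes "r1 \<le> r" "r \<le> r2"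
  shows "(H has_real_derivative H' r) (at r)"
proof -
  let ?T = "ln (a / r)"
  have T: "0 < ?T" by (rule T_pos[OF assms])
  have 1: "((\<lambda>r. sqrt (ln (a / r))) has_real_derivative inverse (sqrt ?T) / 2 * (- (1 / r))) (at r)"
    by (rule DERIV_chain2[OF DERIV_real_sqrt[OF T] DERIV_log_weight[OF a r_pos[OF assms(1)]]])
  have 2: "((\<lambda>r. sin (X r)) has_real_derivative cos (X r) * (- (1 / (k * r * ?T)))) (at r)"
    by (rule DERIV_chain2[OF DERIV_sin DERIV_X[OF assms]])
  have "(H has_real_derivative inverse (sqrt ?T) / 2 * (- (1 / r)) * sin (X r) + cos (X r) * (- (1 / (k * r * ?T))) * sqrt ?T) (at r)"
    unfolding H_def[abs_def] by (rule DERIV_mult[OF 1 2])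
  moreover have "inverse s / 2 * (- (1 / r)) * S + C * (- (1 / (k * r * (s * s)))) * s = - (1 / r) * (S / 2 + C / k) / s"
    if "0 < s" for s S C :: real
    using that k r_pos[OF assms(1)] by (simp add: field_simps)
  from this[of "sqrt ?T"] T have "inverse (sqrt ?T) / 2 * (- (1 / r)) * sin (X r) + cos (X r) * (- (1 / (k * r * ?T))) * sqrt ?T = H' r"
    by (simp add: H'_def)
  ultimately show ?thesis by simp
qed

lemma ne: "\<forall>r\<in>{r1..r2}. r \<noteq> 0" "\<forall>r\<in>{r1..r2}. a / r \<noteq> 0" "\<forall>r\<in>{r1..r2}. ln (a / r) \<noteq> 0"
  "\<forall>r\<in>{r1..r2}. sqrt (ln (a / r)) \<noteq> 0" "\<forall>r\<in>{r1..r2}. r * (ln (a / r))\<^sup>2 \<noteq> 0"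
  using r12 a T_pos by fastforce+

lemma cont_T: "continuous_on {r1..r2} (\<lambda>r. ln (a / r))"
  by (intro continuous_intros ne)

lemma cont_X: "continuous_on {r1..r2} X"
  unfolding X_def[abs_def] using k by (intro continuous_intros ne) auto

lemma cont_H: "continuous_on {r1..r2} H"
  unfolding H_def[abs_def] by (intro continuous_intros ne cont_X)

lemma cont_H': "continuous_on {r1..r2} H'"
  unfolding H'_def[abs_def] using k by (intro continuous_intros ne cont_X) auto

lemma H_pos: "r1 < r \<Longrightarrow> r < r2 \<Longrightarrow> 0 < H r"
  unfolding H_def using X_strict[of r] T_pos[of r] by (intro mult_pos_pos sin_gt_zero) auto

sublocale profile F F'
proof
  \<comment> \<open>\<open>H\<close> vanishes at both ends of the arc, so clamping the radius to
    \<open>{r1..r2}\<close> gives one continuous formula.\<close>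
  have eq: "F = (\<lambda>r. H (max r1 (min r r2)))"
  proof
    fix r
    have "H r1 = 0" "H r2 = 0" by (simp_all add: H_def X_ends)
    then show "F r = H (max r1 (min r r2))" using r12 by (auto simp: F_def max_def min_def)
  qed
  show "continuous_on UNIV F"
    unfolding eq by (rule continuous_on_compose2[OF cont_H]) (use r12 in \<open>auto intro!: continuous_intros\<close>)
  fix r
  show "0 \<le> F r" using H_pos by (auto simp: F_def intro: less_imp_le)
  show "0 < r \<and> r < 1" if "0 < F r" using that r12 by (auto simp: F_def split: if_splits)
  show "F' r = 0" if "F r = 0" using that H_pos[of r] by (auto simp: F_def F'_def)
  assume "0 < F r"
  then have r: "r1 < r" "r < r2" by (auto simp: F_def split: if_splits)
  have "(F has_real_derivative H' r) (at r)"
    by (rule has_field_derivative_transform_within_open[OF DERIV_H, of r "{r1<..<r2}"]) (use r in \<open>auto simp: F_def\<close>)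
  then show "(F has_real_derivative F' r) (at r)" using r by (simp add: F'_def)
  have "continuous_on {r1<..<r2} F'"
    by (rule continuous_on_eq[OF continuous_on_subset[OF cont_H']]) (auto simp: F'_def)
  then show "isCont F' r" using r by (simp add: continuous_on_eq_continuous_at)
qed

text \<open>Radial energy, weighted mass (\<open>I2\<close>) and angular mass (\<open>I3\<close>) of
  \<open>H\<close>; numerator and denominator of every trial quotient are combinations of
  these.\<close>

definition "I1 = integral {r1..r2} (\<lambda>r. r * (H' r)\<^sup>2)"
definition "I2 = integral {r1..r2} (\<lambda>r. (H r)\<^sup>2 / (r * (ln (a / r))\<^sup>2))"
definition "I3 = integral {r1..r2} (\<lambda>r. (H r)\<^sup>2 / r)"

lemma cont_integrands:
  "continuous_on {r1..r2} (\<lambda>r. r * (H' r)\<^sup>2)"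
  "continuous_on {r1..r2} (\<lambda>r. (H r)\<^sup>2 / (r * (ln (a / r))\<^sup>2))"
  "continuous_on {r1..r2} (\<lambda>r. (H r)\<^sup>2 / r)"
  by (intro continuous_intros cont_H cont_H' ne)+

text \<open>In the variable \<open>t\<close>, \<open>H\<close> solves the Euler equation
  \<open>f'' = - (1/4 + 1/k\<^sup>2) / t\<^sup>2 * f\<close>. Multiplication by \<open>H\<close> and
  integration by parts leave the boundary term \<open>r * H r * H' r\<close>, written out as
  \<open>?P\<close>, which vanishes at both ends of the arc.\<close>

lemma I1_eq: "I1 = (1/4 + 1/k\<^sup>2) * I2"
proof -
  let ?P = "\<lambda>r. - (sin (X r) * sin (X r)) / 2 - sin (X r) * cos (X r) / k"
  let ?p = "\<lambda>r. r * (H' r)\<^sup>2 - (1/4 + 1/k\<^sup>2) * ((H r)\<^sup>2 / (r * (ln (a / r))\<^sup>2))"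
  have "(?p has_integral (?P r2 - ?P r1)) {r1..r2}"
  proof (rule fundamental_theorem_of_calculus)
    show "r1 \<le> r2" using r12 by simp
    fix r assume r: "r \<in> {r1..r2}"
    let ?T = "ln (a / r)" and ?S = "sin (X r)" and ?C = "cos (X r)"
    have T: "0 < ?T" and r0: "0 < r" using r T_pos r_pos by auto
    let ?x = "- (1 / (k * r * ?T))"
    have x: "(X has_real_derivative ?x) (at r)" using r by (intro DERIV_X) auto
    have s: "((\<lambda>r. sin (X r)) has_real_derivative ?C * ?x) (at r)" by (rule DERIV_chain2[OF DERIV_sin x])
    have c: "((\<lambda>r. cos (X r)) has_real_derivative - ?S * ?x) (at r)" by (rule DERIV_chain2[OF DERIV_cos x])
    have "(?P has_real_derivative - (?C * ?x * ?S + ?C * ?x * ?S) / 2 - (?C * ?x * ?C + (- ?S * ?x) * ?S) / k) (at r)"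
      by (intro DERIV_diff DERIV_cdivide DERIV_minus) (rule DERIV_mult[OF s s] DERIV_mult[OF s c, THEN DERIV_cong]; simp add: mult_ac)+
    moreover have "- (?C * ?x * ?S + ?C * ?x * ?S) / 2 - (?C * ?x * ?C + (- ?S * ?x) * ?S) / k = ?p r"
    proof -
      have h': "r * (H' r)\<^sup>2 = (?S / 2 + ?C / k)\<^sup>2 / (r * ?T)"
        using r0 T unfolding H'_def by (simp add: power_mult_distrib power_divide) (simp add: power2_eq_square)
      have h: "(H r)\<^sup>2 / (r * ?T\<^sup>2) = ?S\<^sup>2 / (r * ?T)"
        using r0 T unfolding H_def by (simp add: power_mult_distrib) (simp add: power2_eq_square)
      have "(S / 2 + C / k)\<^sup>2 / m - (1/4 + 1/k\<^sup>2) * (S\<^sup>2 / m) = - (C * (- (1 / (k * m))) * S + C * (- (1 / (k * m))) * S) / 2 - (C * (- (1 / (k * m))) * C + (- S * (- (1 / (k * m)))) * S) / k"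
        if "0 < m" for S C m :: real
        using that k by (simp add: field_simps power2_eq_square)
      from this[of "r * ?T" ?S ?C] r0 T show ?thesis unfolding h' h by (simp add: mult.assoc)
    qed
    ultimately show "(?P has_vector_derivative ?p r) (at r within {r1..r2})"
      by (simp add: has_real_derivative_iff_has_vector_derivative has_vector_derivative_at_within)
  qed
  then have "integral {r1..r2} ?p = 0" by (simp add: X_ends integral_unique)
  moreover have "integral {r1..r2} ?p = I1 - (1/4 + 1/k\<^sup>2) * I2"
    unfolding I1_def I2_def integral_mult_right[symmetric]
    by (rule integral_diff) (intro integrable_continuous_interval cont_integrands continuous_on_mult_left_real)+
  ultimately show ?thesis by simp
qed

lemma I2_pos: "0 < I2"
proof -
  have nn: "0 \<le> (H r)\<^sup>2 / (r * (ln (a / r))\<^sup>2)" if "r \<in> {r1..r2}" for r using that r_pos[of r] by simp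
  have "0 \<le> I2" unfolding I2_def
    by (intro integral_nonneg integrable_continuous_interval cont_integrands nn)
  moreover have "I2 \<noteq> 0"
  proof
    assume "I2 = 0"
    then have "\<forall>r\<in>{r1..r2}. (H r)\<^sup>2 / (r * (ln (a / r))\<^sup>2) = 0"
      unfolding I2_def by (subst (asm) integral_eq_0_iff) (use cont_integrands nn r12 in auto)
    moreover have m: "(r1 + r2) / 2 \<in> {r1..r2}" "r1 < (r1 + r2) / 2" "(r1 + r2) / 2 < r2" using r12 by auto
    ultimately have "(H ((r1 + r2) / 2))\<^sup>2 / ((r1 + r2) / 2 * (ln (a / ((r1 + r2) / 2)))\<^sup>2) = 0" by blast
    then show False using H_pos[OF m(2,3)] T_pos[of "(r1+r2)/2"] m r12 by simp
  qed
  ultimately show ?thesis by simp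
qed

text \<open>On the arc \<open>ln (a / r) \<le> t2\<close>. The angular cost is thus small when the
  arc lies at small \<open>t\<close>, which \<open>ln a < t1\<close> permits only for
  \<open>a = 1\<close>.\<close>

lemma I3_le: "I3 \<le> t2\<^sup>2 * I2"
proof -
  have "I3 \<le> integral {r1..r2} (\<lambda>r. t2\<^sup>2 * ((H r)\<^sup>2 / (r * (ln (a / r))\<^sup>2)))"
    unfolding I3_def
  proof (rule integral_le)
    fix r assume r: "r \<in> {r1..r2}"
    then have T: "0 < ln (a / r)" "ln (a / r) \<le> t2" and r0: "0 < r" using T_pos T_bounds r_pos by auto
    have "(ln (a / r))\<^sup>2 \<le> t2\<^sup>2" using T by (intro power_mono) auto
    then have "(H r)\<^sup>2 / r * (ln (a / r))\<^sup>2 \<le> (H r)\<^sup>2 / r * t2\<^sup>2" using r0 by (intro mult_left_mono) auto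
    then show "(H r)\<^sup>2 / r \<le> t2\<^sup>2 * ((H r)\<^sup>2 / (r * (ln (a / r))\<^sup>2))"
      using T r0 by (simp add: field_simps)
  qed (intro integrable_continuous_interval cont_integrands continuous_on_mult_left_real)+
  then show ?thesis unfolding I2_def integral_mult_right .
qed

lemma trial_den:
  "(\<integral>\<^sup>+ r. ennreal (r * ((F r)\<^sup>2 / (r\<^sup>2 * (ln (a / r))\<^sup>2) * (2 * pi * c\<^sup>2 + pi * d\<^sup>2))) * indicator {0<..<1} r \<partial>lborel)
    = ennreal ((2 * pi * c\<^sup>2 + pi * d\<^sup>2) * I2)"
proof -
  have "(\<integral>\<^sup>+ r. ennreal (r * ((F r)\<^sup>2 / (r\<^sup>2 * (ln (a / r))\<^sup>2) * (2 * pi * c\<^sup>2 + pi * d\<^sup>2))) * indicator {0<..<1} r \<partial>lborel)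
    = (\<integral>\<^sup>+ r. ennreal ((2 * pi * c\<^sup>2 + pi * d\<^sup>2) * ((H r)\<^sup>2 / (r * (ln (a / r))\<^sup>2))) * indicator {r1<..<r2} r \<partial>lborel)"
    using r12 by (intro nn_integral_cong) (auto simp: indicator_def F_def power2_eq_square mult_ac)
  also have "\<dots> = ennreal (integral {r1..r2} (\<lambda>r. (2 * pi * c\<^sup>2 + pi * d\<^sup>2) * ((H r)\<^sup>2 / (r * (ln (a / r))\<^sup>2))))"
    by (rule nn_integral_continuous_Ioo[OF continuous_on_mult_left_real[OF cont_integrands(2)]]) (use r12 in auto)
  finally show ?thesis unfolding I2_def integral_mult_right .
qed

lemma trial_num:
  "(\<integral>\<^sup>+ r. ennreal (r * ((F' r)\<^sup>2 * (2 * pi * c\<^sup>2 + pi * d\<^sup>2) + pi * (d * F r / r)\<^sup>2)) * indicator {0<..<1} r \<partial>lborel)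
    = ennreal ((2 * pi * c\<^sup>2 + pi * d\<^sup>2) * I1 + pi * d\<^sup>2 * I3)"
proof -
  let ?g = "\<lambda>r. (2 * pi * c\<^sup>2 + pi * d\<^sup>2) * (r * (H' r)\<^sup>2) + pi * d\<^sup>2 * ((H r)\<^sup>2 / r)"
  have "(\<integral>\<^sup>+ r. ennreal (r * ((F' r)\<^sup>2 * (2 * pi * c\<^sup>2 + pi * d\<^sup>2) + pi * (d * F r / r)\<^sup>2)) * indicator {0<..<1} r \<partial>lborel)
    = (\<integral>\<^sup>+ r. ennreal (?g r) * indicator {r1<..<r2} r \<partial>lborel)"
  proof (intro nn_integral_cong)
    fix r :: real
    have "r * ((H' r)\<^sup>2 * (2 * pi * c\<^sup>2 + pi * d\<^sup>2) + pi * (d * H r / r)\<^sup>2) = ?g r" if "0 < r"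
      using that by (simp add: power_divide power_mult_distrib) (simp add: power2_eq_square field_simps)
    then show "ennreal (r * ((F' r)\<^sup>2 * (2 * pi * c\<^sup>2 + pi * d\<^sup>2) + pi * (d * F r / r)\<^sup>2)) * indicator {0<..<1} r = ennreal (?g r) * indicator {r1<..<r2} r"
      using r12 by (auto simp: indicator_def F_def F'_def)
  qed
  also have "\<dots> = ennreal (integral {r1..r2} ?g)"
    by (rule nn_integral_continuous_Ioo[OF continuous_on_add[OF continuous_on_mult_left_real continuous_on_mult_left_real, OF cont_integrands(1,3)]])
      (use r12 in auto)
  also have "integral {r1..r2} ?g = (2 * pi * c\<^sup>2 + pi * d\<^sup>2) * I1 + pi * d\<^sup>2 * I3"
    unfolding I1_def I3_def integral_mult_right[symmetric]
    by (rule integral_add) (intro integrable_continuous_interval continuous_on_mult_left_real cont_integrands)+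
  finally show ?thesis .
qed

text \<open>The second hypothesis says that the angular cost is at most \<open>e\<close> times the
  weighted mass. For radial functions, \<open>d = 0\<close>, it holds with \<open>e = 0\<close>; for
  the pure cosine mode, \<open>c = 0\<close>, it reads \<open>t2\<^sup>2 \<le> e\<close>.\<close>

lemma trial_quotient:
  assumes cd: "c \<noteq> 0 \<or> d \<noteq> 0" and d: "d\<^sup>2 * t2\<^sup>2 \<le> (2 * c\<^sup>2 + d\<^sup>2) * e"
  shows "pu c d F \<in> H01_nonzero" "hardy_quotient a (pu c d F) \<le> ennreal (1/4 + 1/k\<^sup>2 + e)"
proof -
  let ?Y = "2 * pi * c\<^sup>2 + pi * d\<^sup>2"
  have Y: "0 < ?Y" using cd by (smt (verit) mult_pos_pos pi_gt_zero zero_less_power2 zero_le_mult_iff zero_le_power2)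
  have pos: "0 < ?Y * I2" using Y I2_pos by simp
  show "pu c d F \<in> H01_nonzero"
    by (rule profile_quotient(1)[of c d a, unfolded trial_num trial_den]) (use pos Y I2_pos in \<open>auto dest: less_imp_neq\<close>)
  have "hardy_quotient a (pu c d F) = ennreal (?Y * I1 + pi * d\<^sup>2 * I3) / ennreal (?Y * I2)"
    by (rule profile_quotient(2)[of c d a, unfolded trial_num trial_den]) (use pos Y I2_pos in \<open>auto dest: less_imp_neq\<close>)
  also have "\<dots> \<le> ennreal (1/4 + 1/k\<^sup>2 + e)"
  proof (rule quotient_le)
    have "pi * d\<^sup>2 * I3 \<le> pi * d\<^sup>2 * (t2\<^sup>2 * I2)" by (intro mult_left_mono I3_le) auto
    also have "\<dots> = pi * (d\<^sup>2 * t2\<^sup>2) * I2" by simp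
    also have "\<dots> \<le> pi * ((2 * c\<^sup>2 + d\<^sup>2) * e) * I2" using d I2_pos by (intro mult_right_mono mult_left_mono) auto
    also have "\<dots> = ?Y * e * I2" by (simp add: algebra_simps)
    finally have "?Y * I1 + pi * d\<^sup>2 * I3 \<le> (1/4 + 1/k\<^sup>2 + e) * (?Y * I2)"
      unfolding I1_eq by (simp add: algebra_simps)
    then have "ennreal (?Y * I1 + pi * d\<^sup>2 * I3) \<le> ennreal ((1/4 + 1/k\<^sup>2 + e) * (?Y * I2))" by (rule ennreal_leI)
    then show "ennreal (?Y * I1 + pi * d\<^sup>2 * I3) \<le> ennreal (1/4 + 1/k\<^sup>2 + e) * ennreal (?Y * I2)"
      using pos by (simp add: ennreal_mult'')
  qed (use pos in auto)
  finally show "hardy_quotient a (pu c d F) \<le> ennreal (1/4 + 1/k\<^sup>2 + e)" .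
qed

end

lemma inverse_Suc_tendsto: "(\<lambda>n. ennreal (1/4 + 1 / (real (Suc n))\<^sup>2 + f n)) \<longlonglongrightarrow> 1/4" if "f \<longlonglongrightarrow> 0" for f :: "nat \<Rightarrow> real"
proof -
  have "(\<lambda>n. 1/4 + (inverse (real (Suc n)))\<^sup>2 + f n) \<longlonglongrightarrow> 1/4 + 0\<^sup>2 + 0"
    by (intro tendsto_intros LIMSEQ_inverse_real_of_nat that)
  moreover have "(inverse x)\<^sup>2 = 1 / x\<^sup>2" for x :: real by (simp add: power_divide inverse_eq_divide)
  ultimately have "(\<lambda>n. 1/4 + 1 / (real (Suc n))\<^sup>2 + f n) \<longlonglongrightarrow> 1/4 + 0\<^sup>2 + 0" by (simp only:)
  then have "(\<lambda>n. 1/4 + 1 / (real (Suc n))\<^sup>2 + f n) \<longlonglongrightarrow> 1/4" by (simp only: zero_power2 add_0_right)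
  from tendsto_ennrealI[OF this] show ?thesis unfolding quarter_ennreal .
qed

lemma B_const_le:
  assumes a: "1 \<le> a"
  shows "B_const a \<le> 1/4"
proof (rule LIMSEQ_le_const[OF inverse_Suc_tendsto[of "\<lambda>_. 0"]], simp, intro exI allI impI)
  fix n
  \<comment> \<open>Any start beyond \<open>ln a\<close> will do, here \<open>t1 = ln a + 1\<close>;
    only the width of the arc, growing with \<open>n\<close>, matters.\<close>
  interpret trial a "real (Suc n)" "ln (ln a + 1)"
  proof
    have "0 < ln a + 1" using ln_ge_zero[OF a] by linarith
    then show "ln a < exp (ln (ln a + 1))" by simp
  qed (use a in auto)
  have "hardy_quotient a (pu 1 0 F) \<le> ennreal (1/4 + 1 / (real (Suc n))\<^sup>2 + 0)" "pu 1 0 F \<in> H01_nonzero"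
    using trial_quotient[of 1 0 0] by simp_all
  then show "B_const a \<le> ennreal (1/4 + 1 / (real (Suc n))\<^sup>2 + 0)"
    unfolding B_const_def by (rule INF_lower2[rotated])
qed

lemma A_const_1_le: "A_const 1 \<le> 1/4"
proof (rule LIMSEQ_le_const[OF inverse_Suc_tendsto[of "\<lambda>n. (inverse (real (Suc n)))\<^sup>2"]])
  show "(\<lambda>n. (inverse (real (Suc n)))\<^sup>2) \<longlonglongrightarrow> 0"
    using tendsto_power[OF LIMSEQ_inverse_real_of_nat, of 2] by simp
  have "A_const 1 \<le> ennreal (1/4 + 1 / (real (Suc n))\<^sup>2 + (inverse (real (Suc n)))\<^sup>2)" for n
  proof -
    \<comment> \<open>The arc must lie near the unit circle, at small \<open>t\<close>, to make the
      angular cost small: this \<open>\<sigma>\<close> puts its far end \<open>t2\<close> at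
      \<open>1 / (n + 1)\<close>.\<close>
    interpret trial 1 "real (Suc n)" "ln (inverse (real (Suc n))) - real (Suc n) * pi"
      by unfold_locales auto
    have "exp (ln (inverse (real (Suc n)))) = inverse (real (Suc n))" by (rule exp_ln) simp
    then have t: "t2 = inverse (real (Suc n))" unfolding t2_def by (simp only: diff_add_cancel)
    have "1\<^sup>2 * t2\<^sup>2 \<le> (2 * 0\<^sup>2 + 1\<^sup>2) * (inverse (real (Suc n)))\<^sup>2" unfolding t by (simp only: zero_power2 one_power2 mult_zero_right add_0_left mult_1_left)
    from trial_quotient[OF _ this]
    have "hardy_quotient 1 (pu 0 1 F) \<le> ennreal (1/4 + 1 / (real (Suc n))\<^sup>2 + (inverse (real (Suc n)))\<^sup>2)" "pu 0 1 F \<in> H01_nonzero"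
      by (simp_all only: one_neq_zero not_False_eq_True simp_thms)
    moreover have "zero_spherical_average (pu 0 1 F)" by (rule pu_zero_average)
    ultimately show ?thesis
      unfolding A_const_def A_admissible_def by (intro INF_lower2[of "pu 0 1 F"]) auto
  qed
  then show "\<exists>N. \<forall>n\<ge>N. A_const 1 \<le> ennreal (1/4 + 1 / (real (Suc n))\<^sup>2 + (inverse (real (Suc n)))\<^sup>2)" by blast
qed

section \<open>The minimizer\<close>

text \<open>The assumptions are the conclusions of \<open>bessel_ground_state\<close> at
  \<open>t0 = ln a\<close>. With \<open>t = ln (a / r)\<close>, the zero at \<open>ln a\<close> is
  the boundary value on the unit circle, and \<open>exp (- t / 2)\<close> is
  \<open>sqrt (r / a)\<close>, so the profile tends to 0 at the origin.\<close>

locale ground =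
  fixes a l C D T :: real and f f' :: "real \<Rightarrow> real"
  assumes a: "1 < a" and l: "1/4 < l" and f0: "f (ln a) = 0"
    and fpos: "\<And>t. ln a < t \<Longrightarrow> 0 < f t"
    and df: "\<And>t. 0 < t \<Longrightarrow> (f has_real_derivative f' t) (at t)"
    and df': "\<And>t. 0 < t \<Longrightarrow> (f' has_real_derivative (1 - l / t\<^sup>2) * f t) (at t)"
    and decay: "\<And>t. ln a \<le> t \<Longrightarrow> \<bar>f t\<bar> \<le> C * exp (- t / 2)" "\<And>t. ln a \<le> t \<Longrightarrow> \<bar>f' t\<bar> \<le> C * exp (- t / 2)"
    and low: "\<And>t. T \<le> t \<Longrightarrow> - D \<le> f' t / f t"
begin

lemma a1: "1 \<le> a" and la: "0 < ln a" using a by auto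

lemma C0: "0 \<le> C"
proof -
  have "0 \<le> C * exp (- ln a / 2)" using decay(1)[of "ln a"] by (meson abs_ge_zero order_refl order_trans)
  then show ?thesis by (simp add: zero_le_mult_iff)
qed

lemma T_gt: "0 < r \<Longrightarrow> r < 1 \<Longrightarrow> ln a < ln (a / r)"
  using a by (simp add: ln_div)

lemma T_ge: "0 < r \<Longrightarrow> r \<le> 1 \<Longrightarrow> ln a \<le> ln (a / r)"
  using a by (simp add: ln_div)

definition F where "F r = (if 0 < r \<and> r < 1 then f (ln (a / r)) else 0)"
definition F' where "F' r = (if 0 < r \<and> r < 1 then - f' (ln (a / r)) / r else 0)"

lemma exp_T: "0 < r \<Longrightarrow> exp (- ln (a / r)) = r / a"
  using a by (simp add: exp_minus)

lemma exp_half_T: "0 < r \<Longrightarrow> (exp (- ln (a / r) / 2))\<^sup>2 = r / a"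
  by (simp add: exp_T flip: exp_double)

lemma cont_f: "continuous_on {0<..} f" "continuous_on {0<..} f'"
  by (rule DERIV_continuous_on, rule DERIV_subset, rule df df', simp, simp)+

lemma cont_T: "continuous_on {0<..} (\<lambda>r. ln (a / r))"
  using a by (intro continuous_intros) auto

lemma DERIV_fT: "0 < r \<Longrightarrow> r \<le> 1 \<Longrightarrow> ((\<lambda>r. f (ln (a / r))) has_real_derivative f' (ln (a / r)) * (- (1 / r))) (at r)"
  by (rule DERIV_chain2[OF df DERIV_log_weight[OF a1]]) (use T_ge[of r] la in auto)

lemma DERIV_f'T: "0 < r \<Longrightarrow> r \<le> 1 \<Longrightarrow>
    ((\<lambda>r. f' (ln (a / r))) has_real_derivative ((1 - l / (ln (a / r))\<^sup>2) * f (ln (a / r))) * (- (1 / r))) (at r)"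
  by (rule DERIV_chain2[OF df' DERIV_log_weight[OF a1]]) (use T_ge[of r] la in auto)

lemma F_le: "0 < r \<Longrightarrow> (F r)\<^sup>2 \<le> C\<^sup>2 * r / a"
proof -
  assume r: "0 < r"
  show ?thesis
  proof (cases "r < 1")
    case True
    have "\<bar>f (ln (a / r))\<bar> \<le> \<bar>C * exp (- ln (a / r) / 2)\<bar>"
      using decay(1)[OF T_ge[of r]] r True by linarith
    then have "(f (ln (a / r)))\<^sup>2 \<le> (C * exp (- ln (a / r) / 2))\<^sup>2" by (simp only: abs_le_square_iff)
    then have "(f (ln (a / r)))\<^sup>2 \<le> C\<^sup>2 * (r / a)" unfolding power_mult_distrib exp_half_T[OF r] .
    then show ?thesis using r True by (simp add: F_def)
  qed (use r a in \<open>simp add: F_def\<close>)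
qed

sublocale profile F F'
proof
  have iso: "isCont F r" for r
  proof (cases "0 < r")
    case True
    \<comment> \<open>Clamping the argument at \<open>ln a\<close>, where \<open>f\<close> vanishes,
      expresses \<open>F\<close> on all positive radii by one continuous formula.\<close>
    have c: "continuous_on {0<..} (\<lambda>r. f (max (ln a) (ln (a / r))))"
      by (intro continuous_on_compose2[OF cont_f(1)] continuous_on_max continuous_on_const cont_T) (use la in auto)
    have eq: "F r = f (max (ln a) (ln (a / r)))" if "0 < r" for r
    proof (cases "r < 1")
      case True
      then show ?thesis using T_gt[OF that True] that by (simp add: F_def max_def)
    next
      case False
      then have "ln (a / r) \<le> ln a" using that a by (simp add: ln_div)
      then show ?thesis using False f0 by (simp add: F_def max_def)
    qed
    have "continuous_on {0<..} F" by (rule continuous_on_eq[OF c]) (simp add: eq)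
    then show ?thesis using True by (simp add: continuous_on_eq_continuous_at)
  next
    case False
    have "(F \<longlongrightarrow> 0) (at r)"
    proof (rule Lim_null_comparison)
      show "\<forall>\<^sub>F x in at r. norm (F x) \<le> sqrt (C\<^sup>2 * max 0 x / a)"
      proof (intro always_eventually allI)
        fix x
        show "norm (F x) \<le> sqrt (C\<^sup>2 * max 0 x / a)"
        proof (cases "0 < x")
          case True
          then show ?thesis using F_le[OF True] by (simp add: real_le_rsqrt)
        qed (use a in \<open>simp add: F_def\<close>)
      qed
      have m: "max 0 r = 0" using False by simp
      have "((\<lambda>x. sqrt (C\<^sup>2 * max 0 x / a)) \<longlongrightarrow> sqrt (C\<^sup>2 * max 0 r / a)) (at r)"
        using a by (intro tendsto_intros) auto
      then show "((\<lambda>x. sqrt (C\<^sup>2 * max 0 x / a)) \<longlongrightarrow> 0) (at r)" unfolding m by simp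
    qed
    then show ?thesis using False by (simp add: isCont_def F_def)
  qed
  then show "continuous_on UNIV F" by (simp add: continuous_at_imp_continuous_on)
  fix r
  show "0 \<le> F r" using fpos[OF T_gt[of r]] by (auto simp: F_def)
  show "0 < r \<and> r < 1" if "0 < F r" using that by (auto simp: F_def split: if_splits)
  show "F' r = 0" if "F r = 0" using that fpos[OF T_gt[of r]] by (auto simp: F_def F'_def split: if_splits)
  assume "0 < F r"
  then have r: "0 < r" "r < 1" by (auto simp: F_def split: if_splits)
  have "(F has_real_derivative f' (ln (a / r)) * (- (1 / r))) (at r)"
    by (rule has_field_derivative_transform_within_open[OF DERIV_fT, of r "{0<..<1}"]) (use r in \<open>auto simp: F_def\<close>)
  then show "(F has_real_derivative F' r) (at r)" using r by (simp add: F'_def)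
  have "continuous_on {0<..<1} (\<lambda>r. - f' (ln (a / r)) / r)"
    by (intro continuous_intros continuous_on_compose2[OF cont_f(2)] continuous_on_subset[OF cont_T]) (use T_gt la in force)+
  then have "continuous_on {0<..<1} F'"
    by (rule continuous_on_eq) (auto simp: F'_def)
  then show "isCont F' r" using r by (simp add: continuous_on_eq_continuous_at)
qed

text \<open>Radial and angular energy density together; \<open>den\<close> is the weighted mass
  density. Both omit the common factor \<open>pi\<close> of the cosine mode.\<close>

definition "num = (\<lambda>r. ((f' (ln (a / r)))\<^sup>2 + (f (ln (a / r)))\<^sup>2) / r)"
definition "den = (\<lambda>r. (f (ln (a / r)))\<^sup>2 / (r * (ln (a / r))\<^sup>2))"

lemma cont_num_den: "continuous_on {0<..1} num" "continuous_on {0<..1} den"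
proof -
  have T: "continuous_on {0<..1} (\<lambda>r. ln (a / r))" by (rule continuous_on_subset[OF cont_T]) auto
  have p: "0 < ln (a / r)" if "r \<in> {0<..1}" for r using T_ge[of r] la that by auto
  have c: "continuous_on {0<..1} (\<lambda>r. f (ln (a / r)))" "continuous_on {0<..1} (\<lambda>r. f' (ln (a / r)))"
    by (rule continuous_on_compose2[OF cont_f(1) T], use p in force) (rule continuous_on_compose2[OF cont_f(2) T], use p in force)
  show "continuous_on {0<..1} num" unfolding num_def by (intro continuous_intros c) auto
  show "continuous_on {0<..1} den" unfolding den_def by (intro continuous_intros c T) (use p a in force)+
qed

lemma num_den_nonneg: "0 < r \<Longrightarrow> 0 \<le> num r" "0 < r \<Longrightarrow> 0 \<le> den r"
  by (auto simp: num_def den_def)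

definition "B1 \<epsilon> = f (ln (a / \<epsilon>)) * f' (ln (a / \<epsilon>))"

text \<open>Multiplying \<open>f'' = (1 - l / t\<^sup>2) f\<close> by \<open>f\<close> shows that
  \<open>l * den r - num r\<close> is the \<open>r\<close>-derivative of \<open>f f'\<close> at
  \<open>ln (a / r)\<close>. At \<open>r = 1\<close> the boundary term is 0 since
  \<open>f (ln a) = 0\<close>; \<open>B1\<close> is the one at the inner radius.\<close>

lemma integral_identity:
  assumes e: "0 < \<epsilon>" "\<epsilon> \<le> 1"
  shows "integral {\<epsilon>..1} num = l * integral {\<epsilon>..1} den + B1 \<epsilon>"
proof -
  let ?P = "\<lambda>r. f (ln (a / r)) * f' (ln (a / r))"
  have sub: "{\<epsilon>..1} \<subseteq> {0<..1}" using e by auto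
  note c = continuous_on_subset[OF cont_num_den(1) sub] continuous_on_subset[OF cont_num_den(2) sub]
  have "((\<lambda>r. l * den r - num r) has_integral (?P 1 - ?P \<epsilon>)) {\<epsilon>..1}"
  proof (rule fundamental_theorem_of_calculus[OF e(2)])
    fix r assume "r \<in> {\<epsilon>..1}"
    then have r: "0 < r" "r \<le> 1" using e by auto
    have T: "0 < ln (a / r)" using T_ge[OF r] la by linarith
    have "(?P has_real_derivative f' (ln (a / r)) * (- (1 / r)) * f' (ln (a / r))
        + ((1 - l / (ln (a / r))\<^sup>2) * f (ln (a / r))) * (- (1 / r)) * f (ln (a / r))) (at r)"
      by (rule DERIV_mult[OF DERIV_fT[OF r] DERIV_f'T[OF r]])
    moreover have "y * (- (1 / r)) * y + ((1 - l / t\<^sup>2) * z) * (- (1 / r)) * z = l * (z\<^sup>2 / (r * t\<^sup>2)) - (y\<^sup>2 + z\<^sup>2) / r" if "0 < t" for y z t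
      using that r by (simp add: field_simps power2_eq_square)
    note this[OF T]
    ultimately have "(?P has_real_derivative l * den r - num r) (at r)"
      by (simp add: den_def num_def)
    then show "(?P has_vector_derivative l * den r - num r) (at r within {\<epsilon>..1})"
      by (simp add: has_real_derivative_iff_has_vector_derivative has_vector_derivative_at_within)
  qed
  moreover have "integral {\<epsilon>..1} (\<lambda>r. l * den r - num r) = l * integral {\<epsilon>..1} den - integral {\<epsilon>..1} num"
    unfolding integral_mult_right[symmetric]
    by (rule integral_diff) (intro integrable_continuous_interval continuous_on_mult_left_real c)+
  ultimately have "l * integral {\<epsilon>..1} den - integral {\<epsilon>..1} num = ?P 1 - ?P \<epsilon>"
    by (simp add: integral_unique)
  then show ?thesis by (simp add: B1_def f0)
qed

text \<open>Each factor is at most \<open>C * sqrt (\<epsilon> / a)\<close>, so the boundary term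
  disappears as the inner radius tends to 0.\<close>

lemma B1_bound: "0 < \<epsilon> \<Longrightarrow> \<epsilon> \<le> 1 \<Longrightarrow> B1 \<epsilon> \<le> C\<^sup>2 / a * \<epsilon>"
proof -
  assume e: "0 < \<epsilon>" "\<epsilon> \<le> 1"
  let ?E = "C * exp (- ln (a / \<epsilon>) / 2)"
  have "B1 \<epsilon> \<le> \<bar>f (ln (a / \<epsilon>))\<bar> * \<bar>f' (ln (a / \<epsilon>))\<bar>" by (simp add: B1_def flip: abs_mult)
  also have "\<dots> \<le> ?E * ?E" using decay[OF T_ge[OF e]] C0 by (intro mult_mono) auto
  also have "\<dots> = C\<^sup>2 * (exp (- ln (a / \<epsilon>) / 2))\<^sup>2" by (simp add: power2_eq_square)
  also have "\<dots> = C\<^sup>2 / a * \<epsilon>" unfolding exp_half_T[OF e(1)] by simp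
  finally show ?thesis .
qed

lemma den_le: "0 < r \<Longrightarrow> r < 1 \<Longrightarrow> den r \<le> C\<^sup>2 / (a * (ln a)\<^sup>2)"
proof -
  assume r: "0 < r" "r < 1"
  have "(f (ln (a / r)))\<^sup>2 \<le> C\<^sup>2 * r / a" using F_le[OF r(1)] r by (simp add: F_def)
  moreover have "(ln a)\<^sup>2 \<le> (ln (a / r))\<^sup>2" using T_gt[OF r] la by (intro power_mono) auto
  ultimately have "den r \<le> (C\<^sup>2 * r / a) / (r * (ln a)\<^sup>2)"
    unfolding den_def using r la a by (intro frac_le mult_left_mono mult_pos_pos) auto
  then show ?thesis using r by (simp add: field_simps)
qed

abbreviation "N \<equiv> \<integral>\<^sup>+ r. ennreal (num r) * indicator {0<..<1} r \<partial>lborel"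
abbreviation "Dn \<equiv> \<integral>\<^sup>+ r. ennreal (den r) * indicator {0<..<1} r \<partial>lborel"

lemma Dn_finite: "Dn < \<infinity>"
proof -
  have "Dn \<le> (\<integral>\<^sup>+ r. ennreal (C\<^sup>2 / (a * (ln a)\<^sup>2)) * indicator {0<..<1::real} r \<partial>lborel)"
    by (intro nn_integral_mono) (auto simp: indicator_def intro!: ennreal_leI den_le)
  also have "\<dots> < \<infinity>" by (simp add: nn_integral_cmult_indicator ennreal_mult_less_top)
  finally show ?thesis .
qed

lemma measurable_restr:
  assumes "g = num \<or> g = den"
  shows "(\<lambda>r. ennreal (g r) * indicator {0<..1} r) \<in> borel_measurable borel" "(\<lambda>r. ennreal (g r) * indicator {0<..<1} r) \<in> borel_measurable borel"
proof -
  have "continuous_on {0<..1} g" using assms cont_num_den by auto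
  then have "(\<lambda>r. indicator {0<..1} r *\<^sub>R g r) \<in> borel_measurable borel"
    by (intro borel_measurable_continuous_on_indicator) auto
  then have m: "(\<lambda>r. ennreal (indicator {0<..1} r *\<^sub>R g r)) \<in> borel_measurable borel" by measurable
  have eq: "(\<lambda>r. ennreal (indicator {0<..1} r *\<^sub>R g r)) = (\<lambda>r. ennreal (g r) * indicator {0<..1} r)"
    by (auto simp: fun_eq_iff indicator_def)
  show m1: "(\<lambda>r. ennreal (g r) * indicator {0<..1} r) \<in> borel_measurable borel" using m unfolding eq .
  have "(\<lambda>r. ennreal (g r) * indicator {0<..1} r * indicator {0<..<1} r) \<in> borel_measurable borel"
    by (rule borel_measurable_times_ennreal[OF m1]) auto
  moreover have "(\<lambda>r. ennreal (g r) * indicator {0<..1} r * indicator {0<..<1} r) = (\<lambda>r. ennreal (g r) * indicator {0<..<1} r)"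
    by (auto simp: fun_eq_iff indicator_def)
  ultimately show "(\<lambda>r. ennreal (g r) * indicator {0<..<1} r) \<in> borel_measurable borel" by (simp only:)
qed

text \<open>\<open>integral_identity\<close> in the limit of inner radius 0. An inequality is
  enough, as \<open>lower\<close> supplies the reverse bound for the quotient; together with
  \<open>Dn_finite\<close> it also shows that the energy is finite.\<close>

lemma N_le: "N \<le> ennreal l * Dn"
proof -
  let ?e = "\<lambda>n. inverse (real (Suc n))"
  have e: "0 < ?e n" "?e n \<le> 1" for n by (auto simp: field_simps)
  have lim: "(\<lambda>n. \<integral>\<^sup>+ r. ennreal (num r) * indicator {?e n..1} r \<partial>lborel) \<longlonglongrightarrow> (\<integral>\<^sup>+ r. ennreal (num r) * indicator {0<..1} r \<partial>lborel)"
  proof (rule nn_integral_LIMSEQ)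
    have dec: "?e (Suc n) \<le> ?e n" for n by (simp add: field_simps)
    show "incseq (\<lambda>n r. ennreal (num r) * indicator {?e n..1} r)"
    proof (rule incseq_SucI, rule le_funI)
      fix n r
      have "{?e n..1} \<subseteq> {?e (Suc n)..1}" unfolding atLeastatMost_subset_iff by (intro disjI2 conjI dec) simp
      then have "indicator {?e n..1} r \<le> (indicator {?e (Suc n)..1} r :: ennreal)" by (rule indicator_mono)
      then show "ennreal (num r) * indicator {?e n..1} r \<le> ennreal (num r) * indicator {?e (Suc n)..1} r"
        by (rule mult_left_mono) simp
    qed
    show "(\<lambda>r. ennreal (num r) * indicator {?e n..1} r) \<in> borel_measurable lborel" for n
    proof -
      have "(\<lambda>r. ennreal (num r) * indicator {0<..1} r * indicator {?e n..1} r) \<in> borel_measurable borel"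
        by (rule borel_measurable_times_ennreal[OF measurable_restr(1)]) auto
      moreover have "(\<lambda>r. ennreal (num r) * indicator {0<..1} r * indicator {?e n..1} r) = (\<lambda>r. ennreal (num r) * indicator {?e n..1} r)"
      proof
        fix r
        have "{?e n..1} \<subseteq> {0<..1}" using e(1)[of n] unfolding subset_eq Ball_def atLeastAtMost_iff greaterThanAtMost_iff by (meson less_le_trans)
        then show "ennreal (num r) * indicator {0<..1} r * indicator {?e n..1} r = ennreal (num r) * indicator {?e n..1} r"
          by (cases "r \<in> {?e n..1}") (auto simp del: atLeastAtMost_iff greaterThanAtMost_iff)
      qed
      ultimately show ?thesis by simp
    qed
    fix r :: real
    have "\<forall>\<^sub>F n in sequentially. ennreal (num r) * indicator {?e n..1} r = ennreal (num r) * indicator {0<..1} r"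
    proof (cases "0 < r")
      case True
      then have "\<forall>\<^sub>F n in sequentially. ?e n < r" by (rule order_tendstoD(2)[OF LIMSEQ_inverse_real_of_nat])
      then show ?thesis by eventually_elim (use True in \<open>auto simp: indicator_def\<close>)
    next
      case False
      have "r \<notin> {?e n..1}" for n using e(1)[of n] False unfolding atLeastAtMost_iff by linarith
      then show ?thesis using False by (auto simp: indicator_def)
    qed
    then show "(\<lambda>n. ennreal (num r) * indicator {?e n..1} r) \<longlonglongrightarrow> ennreal (num r) * indicator {0<..1} r"
      by (rule tendsto_eventually)
  qed
  have le: "(\<integral>\<^sup>+ r. ennreal (num r) * indicator {?e n..1} r \<partial>lborel) \<le> ennreal l * Dn + ennreal (C\<^sup>2 / a * ?e n)" for n
  proof -
    have sub: "{?e n..1} \<subseteq> {0<..1}" using e(1)[of n] unfolding subset_eq Ball_def atLeastAtMost_iff greaterThanAtMost_iff by (meson less_le_trans)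
    note c = continuous_on_subset[OF cont_num_den(1) sub] continuous_on_subset[OF cont_num_den(2) sub]
    have nn: "0 \<le> num r" "0 \<le> den r" if "r \<in> {?e n..1}" for r using num_den_nonneg[of r] sub that by auto
    have dp: "0 \<le> integral {?e n..1} den" by (intro integral_nonneg integrable_continuous_interval c nn)
    have "(\<integral>\<^sup>+ r. ennreal (num r) * indicator {?e n..1} r \<partial>lborel) = ennreal (integral {?e n..1} num)"
      by (rule nn_integral_continuous_Icc[OF c(1) nn(1)])
    also have "\<dots> \<le> ennreal (l * integral {?e n..1} den + C\<^sup>2 / a * ?e n)"
      unfolding integral_identity[OF e] by (intro ennreal_leI add_left_mono B1_bound e)
    also have "\<dots> = ennreal l * ennreal (integral {?e n..1} den) + ennreal (C\<^sup>2 / a * ?e n)"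
      using dp l a e(1)[of n] by (simp add: ennreal_mult ennreal_plus)
    also have "ennreal (integral {?e n..1} den) = (\<integral>\<^sup>+ r. ennreal (den r) * indicator {?e n<..<1} r \<partial>lborel)"
      by (rule nn_integral_continuous_Ioo[OF c(2) nn(2), symmetric])
    also have "ennreal l * (\<integral>\<^sup>+ r. ennreal (den r) * indicator {?e n<..<1} r \<partial>lborel) + ennreal (C\<^sup>2 / a * ?e n) \<le> ennreal l * Dn + ennreal (C\<^sup>2 / a * ?e n)"
    proof (intro add_right_mono mult_left_mono nn_integral_mono)
      fix r
      have "{?e n<..<1} \<subseteq> {0<..<1}" using e(1)[of n] unfolding subset_eq Ball_def greaterThanLessThan_iff by (meson less_trans)
      then show "indicator {?e n<..<1} r \<le> (indicator {0<..<1} r :: ennreal)" by (rule indicator_mono)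
    qed auto
    finally show ?thesis .
  qed
  have "(\<lambda>n. C\<^sup>2 / a * ?e n) \<longlonglongrightarrow> C\<^sup>2 / a * 0"
    by (intro tendsto_intros LIMSEQ_inverse_real_of_nat)
  then have "(\<lambda>n. ennreal l * Dn + ennreal (C\<^sup>2 / a * ?e n)) \<longlonglongrightarrow> ennreal l * Dn + ennreal (C\<^sup>2 / a * 0)"
    by (intro tendsto_add tendsto_const tendsto_ennrealI)
  then have "(\<integral>\<^sup>+ r. ennreal (num r) * indicator {0<..1} r \<partial>lborel) \<le> ennreal l * Dn + ennreal (C\<^sup>2 / a * 0)"
    by (rule LIMSEQ_le[OF lim]) (use le in blast)
  moreover have "N \<le> (\<integral>\<^sup>+ r. ennreal (num r) * indicator {0<..1} r \<partial>lborel)"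
    by (intro nn_integral_mono mult_left_mono indicator_mono) auto
  ultimately show ?thesis by simp
qed

lemma Dn_pos: "Dn \<noteq> 0"
proof
  assume "Dn = 0"
  then have "AE r in lborel. ennreal (den r) * indicator {0<..<1} r = 0"
    using measurable_restr(2)[of den] by (subst (asm) nn_integral_0_iff_AE) auto
  then have "AE r in lborel. r \<notin> {0<..<1::real}"
  proof eventually_elim
    case (elim r)
    show ?case
    proof
      assume r: "r \<in> {0<..<1}"
      then have r': "0 < r" "r < 1" by auto
      have "0 < den r" unfolding den_def
        using fpos[OF T_gt[OF r']] T_gt[OF r'] la r' by (intro divide_pos_pos mult_pos_pos zero_less_power) auto
      then show False using elim r by simp
    qed
  qed
  moreover have "(AE r in lborel. r \<notin> {0<..<1::real}) = (emeasure lborel {0<..<1::real} = 0)"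
    by (rule AE_iff_measurable) auto
  ultimately have "emeasure lborel {0<..<1::real} = 0" by (simp only:)
  then show False by simp
qed

lemma num_eq: "(\<integral>\<^sup>+ r. ennreal (r * ((F' r)\<^sup>2 * (2 * pi * 0\<^sup>2 + pi * 1\<^sup>2) + pi * (1 * F r / r)\<^sup>2)) * indicator {0<..<1} r \<partial>lborel) = ennreal pi * N"
proof -
  have "(\<integral>\<^sup>+ r. ennreal (r * ((F' r)\<^sup>2 * (2 * pi * 0\<^sup>2 + pi * 1\<^sup>2) + pi * (1 * F r / r)\<^sup>2)) * indicator {0<..<1} r \<partial>lborel)
    = (\<integral>\<^sup>+ r. ennreal pi * (ennreal (num r) * indicator {0<..<1} r) \<partial>lborel)"
  proof (intro nn_integral_cong)
    fix r :: real
    have "r * ((- y / r)\<^sup>2 * (2 * pi * 0\<^sup>2 + pi * 1\<^sup>2) + pi * (1 * z / r)\<^sup>2) = pi * ((y\<^sup>2 + z\<^sup>2) / r)" if "0 < r" for y z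
      using that by (simp add: field_simps power2_eq_square)
    then show "ennreal (r * ((F' r)\<^sup>2 * (2 * pi * 0\<^sup>2 + pi * 1\<^sup>2) + pi * (1 * F r / r)\<^sup>2)) * indicator {0<..<1} r
      = ennreal pi * (ennreal (num r) * indicator {0<..<1} r)"
      using num_den_nonneg(1)[of r] by (cases "r \<in> {0<..<1}") (simp_all add: F_def F'_def num_def ennreal_mult[symmetric])
  qed
  also have "\<dots> = ennreal pi * N" by (rule nn_integral_cmult) (use measurable_restr(2)[of num] in simp)
  finally show ?thesis .
qed

lemma den_eq: "(\<integral>\<^sup>+ r. ennreal (r * ((F r)\<^sup>2 / (r\<^sup>2 * (ln (a / r))\<^sup>2) * (2 * pi * 0\<^sup>2 + pi * 1\<^sup>2))) * indicator {0<..<1} r \<partial>lborel) = ennreal pi * Dn"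
proof -
  have "(\<integral>\<^sup>+ r. ennreal (r * ((F r)\<^sup>2 / (r\<^sup>2 * (ln (a / r))\<^sup>2) * (2 * pi * 0\<^sup>2 + pi * 1\<^sup>2))) * indicator {0<..<1} r \<partial>lborel)
    = (\<integral>\<^sup>+ r. ennreal pi * (ennreal (den r) * indicator {0<..<1} r) \<partial>lborel)"
  proof (intro nn_integral_cong)
    fix r :: real
    have *: "r * (z / (r\<^sup>2 * t) * (2 * pi * 0\<^sup>2 + pi * 1\<^sup>2)) = pi * (z / (r * t))" if "0 < r" for r z t :: real
      using that by (simp add: power2_eq_square)
    show "ennreal (r * ((F r)\<^sup>2 / (r\<^sup>2 * (ln (a / r))\<^sup>2) * (2 * pi * 0\<^sup>2 + pi * 1\<^sup>2))) * indicator {0<..<1} r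
      = ennreal pi * (ennreal (den r) * indicator {0<..<1} r)"
    proof (cases "r \<in> {0<..<1}")
      case True
      then have "F r = f (ln (a / r))" by (simp add: F_def)
      with True *[of r "(f (ln (a / r)))\<^sup>2" "(ln (a / r))\<^sup>2"] num_den_nonneg(2)[of r] show ?thesis
        by (simp add: den_def flip: ennreal_mult)
    qed simp
  qed
  also have "\<dots> = ennreal pi * Dn" by (rule nn_integral_cmult) (use measurable_restr(2)[of den] in simp)
  finally show ?thesis .
qed

lemma minimizer_quotient:
  "pu 0 1 F \<in> A_admissible" "hardy_quotient a (pu 0 1 F) \<le> ennreal l"
proof -
  have fin: "ennreal pi * N < \<infinity>"
    using N_le Dn_finite by (auto simp: ennreal_mult_less_top intro: le_less_trans)
  have pos: "ennreal pi * Dn \<noteq> 0" using Dn_pos by simp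
  have "pu 0 1 F \<in> H01_nonzero"
    by (rule profile_quotient(1)[of 0 1 a, unfolded num_eq den_eq, OF fin pos])
  then show "pu 0 1 F \<in> A_admissible" using pu_zero_average by (simp add: A_admissible_def)
  have "hardy_quotient a (pu 0 1 F) = (ennreal pi * N) / (ennreal pi * Dn)"
    by (rule profile_quotient(2)[of 0 1 a, unfolded num_eq den_eq, OF fin pos])
  also have "\<dots> \<le> ennreal l"
  proof (rule quotient_le[OF _ pos])
    have "ennreal pi * N \<le> ennreal pi * (ennreal l * Dn)" by (rule mult_left_mono[OF N_le]) simp
    then show "ennreal pi * N \<le> ennreal l * (ennreal pi * Dn)" by (simp add: mult_ac)
    show "ennreal pi * Dn \<noteq> \<infinity>" using Dn_finite by (simp add: ennreal_mult_eq_top_iff)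
  qed
  finally show "hardy_quotient a (pu 0 1 F) \<le> ennreal l" .
qed

text \<open>For \<open>\<psi> = f' / f\<close> the differential equation gives
  \<open>- \<psi>' - \<psi>\<^sup>2 = l / t\<^sup>2 - 1\<close> exactly, and the vanishing averages
  pay for the 1. At large \<open>t\<close>, \<open>\<psi>\<close> is controlled only from below, by
  \<open>low\<close>, which suffices when means are removed.\<close>

lemma lower:
  assumes u: "u \<in> A_admissible"
  shows "ennreal l \<le> hardy_quotient a u"
proof -
  have u': "u \<in> H01_nonzero" "zero_spherical_average u" using u by (auto simp: A_admissible_def)
  then obtain G where G: "has_H01_gradient u G" by (auto simp: H01_nonzero_def H01_def)
  have m: "u \<in> borel_measurable (lebesgue_on unit_disc)" using G by (simp add: has_H01_gradient_def)
  have pos: "0 < t" "0 < f t" if "ln a < t" for t using that la fpos by auto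
  have "(\<integral>\<^sup>+ x. ennreal (l / (ln (a / norm x))\<^sup>2 / (norm x)\<^sup>2 * (u x)\<^sup>2) \<partial>lebesgue_on unit_disc) \<le> L2sq G"
  proof (rule H01_lower_bound_log[OF a1, where \<psi> = "\<lambda>t. f' t / f t" and \<psi>' = "\<lambda>t. (1 - l / t\<^sup>2) - (f' t / f t)\<^sup>2"
        and W = "\<lambda>t. l / t\<^sup>2" and b = True and C = "max 0 D" and T = T])
    show "((\<lambda>t. f' t / f t) has_real_derivative (1 - l / t\<^sup>2) - (f' t / f t)\<^sup>2) (at t)" if t: "ln a < t" for t
    proof -
      have "((\<lambda>t. f' t / f t) has_real_derivative (((1 - l / t\<^sup>2) * f t) * f t - f' t * f' t) / (f t * f t)) (at t)"
        by (rule DERIV_divide[OF df' df]) (use pos[OF t] in auto)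
      moreover have "((c * y) * y - z * z) / (y * y) = c - (z / y)\<^sup>2" if "0 < y" for c y z :: real
        using that by (simp add: field_simps power2_eq_square)
      ultimately show ?thesis using pos(2)[OF t] by simp
    qed
    have cf: "continuous_on {ln a<..} f" "continuous_on {ln a<..} f'"
      by (rule continuous_on_subset[OF cont_f(1)] continuous_on_subset[OF cont_f(2)]; use la in auto)+
    show "continuous_on {ln a<..} (\<lambda>t. (1 - l / t\<^sup>2) - (f' t / f t)\<^sup>2)"
      by (intro continuous_intros cf) (use pos in force)+
    show "continuous_on {ln a<..} (\<lambda>t. l / t\<^sup>2)" by (intro continuous_intros) (use pos in force)
    show "- max 0 D \<le> f' t / f t" if "T < t" for t using low[of t] that by linarith
    show "l / t\<^sup>2 - of_bool True \<le> - ((1 - l / t\<^sup>2) - (f' t / f t)\<^sup>2) - (f' t / f t)\<^sup>2" if "ln a < t" for t by simp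
  qed (use l G u' in auto)
  then have "ennreal l * hardy_den a u \<le> L2sq G"
    using hardy_den_scaled[OF m, of l a] l by simp
  then show ?thesis unfolding hardy_quotient_eq[OF G]
    by (intro le_quotient hardy_den_nonzero[OF a1 u'(1)] hardy_den_finite[OF a1 G])
qed

lemma minimizer: "A_const a = ennreal l" "A_minimizer a (pu 0 1 F)"
proof -
  have ge: "ennreal l \<le> A_const a" unfolding A_const_def by (rule INF_greatest[OF lower])
  have le: "A_const a \<le> hardy_quotient a (pu 0 1 F)"
    unfolding A_const_def by (rule INF_lower[OF minimizer_quotient(1)])
  show "A_const a = ennreal l" using ge le minimizer_quotient(2) by (meson antisym order_trans)
  then show "A_minimizer a (pu 0 1 F)"
    using le minimizer_quotient by (simp add: A_minimizer_def antisym)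
qed

end

lemma minimizer_exists:
  assumes a: "1 < a"
  shows "A_const a > 1/4 \<and> (\<exists>u. A_minimizer a u)"
proof -
  have "0 < ln a" using a by simp
  from bessel_ground_state[OF this]
  obtain l f f' C D T where "1/4 < l" "f (ln a) = 0" "\<forall>t>ln a. 0 < f t"
    "\<forall>t>0. (f has_real_derivative f' t) (at t) \<and> (f' has_real_derivative (1 - l / t\<^sup>2) * f t) (at t)"
    "\<forall>t\<ge>ln a. \<bar>f t\<bar> \<le> C * exp (- t / 2) \<and> \<bar>f' t\<bar> \<le> C * exp (- t / 2)"
    "\<forall>t\<ge>T. - D \<le> f' t / f t" by blast
  then interpret ground a l C D T f f' by unfold_locales (use a in auto)
  have "ennreal (1/4) < ennreal l" using l by (intro ennreal_lessI) auto
  then have "1/4 < A_const a" unfolding minimizer(1) quarter_ennreal .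
  then show ?thesis using minimizer(2) by blast
qed

theorem corollary2:
  shows "(\<forall>a>1. A_const a > 1/4 \<and> B_const a = 1/4)
    \<and> A_const 1 = 1/4 \<and> B_const 1 = 1/4
    \<and> (\<forall>a\<ge>1. (\<exists>u. A_minimizer a u) \<longleftrightarrow> a > 1)"
proof (intro conjI allI impI)
  have B: "B_const a = 1/4" if "1 \<le> a" for a
    using B_const_ge[OF that] B_const_le[OF that] by (rule antisym[rotated])
  show "B_const 1 = 1/4" by (rule B) simp
  show A1: "A_const 1 = 1/4"
    using A_const_1_le B_le_A[of 1] B[of 1] by (simp add: antisym)
  show "A_const a > 1/4" if "1 < a" for a using minimizer_exists[OF that] by blast
  show "B_const a = 1/4" if "1 < a" for a using that by (intro B) simp
  show "(\<exists>u. A_minimizer a u) \<longleftrightarrow> a > 1" if "1 \<le> a" for a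
  proof
    assume "\<exists>u. A_minimizer a u"
    then have "a \<noteq> 1" using no_minimizer_1[OF A1] by blast
    then show "1 < a" using that by simp
  qed (use minimizer_exists in blast)
qed

end
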